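(* Let $K\subset\mathbb{C}^2$ be compact, regular and polynomially convex. If $\{Q_n\}$ is a sequence of polynomials with $Q_n\in H_n(C)$ satisfying $$\limsup_{n\to\infty}\frac1n\log|Q_n(\zeta)|\le\rho_{C,K}(\zeta)\quad\text{for all }\zeta\in\partial P^2,$$ then $\limsup_{n\to\infty}\|Tch_KQ_n\|_K^{1/n}\le1$.
   Context: $a,b$ relatively prime positive integers; $C$ the triangle with vertices $(0,0),(b,0),(0,a)$; $Poly(nC)$ is the space of $\sum_{aj+bk\le nab}c_{jk}z_1^jz_2^k$ and $H_n(C)$ the space of $\sum_{aj+bk=nab}c_{jk}z_1^jz_2^k$. $H_C(z)=\max(b\log^+|z_1|,a\log^+|z_2|)$; $L_C$ the plurisubharmonic $u$ with $u\le H_C+c_u$; $V_{C,K}(z)=\sup\{u(z):u\in L_C,\ u\le0\text{ on }K\}$, $V^*_{C,K}$ its usc regularization; $\lambda\circ(z_1,z_2)=(\lambda^az_1,\lambda^bz_2)$; $\rho_{C,K}(z)=\limsup_{|\lambda|\to\infty}[V^*_{C,K}(\lambda\circ z)-ab\log|\lambda|]$. $K$ is regular if $V_{\Sigma,K}$ (with $\Sigma=\{x\ge0:x_1+x_2\le1\}$ in place of $C$) is continuous; polynomially convex means $K$ equals its polynomial hull. $\partial P^2$ is the boundary of the unit bidisk. For $h_n\in H_n(C)$, $Tch_Kh_n$ denotes a polynomial $h_n+p$ with $p\in Poly((n-1)C)$ such that $\|h_n+p\|_K=\inf\{\|h_n+q\|_K:q\in Poly((n-1)C)\}$. *)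

theory Defs
  imports "HOL-Analysis.Analysis"
begin

definition logplus :: "real \<Rightarrow> real" where
  "logplus x = (if x \<le> 1 then 0 else ln x)"

definition elog :: "real \<Rightarrow> ereal" where
  "elog x = (if x = 0 then - \<infinity> else ereal (ln x))"

definition PolyC :: "nat \<Rightarrow> nat \<Rightarrow> nat \<Rightarrow> (complex \<times> complex \<Rightarrow> complex) set" where
  "PolyC a b n = {f. \<exists>c :: nat \<Rightarrow> nat \<Rightarrow> complex.
      (\<forall>j k. a * j + b * k > n * a * b \<longrightarrow> c j k = 0) \<and>
      f = (\<lambda>z. \<Sum>j\<le>n * b. \<Sum>k\<le>n * a. c j k * fst z ^ j * snd z ^ k)}"

definition HC :: "nat \<Rightarrow> nat \<Rightarrow> nat \<Rightarrow> (complex \<times> complex \<Rightarrow> complex) set" where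
  "HC a b n = {f. \<exists>c :: nat \<Rightarrow> nat \<Rightarrow> complex.
      (\<forall>j k. a * j + b * k \<noteq> n * a * b \<longrightarrow> c j k = 0) \<and>
      f = (\<lambda>z. \<Sum>j\<le>n * b. \<Sum>k\<le>n * a. c j k * fst z ^ j * snd z ^ k)}"

definition all_polys :: "(complex \<times> complex \<Rightarrow> complex) set" where
  "all_polys = {f. \<exists>(N::nat) (c :: nat \<Rightarrow> nat \<Rightarrow> complex).
      f = (\<lambda>z. \<Sum>j\<le>N. \<Sum>k\<le>N. c j k * fst z ^ j * snd z ^ k)}"

definition supnorm :: "(complex \<times> complex) set \<Rightarrow> (complex \<times> complex \<Rightarrow> complex) \<Rightarrow> real" where
  "supnorm K f = (SUP z\<in>K. cmod (f z))"

definition poly_hull :: "(complex \<times> complex) set \<Rightarrow> (complex \<times> complex) set" where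
  "poly_hull K = {z. \<forall>p\<in>all_polys. cmod (p z) \<le> supnorm K p}"

definition polynomially_convex :: "(complex \<times> complex) set \<Rightarrow> bool" where
  "polynomially_convex K \<longleftrightarrow> poly_hull K = K"

definition eintegral :: "real set \<Rightarrow> (real \<Rightarrow> ereal) \<Rightarrow> ereal" where
  "eintegral S g =
     enn2ereal (\<integral>\<^sup>+ x \<in> S. e2ennreal (max 0 (g x)) \<partial>lborel)
     - enn2ereal (\<integral>\<^sup>+ x \<in> S. e2ennreal (max 0 (- g x)) \<partial>lborel)"

definition circle_mean :: "(complex \<Rightarrow> ereal) \<Rightarrow> complex \<Rightarrow> real \<Rightarrow> ereal" where
  "circle_mean g c r = eintegral {0..2*pi} (\<lambda>\<theta>. g (c + complex_of_real r * cis \<theta>)) / ereal (2*pi)"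

definition cline :: "complex \<times> complex \<Rightarrow> complex \<times> complex \<Rightarrow> complex \<Rightarrow> complex \<times> complex" where
  "cline z w t = (fst z + t * fst w, snd z + t * snd w)"

definition psh :: "(complex \<times> complex \<Rightarrow> ereal) \<Rightarrow> bool" where
  "psh u \<longleftrightarrow> (\<forall>z. u z < \<infinity>) \<and> (\<forall>z. Limsup (at z) u \<le> u z) \<and>
     (\<forall>z w c r. r > 0 \<longrightarrow> u (cline z w c) \<le> circle_mean (\<lambda>t. u (cline z w t)) c r)"

definition Lclass :: "(complex \<times> complex \<Rightarrow> real) \<Rightarrow> (complex \<times> complex \<Rightarrow> ereal) set" where
  "Lclass H = {u. psh u \<and> (\<exists>c::real. \<forall>z. u z \<le> ereal (H z + c))}"

definition Vext :: "(complex \<times> complex \<Rightarrow> real) \<Rightarrow> (complex \<times> complex) set \<Rightarrow> complex \<times> complex \<Rightarrow> ereal" where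
  "Vext H K z = Sup {u z | u. u \<in> Lclass H \<and> (\<forall>w\<in>K. u w \<le> 0)}"

definition Vstar :: "(complex \<times> complex \<Rightarrow> real) \<Rightarrow> (complex \<times> complex) set \<Rightarrow> complex \<times> complex \<Rightarrow> ereal" where
  "Vstar H K z = Limsup (nhds z) (Vext H K)"

definition H_C :: "nat \<Rightarrow> nat \<Rightarrow> complex \<times> complex \<Rightarrow> real" where
  "H_C a b z = max (real b * logplus (cmod (fst z))) (real a * logplus (cmod (snd z)))"

definition H_Sigma :: "complex \<times> complex \<Rightarrow> real" where
  "H_Sigma z = max (logplus (cmod (fst z))) (logplus (cmod (snd z)))"

definition regular :: "(complex \<times> complex) set \<Rightarrow> bool" where
  "regular K \<longleftrightarrow> (\<forall>z. \<bar>Vext H_Sigma K z\<bar> \<noteq> \<infinity>) \<and>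
      continuous_on UNIV (\<lambda>z. real_of_ereal (Vext H_Sigma K z))"

definition wscale :: "nat \<Rightarrow> nat \<Rightarrow> complex \<Rightarrow> complex \<times> complex \<Rightarrow> complex \<times> complex" where
  "wscale a b l z = (l ^ a * fst z, l ^ b * snd z)"

definition rho_C :: "nat \<Rightarrow> nat \<Rightarrow> (complex \<times> complex) set \<Rightarrow> complex \<times> complex \<Rightarrow> ereal" where
  "rho_C a b K z = Limsup at_infinity
     (\<lambda>l. Vstar (H_C a b) K (wscale a b l z) - ereal (real (a * b) * ln (cmod l)))"

definition bidisk_boundary :: "(complex \<times> complex) set" where
  "bidisk_boundary = {z. max (cmod (fst z)) (cmod (snd z)) = 1}"

text \<open>T is a Chebyshev polynomial Tch_K h for h in H_n(C), n \<ge> 1.\<close>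
definition is_Tch :: "nat \<Rightarrow> nat \<Rightarrow> (complex \<times> complex) set \<Rightarrow> nat \<Rightarrow>
    (complex \<times> complex \<Rightarrow> complex) \<Rightarrow> (complex \<times> complex \<Rightarrow> complex) \<Rightarrow> bool" where
  "is_Tch a b K n h T \<longleftrightarrow> (\<exists>p\<in>PolyC a b (n - 1). T = (\<lambda>z. h z + p z)) \<and>
     supnorm K T = Inf {supnorm K (\<lambda>z. h z + q z) | q. q \<in> PolyC a b (n - 1)}"

end

theory Submission
 imports Defs "HOL-Complex_Analysis.Complex_Analysis" "HOL-Computational_Algebra.Fundamental_Theorem_Algebra"
begin

text \<open>The extremal function \<open>V\<close> of \<open>K\<close> is continuous, and even equicontinuous under small translations and
  dilations, because translates and dilates of competitors are almost competitors.  Hence \<open>V(\<lambda> \<circ> \<zeta>) - ab log|\<lambda>|\<close>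
  converges to \<open>\<rho>(\<zeta>)\<close> locally uniformly in \<open>\<zeta>\<close>, and a Hartogs type argument turns the
  hypothesis on \<open>Q\<^sub>n\<close> into \<open>|Q\<^sub>n| \<le> exp(n(V + \<epsilon>))\<close> outside a ball, uniformly for large \<open>n\<close>.  The function
  \<open>- \<chi> Q\<^sub>n\<close>, with a cut-off \<open>\<chi>\<close> equal to 1 on that ball, is then corrected to an entire function \<open>U\<close> by
  Hoermander's \<open>L\<^sup>2\<close> estimate with a weight close to \<open>2(n - 3)V\<close>: the growth of the weight forces
  \<open>U \<in> Poly((n-1)C)\<close>, and on \<open>K\<close>, where \<open>V\<close> vanishes, \<open>Q\<^sub>n + U\<close> is at most \<open>C exp(4n\<epsilon>)\<close>.
  The \<open>L\<^sup>2\<close> estimate is carried out on the incomplete inner product space of test functions, with a minimising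
  sequence in place of a solution.\<close>

text \<open>Two obstacles shape the argument. The first is the weight. Its derivatives of order one
  and two must be bounded on all of C^2, for only then are the commutators with mollifiers bounded
  and does duality close on compactly supported test functions. \<open>V\<close> grows at infinity,
  but the derivatives of its mollification see only its oscillation, which is uniformly small.
  Strict plurisubharmonicity is bought with ln (1 + |z1|^2) + ln (1 + |z2|^2); this costs a factor
  (2 + |z1|) (2 + |z2|) in the growth of U and explains n - 3, since (n - 3) ab + a + b <= (n - 1)
  ab. The second lies in the definitions. Regularity refers to the simplex; as H_C is at most max(a,
  b) times H_Sigma, it still forces \<open>V\<close> to be small near K, where the stability
  argument starts. And \<open>rho\<close> is a limsup, which bounds slices of \<open>V\<close> only
  from above. The passage from \<open>rho\<close> back to \<open>V\<close> outside a ball takes a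
  bound from below, and this is found by comparison with a Green function on one slice and by a mean
  value over rotations for the neighbouring slices.\<close>

type_synonym c2 = "complex \<times> complex"

section \<open>Smooth maps through iterated directional derivatives\<close>

definition Dd :: "'a::real_normed_vector => ('a => 'b::real_normed_vector) => 'a => 'b" where
 "Dd e f z = frechet_derivative f (at z) e"

text \<open>Derivatives are tested one direction at a time, so that all levels of the recursion
  speak of maps between the same two spaces and each closure property takes a single induction on
  \<open>k\<close>.\<close>

primrec Ck :: "nat => ('a::real_normed_vector => 'b::real_normed_vector) => bool" where
 "Ck 0 f \<longleftrightarrow> continuous_on UNIV f"
| "Ck (Suc k) f \<longleftrightarrow> (\<forall>z. f differentiable (at z)) \<and> (\<forall>e. Ck k (Dd e f))"

definition smooth :: "('a::real_normed_vector => 'b::real_normed_vector) => bool" where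
 "smooth f \<longleftrightarrow> (\<forall>k. Ck k f)"

lemma Dd_eq: "(f has_derivative f') (at z) ==> Dd e f z = f' e"
 unfolding Dd_def by (metis frechet_derivative_at)

lemma has_derivative_Dd: "f differentiable (at z) ==> (f has_derivative (%e. Dd e f z)) (at z)"
 unfolding Dd_def by (simp add: frechet_derivative_works)

lemma Ck_SucD: "Ck (Suc k) f ==> Ck k f"
proof (induction k arbitrary: f)
 case 0
 then show ?case by (simp add: continuous_at_imp_continuous_on differentiable_imp_continuous_within)
next
 case (Suc k)
 then show ?case by (metis Ck.simps(2))
qed

lemma smooth_Suc: "smooth f \<longleftrightarrow> (\<forall>z. f differentiable (at z)) \<and> (\<forall>e. smooth (Dd e f))"
 unfolding smooth_def by (metis Ck.simps(2) Ck_SucD)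

lemma smooth_Dd: "smooth f ==> smooth (Dd e f)"
 using smooth_Suc by blast

lemma smooth_differentiable: "smooth f ==> f differentiable (at z)"
 using smooth_Suc by blast

lemma smooth_has_derivative: "smooth f ==> (f has_derivative (%e. Dd e f z)) (at z)" by (simp add: has_derivative_Dd smooth_differentiable)

lemma smooth_continuous: "smooth f ==> continuous_on S f" by (metis Ck.simps(1) continuous_on_subset smooth_def subset_UNIV)

lemma smooth_borel [measurable_dest]: "smooth f ==> f \<in> borel_measurable borel" by (simp add: borel_measurable_continuous_onI smooth_continuous)

lemma smooth_linear_Dd: "smooth f ==> bounded_linear (%e. Dd e f z)"
 using has_derivative_bounded_linear smooth_has_derivative by blast

lemma Dd_const [simp]: "Dd e (%z. c) = (%z. 0)" by (rule ext, rule Dd_eq[where f'="%_. 0"]) simp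

lemma Ck_const: "Ck k (%z. c)" by (induction k arbitrary: c) auto

lemma smooth_const [simp, intro]: "smooth (%z. c)" by (simp add: smooth_def Ck_const)

lemma Dd_bounded_linear: "bounded_linear L ==> Dd e L = (%z. L e)" by (rule ext, rule Dd_eq) (rule bounded_linear_imp_has_derivative)

lemma smooth_bounded_linear: "bounded_linear L ==> smooth L" by (subst smooth_Suc) (auto simp: Dd_bounded_linear bounded_linear_imp_differentiable)

lemma Dd_add:
 assumes "f differentiable (at z)" "g differentiable (at z)"
 shows "Dd e (%z. f z + g z) z = Dd e f z + Dd e g z" by (rule Dd_eq[OF has_derivative_add[OF has_derivative_Dd has_derivative_Dd]]) fact+

lemma Ck_add: "Ck k f ==> Ck k g ==> Ck k (%z. f z + g z)"
proof (induction k arbitrary: f g)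
 case 0
 then show ?case by (auto intro: continuous_intros)
next
 case (Suc k)
 then have "Dd e (%z. f z + g z) = (%z. Dd e f z + Dd e g z)" for e by (auto simp: Dd_add)
 with Suc show ?case by simp
qed

lemma smooth_add [intro]: "smooth f ==> smooth g ==> smooth (%z. f z + g z)" by (simp add: smooth_def Ck_add)

lemma Dd_compose_linear:
 assumes "bounded_linear L" "f differentiable (at z)"
 shows "Dd e (%z. L (f z)) z = L (Dd e f z)" by (rule Dd_eq[OF bounded_linear.has_derivative[OF assms(1) has_derivative_Dd[OF assms(2)]]])

lemma Ck_compose_linear: "bounded_linear L ==> Ck k f ==> Ck k (%z. L (f z))"
proof (induction k arbitrary: f)
 case 0
 then show ?case by (metis Ck.simps(1) bounded_linear.continuous_on)
next
 case (Suc k)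
 then have "Dd e (%z. L (f z)) = (%z. L (Dd e f z))" for e by (auto simp: Dd_compose_linear)
 moreover have "(%z. L (f z)) differentiable (at z)" for z
  using bounded_linear.has_derivative[OF Suc.prems(1) has_derivative_Dd] Suc.prems by (force simp: differentiable_def)
 ultimately show ?case
  using Suc by simp
qed

lemma smooth_compose_linear: "bounded_linear L ==> smooth f ==> smooth (%z. L (f z))" by (simp add: smooth_def Ck_compose_linear)

lemma Dd_bilinear:
 assumes "bounded_bilinear p" "f differentiable (at z)" "g differentiable (at z)"
 shows "Dd e (%z. p (f z) (g z)) z = p (f z) (Dd e g z) + p (Dd e f z) (g z)"
 by (rule Dd_eq[OF bounded_bilinear.FDERIV[OF assms(1) has_derivative_Dd has_derivative_Dd]]) fact+

lemma Ck_bilinear: "bounded_bilinear p ==> Ck k f ==> Ck k g ==> Ck k (%z. p (f z) (g z))"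
proof (induction k arbitrary: f g)
 case 0
 then show ?case by (metis Ck.simps(1) bounded_bilinear.continuous_on)
next
 case (Suc k)
 then have "Dd e (%z. p (f z) (g z)) = (%z. p (f z) (Dd e g z) + p (Dd e f z) (g z))" for e by (auto simp: Dd_bilinear)
 moreover have "(%z. p (f z) (g z)) differentiable (at z)" for z
  by (rule differentiableI[OF bounded_bilinear.FDERIV[OF Suc.prems(1) has_derivative_Dd has_derivative_Dd]])
   (use Suc.prems in simp_all)
 moreover have "Ck k f" "Ck k g"
  using Suc.prems Ck_SucD by blast+
 ultimately show ?case
  using Suc by (simp add: Ck_add)
qed

lemma smooth_bilinear: "bounded_bilinear p ==> smooth f ==> smooth g ==> smooth (%z. p (f z) (g z))" by (simp add: smooth_def Ck_bilinear)

lemma smooth_mult [intro]: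
 fixes f g :: "'a::real_normed_vector => 'b::real_normed_algebra"
 shows "smooth f ==> smooth g ==> smooth (%z. f z * g z)" by (rule smooth_bilinear[OF bounded_bilinear_mult])

lemma Dd_mult:
 fixes f g :: "'a::real_normed_vector => 'b::real_normed_algebra"
 assumes "f differentiable (at z)" "g differentiable (at z)"
 shows "Dd e (%z. f z * g z) z = f z * Dd e g z + Dd e f z * g z" by (rule Dd_bilinear[OF bounded_bilinear_mult assms])

lemma smooth_minus [intro]: "smooth f ==> smooth (%z. - f z)" by (rule smooth_compose_linear[OF bounded_linear_minus[OF bounded_linear_ident]])

lemma smooth_diff [intro]: "smooth f ==> smooth g ==> smooth (%z. f z - g z)"
 using smooth_add[of f "%z. - g z"] smooth_minus[of g] by simp

lemma smooth_sum [intro]: "(!!i. i \<in> I ==> smooth (f i)) ==> smooth (%z. \<Sum>i\<in>I. f i z)" by (induction I rule: infinite_finite_induct) auto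

lemma smooth_power [intro]:
 fixes f :: "'a::real_normed_vector => 'b::real_normed_algebra_1"
 shows "smooth f ==> smooth (%z. f z ^ n)" by (induction n) auto

lemma smooth_of_real [intro]:
 "smooth f ==> smooth (%z. of_real (f z) :: 'b::{real_normed_algebra_1})" by (rule smooth_compose_linear[OF bounded_linear_of_real])

lemma smooth_cnj [intro]: "smooth f ==> smooth (%z. cnj (f z))" by (rule smooth_compose_linear[OF bounded_linear_cnj])

lemma smooth_Re [intro]: "smooth f ==> smooth (%z. Re (f z))" by (rule smooth_compose_linear[OF bounded_linear_Re])

lemma smooth_fst [intro, simp]: "smooth fst" and smooth_snd [intro, simp]: "smooth snd"
 by (simp_all add: smooth_bounded_linear bounded_linear_fst bounded_linear_snd)

lemma Ck_exp_aux:
 fixes f :: "'a::real_normed_vector => real"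
 assumes "smooth f" shows "Ck k (%z. exp (f z))"
proof (induction k)
 case 0
 show ?case using smooth_continuous[OF assms] by (auto intro: continuous_intros)
next
 case (Suc k)
 have d: "((%z. exp (f z)) has_derivative (%e. Dd e f z * exp (f z))) (at z)" for z
  by (rule has_derivative_eq_rhs[OF has_derivative_exp[OF smooth_has_derivative[OF assms]]])
   (auto simp: mult.commute)
 then have "Dd e (%z. exp (f z)) = (%z. Dd e f z * exp (f z))" for e
  using Dd_eq by blast
 moreover have "Ck k (%z. Dd e f z * exp (f z))" for e
  using Ck_bilinear[OF bounded_bilinear_mult _ Suc] smooth_Dd[OF assms] smooth_def by blast
 ultimately show ?case
  using d by (auto simp: differentiable_def)
qed

lemma smooth_exp [intro]:
 fixes f :: "'a::real_normed_vector => real"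
 shows "smooth f ==> smooth (%z. exp (f z))" by (simp add: smooth_def[of "%z. exp (f z)"] Ck_exp_aux)

lemma Dd_exp:
 fixes f :: "'a::real_normed_vector => real"
 assumes "smooth f" shows "Dd e (%z. exp (f z)) z = Dd e f z * exp (f z)"
 by (rule Dd_eq, rule has_derivative_eq_rhs[OF has_derivative_exp[OF smooth_has_derivative[OF assms]]])
   (auto simp: mult.commute)

lemma Ck_inverse_aux:
 fixes f :: "'a::real_normed_vector => real"
 assumes "smooth f" "!!z. f z ~= 0" shows "Ck k (%z. inverse (f z))"
proof (induction k)
 case 0
 show ?case using smooth_continuous[OF assms(1)] assms(2) by (auto intro: continuous_intros)
next
 case (Suc k)
 have d: "((%z. inverse (f z)) has_derivative (%e. - (inverse (f z) * Dd e f z * inverse (f z)))) (at z)" for z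
  by (rule Deriv.has_derivative_inverse[OF assms(2) smooth_has_derivative[OF assms(1)]])
 then have "Dd e (%z. inverse (f z)) = (%z. (- Dd e f z) * (inverse (f z) * inverse (f z)))" for e
  using Dd_eq[OF d] by auto
 moreover have "Ck k (%z. (- Dd e f z) * (inverse (f z) * inverse (f z)))" for e
  using Ck_bilinear[OF bounded_bilinear_mult _ Ck_bilinear[OF bounded_bilinear_mult Suc Suc]]
   smooth_minus[OF smooth_Dd[OF assms(1)]] smooth_def by blast
 ultimately show ?case
  using d by (auto simp: differentiable_def)
qed

lemma smooth_inverse [intro]:
 fixes f :: "'a::real_normed_vector => real"
 shows "smooth f ==> (!!z. f z ~= 0) ==> smooth (%z. inverse (f z))" by (simp add: smooth_def[of "%z. inverse (f z)"] Ck_inverse_aux)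

lemma smooth_ln:
 fixes f :: "'a::real_normed_vector => real"
 assumes "smooth f" "!!z. f z > 0" shows "smooth (%z. ln (f z))"
  and "Dd e (%z. ln (f z)) z = Dd e f z * inverse (f z)"
proof -
 have d: "((%z. ln (f z)) has_derivative (%e. Dd e f z * inverse (f z))) (at z)" for z
  using has_derivative_ln[OF assms(2) smooth_has_derivative[OF assms(1)]] by simp
 show D: "Dd e (%z. ln (f z)) z = Dd e f z * inverse (f z)" for e z
  using Dd_eq[OF d] .
 have "smooth (Dd e (%z. ln (f z)))" for e
  using assms D by (auto intro!: smooth_mult smooth_Dd smooth_inverse simp: ext[OF D] less_imp_neq[THEN not_sym])
 with d show "smooth (%z. ln (f z))" by (subst smooth_Suc) (auto simp: differentiable_def)
qed

text \<open>The functions \<open>t\<^sup>-\<^sup>m exp(-1/t)\<close>, extended by \<open>0\<close>: their span is closed under differentiation.\<close>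

definition bumpf :: "nat => real => real" where
 "bumpf m t = (if t <= 0 then 0 else (1 / t) ^ m * exp (- (1 / t)))"

text \<open>Of the exponential series of 1 / t only the term of index \<open>m + 2\<close> is kept.
  The resulting factor t^2 makes every \<open>bumpf m\<close> differentiable at 0 with derivative
  0.\<close>

lemma bumpf_le: assumes "t > 0" shows "bumpf m t <= fact (m + 2) * t^2"
proof -
 define x where "x = 1 / t"
 have x: "x > 0" using assms by (simp add: x_def)
 have "(\<Sum>n\<in>{m+2}. x ^ n /\<^sub>R fact n) <= exp x"
  unfolding exp_def using x summable_exp_generic[of x] by (intro sum_le_suminf) auto
 then have "x ^ m * exp (- x) * x^2 <= fact (m + 2)" by (simp add: exp_minus field_simps power_add power2_eq_square del: fact_Suc)
 then show ?thesis
  using assms by (simp add: bumpf_def x_def field_simps power2_eq_square del: fact_Suc)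
qed

lemma bumpf_nonneg: "bumpf m t >= 0" by (simp add: bumpf_def)

lemma bumpf_deriv:
 "(bumpf m has_real_derivative bumpf (m + 2) t - real m * bumpf (m + 1) t) (at t)"
proof -
 consider "t > 0" | "t < 0" | "t = 0" by linarith
 then show ?thesis
 proof cases
  case 1
  have "((%t. (1 / t) ^ m * exp (- (1 / t))) has_real_derivative
    bumpf (m + 2) t - real m * bumpf (m + 1) t) (at t)"
  proof (cases m)
   case (Suc k)
   have "((%t. inverse t ^ Suc k * exp (- inverse t)) has_real_derivative
    inverse t ^ (k + 3) * exp (- inverse t) - real (Suc k) * (inverse t ^ (k + 2) * exp (- inverse t))) (at t)"
   proof -
    have "(inverse has_real_derivative - (inverse t * inverse t)) (at t)"
     using 1 by (auto intro!: derivative_eq_intros)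
    from DERIV_mult[OF DERIV_power_Suc[OF this, of k] DERIV_fun_exp[OF DERIV_minus[OF this]]]
    show ?thesis by (rule DERIV_cong) (simp add: eval_nat_numeral algebra_simps)
   qed
   then show ?thesis
    using 1 Suc by (simp add: bumpf_def inverse_eq_divide eval_nat_numeral)
  qed (use 1 in \<open>auto intro!: derivative_eq_intros simp: bumpf_def field_simps power2_eq_square\<close>)
  moreover have ev: "eventually (%s. bumpf m s = (1 / s) ^ m * exp (- (1 / s))) (nhds t)"
   using eventually_nhds_in_open[of "{0<..}" t] 1 by (auto elim!: eventually_mono simp: bumpf_def)
  ultimately show ?thesis by (simp add: DERIV_cong_ev[OF refl ev refl])
 next
  case 2
  have ev: "eventually (%s. bumpf m s = 0) (nhds t)"
   using eventually_nhds_in_open[of "{..<0}" t] 2 by (auto elim!: eventually_mono simp: bumpf_def)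
  moreover have "((%t. 0) has_real_derivative bumpf (m + 2) t - real m * bumpf (m + 1) t) (at t)"
   using 2 by (simp add: bumpf_def)
  ultimately show ?thesis by (simp add: DERIV_cong_ev[OF refl ev refl])
 next
  case 3
  have le: "\<bar>bumpf m h / h\<bar> <= fact (m + 2) * \<bar>h\<bar>" for h
   using bumpf_le[of h m] bumpf_nonneg[of m h] by (cases "h > 0") (auto simp: divide_le_eq power2_eq_square bumpf_def mult_ac not_less
    intro!: mult_nonpos_nonneg simp del: fact_Suc)
  have "((%h. fact (m + 2) * \<bar>h::real\<bar>) \<longlongrightarrow> fact (m + 2) * \<bar>0\<bar>) (at 0)" by (intro tendsto_intros)
  then have "((%h. bumpf m h / h) \<longlongrightarrow> 0) (at 0)" by (intro Lim_null_comparison[of "%h. bumpf m h / h"]) (use le in auto)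
  then show ?thesis
   using 3 by (simp add: DERIV_def bumpf_def)
 qed
qed

text \<open>The exponent \<open>m\<close> must vary in the induction, because differentiation raises
  it by one and by two.\<close>

lemma Ck_bumpf_aux:
 fixes f :: "'a::real_normed_vector => real"
 assumes "smooth f" shows "Ck k (%z. bumpf m (f z))"
proof (induction k arbitrary: m)
 case 0
 have "continuous_on UNIV (bumpf m)" by (rule DERIV_continuous_on[OF has_field_derivative_at_within[OF bumpf_deriv]])
 then show ?case by (simp add: continuous_on_compose2[OF _ smooth_continuous[OF assms]])
next
 case (Suc k)
 have d: "((%z. bumpf m (f z)) has_derivative
   (%e. (bumpf (m+2) (f z) - real m * bumpf (m+1) (f z)) * Dd e f z)) (at z)" for z
  using has_derivative_compose[OF smooth_has_derivative[OF assms]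
   bumpf_deriv[of m "f z", unfolded has_field_derivative_def]] by (simp add: o_def mult.commute)
 then have "Dd e (%z. bumpf m (f z)) = (%z. (bumpf (m+2) (f z) + (- real m) * bumpf (m+1) (f z)) * Dd e f z)" for e
  using Dd_eq[OF d] by auto
 moreover have "Ck k (%z. (bumpf (m+2) (f z) + (- real m) * bumpf (m+1) (f z)) * Dd e f z)" for e
  by (intro Ck_bilinear[OF bounded_bilinear_mult] Ck_add Suc Ck_const)
   (use smooth_Dd[OF assms] smooth_def in blast)
 ultimately show ?case
  using d by (auto simp: differentiable_def)
qed

lemma smooth_bumpf:
 fixes f :: "'a::real_normed_vector => real"
 shows "smooth f ==> smooth (%z. bumpf m (f z))" by (simp add: smooth_def[of "%z. bumpf m (f z)"] Ck_bumpf_aux)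

section \<open>Derivatives along lines and symmetry of second derivatives\<close>

lemma smooth_line:
 assumes "smooth g"
 shows "((%x. g (p + x *\<^sub>R v)) has_vector_derivative Dd v g (p + x *\<^sub>R v)) (at x within S)"
proof -
 have "((%x. g (p + x *\<^sub>R v)) has_derivative (%h. Dd (h *\<^sub>R v) g (p + x *\<^sub>R v))) (at x within S)"
  by (rule has_derivative_compose[OF _ smooth_has_derivative[OF assms], of "%x. p + x *\<^sub>R v" "%h. h *\<^sub>R v" x S])
   (auto intro!: derivative_eq_intros)
 then show ?thesis
  unfolding has_vector_derivative_def by (simp add: linear_simps(5)[OF smooth_linear_Dd[OF assms]])
qed

lemma vector_mvt_bound:
 fixes f :: "real => 'b::real_normed_vector"
 assumes "s >= 0" and d: "!!x. x \<in> {0..s} ==> (f has_vector_derivative f' x) (at x within {0..s})"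
  and B: "!!x. x \<in> {0..s} ==> norm (f' x) <= B"
 shows "norm (f s - f 0) <= B * s"
proof -
 have "norm (f s - f 0) <= B * norm (s - 0)"
 proof (rule differentiable_bound[where S="{0..s}" and f'="%x h. h *\<^sub>R f' x"])
  show "onorm (%h. h *\<^sub>R f' x) <= B" if "x \<in> {0..s}" for x
   using B[OF that] by (intro onorm_le) (simp add: mult.commute[of B] mult_left_mono)
 qed (use assms in \<open>auto simp: has_vector_derivative_def\<close>)
 then show ?thesis using assms by simp
qed

text \<open>The second difference over a square of side \<open>s\<close> is estimated by the mean
  value inequality twice, along \<open>e'\<close> inside and along \<open>e\<close> outside. The
  second difference is symmetric in \<open>e\<close> and \<open>e'\<close>, so exchanging the two
  compares both mixed derivatives with the same quantity.\<close>

lemma Dd_commute_aux: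
 fixes f :: "'a::real_normed_vector => 'b::real_normed_vector"
 assumes sm: "smooth f" and s: "s >= 0"
  and om: "!!x y. 0 <= x ==> x <= s ==> 0 <= y ==> y <= s ==>
    norm (Dd e' (Dd e f) (z + x *\<^sub>R e + y *\<^sub>R e') - Dd e' (Dd e f) z) <= \<omega>"
 shows "norm (f (z + s *\<^sub>R e + s *\<^sub>R e') - f (z + s *\<^sub>R e) - f (z + s *\<^sub>R e') + f z
  - (s * s) *\<^sub>R Dd e' (Dd e f) z) <= \<omega> * s * s"
proof -
 define c where "c = Dd e' (Dd e f) z"
 have inner: "norm (Dd e f (z + x *\<^sub>R e + s *\<^sub>R e') - Dd e f (z + x *\<^sub>R e) - s *\<^sub>R c) <= \<omega> * s"
  if x: "0 <= x" "x <= s" for x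
 proof -
  have "norm ((Dd e f (z + x *\<^sub>R e + s *\<^sub>R e') - s *\<^sub>R c) - (Dd e f (z + x *\<^sub>R e + 0 *\<^sub>R e') - 0 *\<^sub>R c))
   <= \<omega> * s"
  proof (rule vector_mvt_bound[OF s])
   show "((%y. Dd e f (z + x *\<^sub>R e + y *\<^sub>R e') - y *\<^sub>R c) has_vector_derivative
    Dd e' (Dd e f) (z + x *\<^sub>R e + y *\<^sub>R e') - c) (at y within {0..s})" for y
    by (rule has_vector_derivative_diff[OF smooth_line[OF smooth_Dd[OF sm]]])
     (auto intro!: derivative_eq_intros)
  qed (use x om in \<open>auto simp: c_def\<close>)
  then show ?thesis by (simp add: algebra_simps)
 qed
 have "norm ((f (z + s *\<^sub>R e' + s *\<^sub>R e) - f (z + s *\<^sub>R e) - s *\<^sub>R (s *\<^sub>R c))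
    - (f (z + s *\<^sub>R e' + 0 *\<^sub>R e) - f (z + 0 *\<^sub>R e) - 0 *\<^sub>R (s *\<^sub>R c))) <= (\<omega> * s) * s"
 proof (rule vector_mvt_bound[OF s])
  show "((%x. f (z + s *\<^sub>R e' + x *\<^sub>R e) - f (z + x *\<^sub>R e) - x *\<^sub>R (s *\<^sub>R c)) has_vector_derivative
    Dd e f (z + s *\<^sub>R e' + x *\<^sub>R e) - Dd e f (z + x *\<^sub>R e) - s *\<^sub>R c) (at x within {0..s})" for x
   by (rule has_vector_derivative_diff[OF has_vector_derivative_diff[OF smooth_line[OF sm] smooth_line[OF sm]]])
    (auto intro!: derivative_eq_intros)
 next
  show "norm (Dd e f (z + s *\<^sub>R e' + x *\<^sub>R e) - Dd e f (z + x *\<^sub>R e) - s *\<^sub>R c) <= \<omega> * s" if "x \<in> {0..s}" for x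
   using inner[of x] that by (simp add: add.assoc add.commute[of "x *\<^sub>R e"])
 qed
 then show ?thesis by (simp add: c_def algebra_simps)
qed

lemma Dd_commute:
 fixes f :: "'a::real_normed_vector => 'b::real_normed_vector"
 assumes sm: "smooth f"
 shows "Dd e (Dd e' f) z = Dd e' (Dd e f) z"
proof -
 define a where "a = Dd e (Dd e' f) z - Dd e' (Dd e f) z"
 have "norm a <= 2 * \<omega>" if "\<omega> > 0" for \<omega>
 proof -
  have cont: "\<exists>d>0. \<forall>x. dist x z < d \<longrightarrow> norm (Dd u (Dd v f) x - Dd u (Dd v f) z) < \<omega>" for u v
   using smooth_continuous[OF smooth_Dd[OF smooth_Dd[OF sm]], of UNIV u v] that
   unfolding continuous_on_iff by (metis UNIV_I dist_norm)
  obtain d1 d2 where d: "d1 > 0" "d2 > 0"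
   and d1: "!!x. dist x z < d1 ==> norm (Dd e' (Dd e f) x - Dd e' (Dd e f) z) < \<omega>"
   and d2: "!!x. dist x z < d2 ==> norm (Dd e (Dd e' f) x - Dd e (Dd e' f) z) < \<omega>"
   using cont by metis
  define s where "s = min d1 d2 / (2 * (norm e + norm e' + 1))"
  have s: "s > 0" using d by (simp add: s_def add_nonneg_pos)
  have near: "dist (z + x *\<^sub>R u + y *\<^sub>R v) z < min d1 d2"
   if "0 <= x" "x <= s" "0 <= y" "y <= s" "norm u + norm v = norm e + norm e'" for x y u v
  proof -
   have "norm (x *\<^sub>R u + y *\<^sub>R v) <= x * norm u + y * norm v"
    using norm_triangle_ineq[of "x *\<^sub>R u" "y *\<^sub>R v"] that by simp
   also have "... <= s * norm u + s * norm v"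
    using that by (intro add_mono mult_right_mono) auto
   also have "... = s * (norm e + norm e')"
    using that by (metis distrib_left)
   also have "... < s * (2 * (norm e + norm e' + 1))"
    using s by (intro mult_strict_left_mono) (auto simp: add_nonneg_pos add.commute intro: add_pos_nonneg)
   also have "... = min d1 d2"
   proof -
    have "2 * (norm e + norm e' + 1) ~= 0"
     using norm_ge_zero[of e] norm_ge_zero[of e'] by (smt (verit))
    then show ?thesis unfolding s_def by (rule nonzero_eq_divide_eq[THEN iffD1, OF _ refl])
   qed
   finally show ?thesis by (simp add: dist_norm add.assoc)
  qed
  have 1: "norm (f (z + s *\<^sub>R e + s *\<^sub>R e') - f (z + s *\<^sub>R e) - f (z + s *\<^sub>R e') + f z
   - (s * s) *\<^sub>R Dd e' (Dd e f) z) <= \<omega> * s * s"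
   by (rule Dd_commute_aux[OF sm]) (use s near[of _ _ e e'] d1 in \<open>auto intro!: less_imp_le\<close>)
  have 2: "norm (f (z + s *\<^sub>R e' + s *\<^sub>R e) - f (z + s *\<^sub>R e') - f (z + s *\<^sub>R e) + f z
   - (s * s) *\<^sub>R Dd e (Dd e' f) z) <= \<omega> * s * s"
   by (rule Dd_commute_aux[OF sm]) (use s near[of _ _ e' e] d2 in \<open>auto intro!: less_imp_le\<close>)
  have eq: "(s * s) *\<^sub>R a = (f (z + s *\<^sub>R e + s *\<^sub>R e') - f (z + s *\<^sub>R e) - f (z + s *\<^sub>R e') + f z
    - (s * s) *\<^sub>R Dd e' (Dd e f) z) - (f (z + s *\<^sub>R e' + s *\<^sub>R e) - f (z + s *\<^sub>R e') - f (z + s *\<^sub>R e) + f z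
   - (s * s) *\<^sub>R Dd e (Dd e' f) z)" by (simp add: a_def algebra_simps)
  have "norm ((s * s) *\<^sub>R a) <= \<omega> * s * s + \<omega> * s * s"
   unfolding eq using norm_triangle_ineq4 1 2 by (meson add_mono order_trans)
  then have "(s * s) * norm a <= (s * s) * (2 * \<omega>)"
   using s by (simp add: algebra_simps)
  then show ?thesis using s by simp
 qed
 then have "norm a <= \<omega>" if "\<omega> > 0" for \<omega>
  using that by (metis half_gt_zero mult.commute nonzero_mult_div_cancel_left times_divide_eq_right zero_neq_numeral)
 then have "norm a <= 0" by (meson dense_ge)
 then show ?thesis by (simp add: a_def)
qed

section \<open>Convolution with compactly supported smooth kernels\<close>

definition lbm :: "('a::euclidean_space => complex) => bool" where
 "lbm f \<longleftrightarrow> f \<in> borel_measurable borel \<and> (\<forall>R. \<exists>B. \<forall>z. norm z <= R \<longrightarrow> norm (f z) <= B)"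

text \<open>A radius instead of a support set: radii add under convolution and grow by an arbitrary
  positive amount under differentiation. The companion class \<open>lbm\<close> admits discontinuous
  functions such as indicators of balls, which are mollified as well.\<close>

definition vanish :: "real => ('a::real_normed_vector => 'b::zero) => bool" where
 "vanish r f \<longleftrightarrow> (\<forall>z. norm z >= r \<longrightarrow> f z = 0)"

lemma vanishD: "vanish r f ==> norm z >= r ==> f z = 0"
 unfolding vanish_def by blast

lemma lbm_measurable [measurable_dest]: "lbm f ==> f \<in> borel_measurable borel" by (simp add: lbm_def)

lemma lbm_continuous: assumes "continuous_on UNIV f" shows "lbm f"
proof -
 have "\<exists>B. \<forall>z. norm z <= R \<longrightarrow> norm (f z) <= B" for R
 proof -
  have "compact (f ` cball 0 R)"
   using assms by (intro compact_continuous_image) (auto intro: continuous_on_subset)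
  then show ?thesis by (meson bounded_iff compact_imp_bounded image_eqI mem_cball_0)
 qed
 then show ?thesis
  using assms by (simp add: lbm_def borel_measurable_continuous_onI)
qed

lemma lbm_smooth: "smooth f ==> lbm f" by (simp add: lbm_continuous smooth_continuous)

lemma lbm_mult: assumes "lbm f" "lbm g" shows "lbm (%z. f z * g z)"
proof -
 have "\<exists>B. \<forall>z. norm z <= R \<longrightarrow> norm (f z * g z) <= B" for R
 proof -
  obtain A B where "!!z. norm z <= R ==> norm (f z) <= A" "!!z. norm z <= R ==> norm (g z) <= B"
   using assms by (metis lbm_def)
  then have "\<forall>z. norm z <= R \<longrightarrow> norm (f z * g z) <= A * B"
   by (metis (no_types, opaque_lifting) mult_mono norm_ge_zero norm_mult order_trans)
  then show ?thesis by blast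
 qed
 then show ?thesis using assms by (auto simp: lbm_def)
qed

lemma lbm_compose_isometry:
 assumes "lbm f" "g \<in> borel_measurable borel" "!!z. norm (g z) <= norm z + C"
 shows "lbm (%z. f (g z))"
proof -
 have "\<exists>B. \<forall>z. norm z <= R \<longrightarrow> norm (f (g z)) <= B" for R
 proof -
  obtain B where "!!z. norm z <= R + C ==> norm (f z) <= B" using assms by (metis lbm_def)
  then show ?thesis using assms(3) by (metis add_right_mono order_trans)
 qed
 then show ?thesis using assms by (auto simp: lbm_def)
qed

lemma lbm_shift: assumes "lbm f" shows "lbm (%w. f (z - w))"
 using assms by (rule lbm_compose_isometry[where C="norm z"])
  (auto intro: order_trans[OF norm_triangle_ineq4])

lemma integrable_lbm_vanish:
 fixes f :: "'a::euclidean_space => complex"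
 assumes "lbm f" "vanish r f" shows "integrable lborel f"
proof -
 obtain B where B: "!!z. norm z <= r ==> norm (f z) <= B" using assms(1) by (metis lbm_def)
 have "integrable lborel (%z::'a. \<bar>B\<bar> * indicator (cball 0 r) z :: real)"
  using emeasure_bounded_finite[of "cball (0::'a) r"] by (intro integrable_mult_right integrable_real_indicator) auto
 then show ?thesis
 proof (rule Bochner_Integration.integrable_bound)
  show "AE z in lborel. norm (f z) <= norm (\<bar>B\<bar> * indicator (cball 0 r) z :: real)"
   using B assms(2) by (force simp: vanish_def indicator_def)
 qed (use assms in \<open>simp add: lbm_def\<close>)
qed

lemma vanish_shift: "vanish r f ==> vanish (norm z + r) (%w. f (z - w))"
 unfolding vanish_def by (metis (no_types, lifting) add.commute add_le_cancel_left norm_minus_commute norm_triangle_sub order_trans)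

lemma vanish_mult1: "vanish r f ==> vanish r (%w. f w * (g w :: 'a::mult_zero))" by (simp add: vanish_def)
lemma vanish_mult2: "vanish r g ==> vanish r (%w. (f w :: 'a::mult_zero) * g w)" by (simp add: vanish_def)

lemma lborel_distr_reflect: "distr lborel borel (%w. z - w) = (lborel :: c2 measure)"
 using lborel_affine[of "-1" z] by (simp add: density_1)

lemma integral_reflect:
 fixes f :: "c2 => complex"
 assumes [measurable]: "f \<in> borel_measurable borel"
 shows "(LINT w|lborel. f (z - w)) = (LINT w|lborel. f w)"
proof -
 have "(LINT w|lborel. f w) = (LINT w|distr lborel borel (%w. z - w). f w)" by (simp add: lborel_distr_reflect)
 also have "... = (LINT w|lborel. f (z - w))" by (rule integral_distr) auto
 finally show ?thesis by simp
qed

lemma bochner_norm_bound: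
 fixes f :: "'a => 'b::{banach, second_countable_topology}"
 assumes "integrable M f" "integrable M g" "!!x. norm (f x) <= g x"
 shows "norm (integral\<^sup>L M f) <= integral\<^sup>L M g" by (rule order_trans[OF integral_norm_bound integral_mono]) (use assms in auto)

definition conv :: "(c2 => complex) => (c2 => complex) => c2 => complex" where
 "conv k f z = (LINT w|lborel. k (z - w) * f w)"

lemma conv_integrable:
 assumes "lbm k" "lbm f" "vanish r k \<or> vanish r f"
 shows "integrable lborel (%w. k (z - w) * f w)"
proof -
 have "lbm (%w. k (z - w) * f w)" by (intro lbm_mult lbm_shift assms)
 from assms(3) show ?thesis
 proof
  assume "vanish r k"
  from vanish_mult1[OF vanish_shift[OF this]] show ?thesis by (rule integrable_lbm_vanish[OF \<open>lbm (%w. k (z - w) * f w)\<close>])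
 next
  assume "vanish r f"
  from vanish_mult2[OF this] show ?thesis by (rule integrable_lbm_vanish[OF \<open>lbm (%w. k (z - w) * f w)\<close>])
 qed
qed

lemma conv_commute:
 assumes [measurable]: "k \<in> borel_measurable borel" "f \<in> borel_measurable borel"
 shows "conv k f z = conv f k z"
 unfolding conv_def by (subst integral_reflect[symmetric, of _ z]) (auto simp: mult.commute)

lemma Dd_sum_Basis:
 assumes "smooth (f :: c2 => 'b::real_normed_vector)"
 shows "Dd e f z = (\<Sum>b\<in>Basis. (e \<bullet> b) *\<^sub>R Dd b f z)"
proof -
 interpret bounded_linear "%e. Dd e f z" by (rule smooth_linear_Dd[OF assms])
 have "Dd e f z = Dd (\<Sum>b\<in>Basis. (e \<bullet> b) *\<^sub>R b) f z" by (simp add: euclidean_representation)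
 also have "... = (\<Sum>b\<in>Basis. Dd ((e \<bullet> b) *\<^sub>R b) f z)" by (rule sum)
 also have "... = (\<Sum>b\<in>Basis. (e \<bullet> b) *\<^sub>R Dd b f z)" by (simp only: scaleR)
 finally show ?thesis .
qed

lemma finite_dim_Dd_bound:
 fixes f :: "c2 => complex"
 assumes "smooth f" "!!b. b \<in> Basis ==> norm (Dd b f z) <= C"
 shows "norm (Dd e f z) <= 4 * C * norm e"
proof -
 have C: "C >= 0" using assms(2)[of "(1,0)"] norm_ge_zero order_trans by (metis Basis_complex_def Basis_prod_def UnI1 image_eqI insertI1)
 have "Dd e f z = (\<Sum>b\<in>Basis. (e \<bullet> b) *\<^sub>R Dd b f z)" by (rule Dd_sum_Basis[OF assms(1)])
 also have "norm ... <= (\<Sum>b\<in>(Basis::c2 set). norm e * C)" by (intro sum_norm_le) (auto intro!: mult_mono simp: Basis_le_norm assms)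
 finally show ?thesis by (simp add: mult_ac)
qed

lemma vanish_Dd:
 fixes f :: "c2 => 'b::real_normed_vector"
 assumes "vanish r f" "\<delta> > 0" shows "vanish (r + \<delta>) (Dd e f)"
proof -
 have "Dd e f z = 0" if z: "norm z >= r + \<delta>" for z
 proof (rule Dd_eq[where f'="%_. 0"])
  have ev: "eventually (%w. w \<in> {w. norm w > r}) (nhds z)"
   using z \<open>\<delta> > 0\<close> by (intro eventually_nhds_in_open) (auto intro!: open_Collect_less continuous_intros)
  have "((%_. 0) has_derivative (%_. 0)) (at z)" by simp
  then show "(f has_derivative (%_. 0)) (at z)" by (rule has_derivative_transform_eventually)
    (use ev vanishD[OF assms(1)] z \<open>\<delta> > 0\<close> in \<open>auto simp: eventually_at_filter elim!: eventually_mono\<close>)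
 qed
 then show ?thesis by (simp add: vanish_def)
qed

lemma vanish_bounded:
 assumes "continuous_on UNIV (f :: c2 => complex)" "vanish r f"
 obtains B where "B >= 0" "!!z. norm (f z) <= B"
proof -
 obtain B where B: "!!z. norm z <= r ==> norm (f z) <= B"
  using lbm_continuous[OF assms(1)] by (metis lbm_def)
 have "norm (f z) <= \<bar>B\<bar>" for z
  using vanishD[OF assms(2), of z] B[of z] by (cases "norm z <= r") auto
 then show thesis using that[of "\<bar>B\<bar>"] by auto
qed

lemma vanish_mono: "vanish r f ==> r <= s ==> vanish s f" by (auto simp: vanish_def)

lemma smooth_Dd_bounded:
 fixes f :: "c2 => complex"
 assumes "smooth f" "vanish r f"
 obtains B where "B >= 0" "!!e z. norm (Dd e f z) <= B * norm e"
proof -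
 have "\<exists>B\<ge>0. \<forall>z. norm (Dd b f z) <= B" for b
  using vanish_bounded[OF smooth_continuous[OF smooth_Dd[OF assms(1)]] vanish_Dd[OF assms(2), of 1]] by (metis zero_less_one)
 then obtain B where B: "!!b. B b >= 0" "!!b z. norm (Dd b f z) <= B b" by metis
 have "norm (Dd b f z) <= (\<Sum>b\<in>Basis. B b)" if "b \<in> Basis" for b z
  by (rule order_trans[OF B(2)], rule member_le_sum) (use that B(1) in auto)
 from finite_dim_Dd_bound[OF assms(1) this] show thesis
  using that[of "4 * (\<Sum>b\<in>Basis. B b)"] B by (simp add: sum_nonneg)
qed

lemma Dd_bounded_Lipschitz:
 fixes f :: "c2 => 'b::real_normed_vector"
 assumes "smooth f" and B: "!!e z. norm (Dd e f z) <= B * norm e"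
 shows "norm (f x - f y) <= B * norm (x - y)"
proof (rule differentiable_bound[where S=UNIV and f'="%z e. Dd e f z"])
 show "onorm (%e. Dd e f z) <= B" for z by (rule onorm_le[of "%e. Dd e f z"]) (rule B)
qed (auto simp: smooth_has_derivative assms)

lemma smooth_taylor2:
 fixes f :: "c2 => complex"
 assumes f: "smooth f" and B: "!!b e z. b \<in> Basis ==> norm (Dd e (Dd b f) z) <= B * norm e"
 shows "norm (f (z + h) - f z - Dd h f z) <= 4 * B * (norm h)^2"
proof -
 have B0: "B >= 0"
  using order_trans[OF norm_ge_zero B[of "(1,0)" "(1,0)" 0]] by (simp add: Basis_prod_def Basis_complex_def norm_Pair)
 have "norm ((f (z + 1 *\<^sub>R h) - 1 *\<^sub>R Dd h f z) - (f (z + 0 *\<^sub>R h) - 0 *\<^sub>R Dd h f z)) <= (4 * B * (norm h)^2) * 1"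
 proof (rule vector_mvt_bound)
  show "((%x. f (z + x *\<^sub>R h) - x *\<^sub>R Dd h f z) has_vector_derivative
    Dd h f (z + x *\<^sub>R h) - Dd h f z) (at x within {0..1})" for x
   by (rule has_vector_derivative_diff[OF smooth_line[OF f]]) (auto intro!: derivative_eq_intros)
  show "norm (Dd h f (z + x *\<^sub>R h) - Dd h f z) <= 4 * B * (norm h)^2" if x: "x \<in> {0..1}" for x
  proof -
   define g where "g = (%w. f (w + x *\<^sub>R h) - f w)"
   have "norm (Dd b f (z + x *\<^sub>R h) - Dd b f z) <= B * norm h" if "b \<in> Basis" for b
    using Dd_bounded_Lipschitz[OF smooth_Dd[OF f] B[OF that], of "z + x *\<^sub>R h" z] x B0
    by (auto intro!: order_trans[OF _ mult_left_mono[of _ "norm h" B]] simp: mult_left_le_one_le)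
   moreover have D: "Dd h f w = (\<Sum>b\<in>Basis. (h \<bullet> b) *\<^sub>R Dd b f w)" for w by (rule Dd_sum_Basis[OF f])
   ultimately have "norm ((\<Sum>b\<in>Basis. (h \<bullet> b) *\<^sub>R Dd b f (z + x *\<^sub>R h)) - (\<Sum>b\<in>Basis. (h \<bullet> b) *\<^sub>R Dd b f z)) <= (\<Sum>b\<in>(Basis::c2 set). norm h * (B * norm h))"
    unfolding sum_subtractf[symmetric] scaleR_diff_right[symmetric] by (intro sum_norm_le) (auto intro!: mult_mono simp: Basis_le_norm)
   then show ?thesis unfolding D[symmetric] by (simp add: power2_eq_square mult_ac)
  qed
 qed auto
 then show ?thesis by (simp add: algebra_simps)
qed

lemma smooth_vanish_taylor2:
 fixes f :: "c2 => complex"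
 assumes f: "smooth f" and v: "vanish r f"
 obtains C where "C >= 0" "!!z h. norm (f (z + h) - f z - Dd h f z) <= C * (norm h)^2"
proof -
 have "\<exists>B\<ge>0. \<forall>e z. norm (Dd e (Dd b f) z) <= B * norm e" for b
  using smooth_Dd_bounded[OF smooth_Dd[OF f] vanish_Dd[OF v, of 1]] by (metis zero_less_one)
 then obtain B where B: "!!b. B b >= 0" "!!b e z. norm (Dd e (Dd b f) z) <= B b * norm e" by metis
 have "norm (Dd e (Dd b f) z) <= (\<Sum>b\<in>Basis. B b) * norm e" if "b \<in> Basis" for b e z
  using member_le_sum[OF that, of B] B(1) by (intro order_trans[OF B(2) mult_right_mono]) auto
 from smooth_taylor2[OF f this] show thesis
  using that[of "4 * (\<Sum>b\<in>Basis. B b)"] B by (simp add: sum_nonneg)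
qed

text \<open>The Taylor error of the kernel is quadratic with a constant independent of the point,
  and it vanishes off a fixed ball. Integrated against a locally bounded \<open>f\<close> it stays
  quadratic, so \<open>f\<close> may be rough.\<close>

lemma conv_has_derivative:
 assumes k: "smooth k" "vanish r k" and f: "lbm f"
 shows "(conv k f has_derivative (%e. conv (Dd e k) f z)) (at z)"
proof -
 obtain C where C: "C >= 0" "!!z h. norm (k (z + h) - k z - Dd h k z) <= C * (norm h)^2"
  using smooth_vanish_taylor2[OF k] by metis
 obtain B where B: "B >= 0" "!!e z. norm (Dd e k z) <= B * norm e"
  using smooth_Dd_bounded[OF k] by metis
 have int: "integrable lborel (%w. Dd e k (z - w) * f w)" for e z
  using conv_integrable[OF lbm_smooth[OF smooth_Dd[OF k(1)]] f] vanish_Dd[OF k(2), of 1] by (metis zero_less_one)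
 have intk: "integrable lborel (%w. k (z - w) * f w)" for z
  using conv_integrable[OF lbm_smooth[OF k(1)] f] k(2) by metis
 \<comment> \<open>The ball leaves room for a shift by at most 1 and for the enlarged support of the
   derivative kernel; outside it all three terms of the error vanish.\<close>
 define I where "I = (LINT w|lborel. norm (indicator (cball 0 (norm z + r + 2)) w * f w))"
 have intI: "integrable lborel (%w. norm (indicator (cball 0 (norm z + r + 2)) w * f w))"
 proof (intro integrable_norm integrable_lbm_vanish[where r="norm z + r + 3"])
  have "lbm (indicator (cball 0 (norm z + r + 2)))" by (auto simp: lbm_def indicator_def intro!: exI[of _ 1] borel_measurable_indicator')
  then show "lbm (%w. indicator (cball 0 (norm z + r + 2)) w * f w)" by (intro lbm_mult f)
 qed (auto simp: vanish_def)
 have lin: "conv (Dd (s *\<^sub>R x + y) k) f z = s *\<^sub>R conv (Dd x k) f z + conv (Dd y k) f z" for s x y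
 proof -
  have "(%w. Dd (s *\<^sub>R x + y) k (z - w) * f w) = (%w. s *\<^sub>R (Dd x k (z - w) * f w) + Dd y k (z - w) * f w)"
   using linear_simps[OF smooth_linear_Dd[OF k(1)]] by (auto simp: algebra_simps)
  then show ?thesis unfolding conv_def using int by simp
 qed
 have main: "norm (conv k f (z + h) - conv k f z - conv (Dd h k) f z) <= C * I * (norm h)^2"
  if h: "norm h <= 1" for h
 proof -
  have "conv k f (z + h) - conv k f z - conv (Dd h k) f z =
   (LINT w|lborel. k (z + h - w) * f w - k (z - w) * f w - Dd h k (z - w) * f w)"
   unfolding conv_def using int intk by simp
  also have "norm ... <= (LINT w|lborel. C * (norm h)^2 * norm (indicator (cball 0 (norm z + r + 2)) w * f w))"
  proof (rule bochner_norm_bound)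
   show "integrable lborel (%w. k (z + h - w) * f w - k (z - w) * f w - Dd h k (z - w) * f w)"
    using int intk by simp
   show "norm (k (z + h - w) * f w - k (z - w) * f w - Dd h k (z - w) * f w)
    <= C * (norm h)^2 * norm (indicator (cball 0 (norm z + r + 2)) w * f w)" for w
   proof (cases "norm w <= norm z + r + 2")
    case True
    have "norm (k (z + h - w) * f w - k (z - w) * f w - Dd h k (z - w) * f w)
     = norm (k ((z - w) + h) - k (z - w) - Dd h k (z - w)) * norm (f w)" by (simp add: norm_mult[symmetric] algebra_simps)
    also have "... <= (C * (norm h)^2) * norm (f w)"
     using C by (intro mult_right_mono) auto
    finally show ?thesis using True by simp
   next
    case False
    then have "norm (z - w) >= r + 2" "norm (z + h - w) >= r + 1"
     using h norm_triangle_ineq2[of w z] norm_triangle_ineq2[of w "z + h"] norm_triangle_ineq[of z h] by (auto simp: norm_minus_commute)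
    then show ?thesis
     using vanishD[OF k(2)] vanishD[OF vanish_Dd[OF k(2), of 1 h]] False by simp
   qed
  qed (use intI in simp)
  also have "... = C * I * (norm h)^2" unfolding I_def by (simp add: mult_ac)
  finally show ?thesis .
 qed
 have I0: "I >= 0" unfolding I_def by simp
 show ?thesis
  unfolding has_derivative_at
 proof
  show "bounded_linear (%e. conv (Dd e k) f z)"
  proof -
   have "linear (%e. conv (Dd e k) f z)"
   proof (rule linearI)
    have "conv (Dd 0 k) f z = 0" by (simp add: conv_def linear_simps(3)[OF smooth_linear_Dd[OF k(1)]])
    then show "conv (Dd (s *\<^sub>R x) k) f z = s *\<^sub>R conv (Dd x k) f z" for s x
     using lin[of s x 0] by simp
   qed (use lin[of 1] in simp)
   then show ?thesis by (rule linear_conv_bounded_linear[THEN iffD1])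
  qed
  show "((%h. norm (conv k f (z + h) - conv k f z - conv (Dd h k) f z) / norm h) \<longlongrightarrow> 0) (at 0)"
  proof (rule Lim_null_comparison)
   have "eventually (%h. h \<in> ball 0 1) (at (0::c2))" by (intro eventually_at_in_open') auto
   then show "eventually (%h. norm (norm (conv k f (z + h) - conv k f z - conv (Dd h k) f z) / norm h)
     <= C * I * norm h) (at 0)"
   proof eventually_elim
    case (elim h)
    then show ?case
     using main[of h] C(1) I0 by (cases "h = 0") (auto simp: divide_le_eq power2_eq_square mult_ac)
   qed
   have "((%h::c2. C * I * norm h) \<longlongrightarrow> C * I * norm (0::c2)) (at 0)" by (intro tendsto_intros)
   then show "((%h::c2. C * I * norm h) \<longlongrightarrow> 0) (at 0)" by simp
  qed
 qed
qed

lemma Dd_conv: "smooth k ==> vanish r k ==> lbm f ==> Dd e (conv k f) = conv (Dd e k) f"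
 using conv_has_derivative Dd_eq by blast

lemma smooth_conv:
 assumes "smooth k" "vanish r k" "lbm f" shows "smooth (conv k f)"
proof -
 have "Ck n (conv k f)" if "smooth k" "vanish r k" for n k r
  using that
 proof (induction n arbitrary: k r)
  case 0
  then show ?case
   using conv_has_derivative[OF _ _ assms(3)] by (auto intro!: has_derivative_continuous_on simp: )
 next
  case (Suc n)
  have "Ck n (Dd e (conv k f))" for e
   using Suc.IH[OF smooth_Dd[OF Suc.prems(1)] vanish_Dd[OF Suc.prems(2), of 1]] by (simp add: Dd_conv[OF Suc.prems assms(3)])
  then show ?case
   using differentiableI[OF conv_has_derivative[OF Suc.prems assms(3)]] by (simp del: split_paired_All)
 qed
 then show ?thesis using assms by (auto simp: smooth_def)
qed

lemma vanish_conv: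
 assumes "vanish r k" "vanish s f" shows "vanish (r + s) (conv k f)"
proof -
 have "k (z - w) * f w = 0" if "norm z >= r + s" for z w
  using that vanishD[OF assms(1), of "z - w"] vanishD[OF assms(2), of w] norm_triangle_ineq2[of z w] by (cases "norm w >= s") auto
 then have "conv k f z = 0" if "norm z >= r + s" for z
  using that unfolding conv_def by (subst Bochner_Integration.integral_cong[OF refl, of _ _ "%_. 0"]) auto
 then show ?thesis unfolding vanish_def by blast
qed

text \<open>Convolution with the constant 1 produces a constant function, whose derivative is 0.
  This stands in for integration by parts.\<close>

lemma integral_Dd_zero:
 assumes "smooth (f :: c2 => complex)" "vanish r f" shows "(LINT w|lborel. Dd e f w) = 0"
proof -
 have "conv f (%_. 1) = (%z. LINT w|lborel. f w)"
  using assms by (auto simp: conv_def integral_reflect smooth_borel)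
 then have "Dd e (conv f (%_. 1)) 0 = 0" by simp
 moreover have "Dd e (conv f (%_. 1)) 0 = conv (Dd e f) (%_. 1) 0"
  using Dd_conv[OF assms lbm_smooth[of "%_. 1"]] by simp
 moreover have "conv (Dd e f) (%_. 1) 0 = (LINT w|lborel. Dd e f w)"
  using integral_reflect[of "Dd e f" 0] smooth_borel[OF smooth_Dd[OF assms(1)]] by (simp add: conv_def)
 ultimately show ?thesis by simp
qed

section \<open>Duality in an incomplete inner product space\<close>

lemma riesz_sequence:
 fixes S :: "'h::real_inner set" and l :: "'h => real"
 assumes S: "subspace S"
  and lin: "!!x y s. l (s *\<^sub>R x + y) = s * l x + l y"
  and bd: "!!x. x \<in> S ==> \<bar>l x\<bar> <= M * norm x" and M: "M >= 0"
 obtains X :: "nat => 'h" where "!!k. X k \<in> S" "Cauchy X" "!!k. norm (X k) <= M + 1"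
  "!!y. y \<in> S ==> (%k. X k \<bullet> y) \<longlonglongrightarrow> l y"
proof -
 \<comment> \<open>Riesz representation without completeness: the minimiser of \<open>E\<close> on
   \<open>S\<close> would represent \<open>l\<close>. A minimising sequence already serves: it is
   Cauchy by convexity, and perturbing it shows that it represents \<open>l\<close>
   asymptotically.\<close>
 define E where "E x = (norm x)^2 - 2 * l x" for x
 have l0: "l 0 = 0" using lin[of 1 0 0] by simp
 have E_ge: "E x >= - M\<^sup>2" if "x \<in> S" for x
 proof -
  have "0 <= (norm x - M)^2" by simp
  moreover have "l x <= M * norm x" using bd[OF that] by simp
  ultimately show ?thesis unfolding E_def power2_diff by (simp add: mult_ac)
 qed
 define m where "m = Inf (E ` S)"
 have bdd: "bdd_below (E ` S)" using E_ge by (auto simp: bdd_below_def)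
 have m_le: "m <= E x" if "x \<in> S" for x
  unfolding m_def using bdd that by (intro cInf_lower) auto
 have ex: "\<exists>x\<in>S. E x < m + 1 / (real k + 1)" for k :: nat
 proof -
  have "Inf (E ` S) < m + 1 / (real k + 1)" by (simp add: m_def)
  then show ?thesis
   using cInf_lessD[of "E ` S"] subspace_0[OF S] by blast
 qed
 then obtain X where XS: "!!k. X k \<in> S" and XE: "!!k::nat. E (X k) < m + 1 / (real k + 1)" by metis
 have dev: "(X k \<bullet> y - l y)^2 <= (1 / (real k + 1)) * (norm y)^2" if y: "y \<in> S" for k y
 proof (cases "y = 0")
  case True
  then show ?thesis by (simp add: l0)
 next
  case False
  define d where "d = X k \<bullet> y - l y"
  \<comment> \<open>The minimiser of the quadratic polynomial t -> E (X k + t y).\<close>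
  define t where "t = - d / (norm y)^2"
  have "X k + t *\<^sub>R y \<in> S" using XS y S by (simp add: subspace_add subspace_scale)
  then have "m <= E (X k + t *\<^sub>R y)" by (rule m_le)
  also have "... = E (X k) + 2 * t * d + t^2 * (norm y)^2"
   using lin[of t y "X k"] by (simp add: E_def d_def power2_norm_eq_inner inner_add inner_commute algebra_simps power2_eq_square[of t])
  also have "... = E (X k) - d^2 / (norm y)^2"
   using False by (simp add: t_def field_simps power2_eq_square)
  finally have "d^2 / (norm y)^2 < 1 / (real k + 1)" using XE[of k] by simp
  then show ?thesis using False by (simp add: d_def divide_less_eq less_imp_le)
 qed
 have norm: "norm (X k) <= M + 1" for k
 proof -
  have "(X k \<bullet> X k - l (X k))^2 <= 1 * (norm (X k))^2" by (rule order_trans[OF dev[OF XS] mult_right_mono]) auto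
  then have "\<bar>X k \<bullet> X k - l (X k)\<bar> <= norm (X k)"
   using abs_le_square_iff[of "X k \<bullet> X k - l (X k)" "norm (X k)"] by simp
  then have "norm (X k) * norm (X k) <= (M + 1) * norm (X k)"
   using bd[OF XS[of k]] by (simp add: power2_norm_eq_inner[symmetric] power2_eq_square algebra_simps)
  then show ?thesis using M by (cases "norm (X k) = 0") auto
 qed
 \<comment> \<open>Parallelogram identity at the midpoint, whose energy is at least
   \<open>m\<close>.\<close>
 have cauchy: "(norm (X k - X j))^2 <= 2 * (1 / (real k + 1)) + 2 * (1 / (real j + 1))" for k j
 proof -
  have "(1/2) *\<^sub>R X k + (1/2) *\<^sub>R X j \<in> S"
   using XS S by (simp add: subspace_add subspace_scale)
  then have "m <= E ((1/2) *\<^sub>R X k + (1/2) *\<^sub>R X j)" by (rule m_le)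
  also have "... = E (X k) / 2 + E (X j) / 2 - (norm (X k - X j))^2 / 4"
  proof -
   have "l ((1/2) *\<^sub>R X k + (1/2) *\<^sub>R X j) = l (X k) / 2 + l (X j) / 2"
    using lin[of "1/2" "X k" "(1/2) *\<^sub>R X j"] lin[of "1/2" "X j" 0] by (simp add: l0)
   then show ?thesis by (simp add: E_def power2_norm_eq_inner inner_add inner_diff inner_commute field_simps)
  qed
  finally show ?thesis using XE[of k] XE[of j] by simp
 qed
 have "Cauchy X"
 proof (rule metric_CauchyI)
  fix e :: real assume e: "e > 0"
  obtain N where N: "1 / (real N + 1) < e^2 / 4"
   using reals_Archimedean[of "e^2 / 4"] e by (auto simp: inverse_eq_divide add.commute)
  have "dist (X k) (X j) < e" if "k >= N" "j >= N" for k j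
  proof -
   have "1 / (real i + 1) <= 1 / (real N + 1)" if "i >= N" for i using that by (simp add: frac_le)
   from this[of k] this[of j] have "(norm (X k - X j))^2 < e^2" using cauchy[of k j] N that by linarith
   then show ?thesis using e by (simp add: dist_norm power_less_imp_less_base)
  qed
  then show "\<exists>N. \<forall>k\<ge>N. \<forall>j\<ge>N. dist (X k) (X j) < e" by blast
 qed
 moreover have "(%k. X k \<bullet> y) \<longlonglongrightarrow> l y" if y: "y \<in> S" for y
 proof -
  have "(%k. (1 / (real k + 1)) * (norm y)^2) \<longlonglongrightarrow> 0 * (norm y)^2"
   by (intro tendsto_mult tendsto_const) (use LIMSEQ_inverse_real_of_nat in \<open>simp add: inverse_eq_divide add.commute\<close>)
  then have "(%k. (X k \<bullet> y - l y)^2) \<longlonglongrightarrow> 0"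
   by (intro Lim_null_comparison[of "%k. (X k \<bullet> y - l y)^2"]) (use dev[OF y] in auto)
  then have "(%k. sqrt ((X k \<bullet> y - l y)^2)) \<longlonglongrightarrow> sqrt 0" by (rule tendsto_real_sqrt)
  then show ?thesis by (simp add: tendsto_rabs_zero_iff Lim_null[symmetric])
 qed
 ultimately show thesis using that XS norm by blast
qed

text \<open>Abstract weighted d-bar complex: \<open>A1\<close>, \<open>A2\<close> are the d-bar
  operators, \<open>B1\<close>, \<open>B2\<close> their formal adjoints, \<open>J m\<close>
  mollifiers. \<open>R1\<close> to \<open>S2\<close> are Friedrichs commutators, which tend to 0. In
  \<open>SB1\<close> and \<open>SB2\<close> a second derivative is involved and only a bound uniform
  in \<open>m\<close> survives; \<open>cm\<close> may blow up with \<open>m\<close>.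
  \<open>pos\<close> stands for positivity of the Levi form without a uniform lower bound: each
  fixed \<open>f\<close> gets its own constant.\<close>

locale dbar_complex =
 fixes A1 A2 B1 B2 :: "'h::real_inner => 'h" and J :: "nat => 'h => 'h"
  and err cm :: "nat => real" and C :: real
 assumes linA1: "linear A1" and linA2: "linear A2" and linB1: "linear B1" and linB2: "linear B2"
  and linJ: "!!m. linear (J m)"
  and adj1: "!!f g. A1 f \<bullet> g = f \<bullet> B1 g" and adj2: "!!f g. A2 f \<bullet> g = f \<bullet> B2 g"
  and comm: "!!f. A1 (A2 f) = A2 (A1 f)"
  and Jadj: "!!m f g. J m f \<bullet> g = f \<bullet> J m g" and Jle: "!!m f. norm (J m f) <= norm f"
  and Jlim: "!!f. (%m. J m f) \<longlonglongrightarrow> f"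
  and err: "err \<longlonglongrightarrow> 0"
  and R1: "!!m f. norm (B1 (J m f) - J m (B1 f)) <= err m * norm f"
  and R2: "!!m f. norm (B2 (J m f) - J m (B2 f)) <= err m * norm f"
  and S1: "!!m f. norm (A1 (J m f) - J m (A1 f)) <= err m * norm f"
  and S2: "!!m f. norm (A2 (J m f) - J m (A2 f)) <= err m * norm f"
  and SB1: "!!m f. norm (A1 (J m (B1 f)) - J m (A1 (B1 f))) <= C * norm f"
  and SB2: "!!m f. norm (A2 (J m (B2 f)) - J m (A2 (B2 f))) <= C * norm f"
  and BJ1: "!!m f. norm (B1 (J m f)) <= cm m * norm f"
  and BJ2: "!!m f. norm (B2 (J m f)) <= cm m * norm f"
  and pos: "!!f. \<exists>c. \<forall>g. \<bar>g \<bullet> f\<bar> <= c * sqrt ((norm (B1 g))^2 + (norm (B2 g))^2)"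
begin

lemma B_comm: "B1 (B2 g) = B2 (B1 g)"
proof -
 have "f \<bullet> (B1 (B2 g) - B2 (B1 g)) = 0" for f by (metis adj1 adj2 cancel_comm_monoid_add_class.diff_cancel comm inner_diff_right)
 then show ?thesis by (metis inner_eq_zero_iff right_minus_eq)
qed

text \<open>One \<open>B\<close> is carried to the other side as \<open>A\<close>. The defects are
  commutators with \<open>J m\<close>; in the main term \<open>g\<close> is paired with the image
  under A B of a mollified element, where an asymptotic equation for \<open>g\<close> can be
  used.\<close>

lemma BJ_identity:
 fixes A B :: "'h => 'h"
 assumes "linear B" and adj: "!!f g. A f \<bullet> g = f \<bullet> B g"
 shows "B (J m f) \<bullet> B (J m g) = A (B (J m (J m f))) \<bullet> g + J m f \<bullet> (A (J m (B g)) - J m (A (B g)))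
  + B (J m f) \<bullet> (B (J m g) - J m (B g))"
proof -
 have adj': "B f \<bullet> g = f \<bullet> A g" for f g by (metis adj inner_commute)
 have "J m f \<bullet> A (J m (B g)) = B (J m f) \<bullet> J m (B g)" by (simp add: adj')
 moreover have "J m f \<bullet> J m (A (B g)) = A (B (J m (J m f))) \<bullet> g" by (simp add: adj adj' Jadj[symmetric])
 ultimately show ?thesis by (simp add: inner_diff_right)
qed

text \<open>The pairing with \<open>f0\<close> is represented asymptotically on the range of
  \<open>T\<close>, whose second component records the compatibility term
  \<open>A1 \<alpha>2 - A2 \<alpha>1\<close>. The first component of the representing sequence is
  \<open>v\<close>. In a complete space the second component would vanish as a solution of the
  homogeneous adjoint problem; here it is shown to tend weakly to 0.\<close>

theorem exists_minimal_sequence: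
 assumes M: "M >= 0" and bound: "!!\<alpha>1 \<alpha>2. \<bar>f0 \<bullet> (B1 \<alpha>1 + B2 \<alpha>2)\<bar>
   <= M * sqrt ((norm (B1 \<alpha>1 + B2 \<alpha>2))^2 + (norm (A1 \<alpha>2 - A2 \<alpha>1))^2)"
 obtains v where "Cauchy v" "!!k. norm (v k) <= M + 1"
  "!!\<beta>1 \<beta>2. (%k. (f0 - v k) \<bullet> (B1 \<beta>1 + B2 \<beta>2)) \<longlonglongrightarrow> 0"
proof -
 define T where "T p = (B1 (fst p) + B2 (snd p), A1 (snd p) - A2 (fst p))" for p
 have linT: "linear T" by (rule linearI) (auto simp: T_def linear_add[OF linA1] linear_add[OF linA2] linear_add[OF linB1]
    linear_add[OF linB2] linear_scale[OF linA1] linear_scale[OF linA2] linear_scale[OF linB1]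
    linear_scale[OF linB2] algebra_simps)
 have sub: "subspace (range T)" using linT by (simp add: linear_subspace_image)
 obtain X where X: "!!k. X k \<in> range T" "Cauchy X" "!!k. norm (X k) <= M + 1"
  "!!y. y \<in> range T ==> (%k. X k \<bullet> y) \<longlonglongrightarrow> f0 \<bullet> fst y"
 proof (rule riesz_sequence[OF sub, of "%x. f0 \<bullet> fst x" M])
  show "f0 \<bullet> fst (s *\<^sub>R x + y) = s * (f0 \<bullet> fst x) + f0 \<bullet> fst y" for s and x y :: "'h \<times> 'h"
   by (simp add: inner_add_right)
  show "\<bar>f0 \<bullet> fst x\<bar> <= M * norm x" if "x \<in> range T" for x
   using that bound by (auto simp: T_def norm_Pair)
 qed (use M in blast)+
 define v where "v k = fst (X k)" for k
 define s where "s k = snd (X k)" for k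
 have cv: "Cauchy v" unfolding v_def
  using X(2) by (intro bounded_linear.Cauchy[OF bounded_linear_fst, unfolded o_def]) 
 have cs: "Cauchy s" unfolding s_def
  using X(2) by (intro bounded_linear.Cauchy[OF bounded_linear_snd, unfolded o_def])
 have nv: "norm (v k) <= M + 1" for k
  using X(3)[of k] norm_fst_le[of "fst (X k)" "snd (X k)"] unfolding v_def by simp
 define L where "L = M + 1"
 have ns: "norm (s k) <= L" for k
  using X(3)[of k] norm_snd_le[of "snd (X k)" "fst (X k)"] unfolding s_def L_def by simp
 have L0: "L >= 0" using ns[of 0] norm_ge_zero order_trans by blast
 have lim: "(%k. v k \<bullet> (B1 \<beta>1 + B2 \<beta>2) + s k \<bullet> (A1 \<beta>2 - A2 \<beta>1)) \<longlonglongrightarrow> f0 \<bullet> (B1 \<beta>1 + B2 \<beta>2)" for \<beta>1 \<beta>2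
  using X(4)[OF rangeI, of "(\<beta>1, \<beta>2)"] by (simp add: inner_prod_def v_def s_def T_def)
 define P where "P g = A1 (B1 g) + A2 (B2 g)" for g
 \<comment> \<open>The pairs \<open>(- B2 g, B1 g)\<close> are annihilated by the first component of
   \<open>T\<close>, so they test \<open>s\<close> alone. In the limit \<open>s\<close> is
   orthogonal to the range of the Laplacian \<open>P\<close>.\<close>
 have limP: "(%k. s k \<bullet> P g) \<longlonglongrightarrow> 0" for g
 proof -
  have "B1 (- B2 g) + B2 (B1 g) = 0" by (simp add: linear_neg[OF linB1] B_comm)
  moreover have "A1 (B1 g) - A2 (- B2 g) = P g" by (simp add: P_def linear_neg[OF linA2])
  ultimately show ?thesis using lim[of "- B2 g" "B1 g"] by simp
 qed
 \<comment> \<open>Formally the squared norms of \<open>B1 s\<close> and \<open>B2 s\<close> add up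
   to the pairing of \<open>s\<close> with \<open>P s\<close>, that is 0. As \<open>s\<close> is
   only a Cauchy sequence and \<open>B\<close> is unbounded, it is mollified first. Order of
   choices: \<open>l0\<close> from the Cauchy property, \<open>m\<close> for the single element
   \<open>s l0\<close>, then \<open>l1\<close> depending on \<open>m\<close> through
   \<open>cm m\<close>.\<close>
 have key: "\<exists>m l1. \<forall>l\<ge>l1. (norm (B1 (J m (s l))))^2 + (norm (B2 (J m (s l))))^2 <= \<kappa> \<and> norm (J m (s l) - s l) <= \<kappa>"
  if \<kappa>: "0 < \<kappa>" "\<kappa> <= 1" for \<kappa>
 proof -
  define D where "D = L * \<bar>C\<bar> + 1"
  have D: "D > 0" "L * \<bar>C\<bar> <= D" "1 <= D" using L0 by (auto simp: D_def add_nonneg_pos)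
  define \<tau> where "\<tau> = \<kappa> / (16 * D)"
  have \<tau>: "\<tau> > 0" "\<tau> <= \<kappa> / 16" "L * (2 * \<bar>C\<bar> * \<tau>) <= \<kappa> / 8"
  proof -
   show "\<tau> > 0" using \<kappa> D by (simp add: \<tau>_def)
   show "\<tau> <= \<kappa> / 16" unfolding \<tau>_def by (rule divide_left_mono) (use \<kappa> D in auto)
   have "L * (2 * \<bar>C\<bar> * \<tau>) = (L * \<bar>C\<bar>) * (2 * \<tau>)" by simp
   also have "... <= D * (2 * \<tau>)" using D \<open>\<tau> > 0\<close> by (intro mult_right_mono) auto
   also have "... = \<kappa> / 8" using D by (simp add: \<tau>_def)
   finally show "L * (2 * \<bar>C\<bar> * \<tau>) <= \<kappa> / 8" .
  qed
  obtain l0 where l0: "!!k. k >= l0 ==> norm (s k - s l0) < \<tau>"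
   using cs \<tau>(1) unfolding Cauchy_altdef2 dist_norm by blast
  define b1 where "b1 = norm (B1 (s l0))"
  define b2 where "b2 = norm (B2 (s l0))"
  have "(%m. err m * (L * (b1 + b2))) \<longlonglongrightarrow> 0" "(%m. err m * L) \<longlonglongrightarrow> 0"
   "(%m. norm (J m (s l0) - s l0)) \<longlonglongrightarrow> 0"
   using tendsto_mult_left_zero[OF err] Jlim[of "s l0"] by (auto simp: tendsto_norm_zero Lim_null[symmetric])
  then have "eventually (%m. err m * (L * (b1 + b2)) < \<kappa> / 8) sequentially"
    "eventually (%m. err m * L < \<kappa> / 8) sequentially"
    "eventually (%m. norm (J m (s l0) - s l0) < \<kappa> / 8) sequentially"
   using order_tendstoD(2)[of _ 0 sequentially "\<kappa> / 8"] \<kappa> by auto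
  then have "eventually (%m. err m * (L * (b1 + b2)) < \<kappa> / 8 \<and> err m * L < \<kappa> / 8
    \<and> norm (J m (s l0) - s l0) < \<kappa> / 8) sequentially" by eventually_elim auto
  then obtain m where m: "err m * (L * (b1 + b2)) < \<kappa> / 8" "err m * L < \<kappa> / 8"
   "norm (J m (s l0) - s l0) < \<kappa> / 8"
   using eventually_happens by (auto simp: eventually_sequentially)
  have "\<kappa> / (8 * (\<bar>cm m\<bar> + 1)) > 0" using \<kappa> by simp
  then obtain l1 where l1: "!!k l. k >= l1 ==> l >= l1 ==> norm (s k - s l) < \<kappa> / (8 * (\<bar>cm m\<bar> + 1))"
   using cs unfolding Cauchy_def dist_norm by meson
  have J_near: "norm (J m (s l) - s l) <= \<kappa>" if "l >= l0" for l
  proof -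
   have "J m (s l) - s l = J m (s l - s l0) + (J m (s l0) - s l0) - (s l - s l0)" by (simp add: linear_diff[OF linJ])
   then have "norm (J m (s l) - s l) <= norm (J m (s l - s l0)) + norm (J m (s l0) - s l0) + norm (s l - s l0)"
    by (smt (verit) norm_triangle_ineq norm_triangle_ineq4)
   also have "... <= \<tau> + \<kappa> / 8 + \<tau>"
    using Jle[of m "s l - s l0"] m(3) l0[OF that] by linarith
   finally show ?thesis using \<tau>(2) \<kappa> by simp
  qed
  \<comment> \<open>Split \<open>s k\<close> at \<open>s l0\<close>: the fixed part has a small
    commutator for this \<open>m\<close>, and the remainder is small and meets the uniform constant
    \<open>C\<close>.\<close>
  have SBsmall: "norm (A (J m (B (s k))) - J m (A (B (s k)))) <= err m * norm (B (s l0)) + \<bar>C\<bar> * \<tau>"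
   if lin: "linear A" "linear B" and Sj: "!!f. norm (A (J m f) - J m (A f)) <= err m * norm f"
    and SBj: "!!f. norm (A (J m (B f)) - J m (A (B f))) <= C * norm f" and k: "k >= l0" for A B :: "'h => 'h" and k
  proof -
   have "A (J m (B (s k))) - J m (A (B (s k))) = (A (J m (B (s l0))) - J m (A (B (s l0))))
     + (A (J m (B (s k - s l0))) - J m (A (B (s k - s l0))))" by (simp add: linear_diff[OF linJ] linear_diff[OF lin(1)] linear_diff[OF lin(2)])
   then have "norm (A (J m (B (s k))) - J m (A (B (s k)))) <= err m * norm (B (s l0)) + C * norm (s k - s l0)"
    using norm_triangle_ineq Sj[of "B (s l0)"] SBj[of "s k - s l0"] by (smt (verit))
   also have "C * norm (s k - s l0) <= \<bar>C\<bar> * \<tau>"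
    using l0[OF k] by (intro mult_mono) auto
   finally show ?thesis by simp
  qed
  have one: "B (J m (s l)) \<bullet> B (J m (s l)) <= A (B (J m (J m (s l)))) \<bullet> s k + L * (err m * norm (B (s l0)) + \<bar>C\<bar> * \<tau>)
    + norm (B (J m (s l))) * (\<kappa> / 4)"
   if lin: "linear A" "linear B" and adj: "!!f g. A f \<bullet> g = f \<bullet> B g"
    and Sj: "!!f. norm (A (J m f) - J m (A f)) <= err m * norm f"
    and SBj: "!!f. norm (A (J m (B f)) - J m (A (B f))) <= C * norm f"
    and Rj: "!!f. norm (B (J m f) - J m (B f)) <= err m * norm f"
    and BJj: "!!f. norm (B (J m f)) <= cm m * norm f"
    and k: "k >= l0" "k >= l1" and l: "l >= l1" for A B :: "'h => 'h" and k l
  proof -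
   have "B (J m (s l)) \<bullet> B (J m (s l)) = B (J m (s l)) \<bullet> B (J m (s k)) + B (J m (s l)) \<bullet> B (J m (s l - s k))"
    by (simp add: linear_diff[OF linJ] linear_diff[OF lin(2)] inner_diff_right)
   also have "B (J m (s l)) \<bullet> B (J m (s k)) = A (B (J m (J m (s l)))) \<bullet> s k
     + J m (s l) \<bullet> (A (J m (B (s k))) - J m (A (B (s k)))) + B (J m (s l)) \<bullet> (B (J m (s k)) - J m (B (s k)))"
    by (rule BJ_identity[OF lin(2) adj])
   also have "J m (s l) \<bullet> (A (J m (B (s k))) - J m (A (B (s k)))) <= L * (err m * norm (B (s l0)) + \<bar>C\<bar> * \<tau>)"
   proof -
    have "J m (s l) \<bullet> (A (J m (B (s k))) - J m (A (B (s k)))) <=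
      norm (J m (s l)) * norm (A (J m (B (s k))) - J m (A (B (s k))))" by (rule norm_cauchy_schwarz)
    also have "... <= L * (err m * norm (B (s l0)) + \<bar>C\<bar> * \<tau>)"
     using SBsmall[OF lin Sj SBj k(1)] Jle[of m "s l"] ns[of l] L0 by (intro mult_mono) auto
    finally show ?thesis .
   qed
   also have "B (J m (s l)) \<bullet> (B (J m (s k)) - J m (B (s k))) <= norm (B (J m (s l))) * (\<kappa> / 8)"
   proof -
    have "norm (B (J m (s k)) - J m (B (s k))) <= \<kappa> / 8"
    proof (cases "err m >= 0")
     case True
     then show ?thesis using Rj[of "s k"] mult_left_mono[OF ns[of k] True] m(2) by linarith
    next
     case False
     then have "err m * norm (s k) <= 0" by (simp add: mult_nonpos_nonneg)
     then show ?thesis using Rj[of "s k"] \<kappa> by linarith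
    qed
    then show ?thesis by (intro order_trans[OF norm_cauchy_schwarz] mult_left_mono) auto
   qed
   also have "B (J m (s l)) \<bullet> B (J m (s l - s k)) <= norm (B (J m (s l))) * (\<kappa> / 8)"
   proof -
    have "norm (B (J m (s l - s k))) <= (\<bar>cm m\<bar> + 1) * norm (s l - s k)" by (rule order_trans[OF BJj]) (auto intro!: mult_right_mono)
    also have "... <= (\<bar>cm m\<bar> + 1) * (\<kappa> / (8 * (\<bar>cm m\<bar> + 1)))"
     using l1[OF l k(2)] by (intro mult_left_mono) auto
    also have "... = \<kappa> / 8" by (simp add: field_simps) 
    finally show ?thesis by (intro order_trans[OF norm_cauchy_schwarz] mult_left_mono) auto
   qed
   finally show ?thesis by (simp add: algebra_simps)
  qed
  have E: "(norm (B1 (J m (s l))))^2 + (norm (B2 (J m (s l))))^2 <= \<kappa>" if l: "l >= max l0 l1" for l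
  proof -
   define n1 where "n1 = norm (B1 (J m (s l)))"
   define n2 where "n2 = norm (B2 (J m (s l)))"
   define c where "c = L * (err m * (b1 + b2)) + L * (2 * \<bar>C\<bar> * \<tau>)"
   have "n1^2 + n2^2 <= s k \<bullet> P (J m (J m (s l))) + (c + (n1 + n2) * (\<kappa> / 4))" if k: "k >= max l0 l1" for k
    using one[of A1 B1 k l, OF linA1 linB1 adj1 S1 SB1 R1 BJ1] one[of A2 B2 k l, OF linA2 linB2 adj2 S2 SB2 R2 BJ2] k l
    by (simp add: P_def n1_def n2_def c_def b1_def b2_def power2_norm_eq_inner inner_add_left inner_commute algebra_simps)
   \<comment> \<open>Here \<open>k\<close> tends to infinity while \<open>l\<close> and
     \<open>m\<close> are fixed, and \<open>limP\<close> removes the main term.\<close>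
   then have "n1^2 + n2^2 <= 0 + (c + (n1 + n2) * (\<kappa> / 4))" by (intro LIMSEQ_le_const[OF tendsto_add[OF limP tendsto_const]]) blast
   moreover have "c = err m * (L * (b1 + b2)) + L * (2 * \<bar>C\<bar> * \<tau>)" by (simp add: c_def)
   then have "c <= \<kappa> / 4" using \<tau>(3) m(1) by linarith
   moreover have "n1 * (\<kappa> / 4) <= n1^2 / 4 + \<kappa>^2 / 16" "n2 * (\<kappa> / 4) <= n2^2 / 4 + \<kappa>^2 / 16"
    using zero_le_power2[of "n1 - \<kappa> / 2"] zero_le_power2[of "n2 - \<kappa> / 2"] by (auto simp: power2_eq_square algebra_simps)
   moreover have "\<kappa>^2 <= \<kappa>" using \<kappa> by (simp add: power2_eq_square mult_left_le)
   ultimately have "n1^2 + n2^2 <= \<kappa>" using \<kappa> unfolding distrib_right by linarith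
   then show ?thesis by (simp add: n1_def n2_def)
  qed
  show ?thesis
   using E J_near by (intro exI[of _ m] exI[of _ "max l0 l1"]) auto
 qed
 \<comment> \<open>\<open>pos\<close> bounds the pairing of the mollified \<open>s l\<close> with
   \<open>f\<close> by quantities that \<open>key\<close> makes small, and the mollified element is
   close to \<open>s l\<close> itself.\<close>
 have weak: "(%k. s k \<bullet> f) \<longlonglongrightarrow> 0" for f
 proof -
  obtain c where c: "!!g. \<bar>g \<bullet> f\<bar> <= c * sqrt ((norm (B1 g))^2 + (norm (B2 g))^2)" using pos by blast
  define c' where "c' = \<bar>c\<bar> + norm f + 1"
  have c': "c' > 0" by (simp add: c'_def add_nonneg_pos)
  show ?thesis
  proof (rule LIMSEQ_I)
   fix e :: real assume e: "e > 0"
   define r where "r = min 1 (e / (2 * c'))"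
   have r: "r > 0" "r <= 1" "r * c' < e"
   proof -
    show "r > 0" "r <= 1" using e c' by (auto simp: r_def)
    have "r * c' <= e / (2 * c') * c'" using c' by (intro mult_right_mono) (auto simp: r_def)
    also have "... < e" using e c' by simp
    finally show "r * c' < e" .
   qed
   obtain m l1 where ml: "!!l. l >= l1 ==> (norm (B1 (J m (s l))))^2 + (norm (B2 (J m (s l))))^2 <= r^2"
    "!!l. l >= l1 ==> norm (J m (s l) - s l) <= r^2"
    using key[of "r^2"] r by (auto simp: power_le_one)
   have "norm (s l \<bullet> f - 0) < e" if "l >= l1" for l
   proof -
    have "sqrt ((norm (B1 (J m (s l))))^2 + (norm (B2 (J m (s l))))^2) <= r"
     using ml(1)[OF that] r by (simp add: real_le_lsqrt)
    then have "\<bar>J m (s l) \<bullet> f\<bar> <= \<bar>c\<bar> * r" by (intro order_trans[OF c] mult_mono) auto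
    moreover have "\<bar>(J m (s l) - s l) \<bullet> f\<bar> <= r * norm f"
    proof (rule order_trans[OF Cauchy_Schwarz_ineq2 mult_right_mono])
     show "norm (J m (s l) - s l) <= r"
      using ml(2)[OF that] r by (smt (verit) mult_left_le power2_eq_square)
    qed auto
    ultimately have "\<bar>s l \<bullet> f\<bar> <= r * (\<bar>c\<bar> + norm f)" by (simp add: inner_diff_left algebra_simps)
    also have "... <= r * c'" using r by (intro mult_left_mono) (auto simp: c'_def)
    finally show ?thesis using r by simp
   qed
   then show "\<exists>no. \<forall>n\<ge>no. norm (s n \<bullet> f - 0) < e" by blast
  qed
 qed
 have "(%k. (f0 - v k) \<bullet> (B1 \<beta>1 + B2 \<beta>2)) \<longlonglongrightarrow> 0" for \<beta>1 \<beta>2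
 proof -
  have "(%k. f0 \<bullet> (B1 \<beta>1 + B2 \<beta>2) - (v k \<bullet> (B1 \<beta>1 + B2 \<beta>2) + s k \<bullet> (A1 \<beta>2 - A2 \<beta>1)) + s k \<bullet> (A1 \<beta>2 - A2 \<beta>1))
   \<longlonglongrightarrow> f0 \<bullet> (B1 \<beta>1 + B2 \<beta>2) - f0 \<bullet> (B1 \<beta>1 + B2 \<beta>2) + 0"
   by (intro tendsto_add tendsto_diff tendsto_const lim weak)
  then show ?thesis by (simp add: inner_diff_left)
 qed
 with cv nv show thesis using that by blast
qed

end

section \<open>The inner product space of test functions\<close>

typedef tf = "{f :: c2 => complex. smooth f \<and> (\<exists>r. vanish r f)}" morphisms tfun Tf by (rule exI[of _ "%_. 0"]) (auto simp: vanish_def)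

lemma smooth_tfun [simp, intro]: "smooth (tfun f)"
 using tfun[of f] by simp

lemma vanish_tfun: obtains r where "vanish r (tfun f)" "r > 0"
proof -
 obtain r where "vanish r (tfun f)" using tfun[of f] by auto
 then show thesis using that[of "max r 1"] vanish_mono[of r "tfun f" "max r 1"] by simp
qed

lemma tfun_Tf: "smooth f ==> vanish r f ==> tfun (Tf f) = f" by (subst Tf_inverse) auto

lemma tf_eqI: "(!!z. tfun f z = tfun g z) ==> f = g"
 using tfun_inject[of f g] by blast

lemma cont_tfun [intro]: "continuous_on S (tfun f)" by (rule smooth_continuous) simp

lemma lbm_tfun [intro]: "lbm (tfun f)" by (rule lbm_smooth) simp

lemma tfun_borel [measurable]: "tfun f \<in> borel_measurable borel" by (rule smooth_borel) simp

lemma integrable_mult_tfun: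
 assumes "lbm g" shows "integrable lborel (%z. g z * tfun f z)" "integrable lborel (%z. tfun f z * g z)"
proof -
 obtain r where r: "vanish r (tfun f)" by (rule vanish_tfun)
 show "integrable lborel (%z. g z * tfun f z)"
  using integrable_lbm_vanish[OF lbm_mult[OF assms lbm_tfun] vanish_mult2[OF r]] .
 then show "integrable lborel (%z. tfun f z * g z)" by (simp add: mult.commute)
qed

lemma lbm_cnj: "lbm f ==> lbm (%z. cnj (f z))"
 unfolding lbm_def by (auto intro: borel_measurable_continuous_on[OF continuous_on_cnj[OF continuous_on_id]])

text \<open>No weight appears here. It is put into the operators by conjugation with exp (p / 2), so
  that one inner product space serves all weights and the mollifiers are symmetric
  contractions.\<close>

definition cip :: "tf => tf => complex" where
 "cip f g = (LINT z|lborel. tfun f z * cnj (tfun g z))"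

lemma cip_integrable: "integrable lborel (%z. tfun f z * cnj (tfun g z))" by (rule integrable_mult_tfun(2)[OF lbm_cnj[OF lbm_tfun]])

lemma vanish_zero_tf: "vanish r (%_. 0)" by (simp add: vanish_def)

instantiation tf :: real_vector
begin

definition zero_tf where "0 = Tf (%_. 0)"
definition plus_tf where "f + g = Tf (%z. tfun f z + tfun g z)"
definition minus_tf where "f - g = Tf (%z. tfun f z - tfun g z)"
definition uminus_tf where "- f = Tf (%z. - tfun f z)"
definition scaleR_tf where "scaleR s f = Tf (%z. s *\<^sub>R tfun f z)"
lemma tfun_zero: "tfun 0 = (%_. 0)"
 unfolding zero_tf_def by (rule tfun_Tf[OF _ vanish_zero_tf]) auto

lemma vanish_two: obtains r where "vanish r (tfun f)" "vanish r (tfun g)"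
 using vanish_tfun[of f] vanish_tfun[of g] vanish_mono by (metis linorder_le_cases)

lemma tfun_plus: "tfun (f + g) = (%z. tfun f z + tfun g z)"
 and tfun_minus: "tfun (f - g) = (%z. tfun f z - tfun g z)"
 and tfun_uminus: "tfun (- f) = (%z. - tfun f z)"
 and tfun_scaleR: "tfun (s *\<^sub>R f) = (%z. s *\<^sub>R tfun f z)"
proof -
 obtain r where r: "vanish r (tfun f)" "vanish r (tfun g)" by (rule vanish_two)
 have v: "vanish r (%z. tfun f z + tfun g z)" "vanish r (%z. tfun f z - tfun g z)"
  "vanish r (%z. - tfun f z)" "vanish r (%z. s *\<^sub>R tfun f z)"
  using r unfolding vanish_def by (simp_all del: split_paired_All)
 show "tfun (f + g) = (%z. tfun f z + tfun g z)" "tfun (f - g) = (%z. tfun f z - tfun g z)"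
  "tfun (- f) = (%z. - tfun f z)" "tfun (s *\<^sub>R f) = (%z. s *\<^sub>R tfun f z)"
  unfolding plus_tf_def minus_tf_def uminus_tf_def scaleR_tf_def by (rule tfun_Tf[OF _ v(1)] tfun_Tf[OF _ v(2)] tfun_Tf[OF _ v(3)] tfun_Tf[OF _ v(4)];
    auto intro!: smooth_compose_linear[OF bounded_linear_scaleR_right])+
qed

lemmas tfun_simps = tfun_zero tfun_plus tfun_minus tfun_uminus tfun_scaleR

instance by standard (rule tf_eqI; simp add: tfun_simps algebra_simps)+

end

lemma cip_self: "cip f f = complex_of_real (LINT z|lborel. (cmod (tfun f z))^2)"
proof -
 have "(%z. tfun f z * cnj (tfun f z)) = (%z. complex_of_real ((cmod (tfun f z))^2))" by (intro ext) (rule complex_norm_square[symmetric])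
 then show ?thesis unfolding cip_def by (simp only: integral_complex_of_real)
qed

lemma sq_integrable: "integrable lborel (%z. (cmod (tfun f z))^2)"
proof -
 have "(%z. (cmod (tfun f z))^2) = (%z. Re (tfun f z * cnj (tfun f z)))" by (auto simp: complex_norm_square[symmetric] simp del: of_real_power) 
 then show ?thesis using integrable_Re[OF cip_integrable[of f f]] by simp
qed

lemma cip_add: "cip (f + g) h = cip f h + cip g h"
 unfolding cip_def using cip_integrable[of f h] cip_integrable[of g h] by (simp add: tfun_plus distrib_right)

lemma cip_scaleR: "cip (s *\<^sub>R f) h = s *\<^sub>R cip f h"
 unfolding cip_def by (simp add: tfun_scaleR)

lemma cip_commute: "cip g f = cnj (cip f g)"
 unfolding cip_def Bochner_Integration.integral_cnj[symmetric] by (simp only: complex_cnj_mult complex_cnj_cnj mult.commute)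

text \<open>The set where a continuous function is nonzero is open; an open set of measure 0 is
  empty.\<close>

lemma cip_zero: assumes "Re (cip f f) = 0" shows "f = 0"
proof -
 have "(LINT z|lborel. (cmod (tfun f z))^2) = 0" using assms by (simp add: cip_self)
 then have ae: "AE z in lborel. (cmod (tfun f z))^2 = 0"
  using integral_nonneg_eq_0_iff_AE[OF sq_integrable[of f]] by simp
 have "open {z. tfun f z ~= 0}"
  using cont_tfun[of UNIV f] by (intro open_Collect_neq) (auto intro: continuous_intros)
 moreover have "{z. tfun f z ~= 0} \<in> null_sets lborel"
  using ae by (subst (asm) AE_iff_null) (auto)
 then have "negligible {z. tfun f z ~= 0}" by (simp add: negligible_iff_null_sets null_sets_completionI)
 ultimately have "{z. tfun f z ~= 0} = {}" using open_not_negligible by blast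
 then have "tfun f z = 0" for z by blast
 then show ?thesis by (intro tf_eqI) (simp add: tfun_zero)
qed

instantiation tf :: real_inner
begin

definition inner_tf where "inner f g = Re (cip f g)"
definition norm_tf where "norm f = sqrt (inner f f)" for f :: tf
definition sgn_tf where "sgn f = f /\<^sub>R norm f" for f :: tf
definition dist_tf where "dist f g = norm (f - g)" for f g :: tf
definition uniformity_tf :: "(tf \<times> tf) filter" where "uniformity_tf = (INF e\<in>{0<..}. principal {(x, y). dist x y < e})"
definition open_tf :: "tf set => bool" where "open_tf U = (\<forall>x\<in>U. eventually (%(x', y). x' = x \<longrightarrow> y \<in> U) uniformity)"

instance
proof
 fix f g h :: tf and s t :: real and U :: "tf set"
 show "dist f g = norm (f - g)" "sgn f = f /\<^sub>R norm f" "norm f = sqrt (f \<bullet> f)" by (simp_all add: dist_tf_def sgn_tf_def norm_tf_def)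
 show "uniformity = (INF e\<in>{0<..}. principal {(x::tf, y). dist x y < e})" by (simp add: uniformity_tf_def)
 show "open U = (\<forall>x\<in>U. eventually (%(x', y). x' = x \<longrightarrow> y \<in> U) uniformity)" by (simp add: open_tf_def)
 show "f \<bullet> g = g \<bullet> f" unfolding inner_tf_def by (subst cip_commute) simp
 show "(f + g) \<bullet> h = f \<bullet> h + g \<bullet> h" by (simp add: inner_tf_def cip_add)
 show "(s *\<^sub>R f) \<bullet> g = s * (f \<bullet> g)" by (simp add: inner_tf_def cip_scaleR)
 show "0 <= f \<bullet> f" by (simp add: inner_tf_def cip_self)
 show "(f \<bullet> f = 0) = (f = 0)"
  using cip_zero[of f] by (auto simp: inner_tf_def) (simp add: cip_def tfun_zero)
qed

end

lemma norm_tf_sq: "(norm f)^2 = (LINT z|lborel. (cmod (tfun f z))^2)"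
 unfolding power2_norm_eq_inner inner_tf_def cip_self by simp

lemma integrable_real_bounded:
 fixes f :: "'a::euclidean_space => real"
 assumes [measurable]: "f \<in> borel_measurable borel" and "!!x. \<bar>f x\<bar> <= B" and "vanish r f"
 shows "integrable lborel f"
proof -
 have "lbm (%x. complex_of_real (f x))"
  using assms(2) by (auto simp: lbm_def)
 then have "integrable lborel (%x. complex_of_real (f x))"
  by (rule integrable_lbm_vanish[where r=r]) (use assms(3) in \<open>auto simp: vanish_def\<close>)
 then show ?thesis by (simp add: complex_of_real_integrable_eq)
qed

lemma tfun_bounded: obtains B where "B >= 0" "!!z. cmod (tfun f z) <= B" by (metis cont_tfun vanish_bounded vanish_tfun)

lemma integral_reflect_real:
 fixes f :: "c2 => real"
 assumes [measurable]: "f \<in> borel_measurable borel"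
 shows "(LINT w|lborel. f (z - w)) = (LINT w|lborel. f w)"
proof -
 have "(LINT w|lborel. f w) = (LINT w|distr lborel borel (%w. z - w). f w)" by (simp add: lborel_distr_reflect)
 also have "... = (LINT w|lborel. f (z - w))" by (rule integral_distr) auto
 finally show ?thesis by simp
qed

lemma integral_translate_real:
 fixes f :: "c2 => real"
 assumes [measurable]: "f \<in> borel_measurable borel"
 shows "(LINT w|lborel. f (w - z)) = (LINT w|lborel. f w)"
proof -
 have "(LINT w|lborel. f w) = (LINT w|lborel. (%w. f (- w)) w)"
  using integral_reflect_real[of f 0] by simp
 also have "... = (LINT w|lborel. (%w. f (- w)) (z - w))" by (rule integral_reflect_real[symmetric]) auto
 finally show ?thesis by (simp add: minus_diff_eq)
qed

text \<open>Schur's test for convolutions: Cauchy-Schwarz for the measure \<open>k (z - w)\<close>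
  dw, read off from a nonnegative quadratic polynomial in \<open>t\<close>, followed by
  Fubini.\<close>

lemma schur:
 assumes k: "k \<in> borel_measurable borel" "!!z. 0 <= k z" "!!z. k z <= B" "vanish r k"
  and F: "!!z. cmod (tfun F z) <= (LINT w|lborel. k (z - w) * cmod (tfun f w))"
 shows "norm F <= (LINT w|lborel. k w) * norm f"
proof -
 note [measurable] = k(1)
 define I where "I = (LINT w|lborel. k w)"
 obtain s where s: "vanish s (tfun f)" "s > 0" by (rule vanish_tfun)
 obtain C where C: "C >= 0" "!!z. cmod (tfun f z) <= C" using tfun_bounded[of f] by metis
 have B: "B >= 0" using k(2,3)[of 0] by linarith
 have I0: "I >= 0" unfolding I_def using k by simp
 have vs: "vanish (norm z + r) (%w. k (z - w))" for z by (rule vanish_shift[OF k(4)])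
 have iks: "integrable lborel (%w. k (z - w))" for z by (rule integrable_real_bounded[OF _ _ vs, of _ B]) (use k in auto)
 have Is: "(LINT w|lborel. k (z - w)) = I" for z unfolding I_def by (rule integral_reflect_real) (rule k)
 have i1: "integrable lborel (%w. k (z - w) * cmod (tfun f w))" for z by (rule integrable_real_bounded[of _ "B * C" "norm z + r"])
   (simp_all add: abs_mult k(2) mult_mono[OF k(3) C(2)] B vanish_mult1[OF vs])
 have i2: "integrable lborel (%w. k (z - w) * (cmod (tfun f w))^2)" for z by (rule integrable_real_bounded[of _ "B * C^2" "norm z + r"])
   (simp_all add: abs_mult k(2) mult_mono[OF k(3) power_mono[OF C(2)]] B vanish_mult1[OF vs])
 have pt: "(cmod (tfun F z))^2 <= I * (LINT w|lborel. k (z - w) * (cmod (tfun f w))^2)" for z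
 proof -
  define a where "a = (LINT w|lborel. k (z - w) * cmod (tfun f w))"
  define b where "b = (LINT w|lborel. k (z - w) * (cmod (tfun f w))^2)"
  have quad: "0 <= b - 2 * t * a + t^2 * I" for t
  proof -
   have "0 <= (LINT w|lborel. k (z - w) * (cmod (tfun f w) - t)^2)"
    using k by (intro integral_nonneg_AE) auto
   also have "(%w. k (z - w) * (cmod (tfun f w) - t)^2) = (%w. k (z - w) * (cmod (tfun f w))^2
     - (2 * t) * (k (z - w) * cmod (tfun f w)) + t^2 * k (z - w))" by (auto simp: power2_eq_square algebra_simps)
   also have "(LINT w|lborel. ... w) = b - 2 * t * a + t^2 * I"
    using i1[of z] i2[of z] iks[of z] Is[of z] by (simp add: a_def b_def)
   finally show ?thesis .
  qed
  have "a^2 <= I * b"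
  proof (cases "I = 0")
   case True
   have "a = 0"
   proof (rule ccontr)
    assume "a ~= 0"
    then show False using quad[of "(b + 1) / (2 * a)"] True by (simp add: field_simps)
   qed
   then show ?thesis using True by simp
  next
   case False
   have "0 <= I * (b - 2 * (a / I) * a + (a / I)^2 * I)"
    using quad[of "a / I"] I0 by simp
   also have "... = I * b - a^2" using False by (simp add: field_simps power2_eq_square)
   finally show ?thesis by simp
  qed
  moreover have "(cmod (tfun F z))^2 <= a^2"
   using F[of z] by (intro power_mono) (auto simp: a_def)
  ultimately show ?thesis by (simp add: b_def)
 qed
 define G where "G = (%(w, z). k (z - w) * (cmod (tfun f w))^2)"
 have [measurable]: "fst \<in> borel_measurable (borel :: (c2 \<times> c2) measure)"
  "snd \<in> borel_measurable (borel :: (c2 \<times> c2) measure)" by (intro borel_measurable_continuous_onI continuous_intros)+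
 have iG: "integrable (lborel \<Otimes>\<^sub>M lborel) G"
  unfolding lborel_prod
 proof (rule integrable_real_bounded[of _ "B * C^2" "r + s + s + \<bar>r\<bar>"])
  show "G \<in> borel_measurable borel" unfolding G_def split_beta by measurable
  show "\<bar>G x\<bar> <= B * C^2" for x
   unfolding G_def split_beta by (simp add: abs_mult k(2) mult_mono[OF k(3) power_mono[OF C(2)]] B)
  have "G x = 0" if x: "norm x >= r + s + s + \<bar>r\<bar>" for x
  proof -
   obtain w z where wz: "x = (w, z)" by (cases x)
   have "norm x <= norm w + norm z" unfolding wz by (rule norm_Pair_le)
   then have "norm w >= s \<or> norm (z - w) >= r"
    using x norm_triangle_ineq2[of z w] by linarith
   then show ?thesis
    using vanishD[OF s(1), of w] vanishD[OF k(4), of "z - w"] by (auto simp: G_def wz)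
  qed
  then show "vanish (r + s + s + \<bar>r\<bar>) G" unfolding vanish_def by blast
 qed
 have inner: "(LINT z|lborel. k (z - w) * (cmod (tfun f w))^2) = I * (cmod (tfun f w))^2" for w by (simp add: I_def integral_translate_real[OF k(1)])
 have fub: "(LINT z|lborel. (LINT w|lborel. k (z - w) * (cmod (tfun f w))^2)) =
  (LINT w|lborel. (LINT z|lborel. k (z - w) * (cmod (tfun f w))^2))"
  using lborel_pair.Fubini_integral[of "%w z. k (z - w) * (cmod (tfun f w))^2"] iG by (simp add: G_def)
 have iH: "integrable lborel (%z. LINT w|lborel. k (z - w) * (cmod (tfun f w))^2)"
  using lborel_pair.integrable_snd[of "%w z. k (z - w) * (cmod (tfun f w))^2"] iG by (simp add: G_def)
 have "(norm F)^2 <= (LINT z|lborel. I * (LINT w|lborel. k (z - w) * (cmod (tfun f w))^2))"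
  unfolding norm_tf_sq by (intro integral_mono sq_integrable integrable_mult_right iH pt)
 also have "... = (I * norm f)^2" by (simp only: integral_mult_right_zero fub inner norm_tf_sq power_mult_distrib power2_eq_square[of I] mult.assoc)
 finally show ?thesis
  unfolding I_def[symmetric] using I0 by (rule power2_le_imp_le[OF _ mult_nonneg_nonneg]) simp
qed

section \<open>The mollifiers\<close>

definition bump0 :: "c2 => complex" where "bump0 z = of_real ((bumpf 0 (1 - (norm z)^2))^2)"

lemma smooth_norm2: "smooth (%z::c2. (norm z)^2)"
 unfolding power2_norm_eq_inner by (rule smooth_bilinear[OF bounded_bilinear_inner]) (auto intro!: smooth_bounded_linear bounded_linear_ident)

lemma smooth_bump0: "smooth bump0"
 unfolding bump0_def[abs_def] by (intro smooth_of_real smooth_power smooth_bumpf smooth_diff smooth_const smooth_norm2)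

lemma vanish_bump0: "vanish 1 bump0"
proof -
 have "bump0 z = 0" if "norm z >= 1" for z
  using one_le_power[OF that, of 2] by (simp add: bump0_def bumpf_def)
 then show ?thesis unfolding vanish_def by blast
qed

definition c0 :: real where "c0 = (LINT z|lborel. cmod (bump0 z))"

lemma bump0_real: "bump0 z = of_real (cmod (bump0 z))"
 unfolding bump0_def norm_of_real by simp

text \<open>The bump is defined as a square, so that its integral is the squared norm of a nonzero
  test function.\<close>

lemma c0_pos: "c0 > 0"
proof -
 define F where "F = Tf (%z. of_real (bumpf 0 (1 - (norm z)^2)))"
 have "(%z. complex_of_real (bumpf 0 (1 - (norm (z::c2))^2))) z = 0" if "norm z >= 1" for z
  using one_le_power[OF that, of 2] by (simp add: bumpf_def)
 then have v: "vanish 1 (%z. complex_of_real (bumpf 0 (1 - (norm (z::c2))^2)))"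
  unfolding vanish_def by blast
 have F: "tfun F = (%z. of_real (bumpf 0 (1 - (norm z)^2)))"
  unfolding F_def by (rule tfun_Tf[OF _ v]) (intro smooth_of_real smooth_bumpf smooth_diff smooth_const smooth_norm2)
 have "(norm F)^2 = c0" unfolding norm_tf_sq c0_def F bump0_def by (simp add: norm_power)
 moreover have "F ~= 0"
 proof
  assume "F = 0"
  then have "tfun F 0 = 0" by (simp add: tfun_zero)
  then show False by (simp add: F bumpf_def)
 qed
 ultimately show ?thesis by (metis zero_less_norm_iff zero_less_power)
qed

definition eta :: "real => c2 => complex" where "eta r z = bump0 (z /\<^sub>R r) / of_real (c0 * r ^ 4)"

lemma scale_integral:
 fixes f :: "c2 => real"
 assumes [measurable]: "f \<in> borel_measurable borel" and r: "r > 0"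
 shows "(LINT z|lborel. f (z /\<^sub>R r)) = r ^ 4 * (LINT z|lborel. f z)"
proof -
 have "(LINT z|lborel. f (z /\<^sub>R r)) =
  (LINT z|density (distr lborel borel (%x. 0 + r *\<^sub>R x)) (%_. ennreal (\<bar>r\<bar> ^ DIM(c2))). f (z /\<^sub>R r))"
  using lborel_affine[of r "0::c2"] r by simp
 also have "... = (LINT z|distr lborel borel (%x. 0 + r *\<^sub>R x). \<bar>r\<bar> ^ DIM(c2) *\<^sub>R f (z /\<^sub>R r))"
  by (rule integral_density) auto
 also have "... = (LINT x|lborel. \<bar>r\<bar> ^ DIM(c2) *\<^sub>R f ((0 + r *\<^sub>R x) /\<^sub>R r))" by (rule integral_distr) auto
 finally show ?thesis using r by simp
qed

lemma smooth_eta: "smooth (eta r)"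
proof -
 have *: "smooth (%z. bump0 (z /\<^sub>R r))"
 proof -
  have "bump0 (z /\<^sub>R r) = of_real ((bumpf 0 (1 - (inverse r)^2 * (norm z)^2))^2)" for z
   by (simp add: bump0_def power_mult_distrib power_inverse)
  then have eq: "(%z. bump0 (z /\<^sub>R r)) = (%z. of_real ((bumpf 0 (1 - (inverse r)^2 * (norm z)^2))^2))" by (rule ext)
  show ?thesis
   unfolding eq by (intro smooth_of_real smooth_power smooth_bumpf smooth_diff smooth_mult smooth_const smooth_norm2)
 qed
 have "smooth (%z. bump0 (z /\<^sub>R r) * inverse (of_real (c0 * r ^ 4)))" by (intro smooth_mult * smooth_const)
 then show ?thesis unfolding eta_def[abs_def] divide_inverse .
qed

lemma vanish_eta: assumes "r > 0" shows "vanish r (eta r)"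
proof -
 have "eta r z = 0" if "norm z >= r" for z
  using vanishD[OF vanish_bump0, of "z /\<^sub>R r"] that assms by (simp add: eta_def field_simps)
 then show ?thesis unfolding vanish_def by blast
qed

lemma eta_real: "r > 0 ==> eta r z = of_real (cmod (eta r z))"
 using bump0_real[of "z /\<^sub>R r"] c0_pos by (simp add: eta_def norm_divide norm_mult norm_power)

lemma eta_norm_cong: "norm z = norm w ==> eta r z = eta r w" by (simp add: eta_def bump0_def)

lemma eta_even: "eta r (z - w) = eta r (w - z)" by (rule eta_norm_cong) (rule norm_minus_commute)

lemma cmod_eta_integral: assumes "r > 0" shows "(LINT z|lborel. cmod (eta r z)) = 1"
proof -
 have "(LINT z|lborel. cmod (eta r z)) = (LINT z|lborel. (%z. cmod (bump0 z) / (c0 * r ^ 4)) (z /\<^sub>R r))"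
  using assms c0_pos by (simp add: eta_def norm_divide norm_mult norm_power)
 also have "... = r ^ 4 * (LINT z|lborel. cmod (bump0 z) / (c0 * r ^ 4))"
  by (rule scale_integral[OF _ assms]) (use smooth_borel[OF smooth_bump0] in measurable)
 also have "... = 1" using c0_pos assms by (simp add: c0_def[symmetric])
 finally show ?thesis .
qed

lemma Dd_eta: assumes "r > 0" shows "Dd e (eta r) z = Dd e bump0 (z /\<^sub>R r) / of_real (c0 * r ^ 5)"
proof -
 have "((%z. bump0 (z /\<^sub>R r) / of_real (c0 * r ^ 4)) has_derivative
   (%e. Dd (e /\<^sub>R r) bump0 (z /\<^sub>R r) / of_real (c0 * r ^ 4))) (at z)"
  unfolding divide_inverse[of _ "of_real _"] by (rule has_derivative_mult_left,
    rule has_derivative_compose[OF _ smooth_has_derivative[OF smooth_bump0]])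
   (rule bounded_linear_imp_has_derivative[OF bounded_linear_scaleR_right])
 then have "Dd e (eta r) z = Dd (e /\<^sub>R r) bump0 (z /\<^sub>R r) / of_real (c0 * r ^ 4)"
  unfolding eta_def[abs_def] by (rule Dd_eq)
 also have "... = Dd e bump0 (z /\<^sub>R r) /\<^sub>R r / of_real (c0 * r ^ 4)" by (simp add: linear_simps(5)[OF smooth_linear_Dd[OF smooth_bump0]])
 finally show ?thesis using assms by (simp add: scaleR_conv_of_real field_simps eval_nat_numeral)
qed

text \<open>Mass of the derivative of the mollifier at scale 1. At scale \<open>r\<close> it is
  divided by \<open>r\<close>, which in the commutator estimates cancels against the size of the
  support.\<close>

definition Keta :: "c2 => real" where "Keta e = (LINT z|lborel. cmod (Dd e bump0 z)) / c0"

lemma Dd_eta_integral: assumes "r > 0" shows "(LINT z|lborel. cmod (Dd e (eta r) z)) = Keta e / r"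
proof -
 have "(LINT z|lborel. cmod (Dd e (eta r) z)) = (LINT z|lborel. (%z. cmod (Dd e bump0 z) / (c0 * r ^ 5)) (z /\<^sub>R r))"
  using assms c0_pos by (simp add: Dd_eta norm_divide norm_mult norm_power)
 also have "... = r ^ 4 * (LINT z|lborel. cmod (Dd e bump0 z) / (c0 * r ^ 5))"
  by (rule scale_integral[OF _ assms]) (use smooth_borel[OF smooth_Dd[OF smooth_bump0]] in measurable)
 also have "... = Keta e / r" using c0_pos assms by (simp add: Keta_def field_simps eval_nat_numeral)
 finally show ?thesis .
qed

section \<open>Wirtinger derivatives\<close>

definition ii :: "c2 => c2" where "ii e = (\<i> * fst e, \<i> * snd e)"
text \<open>The Wirtinger derivatives in the complex direction \<open>e\<close>, built from real
  derivatives along \<open>e\<close> and along its image under the complex structure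
  \<open>ii\<close>.\<close>

definition dzb :: "c2 => (c2 => complex) => c2 => complex" where
 "dzb e F z = (Dd e F z + \<i> * Dd (ii e) F z) / 2"
definition dz :: "c2 => (c2 => complex) => c2 => complex" where
 "dz e F z = (Dd e F z - \<i> * Dd (ii e) F z) / 2"

lemma smooth_dz [intro]: "smooth F ==> smooth (dz e F)" and smooth_dzb [intro]: "smooth F ==> smooth (dzb e F)"
 unfolding dz_def[abs_def] dzb_def[abs_def] divide_inverse by (intro smooth_mult smooth_diff smooth_add smooth_const smooth_Dd; assumption)+

lemma vanish_dz: assumes "vanish r F" shows "vanish (r + 1) (dz e F)" "vanish (r + 1) (dzb e F)"
 using vanishD[OF vanish_Dd[OF assms, of 1 e]] vanishD[OF vanish_Dd[OF assms, of 1 "ii e"]] by (auto simp: vanish_def dz_def dzb_def)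

lemma dz_mult: assumes "smooth F" "smooth G"
 shows "dz e (%z. F z * G z) z = F z * dz e G z + dz e F z * G z"
  "dzb e (%z. F z * G z) z = F z * dzb e G z + dzb e F z * G z"
 unfolding dz_def dzb_def Dd_mult[OF smooth_differentiable[OF assms(1)] smooth_differentiable[OF assms(2)]] by (simp_all add: field_simps)

lemma dz_add: assumes "smooth F" "smooth G"
 shows "dz e (%z. F z + G z) z = dz e F z + dz e G z" "dzb e (%z. F z + G z) z = dzb e F z + dzb e G z"
 unfolding dz_def dzb_def Dd_add[OF smooth_differentiable[OF assms(1)] smooth_differentiable[OF assms(2)]] by (simp_all add: field_simps)

lemma Dd_cmult:
 fixes c :: complex and z :: c2
 assumes "smooth F" shows "Dd e (%z. c * F z) z = c * Dd e F z"
 by (rule Dd_compose_linear[OF bounded_linear_mult_right smooth_differentiable[OF assms]])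

lemma dz_cmult: assumes "smooth F"
 shows "dz e (%z. c * F z) z = c * dz e F z" "dzb e (%z. c * F z) z = c * dzb e F z"
 unfolding dz_def dzb_def Dd_cmult[OF assms] by (simp_all add: field_simps)

lemma dz_minus: assumes "smooth F"
 shows "dz e (%z. - F z) z = - dz e F z" "dzb e (%z. - F z) z = - dzb e F z"
 using dz_cmult[OF assms, of e "-1" z] by simp_all

lemma Dd_cnj: assumes "smooth F" shows "Dd e (%z. cnj (F z)) z = cnj (Dd e F z)"
 by (rule Dd_compose_linear[OF bounded_linear_cnj smooth_differentiable[OF assms]])

lemma dz_cnj: assumes "smooth F" shows "dz e (%z. cnj (F z)) z = cnj (dzb e F z)" "dzb e (%z. cnj (F z)) z = cnj (dz e F z)"
 unfolding dz_def dzb_def Dd_cnj[OF assms] by simp_all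

lemma dz_real: assumes "smooth F" "!!z. F z = of_real (f z)" shows "cnj (dz e F z) = dzb e F z" "cnj (dzb e F z) = dz e F z"
proof -
 have "(%z. cnj (F z)) = F" using assms(2) by (intro ext) simp
 then show "cnj (dz e F z) = dzb e F z" "cnj (dzb e F z) = dz e F z"
  using dz_cnj[OF assms(1), of e z] by simp_all
qed

lemma Dd_lin2:
 fixes z :: c2
 assumes "smooth F" "smooth G"
 shows "Dd e (%z. (F z + c * G z) / 2) z = (Dd e F z + c * Dd e G z) / (2::complex)"
proof -
 have "Dd e (%z. inverse 2 * (F z + c * G z)) z = inverse 2 * (Dd e F z + c * Dd e G z)"
  using assms by (subst Dd_cmult; (intro smooth_add smooth_mult smooth_const)?)
   (simp_all add: Dd_add smooth_differentiable smooth_mult Dd_cmult)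
 then show ?thesis by (simp add: field_simps)
qed

lemma dz_commute: assumes "smooth F"
 shows "dz e (dzb e' F) z = dzb e' (dz e F) z" "dzb e (dzb e' F) z = dzb e' (dzb e F) z" "dz e (dz e' F) z = dz e' (dz e F) z"
proof -
 note s = smooth_Dd[OF assms]
 have D: "Dd u (dzb v F) z = (Dd u (Dd v F) z + \<i> * Dd u (Dd (ii v) F) z) / 2"
  "Dd u (dz v F) z = (Dd u (Dd v F) z + (- \<i>) * Dd u (Dd (ii v) F) z) / 2" for u v z
  using Dd_lin2[OF s s, of u v \<i> "ii v" z] Dd_lin2[OF s s, of u v "- \<i>" "ii v" z] by (simp_all add: dzb_def[abs_def] dz_def[abs_def])
 note c = Dd_commute[OF assms, of e e' z] Dd_commute[OF assms, of "ii e" e' z]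
  Dd_commute[OF assms, of e "ii e'" z] Dd_commute[OF assms, of "ii e" "ii e'" z]
 show "dz e (dzb e' F) z = dzb e' (dz e F) z" "dzb e (dzb e' F) z = dzb e' (dzb e F) z" "dz e (dz e' F) z = dz e' (dz e F) z"
  unfolding dz_def[of _ "dzb _ _"] dz_def[of _ "dz _ _"] dzb_def[of _ "dzb _ _"] dzb_def[of _ "dz _ _"] D c by (simp_all add: field_simps)
qed

lemma integral_dz: assumes "smooth F" "vanish r F" shows "(LINT z|lborel. dz e F z) = 0" "(LINT z|lborel. dzb e F z) = 0"
proof -
 have i: "integrable lborel (Dd e F)" for e
  using integrable_lbm_vanish[OF lbm_smooth[OF smooth_Dd[OF assms(1)]] vanish_Dd[OF assms(2), of 1]] by simp
 show "(LINT z|lborel. dz e F z) = 0" "(LINT z|lborel. dzb e F z) = 0"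
  unfolding dz_def dzb_def using i integral_Dd_zero[OF assms] by simp_all
qed

lemma conv_lin: assumes "lbm k" "lbm k'" "lbm f" "vanish r f \<or> (vanish r k \<and> vanish r k')"
 shows "conv (%z. (k z + c * k' z) / 2) f z = (conv k f z + c * conv k' f z) / 2"
proof -
 have "integrable lborel (%w. k (z - w) * f w)" "integrable lborel (%w. k' (z - w) * f w)"
  using conv_integrable[OF assms(1,3)] conv_integrable[OF assms(2,3)] assms(4) by blast+
 moreover have "(%w. (k (z - w) + c * k' (z - w)) / 2 * f w) = (%w. (k (z - w) * f w + c * (k' (z - w) * f w)) / 2)" by (auto simp: field_simps)
 ultimately show ?thesis unfolding conv_def by simp
qed

lemma dz_conv: assumes "smooth k" "vanish r k" "lbm f"
 shows "dz e (conv k f) = conv (dz e k) f" "dzb e (conv k f) = conv (dzb e k) f"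
proof -
 have v: "vanish (r + 1) (Dd e k)" for e by (rule vanish_Dd[OF assms(2)]) simp
 note l = conv_lin[OF lbm_smooth[OF smooth_Dd[OF assms(1)]] lbm_smooth[OF smooth_Dd[OF assms(1)]] assms(3) disjI2[OF conjI[OF v v]]]
 show "dz e (conv k f) = conv (dz e k) f" "dzb e (conv k f) = conv (dzb e k) f"
  using l[of e "- \<i>" "ii e"] l[of e "\<i>" "ii e"] by (auto simp: dz_def[abs_def] dzb_def[abs_def] Dd_conv[OF assms])
qed

lemma dz_conv': assumes "smooth k" "vanish r k" "smooth f" "vanish s f"
 shows "dz e (conv k f) = conv k (dz e f)" "dzb e (conv k f) = conv k (dzb e f)"
proof -
 have c: "conv k f = conv f k" using assms by (intro ext conv_commute) (auto intro: smooth_borel)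
 have c': "conv k (dz e f) = conv (dz e f) k" "conv k (dzb e f) = conv (dzb e f) k"
  using assms by (intro ext conv_commute; auto intro!: smooth_borel)+
 show "dz e (conv k f) = conv k (dz e f)" "dzb e (conv k f) = conv k (dzb e f)"
  unfolding c c' using dz_conv[OF assms(3,4) lbm_smooth[OF assms(1)]] by simp_all
qed

lemma vanish_lbm_bound:
 assumes "smooth (k :: c2 => complex)" "vanish r k"
 obtains B where "B >= 0" "!!z. cmod (k z) <= B"
 using vanish_bounded[OF smooth_continuous[OF assms(1)] assms(2)] by metis

lemma conv_le:
 assumes "smooth k" "vanish r k"
 shows "cmod (conv k (tfun f) z) <= (LINT w|lborel. cmod (k (z - w)) * cmod (tfun f w))"
 unfolding conv_def norm_mult[symmetric] by (rule integral_norm_bound)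

lemma schur_conv:
 assumes k: "smooth k" "vanish r k" and F: "tfun F = conv k (tfun f)"
 shows "norm F <= (LINT w|lborel. cmod (k w)) * norm f"
proof -
 obtain B where B: "!!z. cmod (k z) <= B" using vanish_lbm_bound[OF k] by metis
 show ?thesis
 proof (rule schur[of "%z. cmod (k z)" B r])
  show "vanish r (%z. cmod (k z))" using k(2) unfolding vanish_def by (simp del: split_paired_All)
 qed (use smooth_borel[OF k(1)] B conv_le[OF k] F in \<open>simp_all\<close>)
qed

text \<open>The commutator of \<open>c\<close> with the convolution has kernel (c z - c w) k (z -
  w), and |z - w| < r on its support; the Lipschitz bound thus gains a factor
  \<open>r\<close>.\<close>

lemma schur_commutator:
 assumes k: "smooth k" "vanish r k" and r: "r >= 0" and c: "smooth c" and L: "!!z w. cmod (c z - c w) <= L * norm (z - w)"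
  and F: "!!z. tfun F z = c z * conv k (tfun f) z - conv k (%w. c w * tfun f w) z"
 shows "norm F <= L * r * (LINT w|lborel. cmod (k w)) * norm f"
proof -
 obtain B where B: "!!z. cmod (k z) <= B" using vanish_lbm_bound[OF k] by metis
 have L0: "L >= 0"
  using order_trans[OF norm_ge_zero L[of "(1,0)" 0]] by (simp add: norm_Pair)
 obtain s where s: "vanish s (tfun f)" by (rule vanish_tfun)
 have "norm F <= (LINT w|lborel. L * r * cmod (k w)) * norm f"
 proof (rule schur[of _ "L * r * B" r])
  show "vanish r (%z. L * r * cmod (k z))" using k(2) unfolding vanish_def by (simp del: split_paired_All)
  show "cmod (tfun F z) <= (LINT w|lborel. L * r * cmod (k (z - w)) * cmod (tfun f w))" for z
  proof -
   have i1: "integrable lborel (%w. c z * (k (z - w) * tfun f w))"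
    using conv_integrable[OF lbm_smooth[OF k(1)] lbm_tfun, of r f z] k(2) by auto
   have i2: "integrable lborel (%w. k (z - w) * (c w * tfun f w))"
    using conv_integrable[OF lbm_smooth[OF k(1)] lbm_mult[OF lbm_smooth[OF c] lbm_tfun], of r f z] k(2) by auto
   have "tfun F z = (LINT w|lborel. c z * (k (z - w) * tfun f w) - k (z - w) * (c w * tfun f w))"
    unfolding F conv_def Bochner_Integration.integral_diff[OF i1 i2] by simp
   also have "cmod ... <= (LINT w|lborel. L * r * cmod (k (z - w)) * cmod (tfun f w))"
   proof (rule bochner_norm_bound[OF Bochner_Integration.integrable_diff[OF i1 i2]])
    have "integrable lborel (%w. L * r * cmod (k (z - w) * tfun f w))"
     using conv_integrable[OF lbm_smooth[OF k(1)] lbm_tfun, of r f z] k(2) by auto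
    then show "integrable lborel (%w. L * r * cmod (k (z - w)) * cmod (tfun f w))" by (simp add: norm_mult mult.assoc)
    fix w
    have "cmod (c z * (k (z - w) * tfun f w) - k (z - w) * (c w * tfun f w))
     = cmod (c z - c w) * cmod (k (z - w)) * cmod (tfun f w)" by (simp add: norm_mult[symmetric] algebra_simps)
    also have "... <= L * r * cmod (k (z - w)) * cmod (tfun f w)"
    proof (cases "norm (z - w) >= r")
     case True
     then show ?thesis using vanishD[OF k(2), of "z - w"] by simp
    next
     case False
     then have "cmod (c z - c w) <= L * r"
      using L[of z w] L0 by (smt (verit) mult_left_mono)
     then show ?thesis by (intro mult_right_mono) auto
    qed
    finally show "cmod (c z * (k (z - w) * tfun f w) - k (z - w) * (c w * tfun f w)) <=
     L * r * cmod (k (z - w)) * cmod (tfun f w)" .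
   qed
   finally show ?thesis .
  qed
  show "L * r * cmod (k z) <= L * r * B" for z using B[of z] L0 r by (intro mult_left_mono) auto
 qed (use smooth_borel[OF k(1)] L0 r in \<open>simp_all\<close>)
 then show ?thesis by simp
qed

lemma norm_tf_mono:
 assumes "!!z. cmod (tfun F z) <= b * cmod (tfun f z)" "b >= 0"
 shows "norm F <= b * norm f"
proof -
 have "(norm F)^2 <= (LINT z|lborel. b^2 * (cmod (tfun f z))^2)"
  unfolding norm_tf_sq by (intro integral_mono sq_integrable integrable_mult_right)
   (metis assms(1) norm_ge_zero power_mono power_mult_distrib)
 also have "... = (b * norm f)^2" by (simp add: norm_tf_sq power_mult_distrib)
 finally show ?thesis using assms(2) by (rule power2_le_imp_le[OF _ mult_nonneg_nonneg]) simp
qed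

section \<open>Multiplication and mollification as operators\<close>

definition mulop :: "(c2 => complex) => tf => tf" where "mulop c f = Tf (%z. c z * tfun f z)"

lemma tfun_mulop: "smooth c ==> tfun (mulop c f) = (%z. c z * tfun f z)"
 unfolding mulop_def by (rule vanish_tfun[of f]) (rule tfun_Tf[OF _ vanish_mult2]; auto)

definition Jop :: "real => tf => tf" where "Jop r f = Tf (conv (eta r) (tfun f))"

lemma tfun_Jop: "r > 0 ==> tfun (Jop r f) = conv (eta r) (tfun f)"
 unfolding Jop_def by (rule vanish_tfun[of f]) (rule tfun_Tf[OF _ vanish_conv[OF vanish_eta]]; auto intro: smooth_conv smooth_eta vanish_eta)

lemma tf_linear:
 assumes "!!s f g z. tfun (F (s *\<^sub>R f + g)) z = s *\<^sub>R tfun (F f) z + tfun (F g) z"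
 shows "linear F"
proof -
 have add: "F (f + g) = F f + F g" for f g
  using assms[of 1 f g] by (intro tf_eqI) (simp add: tfun_simps)
 have F0: "F 0 = 0" using add[of 0 0] by simp
 have "F (s *\<^sub>R f) = s *\<^sub>R F f" for s f
  using assms[of s f 0] by (intro tf_eqI) (simp add: tfun_simps F0)
 then show ?thesis using add by (intro linearI)
qed

lemma linear_mulop: "smooth c ==> linear (mulop c)" by (rule tf_linear) (simp add: tfun_mulop tfun_simps algebra_simps)

lemma conv_tf_lin: "smooth k ==> vanish r k ==>
 conv k (tfun (s *\<^sub>R f + g)) z = s *\<^sub>R conv k (tfun f) z + conv k (tfun g) z"
proof -
 assume k: "smooth k" "vanish r k"
 have "integrable lborel (%w. k (z - w) * tfun f w)" for f
  using conv_integrable[OF lbm_smooth[OF k(1)] lbm_tfun, of r f z] k(2) by auto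
 then have "integrable lborel (%w. s *\<^sub>R (k (z - w) * tfun f w))" "integrable lborel (%w. k (z - w) * tfun g w)" by auto
 from Bochner_Integration.integral_add[OF this] show ?thesis
  unfolding conv_def by (simp add: tfun_simps distrib_left)
qed

lemma linear_Jop: "r > 0 ==> linear (Jop r)" by (rule tf_linear) (simp only: tfun_Jop conv_tf_lin[OF smooth_eta vanish_eta])

lemma norm_Jop: assumes "r > 0" shows "norm (Jop r f) <= norm f"
 using schur_conv[OF smooth_eta vanish_eta[OF assms] tfun_Jop[OF assms]] by (simp add: cmod_eta_integral[OF assms])

text \<open>The kernel \<open>eta r\<close> is real and even, so Fubini exchanges the two
  factors.\<close>

lemma Jop_adj: assumes r: "r > 0" shows "Jop r f \<bullet> g = f \<bullet> Jop r g"
proof -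
 obtain s t where s: "vanish s (tfun f)" "s > 0" and t: "vanish t (tfun g)" "t > 0"
  using vanish_tfun by metis
 define G where "G = (%(z, w). eta r (z - w) * tfun f w * cnj (tfun g z))"
 have iG: "integrable (lborel \<Otimes>\<^sub>M lborel) G"
  unfolding lborel_prod
 proof (rule integrable_lbm_vanish[of _ "s + t"])
  have "continuous_on UNIV G" unfolding G_def split_beta by (intro continuous_intros continuous_on_compose2[OF smooth_continuous[OF smooth_eta]]
     continuous_on_compose2[OF cont_tfun[of UNIV]]) auto
  then show "lbm G" by (rule lbm_continuous)
  have "G x = 0" if x: "norm x >= s + t" for x
  proof -
   obtain z w where zw: "x = (z, w)" by (cases x)
   have "norm x <= norm z + norm w" unfolding zw by (rule norm_Pair_le)
   then have "norm w >= s \<or> norm z >= t" using x by linarith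
   then show ?thesis using vanishD[OF s(1), of w] vanishD[OF t(1), of z] by (auto simp: G_def zw)
  qed
  then show "vanish (s + t) G" unfolding vanish_def by blast
 qed
 have "cip (Jop r f) g = (LINT z|lborel. (LINT w|lborel. eta r (z - w) * tfun f w * cnj (tfun g z)))"
  unfolding cip_def tfun_Jop[OF r] conv_def by simp
 also have "... = (LINT w|lborel. (LINT z|lborel. eta r (z - w) * tfun f w * cnj (tfun g z)))"
  using lborel_pair.Fubini_integral[of "%z w. eta r (z - w) * tfun f w * cnj (tfun g z)"] iG by (simp add: G_def)
 also have "... = (LINT w|lborel. tfun f w * cnj (LINT z|lborel. eta r (w - z) * tfun g z))"
 proof (rule Bochner_Integration.integral_cong[OF refl])
  fix w
  have "eta r (z - w) * tfun f w * cnj (tfun g z) = tfun f w * cnj (eta r (w - z) * tfun g z)" for z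
   using eta_real[OF r, of "w - z"] eta_even[of r z w]
   by (metis (no_types, lifting) complex_cnj_complex_of_real complex_cnj_mult mult.assoc mult.commute)
  then show "(LINT z|lborel. eta r (z - w) * tfun f w * cnj (tfun g z)) = tfun f w * cnj (LINT z|lborel. eta r (w - z) * tfun g z)"
   by (simp only: integral_mult_right_zero Bochner_Integration.integral_cnj)
 qed
 also have "... = cip f (Jop r g)" unfolding cip_def tfun_Jop[OF r] conv_def ..
 finally show ?thesis by (simp add: inner_tf_def)
qed

lemma conv_eta_const: assumes "r > 0" shows "(LINT w|lborel. eta r (z - w)) = 1"
proof -
 have "(LINT w|lborel. eta r (z - w)) = (LINT w|lborel. eta r w)" by (rule integral_reflect) (rule smooth_borel[OF smooth_eta])
 also have "... = (LINT w|lborel. complex_of_real (cmod (eta r w)))" using eta_real[OF assms] by metis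
 finally show ?thesis by (simp add: cmod_eta_integral[OF assms])
qed

lemma eta_int: "r > 0 ==> integrable lborel (%w. eta r (z - w))"
 using conv_integrable[OF lbm_smooth[OF smooth_eta] lbm_smooth[OF smooth_const[of 1]], of r r z] vanish_eta[of r] by simp

lemma conv_eta_close:
 assumes r: "r > 0" and f: "lbm f" and L: "!!w. norm (z - w) < r ==> cmod (f w - f z) <= L"
 shows "cmod (conv (eta r) f z - f z) <= L"
proof -
 have i1: "integrable lborel (%w. eta r (z - w) * f w)"
  using conv_integrable[OF lbm_smooth[OF smooth_eta] f, of r r z] vanish_eta[OF r] by simp
 have "f z = (LINT w|lborel. eta r (z - w) * f z)" using conv_eta_const[OF r, of z] by simp
 then have "conv (eta r) f z - f z = (LINT w|lborel. eta r (z - w) * f w - eta r (z - w) * f z)"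
  unfolding conv_def using i1 eta_int[OF r, of z] by simp
 also have "cmod ... <= (LINT w|lborel. L * cmod (eta r (z - w)))"
 proof (rule bochner_norm_bound)
  show "integrable lborel (%w. eta r (z - w) * f w - eta r (z - w) * f z)" using i1 eta_int[OF r, of z] by simp
  show "integrable lborel (%w. L * cmod (eta r (z - w)))" using eta_int[OF r, of z] by simp
  fix w
  have "cmod (eta r (z - w) * f w - eta r (z - w) * f z) = cmod (f w - f z) * cmod (eta r (z - w))" by (simp add: norm_mult[symmetric] algebra_simps)
  also have "... <= L * cmod (eta r (z - w))"
   using L[of w] vanishD[OF vanish_eta[OF r], of "z - w"] by (cases "norm (z - w) < r") (auto intro!: mult_right_mono)
  finally show "cmod (eta r (z - w) * f w - eta r (z - w) * f z) <= L * cmod (eta r (z - w))" .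
 qed
 also have "... = L"
  using integral_reflect_real[of "%w. cmod (eta r w)" z] smooth_borel[OF smooth_eta] cmod_eta_integral[OF r] by simp
 finally show ?thesis .
qed

text \<open>A test function is Lipschitz, so the error is uniformly of order \<open>r m\<close>; it
  lives in a fixed ball because \<open>r m\<close> is at most 1.\<close>

lemma Jop_lim: assumes r: "!!m. r m > 0" "!!m. r m <= 1" "r \<longlonglongrightarrow> 0" shows "(%m. Jop (r m) f) \<longlonglongrightarrow> f"
proof -
 obtain s where s: "vanish s (tfun f)" "s > 0" by (rule vanish_tfun)
 obtain B where B: "B >= 0" "!!e z. cmod (Dd e (tfun f) z) <= B * norm e"
  using smooth_Dd_bounded[OF smooth_tfun s(1)] by metis
 define V where "V = measure lborel (cball (0::c2) (s + 1))"
 have "norm (Jop (r m) f - f) <= sqrt V * (B * r m)" for m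
 proof -
  have pt: "(cmod (tfun (Jop (r m) f - f) z))^2 <= (B * r m)^2 * indicator (cball 0 (s + 1)) z" for z
  proof (cases "norm z <= s + 1")
   case True
   have "cmod (conv (eta (r m)) (tfun f) z - tfun f z) <= B * r m"
   proof (rule conv_eta_close[OF r(1) lbm_tfun])
    fix w assume "norm (z - w) < r m"
    then show "cmod (tfun f w - tfun f z) <= B * r m"
     using Dd_bounded_Lipschitz[OF smooth_tfun B(2), of w z] B(1) by (smt (verit) mult_left_mono norm_minus_commute)
   qed
   then show ?thesis using True by (simp add: tfun_simps tfun_Jop[OF r(1)] power_mono)
  next
   case False
   then have "norm z >= s" "norm z >= r m + s" using r(2)[of m] by auto
   then have "tfun (Jop (r m) f - f) z = 0"
    using vanishD[OF s(1), of z] vanishD[OF vanish_conv[OF vanish_eta[OF r(1)] s(1)], of m z] by (simp add: tfun_simps tfun_Jop[OF r(1)])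
   then show ?thesis by simp
  qed
  have i: "integrable lborel (%z. (B * r m)^2 * indicator (cball (0::c2) (s + 1)) z :: real)"
   using emeasure_bounded_finite[of "cball (0::c2) (s + 1)"] by (intro integrable_mult_right integrable_real_indicator) auto
  have "(norm (Jop (r m) f - f))^2 <= (LINT z|lborel. (B * r m)^2 * indicator (cball (0::c2) (s + 1)) z)"
   unfolding norm_tf_sq by (intro integral_mono sq_integrable i pt)
  also have "... = (B * r m)^2 * V" unfolding V_def by simp
  also have "... = (sqrt V * (B * r m))^2" by (simp add: power_mult_distrib V_def)
  finally show ?thesis by (rule power2_le_imp_le) (use B(1) r(1)[of m] in \<open>auto simp: V_def intro!: mult_nonneg_nonneg less_imp_le\<close>)
 qed
 moreover have "(%m. sqrt V * (B * r m)) \<longlonglongrightarrow> sqrt V * (B * 0)" by (intro tendsto_intros r)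
 ultimately have "(%m. Jop (r m) f - f) \<longlonglongrightarrow> 0"
  by (intro Lim_null_comparison[of "%m. Jop (r m) f - f" "%m. sqrt V * (B * r m)"]) auto
 then show ?thesis by (simp add: Lim_null[symmetric])
qed

section \<open>Weighted d-bar operators and the Bochner-Kodaira identity\<close>

locale weight =
 fixes p :: "c2 => real" and b :: real and m :: "c2 => real"
 assumes smooth_p: "smooth p"
  and D1: "!!e z. \<bar>Dd e p z\<bar> <= b * norm e"
  and D2: "!!e e' z. \<bar>Dd e' (Dd e p) z\<bar> <= b * norm e * norm e'"
  and smooth_m: "smooth m" and m_pos: "!!z. m z > 0"
  and levi: "!!z w1 w2. (m z)^2 * ((cmod w1)^2 + (cmod w2)^2) <=
   Re (dzb (1,0) (dz (1,0) (%z. of_real (p z))) z * w1 * cnj w1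
    + dzb (0,1) (dz (1,0) (%z. of_real (p z))) z * w1 * cnj w2
    + dzb (1,0) (dz (0,1) (%z. of_real (p z))) z * w2 * cnj w1
    + dzb (0,1) (dz (0,1) (%z. of_real (p z))) z * w2 * cnj w2)"
begin

definition ph :: "c2 => complex" where "ph z = of_real (p z)"

lemma smooth_ph [intro, simp]: "smooth ph"
 unfolding ph_def[abs_def] by (intro smooth_of_real smooth_p)

definition cA :: "c2 => c2 => complex" where "cA e z = dzb e ph z / 2"
definition cB :: "c2 => c2 => complex" where "cB e z = dz e ph z / 2"

lemma smooth_cA [intro, simp]: "smooth (cA e)" and smooth_cB [intro, simp]: "smooth (cB e)"
 unfolding cA_def[abs_def] cB_def[abs_def] divide_inverse by (intro smooth_mult smooth_const smooth_dzb smooth_dz smooth_ph)+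

text \<open>\<open>opA e\<close> is f -> exp (- p / 2) dzb (exp (p / 2) f), and
  \<open>opB e\<close>, its formal adjoint, is f -> - exp (p / 2) dz (exp (- p / 2) f).\<close>

definition opA :: "c2 => tf => tf" where "opA e f = Tf (%z. dzb e (tfun f) z + cA e z * tfun f z)"
definition opB :: "c2 => tf => tf" where "opB e f = Tf (%z. - dz e (tfun f) z + cB e z * tfun f z)"

lemma tfun_opA: "tfun (opA e f) = (%z. dzb e (tfun f) z + cA e z * tfun f z)"
 and tfun_opB: "tfun (opB e f) = (%z. - dz e (tfun f) z + cB e z * tfun f z)"
proof -
 obtain r where r: "vanish r (tfun f)" by (rule vanish_tfun)
 have v: "vanish (r + 1) (%z. dzb e (tfun f) z + cA e z * tfun f z)" "vanish (r + 1) (%z. - dz e (tfun f) z + cB e z * tfun f z)"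
  using vanishD[OF vanish_dz(1)[OF r]] vanishD[OF vanish_dz(2)[OF r]] vanishD[OF vanish_mono[OF r, of "r + 1"]]
  by (simp_all add: vanish_def del: split_paired_All)
 show "tfun (opA e f) = (%z. dzb e (tfun f) z + cA e z * tfun f z)"
  unfolding opA_def by (rule tfun_Tf[OF _ v(1)]) (intro smooth_add smooth_mult smooth_dzb smooth_tfun smooth_cA)
 show "tfun (opB e f) = (%z. - dz e (tfun f) z + cB e z * tfun f z)"
  unfolding opB_def by (rule tfun_Tf[OF _ v(2)]) (intro smooth_add smooth_minus smooth_mult smooth_dz smooth_tfun smooth_cB)
qed

lemma dz_tfun_lin: "dz e (tfun (s *\<^sub>R f + g)) z = s *\<^sub>R dz e (tfun f) z + dz e (tfun g) z"
 "dzb e (tfun (s *\<^sub>R f + g)) z = s *\<^sub>R dzb e (tfun f) z + dzb e (tfun g) z"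
proof -
 have "tfun (s *\<^sub>R f + g) = (%z. of_real s * tfun f z + tfun g z)" by (simp add: tfun_simps scaleR_conv_of_real)
 moreover have "smooth (%z. of_real s * tfun f z)" by (intro smooth_mult smooth_const smooth_tfun)
 ultimately show "dz e (tfun (s *\<^sub>R f + g)) z = s *\<^sub>R dz e (tfun f) z + dz e (tfun g) z"
  "dzb e (tfun (s *\<^sub>R f + g)) z = s *\<^sub>R dzb e (tfun f) z + dzb e (tfun g) z" by (simp_all add: dz_add dz_cmult scaleR_conv_of_real)
qed

lemma linear_opA: "linear (opA e)" and linear_opB: "linear (opB e)"
 by (rule tf_linear; simp add: tfun_opA tfun_opB dz_tfun_lin, simp add: tfun_simps algebra_simps)+

lemma cnj_cB: "cnj (cB e z) = cA e z"
 using dz_real(1)[OF smooth_ph ph_def] by (simp add: cA_def cB_def)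

lemma op_adj_cip: "cip (opA e f) g = cip f (opB e g)"
proof -
 obtain r where r: "vanish r (tfun f)" by (rule vanish_tfun)
 define H where "H = (%z. tfun f z * cnj (tfun g z))"
 have sH: "smooth H" unfolding H_def by (intro smooth_mult smooth_cnj smooth_tfun)
 have "dzb e H z = tfun f z * cnj (dz e (tfun g) z) + dzb e (tfun f) z * cnj (tfun g z)" for z
  unfolding H_def using dz_mult(2)[OF smooth_tfun smooth_cnj[OF smooth_tfun]] dz_cnj(2)[OF smooth_tfun] by simp
 then have "tfun (opA e f) z * cnj (tfun g z) - tfun f z * cnj (tfun (opB e g) z) = dzb e H z" for z
  by (simp add: tfun_opA tfun_opB cnj_cB[symmetric] algebra_simps)
 then have "cip (opA e f) g - cip f (opB e g) = (LINT z|lborel. dzb e H z)"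
  unfolding cip_def Bochner_Integration.integral_diff[OF cip_integrable cip_integrable, symmetric] by simp
 also have "... = 0" by (rule integral_dz(2)[OF sH, of r]) (simp add: H_def vanish_mult1[OF r])
 finally show ?thesis by simp
qed

lemma op_adj: "opA e f \<bullet> g = f \<bullet> opB e g" by (simp add: inner_tf_def op_adj_cip)

lemma dzb_cA_comm: "dzb e (cA e') z = dzb e' (cA e) z"
proof -
 have c: "cA e = (%z. inverse 2 * dzb e ph z)" for e by (simp add: cA_def[abs_def])
 show ?thesis
  unfolding c dz_cmult(2)[OF smooth_dzb[OF smooth_ph]] using dz_commute(2)[OF smooth_ph, of e e' z] by simp
qed

lemma opA_comm: "opA e (opA e' f) = opA e' (opA e f)"
proof (rule tf_eqI)
 fix z
 have "dzb u (tfun (opA v f)) z = dzb u (dzb v (tfun f)) z + (cA v z * dzb u (tfun f) z + dzb u (cA v) z * tfun f z)" for u v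
  unfolding tfun_opA by (subst dz_add(2)) (auto intro!: smooth_mult simp: dz_mult(2))
 then show "tfun (opA e (opA e' f)) z = tfun (opA e' (opA e f)) z"
  using dz_commute(2)[OF smooth_tfun, of e e' f z] dzb_cA_comm[of e e' z] by (simp add: tfun_opA[of _ "opA _ _"]) (simp add: tfun_opA algebra_simps)
qed

definition lev :: "c2 => c2 => c2 => complex" where "lev e e' = dzb e' (dz e ph)"

lemma smooth_lev [intro, simp]: "smooth (lev e e')" unfolding lev_def by (intro smooth_dzb smooth_dz smooth_ph)

text \<open>What is left after the second derivatives cancel is a coefficient of the Levi form; the
  derivatives of \<open>cB\<close> and of \<open>cA\<close> contribute one half each.\<close>

lemma op_commutator: "opA e' (opB e f) = opB e (opA e' f) + mulop (lev e e') f"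
proof (rule tf_eqI)
 fix z
 have 1: "dzb e' (tfun (opB e f)) z = - dzb e' (dz e (tfun f)) z + (cB e z * dzb e' (tfun f) z + dzb e' (cB e) z * tfun f z)"
  unfolding tfun_opB by (subst dz_add(2)) (auto intro!: smooth_mult simp: dz_mult(2) dz_minus[OF smooth_dz[OF smooth_tfun]])
 have 2: "dz e (tfun (opA e' f)) z = dz e (dzb e' (tfun f)) z + (cA e' z * dz e (tfun f) z + dz e (cA e') z * tfun f z)"
  unfolding tfun_opA by (subst dz_add(1)) (auto intro!: smooth_mult simp: dz_mult(1))
 have 3: "dzb e' (cB e) z + dz e (cA e') z = lev e e' z"
 proof -
  have c: "cB e = (%z. inverse 2 * dz e ph z)" "cA e' = (%z. inverse 2 * dzb e' ph z)" by (simp_all add: cA_def[abs_def] cB_def[abs_def])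
  show ?thesis
   unfolding c dz_cmult(2)[OF smooth_dz[OF smooth_ph]] dz_cmult(1)[OF smooth_dzb[OF smooth_ph]]
    dz_commute(1)[OF smooth_ph] lev_def by (simp add: field_simps)
 qed
 show "tfun (opA e' (opB e f)) z = tfun (opB e (opA e' f) + mulop (lev e e') f) z"
  unfolding tfun_plus tfun_opA[of _ "opB _ _"] tfun_opB[of _ "opA _ _"] 1 2 tfun_mulop[OF smooth_lev] 3[symmetric]
  using dz_commute(1)[OF smooth_tfun, of e e' f z] by (simp add: tfun_opA tfun_opB algebra_simps)
qed

lemma smooth_cm: "smooth (%z. complex_of_real (m z))" by (intro smooth_of_real smooth_m)
lemma smooth_cim: "smooth (%z. complex_of_real (inverse (m z)))"
 by (intro smooth_of_real smooth_inverse smooth_m) (use m_pos in \<open>metis less_irrefl\<close>)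

text \<open>The lower bound \<open>m\<close> of the Levi form may decay at infinity. Pairings are
  therefore split into a factor \<open>im\<close> on the data and a factor \<open>mm\<close> on the
  test form.\<close>

definition mm :: "tf => tf" where "mm = mulop (%z. of_real (m z))"
definition im :: "tf => tf" where "im = mulop (%z. of_real (inverse (m z)))"

lemma mm_im: "f \<bullet> g = im f \<bullet> mm g"
proof -
 have "tfun (im f) z * cnj (tfun (mm g) z) = tfun f z * cnj (tfun g z)" for z
  unfolding mm_def im_def tfun_mulop[OF smooth_cm] tfun_mulop[OF smooth_cim] using m_pos[of z] by simp
 then show ?thesis by (simp add: inner_tf_def cip_def)
qed

lemma B_norm: "opB e f \<bullet> opB e' g = opA e' f \<bullet> opA e g + mulop (lev e e') f \<bullet> g"
proof -
 have "opB e f \<bullet> opB e' g = opA e' (opB e f) \<bullet> g" by (simp add: op_adj)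
 also have "... = opB e (opA e' f) \<bullet> g + mulop (lev e e') f \<bullet> g" by (simp add: op_commutator inner_add_left)
 also have "opB e (opA e' f) \<bullet> g = opA e' f \<bullet> opA e g" by (metis op_adj inner_commute)
 finally show ?thesis .
qed

abbreviation "e1 \<equiv> (1, 0) :: c2"
abbreviation "e2 \<equiv> (0, 1) :: c2"

lemma levi_int: "(norm (mm f))^2 + (norm (mm g))^2 <= mulop (lev e1 e1) f \<bullet> f + mulop (lev e1 e2) f \<bullet> g
 + mulop (lev e2 e1) g \<bullet> f + mulop (lev e2 e2) g \<bullet> g"
proof -
 have i: "integrable lborel (%z. Re (tfun f z * cnj (tfun g z)))" for f g by (rule integrable_Re[OF cip_integrable])
 have inn: "f \<bullet> g = (LINT z|lborel. Re (tfun f z * cnj (tfun g z)))" for f g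
  unfolding inner_tf_def cip_def by (rule integral_Re[symmetric, OF cip_integrable])
 have "(norm (mm f))^2 + (norm (mm g))^2 = (LINT z|lborel. (cmod (tfun (mm f) z))^2 + (cmod (tfun (mm g) z))^2)"
  unfolding norm_tf_sq by (rule Bochner_Integration.integral_add[symmetric, OF sq_integrable sq_integrable])
 also have "... <= (LINT z|lborel. Re (tfun (mulop (lev e1 e1) f) z * cnj (tfun f z)) + Re (tfun (mulop (lev e1 e2) f) z * cnj (tfun g z))
  + Re (tfun (mulop (lev e2 e1) g) z * cnj (tfun f z)) + Re (tfun (mulop (lev e2 e2) g) z * cnj (tfun g z)))"
 proof (rule integral_mono)
  fix z
  have "(cmod (tfun (mm f) z))^2 + (cmod (tfun (mm g) z))^2 = (m z)^2 * ((cmod (tfun f z))^2 + (cmod (tfun g z))^2)"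
   by (simp add: mm_def tfun_mulop[OF smooth_cm] norm_mult power_mult_distrib distrib_left)
  then show "(cmod (tfun (mm f) z))^2 + (cmod (tfun (mm g) z))^2 <= Re (tfun (mulop (lev e1 e1) f) z * cnj (tfun f z)) + Re (tfun (mulop (lev e1 e2) f) z * cnj (tfun g z))
  + Re (tfun (mulop (lev e2 e1) g) z * cnj (tfun f z)) + Re (tfun (mulop (lev e2 e2) g) z * cnj (tfun g z))"
   using levi[of z "tfun f z" "tfun g z"]
   unfolding tfun_mulop[OF smooth_lev] unfolding lev_def ph_def[abs_def] plus_complex.sel by linarith
 qed (intro Bochner_Integration.integrable_add sq_integrable i)+
 also have "... = mulop (lev e1 e1) f \<bullet> f + mulop (lev e1 e2) f \<bullet> g
 + mulop (lev e2 e1) g \<bullet> f + mulop (lev e2 e2) g \<bullet> g"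
  unfolding inn using i by simp
 finally show ?thesis .
qed

text \<open>When both squares are expanded by \<open>B_norm\<close>, the mixed terms of
  \<open>opA e1 g\<close> and \<open>opA e2 f\<close> cancel. What remains is the Levi form and four
  squared norms of \<open>opA\<close>, which are dropped.\<close>

lemma bochner: "(norm (mm f))^2 + (norm (mm g))^2 <= (norm (opB e1 f + opB e2 g))^2 + (norm (opA e1 g - opA e2 f))^2"
proof -
 have "(norm (opB e1 f + opB e2 g))^2 + (norm (opA e1 g - opA e2 f))^2 =
  (mulop (lev e1 e1) f \<bullet> f + mulop (lev e1 e2) f \<bullet> g + mulop (lev e2 e1) g \<bullet> f + mulop (lev e2 e2) g \<bullet> g)
  + ((norm (opA e1 f))^2 + (norm (opA e2 f))^2 + (norm (opA e1 g))^2 + (norm (opA e2 g))^2)"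
  unfolding power2_norm_eq_inner inner_add_left inner_add_right inner_diff_left inner_diff_right B_norm by simp
 then show ?thesis using levi_int[of f g] by (smt (verit) zero_le_power2)
qed

text \<open>The Levi inequality at a form whose second component is 0. It supplies the hypothesis
  \<open>pos\<close> of the abstract complex.\<close>

lemma trace_bound: "(norm (mm g))^2 <= (norm (opB e1 g))^2 + (norm (opB e2 g))^2"
proof -
 have "(norm (mm g))^2 <= mulop (lev e1 e1) g \<bullet> g"
  using levi_int[of g 0] linear_0[OF linear_mulop[OF smooth_cm]] linear_0[OF linear_mulop[OF smooth_lev]] by (simp add: mm_def)
 also have "... <= (norm (opB e1 g))^2"
  unfolding power2_norm_eq_inner B_norm by simp
 finally show ?thesis by (smt (verit) zero_le_power2)
qed

end

section \<open>Friedrichs' commutator estimates and Hoermander's bound\<close>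

lemma conv_add_right:
 assumes "smooth k" "vanish r k" "lbm f" "lbm g"
 shows "conv k (%w. f w + g w) z = conv k f z + conv k g z"
 using Bochner_Integration.integral_add[OF conv_integrable[OF lbm_smooth[OF assms(1)] assms(3), of r z]
   conv_integrable[OF lbm_smooth[OF assms(1)] assms(4), of r z]] assms(2) by (simp add: conv_def distrib_left)

lemma conv_minus_right: "conv k (%w. - f w) z = - conv k f z" by (simp add: conv_def)

lemma vanish_dz_eta: assumes "r > 0" shows "vanish (2 * r) (dz e (eta r))"
 using vanishD[OF vanish_Dd[OF vanish_eta[OF assms] assms, of e]] vanishD[OF vanish_Dd[OF vanish_eta[OF assms] assms, of "ii e"]]
 unfolding vanish_def dz_def by (simp add: del: split_paired_All)

lemma dz_eta_integral: assumes "r > 0"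
 shows "(LINT z|lborel. cmod (dz e (eta r) z)) <= (Keta e + Keta (ii e)) / r"
proof -
 have i: "integrable lborel (%z. cmod (Dd e (eta r) z))" for e
  using integrable_lbm_vanish[OF lbm_smooth[OF smooth_Dd[OF smooth_eta]] vanish_Dd[OF vanish_eta[OF assms] assms]] by (rule integrable_norm)
 have "integrable lborel (%z. cmod (dz e (eta r) z))"
  using integrable_lbm_vanish[OF lbm_smooth[OF smooth_dz[OF smooth_eta]] vanish_dz_eta[OF assms]] by (rule integrable_norm)
 then have "(LINT z|lborel. cmod (dz e (eta r) z)) <= (LINT z|lborel. cmod (Dd e (eta r) z) + cmod (Dd (ii e) (eta r) z))"
 proof (rule integral_mono)
  show "cmod (dz e (eta r) z) <= cmod (Dd e (eta r) z) + cmod (Dd (ii e) (eta r) z)" for z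
   unfolding dz_def using norm_triangle_ineq4[of "Dd e (eta r) z" "\<i> * Dd (ii e) (eta r) z"]
   by (simp add: norm_divide norm_mult) (smt (verit) norm_ge_zero)
 qed (use i in auto)
 also have "... = (Keta e + Keta (ii e)) / r" using i by (simp add: Dd_eta_integral[OF assms] add_divide_distrib)
 finally show ?thesis .
qed

lemma Keta_nonneg: "Keta e >= 0"
 unfolding Keta_def using c0_pos by (intro divide_nonneg_pos) auto

lemma norm_ii [simp]: "norm (ii e) = norm e" by (cases e) (simp add: ii_def norm_Pair norm_mult)

context weight
begin

lemma Dd_ph: "Dd e ph = (%z. of_real (Dd e p z))"
 unfolding ph_def[abs_def] using Dd_compose_linear[OF bounded_linear_of_real smooth_differentiable[OF smooth_p]] by blast

lemma Dd2_ph: "Dd e' (Dd e ph) z = of_real (Dd e' (Dd e p) z)"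
 unfolding Dd_ph using Dd_compose_linear[OF bounded_linear_of_real smooth_differentiable[OF smooth_Dd[OF smooth_p]]] by blast

lemma c_bound: "cmod (cA e z) <= b * norm e" "cmod (cB e z) <= b * norm e"
proof -
 have 1: "cmod (Dd e ph z) <= b * norm e" "cmod (Dd (ii e) ph z) <= b * norm e"
  using D1[of e z] D1[of "ii e" z] by (simp_all add: Dd_ph)
 then have "cmod (Dd e ph z + \<i> * Dd (ii e) ph z) <= 2 * (b * norm e)" "cmod (Dd e ph z - \<i> * Dd (ii e) ph z) <= 2 * (b * norm e)"
  using norm_triangle_ineq[of "Dd e ph z" "\<i> * Dd (ii e) ph z"] norm_triangle_ineq4[of "Dd e ph z" "\<i> * Dd (ii e) ph z"]
  by (simp_all add: norm_mult)
 moreover have "b * norm e >= 0" using 1(1) norm_ge_zero order_trans by blast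
 ultimately show "cmod (cA e z) <= b * norm e" "cmod (cB e z) <= b * norm e" by (simp_all add: cA_def cB_def dzb_def dz_def norm_divide)
qed

lemma b_nonneg: "b >= 0"
 using order_trans[OF norm_ge_zero c_bound(1)[of "(1,0)" 0]] by (simp add: norm_Pair)

lemma Dd_c: "cmod (Dd e' (cA e) z) <= b * norm e * norm e'" "cmod (Dd e' (cB e) z) <= b * norm e * norm e'"
proof -
 note s = smooth_Dd[OF smooth_ph]
 have h: "Dd e' (%z. inverse 2 * ((Dd e ph z + c * Dd (ii e) ph z) / 2)) z
   = inverse 2 * ((Dd e' (Dd e ph) z + c * Dd e' (Dd (ii e) ph) z) / 2)" for c
 proof -
  have "smooth (%z. (Dd e ph z + c * Dd (ii e) ph z) / 2)"
   unfolding divide_inverse by (intro smooth_mult smooth_add smooth_const s)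
  from Dd_cmult[OF this] show ?thesis by (simp only: Dd_lin2[OF s s])
 qed
 have "cA e z = inverse 2 * ((Dd e ph z + \<i> * Dd (ii e) ph z) / 2)"
  "cB e z = inverse 2 * ((Dd e ph z + (- \<i>) * Dd (ii e) ph z) / 2)" for z by (simp_all add: cA_def cB_def dzb_def dz_def)
 then have eq: "cA e = (%z. inverse 2 * ((Dd e ph z + \<i> * Dd (ii e) ph z) / 2))"
  "cB e = (%z. inverse 2 * ((Dd e ph z + (- \<i>) * Dd (ii e) ph z) / 2))" by blast+
 have 1: "cmod (Dd e' (Dd e ph) z) <= b * norm e * norm e'" "cmod (Dd e' (Dd (ii e) ph) z) <= b * norm e * norm e'"
  using D2[of e' e z] D2[of e' "ii e" z] by (simp_all add: Dd2_ph)
 have 2: "cmod (Dd e' (Dd e ph) z + c * Dd e' (Dd (ii e) ph) z) <= 2 * (b * norm e * norm e')" if "cmod c = 1" for c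
  using norm_triangle_ineq[of "Dd e' (Dd e ph) z" "c * Dd e' (Dd (ii e) ph) z"] 1 that by (simp add: norm_mult)
 have n: "b * norm e * norm e' >= 0" using b_nonneg by simp
 show "cmod (Dd e' (cA e) z) <= b * norm e * norm e'"
  unfolding eq h norm_mult norm_divide using 2[of \<i>] n by simp
 show "cmod (Dd e' (cB e) z) <= b * norm e * norm e'"
  unfolding eq h norm_mult norm_divide using 2[of "- \<i>"] n by simp
qed

lemma c_Lipschitz: "cmod (cA e z - cA e w) <= b * norm e * norm (z - w)" "cmod (cB e z - cB e w) <= b * norm e * norm (z - w)"
 by (rule Dd_bounded_Lipschitz[OF smooth_cA Dd_c(1)], rule Dd_bounded_Lipschitz[OF smooth_cB Dd_c(2)])

lemma dz_cA_bound: "cmod (dz e (cA e) z) <= b * norm e * norm e"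
proof -
 have "cmod (Dd e (cA e) z - \<i> * Dd (ii e) (cA e) z) <= 2 * (b * norm e * norm e)"
  using norm_triangle_ineq4[of "Dd e (cA e) z" "\<i> * Dd (ii e) (cA e) z"] Dd_c(1)[of e e z] Dd_c(1)[of "ii e" e z] by (simp add: norm_mult)
 then show ?thesis by (simp add: dz_def norm_divide)
qed

text \<open>The part with constant coefficients commutes with convolution, so the commutator
  involves only the Lipschitz function \<open>cB\<close>.\<close>

lemma commutator_B:
 assumes r: "r > 0" shows "tfun (opB e (Jop r f) - Jop r (opB e f)) z
  = cB e z * conv (eta r) (tfun f) z - conv (eta r) (%w. cB e w * tfun f w) z"
proof -
 obtain s where s: "vanish s (tfun f)" by (rule vanish_tfun)
 have "conv (eta r) (%w. - dz e (tfun f) w + cB e w * tfun f w) z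
  = - conv (eta r) (dz e (tfun f)) z + conv (eta r) (%w. cB e w * tfun f w) z" by (subst conv_add_right[OF smooth_eta vanish_eta[OF r]])
   (auto intro!: lbm_smooth smooth_minus smooth_mult smooth_dz simp: conv_minus_right)
 then show ?thesis by (simp add: tfun_simps tfun_opB tfun_Jop[OF r] dz_conv'(1)[OF smooth_eta vanish_eta[OF r] smooth_tfun s])
qed

lemma commutator_A:
 assumes r: "r > 0" shows "tfun (opA e (Jop r f) - Jop r (opA e f)) z
  = cA e z * conv (eta r) (tfun f) z - conv (eta r) (%w. cA e w * tfun f w) z"
proof -
 obtain s where s: "vanish s (tfun f)" by (rule vanish_tfun)
 have "conv (eta r) (%w. dzb e (tfun f) w + cA e w * tfun f w) z
  = conv (eta r) (dzb e (tfun f)) z + conv (eta r) (%w. cA e w * tfun f w) z" by (subst conv_add_right[OF smooth_eta vanish_eta[OF r]])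
   (auto intro!: lbm_smooth smooth_mult smooth_dzb)
 then show ?thesis by (simp add: tfun_simps tfun_opA tfun_Jop[OF r] dz_conv'(2)[OF smooth_eta vanish_eta[OF r] smooth_tfun s])
qed

lemma norm_commutator:
 assumes r: "r > 0" and e: "norm e = 1"
 shows "norm (opB e (Jop r f) - Jop r (opB e f)) <= b * r * norm f"
  "norm (opA e (Jop r f) - Jop r (opA e f)) <= b * r * norm f"
 using schur_commutator[OF smooth_eta vanish_eta[OF r] less_imp_le[OF r] smooth_cB c_Lipschitz(2) commutator_B[OF r], of e f]
  schur_commutator[OF smooth_eta vanish_eta[OF r] less_imp_le[OF r] smooth_cA c_Lipschitz(1) commutator_A[OF r], of e f]
 by (simp_all add: cmod_eta_integral[OF r] e)

lemma norm_mulop: assumes "smooth c" "!!z. cmod (c z) <= B" shows "norm (mulop c f) <= B * norm f"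
proof -
 have "B >= 0" using order_trans[OF norm_ge_zero assms(2)[of 0]] .
 then show ?thesis by (rule norm_tf_mono[rotated]) (simp add: tfun_mulop[OF assms(1)] norm_mult mult_right_mono[OF assms(2)])
qed

definition KK :: "c2 => real" where "KK e = Keta e + Keta (ii e)"

lemma KK_nonneg: "KK e >= 0" by (simp add: KK_def Keta_nonneg)

text \<open>Friedrichs' lemma with one more derivative. \<open>X\<close> is the commutator of
  \<open>cA\<close> with the mollifier, applied to \<open>opB e f\<close>; the derivative contained
  in \<open>opB e f\<close> is moved to the kernel. There it costs 1 / r against the gain 2 b r of
  the commutator: this is \<open>F1\<close>. \<open>F2\<close> arises where the derivative hits
  \<open>cA\<close>, and \<open>F3\<close> from the part of order zero of
  \<open>opB\<close>.\<close>

lemma norm_SB: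
 assumes r: "r > 0" "r <= 1" and e: "norm e = 1"
 shows "norm (opA e (Jop r (opB e f)) - Jop r (opA e (opB e f))) <= (2 * b * KK e + b + b * b) * norm f"
proof -
 obtain s where s: "vanish s (tfun f)" by (rule vanish_tfun)
 define X where "X = opA e (Jop r (opB e f)) - Jop r (opA e (opB e f))"
 define g where "g = mulop (cB e) f"
 define F3 where "F3 = opA e (Jop r g) - Jop r (opA e g)"
 define F2 where "F2 = Jop r (mulop (dz e (cA e)) f)"
 define F1 where "F1 = F3 - F2 - X"
 have sd: "smooth (dz e (cA e))" by (intro smooth_dz smooth_cA)
 have F1: "tfun F1 z = cA e z * conv (dz e (eta r)) (tfun f) z - conv (dz e (eta r)) (%w. cA e w * tfun f w) z" for z
 proof -
  have 1: "conv (eta r) (tfun (opB e f)) z = - conv (dz e (eta r)) (tfun f) z + conv (eta r) (tfun g) z"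
  proof -
   have "conv (eta r) (dz e (tfun f)) = conv (dz e (eta r)) (tfun f)"
    using dz_conv'(1)[OF smooth_eta vanish_eta[OF r(1)] smooth_tfun s] dz_conv(1)[OF smooth_eta vanish_eta[OF r(1)] lbm_tfun] by metis
   moreover have "conv (eta r) (tfun (opB e f)) z = - conv (eta r) (dz e (tfun f)) z + conv (eta r) (tfun g) z"
    unfolding tfun_opB g_def tfun_mulop[OF smooth_cB] by (subst conv_add_right[OF smooth_eta vanish_eta[OF r(1)]])
     (auto intro!: lbm_smooth smooth_minus smooth_mult smooth_dz simp: conv_minus_right)
   ultimately show ?thesis by simp
  qed
  have 2: "conv (eta r) (%w. cA e w * tfun (opB e f) w) z =
   - (conv (dz e (eta r)) (%w. cA e w * tfun f w) z - tfun F2 z) + conv (eta r) (%w. cA e w * tfun g w) z"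
  proof -
   have vs: "vanish s (%w. cA e w * tfun f w)" by (rule vanish_mult2[OF s])
   have "conv (dz e (eta r)) (%w. cA e w * tfun f w) z = conv (eta r) (dz e (%w. cA e w * tfun f w)) z"
    using dz_conv'(1)[OF smooth_eta vanish_eta[OF r(1)] smooth_mult[OF smooth_cA smooth_tfun] vs]
     dz_conv(1)[OF smooth_eta vanish_eta[OF r(1)] lbm_smooth[OF smooth_mult[OF smooth_cA smooth_tfun]]] by metis
   also have "dz e (%w. cA e w * tfun f w) = (%w. cA e w * dz e (tfun f) w + dz e (cA e) w * tfun f w)"
    by (intro ext) (rule dz_mult(1)[OF smooth_cA smooth_tfun])
   also have "conv (eta r) ... z = conv (eta r) (%w. cA e w * dz e (tfun f) w) z + tfun F2 z"
    unfolding F2_def tfun_Jop[OF r(1)] tfun_mulop[OF sd]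
    by (rule conv_add_right[OF smooth_eta vanish_eta[OF r(1)]]) (intro lbm_smooth smooth_mult smooth_dz smooth_cA smooth_tfun)+
   finally have a: "conv (eta r) (%w. cA e w * dz e (tfun f) w) z = conv (dz e (eta r)) (%w. cA e w * tfun f w) z - tfun F2 z" by simp
   have "(%w. cA e w * tfun (opB e f) w) = (%w. - (cA e w * dz e (tfun f) w) + cA e w * tfun g w)"
    by (simp add: tfun_opB g_def tfun_mulop[OF smooth_cB] algebra_simps)
   then have "conv (eta r) (%w. cA e w * tfun (opB e f) w) z = conv (eta r) (%w. - (cA e w * dz e (tfun f) w)) z + conv (eta r) (%w. cA e w * tfun g w) z"
    by (simp only:) (rule conv_add_right[OF smooth_eta vanish_eta[OF r(1)]];
     intro lbm_smooth smooth_minus smooth_mult smooth_dz smooth_cA smooth_tfun)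
   then show ?thesis by (simp add: conv_minus_right a)
  qed
  show ?thesis
   unfolding F1_def X_def F3_def tfun_minus[of _ "opA _ _ - _"] tfun_minus[of _ F2] commutator_A[OF r(1)] 1 2 by (simp add: algebra_simps)
 qed
 have n1: "norm F1 <= 2 * b * KK e * norm f"
 proof -
  have "norm F1 <= b * norm e * (2 * r) * (LINT w|lborel. cmod (dz e (eta r) w)) * norm f"
   by (rule schur_commutator[OF smooth_dz[OF smooth_eta] vanish_dz_eta[OF r(1)] _ smooth_cA c_Lipschitz(1) F1]) (use r in simp)
  also have "... <= b * norm e * (2 * r) * (KK e / r) * norm f"
   unfolding KK_def using dz_eta_integral[OF r(1), of e] b_nonneg r by (intro mult_right_mono mult_left_mono) auto
  also have "... = 2 * b * KK e * norm f" using r e by simp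
  finally show ?thesis .
 qed
 have n2: "norm F2 <= b * norm f"
  unfolding F2_def using order_trans[OF norm_Jop[OF r(1)] norm_mulop[OF sd dz_cA_bound]] e by simp
 have n3: "norm F3 <= b * b * norm f"
 proof -
  have "norm F3 <= b * r * norm g" unfolding F3_def by (rule norm_commutator(2)[OF r(1) e])
  also have "... <= b * 1 * (b * norm f)"
   using norm_mulop[OF smooth_cB c_bound(2), of e f] e r b_nonneg unfolding g_def by (intro mult_mono) auto
  finally show ?thesis by simp
 qed
 have "norm X <= norm F3 + norm F2 + norm F1"
  using norm_triangle_ineq4[of "F3 - F2" F1] norm_triangle_ineq4[of F3 F2] by (simp add: F1_def)
 then show ?thesis using n1 n2 n3 unfolding X_def by (simp add: algebra_simps)
qed

text \<open>The derivative lands on \<open>eta r\<close> at the price of a constant of order 1 / r,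
  which the abstract complex allows in \<open>cm\<close>.\<close>

lemma norm_BJ:
 assumes r: "r > 0" and e: "norm e = 1"
 shows "norm (opB e (Jop r f)) <= (KK e / r + b) * norm f"
proof -
 define G where "G = mulop (cB e) (Jop r f) - opB e (Jop r f)"
 have "tfun G = conv (dz e (eta r)) (tfun f)"
  unfolding G_def tfun_minus tfun_mulop[OF smooth_cB] tfun_opB
  using dz_conv(1)[OF smooth_eta vanish_eta[OF r] lbm_tfun] by (simp add: tfun_Jop[OF r])
 from schur_conv[OF smooth_dz[OF smooth_eta] vanish_dz_eta[OF r] this]
 have "norm G <= KK e / r * norm f"
  using mult_right_mono[OF dz_eta_integral[OF r, of e], of "norm f"] unfolding KK_def by simp
 moreover have "norm (mulop (cB e) (Jop r f)) <= b * norm f"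
  using norm_mulop[OF smooth_cB c_bound(2), of e "Jop r f"] mult_left_mono[OF norm_Jop[OF r] b_nonneg, of f] e by simp
 moreover have "opB e (Jop r f) = mulop (cB e) (Jop r f) - G" by (simp add: G_def)
 then have "norm (opB e (Jop r f)) <= norm (mulop (cB e) (Jop r f)) + norm G"
  using norm_triangle_ineq4[of "mulop (cB e) (Jop r f)" G] by (simp only:)
 ultimately show ?thesis by (simp add: distrib_right)
qed

text \<open>Moving \<open>opB\<close> over to \<open>f0\<close> pairs \<open>opA e f0\<close> with
  the test form. Dividing by \<open>m\<close> on one side and multiplying by \<open>m\<close> on the
  other makes \<open>bochner\<close> applicable, so the constant is the norm of the d-bar data
  divided by \<open>m\<close>, as in Hoermander's theorem.\<close>

theorem minimal_sequence:
 assumes M: "M = sqrt ((norm (im (opA e1 f0)))^2 + (norm (im (opA e2 f0)))^2)"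
 obtains v where "Cauchy v" "!!k. norm (v k) <= M + 1"
  "!!\<beta>1 \<beta>2. (%k. (f0 - v k) \<bullet> (opB e1 \<beta>1 + opB e2 \<beta>2)) \<longlonglongrightarrow> 0"
proof -
 define r where "r k = 1 / (real k + 1)" for k
 have r: "r k > 0" "r k <= 1" for k by (auto simp: r_def)
 have rlim: "r \<longlonglongrightarrow> 0"
  unfolding r_def[abs_def] using LIMSEQ_inverse_real_of_nat by (simp add: inverse_eq_divide add.commute)
 have n: "norm e1 = 1" "norm e2 = 1" by (simp_all add: norm_Pair)
 define C where "C = 2 * b * (KK e1 + KK e2) + b + b * b"
 have C: "(2 * b * KK e1 + b + b * b) * norm f <= C * norm f" "(2 * b * KK e2 + b + b * b) * norm f <= C * norm f" for f :: tf
  using b_nonneg KK_nonneg unfolding C_def by (intro mult_right_mono; simp add: algebra_simps)+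
 define cm where "cm k = (KK e1 + KK e2) / r k + b" for k
 have cm: "(KK e1 / r k + b) * norm f <= cm k * norm f" "(KK e2 / r k + b) * norm f <= cm k * norm f" for k and f :: tf
  using r[of k] KK_nonneg unfolding cm_def by (intro mult_right_mono; simp add: add_divide_distrib)+
 interpret dbar_complex "opA e1" "opA e2" "opB e1" "opB e2" "%k. Jop (r k)" "%k. b * r k" cm C
 proof (rule dbar_complex.intro)
  show "(%k. b * r k) \<longlonglongrightarrow> 0" using tendsto_mult_right_zero[OF rlim] .
  show "(%k. Jop (r k) f) \<longlonglongrightarrow> f" for f by (rule Jop_lim[OF r rlim])
  show "\<exists>c. \<forall>g. \<bar>g \<bullet> f\<bar> <= c * sqrt ((norm (opB e1 g))^2 + (norm (opB e2 g))^2)" for f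
  proof (intro exI allI)
   fix g
   have "\<bar>g \<bullet> f\<bar> = \<bar>im f \<bullet> mm g\<bar>" using mm_im[of f g] by (simp add: inner_commute)
   also have "... <= norm (im f) * norm (mm g)" by (rule Cauchy_Schwarz_ineq2)
   also have "... <= norm (im f) * sqrt ((norm (opB e1 g))^2 + (norm (opB e2 g))^2)"
    using real_le_rsqrt[OF trace_bound[of g]] by (intro mult_left_mono) auto
   finally show "\<bar>g \<bullet> f\<bar> <= norm (im f) * sqrt ((norm (opB e1 g))^2 + (norm (opB e2 g))^2)" .
  qed
 qed (use order_trans[OF norm_SB[OF r n(1)] C(1)] order_trans[OF norm_SB[OF r n(2)] C(2)]
   order_trans[OF norm_BJ[OF r(1) n(1)] cm(1)] order_trans[OF norm_BJ[OF r(1) n(2)] cm(2)] in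
   \<open>simp_all only: linear_opA linear_opB linear_Jop[OF r(1)] op_adj opA_comm[of e1 e2] Jop_adj[OF r(1)] norm_Jop[OF r(1)]
    norm_commutator[OF r(1) n(1)] norm_commutator[OF r(1) n(2)]\<close>)
 show thesis
 proof (rule exists_minimal_sequence[of M f0])
  show "M >= 0" unfolding M by simp
  fix \<alpha>1 \<alpha>2
  have "f0 \<bullet> (opB e1 \<alpha>1 + opB e2 \<alpha>2) = im (opA e1 f0) \<bullet> mm \<alpha>1 + im (opA e2 f0) \<bullet> mm \<alpha>2"
   by (simp add: inner_add_right op_adj[symmetric] mm_im[symmetric])
  also have "... = (im (opA e1 f0), im (opA e2 f0)) \<bullet> (mm \<alpha>1, mm \<alpha>2)" by simp
  also have "\<bar>...\<bar> <= norm (im (opA e1 f0), im (opA e2 f0)) * norm (mm \<alpha>1, mm \<alpha>2)" by (rule Cauchy_Schwarz_ineq2)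
  also have "... <= M * sqrt ((norm (opB e1 \<alpha>1 + opB e2 \<alpha>2))^2 + (norm (opA e1 \<alpha>2 - opA e2 \<alpha>1))^2)"
   unfolding norm_Pair M using bochner[of \<alpha>1 \<alpha>2] by (intro mult_left_mono) auto
  finally show "\<bar>f0 \<bullet> (opB e1 \<alpha>1 + opB e2 \<alpha>2)\<bar> <=
   M * sqrt ((norm (opB e1 \<alpha>1 + opB e2 \<alpha>2))^2 + (norm (opA e1 \<alpha>2 - opA e2 \<alpha>1))^2)" .
 qed (use that in blast)
qed

end

section \<open>Point values and holomorphy of the limit\<close>

lemma Dd_reflect:
 fixes k :: "c2 => complex"
 assumes "k differentiable (at (z - w))"
 shows "((%w. k (z - w)) has_derivative (%e. - Dd e k (z - w))) (at w)"
proof -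
 have "((%w. z - w) has_derivative (%e. - e)) (at w)" by (auto intro!: derivative_eq_intros)
 from has_derivative_compose[OF this has_derivative_Dd[OF assms]]
 have "((%w. k (z - w)) has_derivative (%e. Dd (- e) k (z - w))) (at w)" .
 moreover have "Dd (- e) k (z - w) = - Dd e k (z - w)" for e
  using linear_neg[OF bounded_linear.linear[OF has_derivative_bounded_linear[OF has_derivative_Dd[OF assms]]]] .
 ultimately show ?thesis by simp
qed

lemma Ck_reflect: "Ck n (k :: c2 => complex) ==> Ck n (%w. k (z - w))"
proof (induction n arbitrary: k)
 case 0
 then show ?case by (auto intro!: continuous_on_compose2[of UNIV k] continuous_intros)
next
 case (Suc n)
 have kd: "k differentiable (at x)" and kc: "Ck n (Dd e k)" for x e using Suc.prems Ck.simps(2) by blast+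
 have d: "((%w. k (z - w)) has_derivative (%e. - Dd e k (z - w))) (at w)" for w by (rule Dd_reflect[OF kd])
 then have "Dd e (%w. k (z - w)) = (%w. - Dd e k (z - w))" for e using Dd_eq by blast
 moreover have "Ck n (%w. - Dd e k (z - w))" for e
  using Ck_compose_linear[OF bounded_linear_minus[OF bounded_linear_ident] Suc.IH[OF kc]] .
 ultimately show ?case using differentiableI[OF d] by (simp del: split_paired_All)
qed

lemma smooth_reflect: "smooth (k :: c2 => complex) ==> smooth (%w. k (z - w))" by (simp add: smooth_def Ck_reflect)

lemma dz_reflect: assumes "smooth k" shows "dz e (%w. k (z - w)) w = - dz e k (z - w)"
proof -
 have "Dd e (%w. k (z - w)) w = - Dd e k (z - w)" for e by (rule Dd_eq[OF Dd_reflect[OF smooth_differentiable[OF assms]]])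
 then show ?thesis by (simp add: dz_def field_simps)
qed

lemma cip_scale: "cip (mulop (%_. c) u) h = c * cip u h" "cip u (mulop (%_. c) h) = cnj c * cip u h"
 by (simp_all add: cip_def tfun_mulop[OF smooth_const] mult.assoc mult.left_commute)

lemma norm_mulop_const: "norm (mulop (%_. c) u) <= cmod c * norm u" by (rule norm_tf_mono) (auto simp: tfun_mulop[OF smooth_const] norm_mult)

text \<open>The real inner product sees only the real part; a unimodular factor rotates the complex
  product onto the positive axis.\<close>

lemma cip_CS: "cmod (cip u h) <= norm u * norm h"
proof (cases "cip u h = 0")
 case False
 define c where "c = cnj (cip u h) / of_real (cmod (cip u h))"
 have c1: "cmod c = 1" using False by (simp add: c_def norm_divide)
 have "c * cip u h = of_real (cmod (cip u h))"
  using False by (simp add: c_def complex_norm_square[symmetric] mult.commute power2_eq_square)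
 then have "cmod (cip u h) = mulop (%_. c) u \<bullet> h" by (simp add: inner_tf_def cip_scale)
 also have "... <= norm (mulop (%_. c) u) * norm h" by (rule norm_cauchy_schwarz)
 also have "... <= norm u * norm h" using norm_mulop_const[of c u] c1 by (intro mult_right_mono) auto
 finally show ?thesis .
qed simp

context weight
begin

definition ex :: "c2 => complex" where "ex z = of_real (exp (p z / 2))"

lemma smooth_ex [simp, intro]: "smooth ex"
 unfolding ex_def[abs_def] divide_inverse by (intro smooth_of_real smooth_exp smooth_mult smooth_p smooth_const)

text \<open>\<open>ex\<close> undoes the conjugation by the weight. The average against
  \<open>eta r\<close> is continuous for the norm, unlike a point value, so it passes to the limit
  along Cauchy sequences that have no limit in the space.\<close>

definition Ev :: "real => tf => c2 => complex" where "Ev r u = conv (eta r) (tfun (mulop ex u))"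

lemma conv_ex_bound:
 assumes k: "smooth k" "vanish s k" "s > 0" and B: "!!z. cmod (k z) <= B" "B >= 0"
  and S: "!!w. norm (w - z) < s ==> exp (p w / 2) <= S" "S >= 0"
 shows "cmod (conv k (tfun (mulop ex u)) z) <= S * (B * sqrt (measure lborel (cball (0::c2) s))) * norm u"
proof -
 define V where "V = measure lborel (cball (0::c2) s)"
 define h where "h = Tf (%w. ex w * cnj (k (z - w)))"
 have vk: "vanish (norm z + s) (%w. ex w * cnj (k (z - w)))"
  using vanishD[OF vanish_shift[OF k(2), of z]] unfolding vanish_def by (simp del: split_paired_All)
 have h: "tfun h = (%w. ex w * cnj (k (z - w)))"
  unfolding h_def by (rule tfun_Tf[OF _ vk]) (intro smooth_mult smooth_cnj smooth_ex smooth_reflect k)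
 have "conv k (tfun (mulop ex u)) z = cip u h"
  unfolding conv_def cip_def h tfun_mulop[OF smooth_ex] by (rule Bochner_Integration.integral_cong[OF refl]) (simp add: ex_def mult_ac)
 also have "cmod ... <= norm u * norm h" by (rule cip_CS)
 also have "norm u * norm h <= norm u * (S * B * sqrt V)"
 proof (rule mult_left_mono[OF _ norm_ge_zero])
  have pt: "(cmod (tfun h w))^2 <= (S * B)^2 * indicator (cball z s) w" for w
  proof (cases "norm (w - z) < s")
   case True
   have "cmod (tfun h w) = exp (p w / 2) * cmod (k (z - w))" by (simp add: h ex_def norm_mult)
   also have "... <= S * B" using S True B by (intro mult_mono) auto
   finally show ?thesis using True by (simp add: power_mono dist_norm norm_minus_commute)
  next
   case False
   then have "k (z - w) = 0" using vanishD[OF k(2), of "z - w"] by (simp add: norm_minus_commute)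
   then show ?thesis by (simp add: h)
  qed
  have i: "integrable lborel (%w. (S * B)^2 * indicator (cball z s) w :: real)"
   using emeasure_bounded_finite[of "cball z s"] by (intro integrable_mult_right integrable_real_indicator) auto
  have "(norm h)^2 <= (LINT w|lborel. (S * B)^2 * indicator (cball z s) w)"
   unfolding norm_tf_sq by (intro integral_mono sq_integrable i pt)
  also have "... = (S * B)^2 * measure lborel (cball z s)" by simp
  also have "measure lborel (cball z s) = V"
  proof -
   have "(LINT w|lborel. indicator (cball z s) w :: real) = (LINT w|lborel. (%w. indicator (cball 0 s) w) (z - w))"
    by (rule Bochner_Integration.integral_cong[OF refl]) (simp add: indicator_def dist_norm norm_minus_commute)
   also have "... = (LINT w|lborel. indicator (cball (0::c2) s) w)"
    using integral_reflect_real[of "indicat_real (cball 0 s)" z, OF borel_measurable_indicator[OF borel_closed[OF closed_cball]]] by simp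
   finally show ?thesis by (simp add: V_def)
  qed
  also have "(S * B)^2 * V = (S * B * sqrt V)^2" by (simp add: power_mult_distrib V_def)
  finally show "norm h <= S * B * sqrt V" by (rule power2_le_imp_le) (use B S in \<open>auto simp: V_def\<close>)
 qed
 finally show ?thesis by (simp add: V_def mult_ac)
qed

lemma Dd_ex: "Dd e ex z = Dd e ph z / 2 * ex z"
proof -
 have s: "smooth (%z. p z / 2)" unfolding divide_inverse by (intro smooth_mult smooth_p smooth_const)
 have 1: "Dd e ex z = of_real (Dd e (%z. exp (p z / 2)) z)"
  unfolding ex_def[abs_def] by (rule Dd_compose_linear[OF bounded_linear_of_real smooth_differentiable[OF smooth_exp[OF s]]])
 have 2: "Dd e (%z. exp (p z / 2)) z = Dd e (%z. p z / 2) z * exp (p z / 2)" by (rule Dd_exp[OF s])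
 have 3: "Dd e (%z. p z / 2) z = Dd e p z / 2"
  using Dd_compose_linear[OF bounded_linear_divide[of 2] smooth_differentiable[OF smooth_p]] .
 show ?thesis unfolding 1 2 3 Dd_ph ex_def by simp
qed

text \<open>With \<open>h\<close> the product of exp (p / 2) and the reflected mollifier, the
  coefficient in \<open>opB\<close> cancels the derivative of the exponential, and
  \<open>opB e h\<close> is exp (p / 2) times \<open>dz e (eta r)\<close> at z - w. Weak
  orthogonality to the range of \<open>opB\<close> is thus the d-bar equation for the
  averages.\<close>

lemma conv_dzb_tendsto:
 assumes r: "r > 0" and lim: "!!\<beta>. (%k. u k \<bullet> opB e \<beta>) \<longlonglongrightarrow> 0"
 shows "(%k. conv (dzb e (eta r)) (tfun (mulop ex (u k))) z) \<longlonglongrightarrow> 0"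
proof -
 define g where "g = (%w. eta r (z - w))"
 have sg: "smooth g" unfolding g_def by (rule smooth_reflect[OF smooth_eta])
 define h where "h = Tf (%w. ex w * g w)"
 have vg: "vanish (norm z + r) g" unfolding g_def by (rule vanish_shift[OF vanish_eta[OF r]])
 have h: "tfun h = (%w. ex w * g w)"
  unfolding h_def by (rule tfun_Tf[OF _ vanish_mult2[OF vg]]) (intro smooth_mult smooth_ex sg)
 have dex: "dz e ex w = cB e w * ex w" for w by (simp add: dz_def cB_def Dd_ex field_simps)
 have Bh: "tfun (opB e h) w = ex w * dz e (eta r) (z - w)" for w
  unfolding tfun_opB h dz_mult(1)[OF smooth_ex sg] dex
  unfolding g_def dz_reflect[OF smooth_eta] by (simp add: algebra_simps)
 have eq: "conv (dzb e (eta r)) (tfun (mulop ex v)) z = cip v (opB e h)" for v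
  unfolding conv_def cip_def tfun_mulop[OF smooth_ex] Bh by (rule Bochner_Integration.integral_cong[OF refl])
   (simp add: ex_def dz_real(1)[OF smooth_eta eta_real[OF r]] mult_ac)
 \<comment> \<open>\<open>opB\<close> is complex linear; testing with i times \<open>h\<close>
   yields the imaginary part of the complex pairing.\<close>
 have Bi: "opB e (mulop (%_. \<i>) h) = mulop (%_. \<i>) (opB e h)"
  by (rule tf_eqI) (simp add: tfun_opB tfun_mulop[OF smooth_const] dz_cmult[OF smooth_tfun] algebra_simps)
 have "(%k. Re (cip (u k) (opB e h))) \<longlonglongrightarrow> 0" using lim[of h] by (simp add: inner_tf_def)
 moreover have "(%k. Im (cip (u k) (opB e h))) \<longlonglongrightarrow> 0"
  using lim[of "mulop (%_. \<i>) h"] unfolding Bi inner_tf_def cip_scale by simp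
 ultimately have "(%k. cip (u k) (opB e h)) \<longlonglongrightarrow> 0" by (simp add: tendsto_complex_iff)
 then show ?thesis by (simp add: eq)
qed

text \<open>Values and derivatives of the averages are Cauchy locally uniformly, since exp (p / 2)
  is locally bounded; so differentiation passes to the limit. The Cauchy-Riemann equations hold
  because the d-bar derivatives of the averages tend to 0.\<close>

lemma holo_limit:
 assumes r: "r > 0" and cu: "Cauchy u"
  and lim: "!!\<beta>1 \<beta>2. (%k. u k \<bullet> (opB e1 \<beta>1 + opB e2 \<beta>2)) \<longlonglongrightarrow> 0"
 obtains U where "!!z. (%k. Ev r (u k) z) \<longlonglongrightarrow> U z"
  "!!z. \<exists>D. (U has_derivative D) (at z) \<and> D (ii e1) = \<i> * D e1 \<and> D (ii e2) = \<i> * D e2"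
proof -
 define \<Phi> where "\<Phi> k z e = conv (Dd e (eta r)) (tfun (mulop ex (u k))) z" for k z e
 have linm: "mulop ex (x - y) = mulop ex x - mulop ex y" for x y by (rule linear_diff[OF linear_mulop[OF smooth_ex]])
 have convdiff: "conv k (tfun (mulop ex (x - y))) z = conv k (tfun (mulop ex x)) z - conv k (tfun (mulop ex y)) z"
  if "smooth k" "vanish s k" for k s x y z
  using conv_tf_lin[OF that, of "-1" "mulop ex y" "mulop ex x" z] by (simp add: linm)
 have der: "(Ev r (u k) has_derivative \<Phi> k z) (at z)" for k z
  unfolding Ev_def \<Phi>_def[abs_def] by (rule conv_has_derivative[OF smooth_eta vanish_eta[OF r] lbm_tfun])
 obtain B where B: "B >= 0" "!!e z. cmod (Dd e (eta r) z) <= B * norm e"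
  using smooth_Dd_bounded[OF smooth_eta vanish_eta[OF r]] by metis
 obtain B0 where B0: "B0 >= 0" "!!z. cmod (eta r z) <= B0"
  using vanish_lbm_bound[OF smooth_eta vanish_eta[OF r]] by metis
 have bnd: "\<exists>C\<ge>0. \<forall>z\<in>ball 0 R. (\<forall>e v. cmod (conv (Dd e (eta r)) (tfun (mulop ex v)) z) <= C * norm e * norm v)
   \<and> (\<forall>v. cmod (conv (eta r) (tfun (mulop ex v)) z) <= C * norm v)" for R
 proof -
  obtain S where S: "!!w. norm w <= R + 2 * r ==> cmod (ex w) <= S"
   using lbm_smooth[OF smooth_ex] by (metis lbm_def)
  define S' where "S' = \<bar>S\<bar>"
  have S': "S' >= 0" "!!w. norm w <= R + 2 * r ==> exp (p w / 2) <= S'"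
  proof -
   fix w :: c2 assume "norm w <= R + 2 * r"
   then show "exp (p w / 2) <= S'" using S[of w] by (simp add: ex_def S'_def)
  qed (simp add: S'_def)
  define W where "W = sqrt (measure lborel (cball (0::c2) (2 * r)))"
  define C where "C = S' * ((B + B0) * W)"
  have W: "W >= 0" "sqrt (measure lborel (cball (0::c2) r)) <= W"
   unfolding W_def using r emeasure_bounded_finite[of "cball (0::c2) (2 * r)"] by (auto intro!: measure_mono_fmeasurable simp: fmeasurable_def)
  have C: "C >= 0" using S' B B0 W by (simp add: C_def)
  have near: "exp (p w / 2) <= S'" if "norm (w - z) < 2 * r" "z \<in> ball 0 R" for w z
   using S'(2)[of w] that norm_triangle_sub[of w z] by simp
  have 1: "cmod (conv (Dd e (eta r)) (tfun (mulop ex v)) z) <= C * norm e * norm v" if z: "z \<in> ball 0 R" for z e v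
  proof -
   have vd: "vanish (2 * r) (Dd e (eta r))" using vanish_Dd[OF vanish_eta[OF r] r, of e] by simp
   have "cmod (conv (Dd e (eta r)) (tfun (mulop ex v)) z) <= S' * (B * norm e * W) * norm v"
    unfolding W_def by (rule conv_ex_bound[OF smooth_Dd[OF smooth_eta] vd _ B(2)]) (use r B S' near[OF _ z] in auto)
   also have "S' * (B * norm e * W) <= C * norm e"
    using S'(1) B(1) B0(1) W(1) by (simp add: C_def algebra_simps)
   finally show ?thesis by (simp add: mult_right_mono)
  qed
  have 2: "cmod (conv (eta r) (tfun (mulop ex v)) z) <= C * norm v" if z: "z \<in> ball 0 R" for z v
  proof -
   have "cmod (conv (eta r) (tfun (mulop ex v)) z) <= S' * (B0 * sqrt (measure lborel (cball (0::c2) r))) * norm v"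
    by (rule conv_ex_bound[OF smooth_eta vanish_eta[OF r] r B0(2)]) (use r B0 S' near[OF _ z] in auto)
   also have "S' * (B0 * sqrt (measure lborel (cball (0::c2) r))) <= C"
    unfolding C_def using S'(1) B(1) B0(1) W by (intro mult_left_mono mult_mono) auto
   finally show ?thesis by (simp add: mult_right_mono)
  qed
  show ?thesis using C 1 2 by (intro exI[of _ C]) auto
 qed
 have close: "\<exists>N. \<forall>k\<ge>N. \<forall>l\<ge>N. norm (u k - u l) < \<epsilon>" if "\<epsilon> > 0" for \<epsilon>
  using cu that unfolding Cauchy_def dist_norm by blast
 have conv: "convergent (%k. \<Phi> k z e)" "convergent (%k. Ev r (u k) z)" for z e
 proof -
  obtain C where C: "C >= 0" "!!e v. cmod (conv (Dd e (eta r)) (tfun (mulop ex v)) z) <= C * norm e * norm v"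
   "!!v. cmod (conv (eta r) (tfun (mulop ex v)) z) <= C * norm v"
   using bnd[of "norm z + 1"] by force
  have "Cauchy (%k. x k)" if x: "!!k l. cmod (x k - x l) <= C' * norm (u k - u l)" and C': "C' >= 0" for x C'
  proof (rule metric_CauchyI)
   fix \<epsilon> :: real assume e: "\<epsilon> > 0"
   obtain N where N: "!!k l. k >= N ==> l >= N ==> norm (u k - u l) < \<epsilon> / (C' + 1)"
    using close[of "\<epsilon> / (C' + 1)"] e C' by auto
   have "dist (x k) (x l) < \<epsilon>" if "k >= N" "l >= N" for k l
   proof -
    have "C' * norm (u k - u l) <= C' * (\<epsilon> / (C' + 1))" using N[OF that] C' by (intro mult_left_mono) auto
    also have "... < \<epsilon>" using e C' by (simp add: field_simps)
    finally show ?thesis using x[of k l] by (simp add: dist_norm)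
   qed
   then show "\<exists>N. \<forall>k\<ge>N. \<forall>l\<ge>N. dist (x k) (x l) < \<epsilon>" by blast
  qed note cau = this
  have vD: "vanish (r + r) (Dd e (eta r))" by (rule vanish_Dd[OF vanish_eta[OF r] r])
  have "Cauchy (%k. \<Phi> k z e)"
  proof (rule cau[of _ "C * norm e"])
   show "cmod (\<Phi> k z e - \<Phi> l z e) <= C * norm e * norm (u k - u l)" for k l
    unfolding \<Phi>_def convdiff[OF smooth_Dd[OF smooth_eta] vD, symmetric] by (rule C(2))
  qed (use C(1) in simp)
  then show "convergent (%k. \<Phi> k z e)" by (simp add: Cauchy_convergent_iff)
  have "Cauchy (%k. Ev r (u k) z)"
  proof (rule cau[of _ C])
   show "cmod (Ev r (u k) z - Ev r (u l) z) <= C * norm (u k - u l)" for k l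
    unfolding Ev_def convdiff[OF smooth_eta vanish_eta[OF r], symmetric] by (rule C(3))
  qed (use C(1) in simp)
  then show "convergent (%k. Ev r (u k) z)" by (simp add: Cauchy_convergent_iff)
 qed
 define U where "U z = Topological_Spaces.lim (%k. Ev r (u k) z)" for z
 define g' where "g' z e = Topological_Spaces.lim (%k. \<Phi> k z e)" for z e
 have limU: "(%k. Ev r (u k) z) \<longlonglongrightarrow> U z" for z
  unfolding U_def using conv(2) by (simp add: convergent_LIMSEQ_iff)
 have limg: "(%k. \<Phi> k z e) \<longlonglongrightarrow> g' z e" for z e
  unfolding g'_def using conv(1) by (simp add: convergent_LIMSEQ_iff)
 have derU: "(U has_derivative g' z) (at z)" for z
 proof -
  define R where "R = norm z + 1"
  obtain C where C: "C >= 0"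
   "!!z e v. z \<in> ball 0 R ==> cmod (conv (Dd e (eta r)) (tfun (mulop ex v)) z) <= C * norm e * norm v"
   using bnd[of R] by blast
  have "\<exists>g. \<forall>x\<in>ball 0 R. (%n. Ev r (u n) x) \<longlonglongrightarrow> g x \<and> (g has_derivative g' x) (at x within ball 0 R)"
  proof (rule has_derivative_sequence)
   show "convex (ball (0::c2) R)" by simp
   show "(0::c2) \<in> ball 0 R" by (simp add: R_def add_nonneg_pos)
   show "(%n. Ev r (u n) 0) \<longlonglongrightarrow> U 0" by (rule limU)
   show "(Ev r (u k) has_derivative \<Phi> k x) (at x within ball 0 R)" for k x by (rule has_derivative_at_withinI[OF der])
   fix \<epsilon> :: real assume e: "\<epsilon> > 0"
   obtain N where N: "!!k l. k >= N ==> l >= N ==> norm (u k - u l) < \<epsilon> / (C + 1)"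
    using close[of "\<epsilon> / (C + 1)"] e C(1) by auto
   have "cmod (\<Phi> k x h - g' x h) <= \<epsilon> * norm h" if k: "k >= N" and x: "x \<in> ball 0 R" for k x h
   proof -
    have vD: "vanish (r + r) (Dd h (eta r))" by (rule vanish_Dd[OF vanish_eta[OF r] r])
    have "cmod (\<Phi> k x h - \<Phi> l x h) <= \<epsilon> * norm h" if l: "l >= N" for l
    proof -
     have "cmod (\<Phi> k x h - \<Phi> l x h) <= C * norm h * norm (u k - u l)"
      using C(2)[OF x, of h "u k - u l"] convdiff[OF smooth_Dd[OF smooth_eta] vD] by (simp add: \<Phi>_def)
     also have "... <= C * norm h * (\<epsilon> / (C + 1))" using N[OF k l] C by (intro mult_left_mono) auto
     also have "... = (C / (C + 1)) * (\<epsilon> * norm h)" by simp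
     also have "... <= 1 * (\<epsilon> * norm h)" using C e by (intro mult_right_mono) (auto simp: divide_le_eq)
     finally show ?thesis by simp
    qed
    moreover have "(%l. cmod (\<Phi> k x h - \<Phi> l x h)) \<longlonglongrightarrow> cmod (\<Phi> k x h - g' x h)" by (intro tendsto_intros limg)
    ultimately show ?thesis by (intro LIMSEQ_le_const2[of _ "cmod (\<Phi> k x h - g' x h)"]) auto
   qed
   then show "\<forall>\<^sub>F n in sequentially. \<forall>x\<in>ball 0 R. \<forall>h. cmod (\<Phi> n x h - g' x h) <= \<epsilon> * norm h"
    by (auto simp: eventually_sequentially simp del: split_paired_All intro!: exI[of _ N])
  qed
  then obtain g where g: "!!x. x \<in> ball 0 R ==> (%n. Ev r (u n) x) \<longlonglongrightarrow> g x"
   "!!x. x \<in> ball 0 R ==> (g has_derivative g' x) (at x within ball 0 R)" by blast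
  have z: "z \<in> ball 0 R" by (simp add: R_def)
  have "(g has_derivative g' z) (at z)" using g(2)[OF z] z by (simp add: at_within_open[OF z open_ball])
  moreover have "g x = U x" if "x \<in> ball 0 R" for x using LIMSEQ_unique[OF g(1)[OF that] limU] .
  ultimately show ?thesis by (rule has_derivative_transform_within_open[OF _ open_ball z]) 
 qed
 have CR: "g' z (ii e) = \<i> * g' z e" if l: "!!\<beta>. (%k. u k \<bullet> opB e \<beta>) \<longlonglongrightarrow> 0" for z e
 proof -
  have "conv (dzb e (eta r)) (tfun (mulop ex v)) z = (conv (Dd e (eta r)) (tfun (mulop ex v)) z
    + \<i> * conv (Dd (ii e) (eta r)) (tfun (mulop ex v)) z) / 2" for v
   using dz_conv(2)[OF smooth_eta vanish_eta[OF r] lbm_tfun, of e "mulop ex v"]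
   by (metis (no_types, lifting) Dd_conv[OF smooth_eta vanish_eta[OF r] lbm_tfun] dzb_def)
  then have "(%k. (\<Phi> k z e + \<i> * \<Phi> k z (ii e)) / 2) \<longlonglongrightarrow> 0"
   using conv_dzb_tendsto[OF r l, of z] unfolding \<Phi>_def by (simp only:)
  moreover have "(%k. (\<Phi> k z e + \<i> * \<Phi> k z (ii e)) / 2) \<longlonglongrightarrow> (g' z e + \<i> * g' z (ii e)) / 2"
   by (intro tendsto_intros limg) simp
  ultimately have "0 = (g' z e + \<i> * g' z (ii e)) / 2" by (rule LIMSEQ_unique)
  then have "\<i> * (g' z e + \<i> * g' z (ii e)) = 0" by simp
  then show ?thesis by (simp add: algebra_simps)
 qed
 have B0': "opB e 0 = 0" for e by (rule linear_0[OF linear_opB])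
 have l1: "(%k. u k \<bullet> opB e1 \<beta>) \<longlonglongrightarrow> 0" for \<beta> using lim[of \<beta> 0] by (simp add: B0')
 have l2: "(%k. u k \<bullet> opB e2 \<beta>) \<longlonglongrightarrow> 0" for \<beta> using lim[of 0 \<beta>] by (simp add: B0')
 show thesis using that[OF limU] derU CR[OF l1] CR[OF l2] by blast
qed

end

section \<open>Entire functions of polynomial growth\<close>

lemma lagrange_poly:
 fixes q :: "complex poly"
 assumes "degree q <= N"
 shows "q = (\<Sum>i\<le>N. smult (poly q (of_nat i)) (smult (inverse (\<Prod>m\<in>{..N}-{i}. of_nat i - of_nat m)) (\<Prod>m\<in>{..N}-{i}. [:- of_nat m, 1:])))"
proof -
 define l where "l i = (smult (inverse (\<Prod>m\<in>{..N}-{i}. of_nat i - of_nat m)) (\<Prod>m\<in>{..N}-{i}. [:- of_nat m, 1:]) :: complex poly)" for i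
 have card: "card (of_nat ` {..N} :: complex set) = Suc N" by (simp add: card_image inj_on_def)
 have deg: "degree (l i) <= N" if "i <= N" for i
 proof -
  have "degree (\<Prod>m\<in>{..N}-{i}. [:- of_nat m, 1:] :: complex poly) <= (\<Sum>m\<in>{..N}-{i}. 1)"
   by (rule order_trans[OF degree_prod_sum_le]) (auto intro: sum_mono)
  also have "... = N" using that by simp
  finally show ?thesis unfolding l_def by (rule order_trans[OF degree_smult_le])
 qed
 have "degree (\<Sum>i\<le>N. smult (poly q (of_nat i)) (l i)) <= N" by (rule degree_sum_le) (auto intro: deg)
 moreover have "poly q x = poly (\<Sum>i\<le>N. smult (poly q (of_nat i)) (l i)) x" if "x \<in> of_nat ` {..N}" for x
 proof -
  obtain n where n: "n <= N" "x = of_nat n" using \<open>x \<in> of_nat ` {..N}\<close> by auto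
  have "poly (l i) x = (if i = n then 1 else 0)" if "i <= N" for i
   using n by (cases "i = n") (auto simp: l_def poly_prod)
  then have "poly (\<Sum>i\<le>N. smult (poly q (of_nat i)) (l i)) x = (\<Sum>i\<le>N. if i = n then poly q (of_nat i) else 0)"
   unfolding poly_sum by (intro sum.cong) auto
  also have "... = poly q x" using n by simp
  finally show ?thesis by simp
 qed
 ultimately have "q = (\<Sum>i\<le>N. smult (poly q (of_nat i)) (l i))"
  using assms card by (intro poly_eqI_degree[of "of_nat ` {..N}"]) auto
 then show ?thesis unfolding l_def .
qed

text \<open>Liouville's theorem in \<open>y\<close> leaves coefficients that are unknown functions
  of \<open>x\<close>. Lagrange interpolation at the nodes 0, ..., N makes the dependence on
  \<open>x\<close> explicit: only the finitely many polynomials y -> \<open>U (of_nat i, y)\<close>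
  enter.\<close>

lemma separate_poly:
 fixes U :: "c2 => complex"
 assumes h1: "!!y. (%x. U (x, y)) holomorphic_on UNIV" and h2: "!!x. (%y. U (x, y)) holomorphic_on UNIV"
  and g: "!!x y. cmod (U (x, y)) <= C * (1 + cmod x) ^ N * (1 + cmod y) ^ N"
 obtains c where "!!x y. U (x, y) = (\<Sum>j\<le>N. \<Sum>k\<le>N. c j k * x ^ j * y ^ k)"
proof -
 have ub: "C * (1 + cmod x) ^ N * D ^ N <= (C * D ^ N * 2 ^ N) * cmod x ^ N" if "cmod x >= 1" "C * D ^ N >= 0" for x D
 proof -
  have "(C * D ^ N) * (1 + cmod x) ^ N <= (C * D ^ N) * (2 * cmod x) ^ N"
   using that by (intro mult_left_mono power_mono) auto
  then show ?thesis by (simp add: power_mult_distrib mult_ac)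
 qed
 have C: "C * (1 + cmod y) ^ N >= 0" for y
  using order_trans[OF norm_ge_zero g[of 0 y]] by simp
 have p1: "U (x, y) = (\<Sum>k\<le>N. (deriv ^^ k) (%x. U (x, y)) 0 / fact k * x ^ k)" for x y
 proof (rule Liouville_polynomial[OF h1, where A=1 and B="C * (1 + cmod y) ^ N * 2 ^ N"])
  show "cmod (U (x, y)) <= C * (1 + cmod y) ^ N * 2 ^ N * cmod x ^ N" if "1 <= cmod x" for x by (rule order_trans[OF g ub[OF that C]])
 qed
 have p2: "U (x, y) = (\<Sum>k\<le>N. (deriv ^^ k) (%y. U (x, y)) 0 / fact k * y ^ k)" for x y
 proof (rule Liouville_polynomial[OF h2, where A=1 and B="C * (1 + cmod x) ^ N * 2 ^ N"])
  show "cmod (U (x, y)) <= C * (1 + cmod x) ^ N * 2 ^ N * cmod y ^ N" if "1 <= cmod y" for y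
  proof -
   have "C * (1 + cmod x) ^ N * (1 + cmod y) ^ N = C * (1 + cmod y) ^ N * (1 + cmod x) ^ N" by (simp add: mult_ac)
   then show ?thesis using g[of x y] ub[OF that C[of x]] by linarith
  qed
 qed
 define d where "d k x = (deriv ^^ k) (%y. U (x, y)) 0 / fact k" for k x
 define l where "l i = (smult (inverse (\<Prod>m\<in>{..N}-{i}. of_nat i - of_nat m)) (\<Prod>m\<in>{..N}-{i}. [:- of_nat m, 1:]) :: complex poly)" for i
 have U: "U (x, y) = (\<Sum>i\<le>N. U (of_nat i, y) * poly (l i) x)" for x y
 proof -
  define q where "q = (\<Sum>k\<le>N. monom ((deriv ^^ k) (%x. U (x, y)) 0 / fact k) k)"
  have q: "poly q x = U (x, y)" for x unfolding q_def poly_sum poly_monom using p1[of x y] by simp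
  have "degree q <= N" unfolding q_def by (intro degree_sum_le) (auto intro: order_trans[OF degree_monom_le])
  then have "poly q x = poly (\<Sum>i\<le>N. smult (poly q (of_nat i)) (l i)) x" unfolding l_def by (subst (1) lagrange_poly) auto
  then show ?thesis by (simp add: q poly_sum)
 qed
 have degl: "degree (l i) <= N" if "i <= N" for i
 proof -
  have "degree (\<Prod>m\<in>{..N}-{i}. [:- of_nat m, 1:] :: complex poly) <= (\<Sum>m\<in>{..N}-{i}. 1)"
   by (rule order_trans[OF degree_prod_sum_le]) (auto intro: sum_mono)
  also have "... = N" using that by simp
  finally show ?thesis unfolding l_def by (rule order_trans[OF degree_smult_le])
 qed
 have lx: "poly (l i) x = (\<Sum>j\<le>N. coeff (l i) j * x ^ j)" if "i <= N" for i x
  unfolding poly_altdef by (rule sum.mono_neutral_left) (use degl[OF that] in \<open>auto simp: coeff_eq_0\<close>)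
 define c where "c j k = (\<Sum>i\<le>N. d k (of_nat i) * coeff (l i) j)" for j k
 have "U (x, y) = (\<Sum>j\<le>N. \<Sum>k\<le>N. c j k * x ^ j * y ^ k)" for x y
 proof -
  have "U (x, y) = (\<Sum>i\<le>N. (\<Sum>k\<le>N. d k (of_nat i) * y ^ k) * (\<Sum>j\<le>N. coeff (l i) j * x ^ j))"
   unfolding U[of x y] using p2[of _ y] lx by (intro sum.cong) (auto simp: d_def)
  also have "... = (\<Sum>i\<le>N. \<Sum>j\<le>N. \<Sum>k\<le>N. d k (of_nat i) * coeff (l i) j * x ^ j * y ^ k)"
   by (intro sum.cong refl) (subst sum_product, subst sum.swap, simp add: mult_ac)
  also have "... = (\<Sum>j\<le>N. \<Sum>i\<le>N. \<Sum>k\<le>N. d k (of_nat i) * coeff (l i) j * x ^ j * y ^ k)" by (rule sum.swap)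
  also have "... = (\<Sum>j\<le>N. \<Sum>k\<le>N. \<Sum>i\<le>N. d k (of_nat i) * coeff (l i) j * x ^ j * y ^ k)" by (intro sum.cong refl sum.swap)
  also have "... = (\<Sum>j\<le>N. \<Sum>k\<le>N. c j k * x ^ j * y ^ k)" by (simp add: c_def sum_distrib_right)
  finally show ?thesis .
 qed
 then show thesis using that by blast
qed

text \<open>Along t -> (t^a x, t^b y) the coefficient of t^e is the weighted homogeneous part
  \<open>F e x y\<close>. The growth bound kills it for \<open>e > d\<close> and all
  \<open>x\<close>, \<open>y\<close>; comparing coefficients first in \<open>x\<close> and then in
  \<open>y\<close> kills each \<open>c j k\<close> of that weight.\<close>

lemma poly_in_PolyC:
 fixes U :: "c2 => complex"
 assumes ab: "0 < a" "0 < b"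
  and U: "!!x y. U (x, y) = (\<Sum>j\<le>N. \<Sum>k\<le>N. c j k * x ^ j * y ^ k)"
  and g: "!!x y. \<exists>C. \<forall>t. 1 <= cmod t \<longrightarrow> cmod (U (t ^ a * x, t ^ b * y)) <= C * cmod t ^ (n * a * b)"
 shows "U \<in> PolyC a b n"
proof -
 define d where "d = n * a * b"
 define M where "M = d + a * N + b * N"
 define F where "F e x y = (\<Sum>j\<le>N. \<Sum>k\<le>N. if a * j + b * k = e then c j k * x ^ j * y ^ k else 0)" for e x y
 have UF: "U (t ^ a * x, t ^ b * y) = (\<Sum>e\<le>M. F e x y * t ^ e)" for t x y
 proof -
  have "(\<Sum>e\<le>M. F e x y * t ^ e) = (\<Sum>e\<le>M. \<Sum>j\<le>N. \<Sum>k\<le>N. if a * j + b * k = e then c j k * x ^ j * y ^ k * t ^ e else 0)"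
   unfolding F_def sum_distrib_right by (intro sum.cong refl) simp
  also have "... = (\<Sum>j\<le>N. \<Sum>e\<le>M. \<Sum>k\<le>N. if a * j + b * k = e then c j k * x ^ j * y ^ k * t ^ e else 0)" by (rule sum.swap)
  also have "... = (\<Sum>j\<le>N. \<Sum>k\<le>N. \<Sum>e\<le>M. if a * j + b * k = e then c j k * x ^ j * y ^ k * t ^ e else 0)"
   by (intro sum.cong refl sum.swap)
  also have "... = (\<Sum>j\<le>N. \<Sum>k\<le>N. c j k * x ^ j * y ^ k * t ^ (a * j + b * k))"
  proof (intro sum.cong refl)
   fix j k assume "j \<in> {..N}" "k \<in> {..N}"
   then have "a * j + b * k <= M" unfolding M_def by (simp add: add_mono trans_le_add2)
   then show "(\<Sum>e\<le>M. if a * j + b * k = e then c j k * x ^ j * y ^ k * t ^ e else 0) = c j k * x ^ j * y ^ k * t ^ (a * j + b * k)" by simp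
  qed
  also have "... = U (t ^ a * x, t ^ b * y)"
   unfolding U by (intro sum.cong refl) (simp add: power_mult_distrib power_add power_mult[symmetric] mult_ac)
  finally show ?thesis by simp
 qed
 have F0: "F e x y = 0" if e: "e > d" "e <= M" for e x y
 proof -
  obtain C where C: "!!t. 1 <= cmod t ==> cmod (U (t ^ a * x, t ^ b * y)) <= C * cmod t ^ d"
   using g[of x y] by (auto simp: d_def)
  define f where "f t = (\<Sum>e\<le>M. F e x y * t ^ e)" for t
  have "f t = (\<Sum>k\<le>d. (deriv ^^ k) f 0 / fact k * t ^ k)" for t
  proof (rule Liouville_polynomial[where A=1 and B=C])
   show "f holomorphic_on UNIV" unfolding f_def by (intro holomorphic_intros)
   show "cmod (f z) <= C * cmod z ^ d" if "1 <= cmod z" for z using C[OF that] by (simp add: UF f_def)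
  qed
  moreover have "(\<Sum>k\<le>d. (deriv ^^ k) f 0 / fact k * t ^ k) = (\<Sum>k\<le>M. (if k <= d then (deriv ^^ k) f 0 / fact k else 0) * t ^ k)" for t
   by (rule sum.mono_neutral_cong_left) (auto simp: M_def)
  ultimately have "\<forall>t. (\<Sum>e\<le>M. F e x y * t ^ e) = (\<Sum>k\<le>M. (if k <= d then (deriv ^^ k) f 0 / fact k else 0) * t ^ k)"
   by (simp add: f_def)
  then have "\<forall>i\<le>M. F i x y = (if i <= d then (deriv ^^ i) f 0 / fact i else 0)" by (simp only: polyfun_eq_coeffs)
  then show ?thesis using e by auto
 qed
 have c0: "c j k = 0" if jk: "j <= N" "k <= N" "a * j + b * k > d" for j k
 proof -
  define e where "e = a * j + b * k"
  have eM: "e <= M" using jk unfolding e_def M_def by (simp add: add_mono trans_le_add2)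
  have "\<forall>x. (\<Sum>i\<le>N. (\<Sum>k\<le>N. (if a * i + b * k = e then c i k else 0) * y ^ k) * x ^ i) = 0" for y
  proof
   fix x
   have "(\<Sum>i\<le>N. (\<Sum>k\<le>N. (if a * i + b * k = e then c i k else 0) * y ^ k) * x ^ i) = F e x y"
    unfolding F_def sum_distrib_right by (intro sum.cong refl) simp
   then show "(\<Sum>i\<le>N. (\<Sum>k\<le>N. (if a * i + b * k = e then c i k else 0) * y ^ k) * x ^ i) = 0"
    using F0[of e x y] jk eM by (simp add: e_def)
  qed
  then have "\<forall>i\<le>N. (\<Sum>k\<le>N. (if a * i + b * k = e then c i k else 0) * y ^ k) = 0" for y
   using polyfun_eq_0[of "%i. \<Sum>k\<le>N. (if a * i + b * k = e then c i k else 0) * y ^ k" N] by blast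
  then have "\<forall>y. (\<Sum>k\<le>N. (if a * j + b * k = e then c j k else 0) * y ^ k) = 0"
   using jk(1) by blast
  then have "\<forall>k\<le>N. (if a * j + b * k = e then c j k else 0) = 0"
   using polyfun_eq_0[of "%k. if a * j + b * k = e then c j k else 0" N] by blast
  then show ?thesis using jk(2) by (auto simp: e_def)
 qed
 define c' where "c' j k = (if j <= N \<and> k <= N then c j k else 0)" for j k
 have c': "c' j k = 0" if "a * j + b * k > n * a * b" for j k
  using c0[of j k] that by (auto simp: c'_def d_def)
 have big: "c' j k = 0" if "j > n * b \<or> k > n * a" for j k
 proof -
  have "a * j + b * k > n * a * b"
   using that
  proof
   assume "j > n * b"
   then have "a * j > a * (n * b)" using ab by simp
   then show ?thesis by (simp add: mult_ac trans_less_add1)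
  next
   assume "k > n * a"
   then have "b * k > b * (n * a)" using ab by simp
   then show ?thesis by (simp add: mult_ac trans_less_add2)
  qed
  then show ?thesis by (rule c')
 qed
 have "U z = (\<Sum>j\<le>n * b. \<Sum>k\<le>n * a. c' j k * fst z ^ j * snd z ^ k)" for z
 proof -
  define T where "T = N + n * a + n * b"
  have ext: "(\<Sum>j\<le>P. \<Sum>k\<le>Q. c' j k * x ^ j * y ^ k) = (\<Sum>j\<le>T. \<Sum>k\<le>T. c' j k * x ^ j * y ^ k)"
   if PQ: "P <= T" "Q <= T" and z: "!!j k. j > P \<or> k > Q ==> c' j k = 0" for P Q x y
  proof -
   have "(\<Sum>k\<le>Q. c' j k * x ^ j * y ^ k) = (\<Sum>k\<le>T. c' j k * x ^ j * y ^ k)" for j by (rule sum.mono_neutral_left) (use PQ z in auto)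
   then have "(\<Sum>j\<le>P. \<Sum>k\<le>Q. c' j k * x ^ j * y ^ k) = (\<Sum>j\<le>P. \<Sum>k\<le>T. c' j k * x ^ j * y ^ k)" by simp
   also have "... = (\<Sum>j\<le>T. \<Sum>k\<le>T. c' j k * x ^ j * y ^ k)" by (rule sum.mono_neutral_left) (use PQ z in auto)
   finally show ?thesis .
  qed
  have "U z = (\<Sum>j\<le>N. \<Sum>k\<le>N. c' j k * fst z ^ j * snd z ^ k)"
   using U[of "fst z" "snd z"] by (simp add: c'_def)
  also have "... = (\<Sum>j\<le>T. \<Sum>k\<le>T. c' j k * fst z ^ j * snd z ^ k)" by (rule ext) (auto simp: T_def c'_def)
  also have "... = (\<Sum>j\<le>n * b. \<Sum>k\<le>n * a. c' j k * fst z ^ j * snd z ^ k)"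
   by (rule ext[symmetric]) (use big in \<open>auto simp: T_def\<close>)
  finally show ?thesis .
 qed
 then show ?thesis unfolding PolyC_def using c' by blast
qed

section \<open>Rotation invariance of Lebesgue measure\<close>

lemma lborel_complex: "distr (lborel \<Otimes>\<^sub>M lborel) borel (%p. Complex (fst p) (snd p)) = (lborel :: complex measure)"
proof (rule lborel_eqI[symmetric])
 have C: "Complex (fst p) (snd p) = complex_of_real (fst p) + \<i> * complex_of_real (snd p)" for p by (rule complex_eqI) auto
 have meas: "(%p. Complex (fst p) (snd p)) \<in> (lborel \<Otimes>\<^sub>M lborel) \<rightarrow>\<^sub>M borel"
  unfolding C by measurable
 fix l u :: complex assume le: "!!b. b \<in> Basis ==> l \<bullet> b <= u \<bullet> b"
 have lu: "Re l <= Re u" "Im l <= Im u" using le[of 1] le[of \<i>] by (auto simp: Basis_complex_def)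
 have "(%p. Complex (fst p) (snd p)) -` box l u \<inter> space (lborel \<Otimes>\<^sub>M lborel) = {Re l<..<Re u} \<times> {Im l<..<Im u}"
  by (auto simp: in_box_complex_iff space_pair_measure)
 then have "emeasure (distr (lborel \<Otimes>\<^sub>M lborel) borel (%p. Complex (fst p) (snd p))) (box l u)
  = emeasure (lborel \<Otimes>\<^sub>M lborel) ({Re l<..<Re u} \<times> {Im l<..<Im u})" by (subst emeasure_distr[OF meas]) auto
 also have "... = ennreal (Re u - Re l) * ennreal (Im u - Im l)"
  using lu by (subst lborel.emeasure_pair_measure_Times) auto
 also have "... = ennreal (\<Prod>b\<in>Basis. (u - l) \<bullet> b)"
  using lu by (simp add: Basis_complex_def ennreal_mult[symmetric])
 finally show "emeasure (distr (lborel \<Otimes>\<^sub>M lborel) borel (%p. Complex (fst p) (snd p))) (box l u) = ennreal (\<Prod>b\<in>Basis. (u - l) \<bullet> b)" .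
qed simp

lemma measurable_Complex2 [measurable]: "(%p. Complex (fst p) (snd p)) \<in> borel_measurable (borel \<Otimes>\<^sub>M borel)"
proof -
 have C: "Complex (fst p) (snd p) = complex_of_real (fst p) + \<i> * complex_of_real (snd p)" for p by (rule complex_eqI) auto
 show ?thesis unfolding C by measurable
qed

lemma measurable_Complex [measurable (raw)]:
 assumes [measurable]: "f \<in> borel_measurable M" "g \<in> borel_measurable M"
 shows "(%x. Complex (f x) (g x)) \<in> borel_measurable M"
proof -
 have C: "Complex (f x) (g x) = complex_of_real (f x) + \<i> * complex_of_real (g x)" for x by (rule complex_eqI) auto
 show ?thesis unfolding C by measurable
qed

lemma nn_integral_complex:
 assumes [measurable]: "g \<in> borel_measurable borel"
 shows "(\<integral>\<^sup>+z. g z \<partial>lborel) = (\<integral>\<^sup>+x. \<integral>\<^sup>+y. g (Complex x y) \<partial>lborel \<partial>lborel)"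
proof -
 have "(\<integral>\<^sup>+z. g z \<partial>lborel) = (\<integral>\<^sup>+p. g (Complex (fst p) (snd p)) \<partial>(lborel \<Otimes>\<^sub>M lborel))"
  by (subst lborel_complex[symmetric], subst nn_integral_distr) auto
 also have "... = (\<integral>\<^sup>+x. \<integral>\<^sup>+y. g (Complex x y) \<partial>lborel \<partial>lborel)"
  by (subst lborel.nn_integral_fst[symmetric]) auto
 finally show ?thesis .
qed

lemma nn_shear_y:
 assumes [measurable]: "g \<in> borel_measurable borel"
 shows "(\<integral>\<^sup>+z. g (Complex (Re z) (Im z + s * Re z)) \<partial>lborel) = (\<integral>\<^sup>+z. g z \<partial>lborel)"
proof -
 have "(\<integral>\<^sup>+z. g (Complex (Re z) (Im z + s * Re z)) \<partial>lborel) = (\<integral>\<^sup>+x. \<integral>\<^sup>+y. g (Complex x (y + s * x)) \<partial>lborel \<partial>lborel)"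
  by (subst nn_integral_complex) auto
 also have "... = (\<integral>\<^sup>+x. \<integral>\<^sup>+y. g (Complex x y) \<partial>lborel \<partial>lborel)"
 proof (rule nn_integral_cong)
  fix x :: real
  show "(\<integral>\<^sup>+y. g (Complex x (y + s * x)) \<partial>lborel) = (\<integral>\<^sup>+y. g (Complex x y) \<partial>lborel)"
   using nn_integral_real_affine[of "%y. g (Complex x y)" 1 "s * x"] by (simp add: add.commute)
 qed
 finally show ?thesis by (simp add: nn_integral_complex)
qed

lemma nn_shear_x:
 assumes [measurable]: "g \<in> borel_measurable borel"
 shows "(\<integral>\<^sup>+z. g (Complex (Re z + s * Im z) (Im z)) \<partial>lborel) = (\<integral>\<^sup>+z. g z \<partial>lborel)"
proof -
 have "(\<integral>\<^sup>+z. g (Complex (Re z + s * Im z) (Im z)) \<partial>lborel) = (\<integral>\<^sup>+x. \<integral>\<^sup>+y. g (Complex (x + s * y) y) \<partial>lborel \<partial>lborel)"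
  by (subst nn_integral_complex) auto
 also have "... = (\<integral>\<^sup>+y. \<integral>\<^sup>+x. g (Complex (x + s * y) y) \<partial>lborel \<partial>lborel)"
  using lborel_pair.Fubini'[of "%x y. g (Complex (x + s * y) y)"] by (simp add: split_beta)
 also have "... = (\<integral>\<^sup>+y. \<integral>\<^sup>+x. g (Complex x y) \<partial>lborel \<partial>lborel)"
 proof (rule nn_integral_cong)
  fix y :: real
  show "(\<integral>\<^sup>+x. g (Complex (x + s * y) y) \<partial>lborel) = (\<integral>\<^sup>+x. g (Complex x y) \<partial>lborel)"
   using nn_integral_real_affine[of "%x. g (Complex x y)" 1 "s * y"] by (simp add: add.commute)
 qed
 also have "... = (\<integral>\<^sup>+x. \<integral>\<^sup>+y. g (Complex x y) \<partial>lborel \<partial>lborel)"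
  using lborel_pair.Fubini'[of "%x y. g (Complex x y)"] by (simp add: split_beta)
 finally show ?thesis by (simp add: nn_integral_complex)
qed

text \<open>A rotation other than \<open>-1\<close> is a product of three shears.\<close>

lemma nn_rotation_aux:
 assumes [measurable]: "g \<in> borel_measurable borel" and c: "cmod c = 1" "c ~= -1"
 shows "(\<integral>\<^sup>+z. g (c * z) \<partial>lborel) = (\<integral>\<^sup>+z. g z \<partial>lborel)"
proof -
 define p q where "p = Re c" and "q = Im c"
 have pq: "p^2 + q^2 = 1" using c(1) by (simp add: p_def q_def cmod_power2[symmetric])
 have p: "1 + p ~= 0"
 proof
  assume "1 + p = 0"
  then have "p = -1" by simp
  with pq have "q = 0" by simp
  with \<open>p = -1\<close> have "c = -1" by (simp add: complex_eq_iff p_def q_def)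
  with c(2) show False by simp
 qed
 define \<tau> where "\<tau> = q / (1 + p)"
 have t1: "1 - \<tau> * q = p"
  using p pq by (simp add: \<tau>_def field_simps power2_eq_square)
 have t2: "\<tau> * (1 + p) = q" using p by (simp add: \<tau>_def)
 define S1 where "S1 z = Complex (Re z + (- \<tau>) * Im z) (Im z)" for z
 define S2 where "S2 z = Complex (Re z) (Im z + q * Re z)" for z
 have [measurable]: "S1 \<in> borel_measurable borel" "S2 \<in> borel_measurable borel"
  unfolding S1_def[abs_def] S2_def[abs_def] by measurable
 have "S1 (S2 (S1 z)) = c * z" for z
 proof (rule complex_eqI)
  have "Re (S1 (S2 (S1 z))) = Re z * (1 - \<tau> * q) - \<tau> * (1 + (1 - \<tau> * q)) * Im z" by (simp add: S1_def S2_def algebra_simps)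
  then show "Re (S1 (S2 (S1 z))) = Re (c * z)" unfolding t1 t2 by (simp add: p_def q_def)
  have "Im (S1 (S2 (S1 z))) = Im z * (1 - \<tau> * q) + q * Re z" by (simp add: S1_def S2_def algebra_simps)
  then show "Im (S1 (S2 (S1 z))) = Im (c * z)" unfolding t1 by (simp add: p_def q_def)
 qed
 then have "(\<integral>\<^sup>+z. g (c * z) \<partial>lborel) = (\<integral>\<^sup>+z. (%z. g (S1 (S2 z))) (S1 z) \<partial>lborel)" by simp
 also have "... = (\<integral>\<^sup>+z. (%z. g (S1 z)) (S2 z) \<partial>lborel)"
  unfolding S1_def by (rule nn_shear_x) (simp add: S1_def[abs_def, symmetric])
 also have "... = (\<integral>\<^sup>+z. g (S1 z) \<partial>lborel)"
  unfolding S2_def by (rule nn_shear_y) simp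
 also have "... = (\<integral>\<^sup>+z. g z \<partial>lborel)"
  unfolding S1_def by (rule nn_shear_x) simp
 finally show ?thesis .
qed

lemma nn_rotation:
 assumes [measurable]: "g \<in> borel_measurable borel" and c: "cmod c = 1"
 shows "(\<integral>\<^sup>+z. g (c * z) \<partial>lborel) = (\<integral>\<^sup>+z. g z \<partial>lborel)"
proof (cases "c = -1")
 case True
 \<comment> \<open>The excluded half turn is a quarter turn applied twice.\<close>
 have "(\<integral>\<^sup>+z. g (c * z) \<partial>lborel) = (\<integral>\<^sup>+z. (%z. g (\<i> * z)) (\<i> * z) \<partial>lborel)" using True by (simp flip: mult.assoc)
 also have "... = (\<integral>\<^sup>+z. g (\<i> * z) \<partial>lborel)" by (rule nn_rotation_aux) (auto simp: complex_eq_iff)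
 also have "... = (\<integral>\<^sup>+z. g z \<partial>lborel)" by (rule nn_rotation_aux) (auto simp: complex_eq_iff)
 finally show ?thesis .
qed (use nn_rotation_aux[OF assms] in simp)

definition rotc :: "complex => c2 => c2" where "rotc c z = (c * fst z, c * snd z)"

lemma continuous_rotc: "continuous_on S (rotc c)"
 unfolding rotc_def[abs_def] by (intro continuous_intros)

lemma rotc_borel [measurable]: "rotc c \<in> borel_measurable borel" by (intro borel_measurable_continuous_onI continuous_rotc)

lemma norm_rotc: "cmod c = 1 ==> norm (rotc c z) = norm z" by (simp add: rotc_def norm_Pair norm_mult norm_prod_def)

lemma distr_rotc: assumes c: "cmod c = 1" shows "distr lborel borel (rotc c) = lborel"
proof (rule measure_eqI)
 fix A assume "A \<in> sets (distr lborel borel (rotc c))"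
 then have A [measurable]: "A \<in> sets (borel :: c2 measure)" by simp
 have A2 [measurable]: "A \<in> sets (borel \<Otimes>\<^sub>M borel)" using A by (simp only: borel_prod)
 define g where "g z = (indicator A z :: ennreal)" for z
 have [measurable]: "g \<in> borel_measurable (borel \<Otimes>\<^sub>M borel)" unfolding g_def by measurable
 have "emeasure (distr lborel borel (rotc c)) A = (\<integral>\<^sup>+z. g z \<partial>(distr lborel borel (rotc c)))"
  unfolding g_def by (subst nn_integral_indicator) auto
 also have "... = (\<integral>\<^sup>+z. g (rotc c z) \<partial>lborel)" by (rule nn_integral_distr) (auto simp: g_def)
 also have "... = (\<integral>\<^sup>+z. g (c * fst z, c * snd z) \<partial>(lborel \<Otimes>\<^sub>M lborel))" by (simp add: rotc_def lborel_prod)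
 also have "... = (\<integral>\<^sup>+x. \<integral>\<^sup>+y. g (c * x, c * y) \<partial>lborel \<partial>lborel)"
  by (subst lborel.nn_integral_fst[symmetric]) auto
 also have "... = (\<integral>\<^sup>+x. \<integral>\<^sup>+y. g (c * x, y) \<partial>lborel \<partial>lborel)"
  by (intro nn_integral_cong nn_rotation[OF _ c]) measurable
 also have "... = (\<integral>\<^sup>+x. \<integral>\<^sup>+y. g (x, y) \<partial>lborel \<partial>lborel)"
  by (rule nn_rotation[OF _ c, of "%x. \<integral>\<^sup>+y. g (x, y) \<partial>lborel"]) measurable
 also have "... = (\<integral>\<^sup>+z. g z \<partial>(lborel \<Otimes>\<^sub>M lborel))" by (rule lborel.nn_integral_fst) auto
 also have "... = emeasure lborel A" unfolding g_def lborel_prod by simp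
 finally show "emeasure (distr lborel borel (rotc c)) A = emeasure lborel A" .
qed simp

lemma integral_rotc:
 fixes f :: "c2 => real"
 assumes [measurable]: "f \<in> borel_measurable borel" and c: "cmod c = 1"
 shows "(LINT w|lborel. f (rotc c w)) = (LINT w|lborel. f w)"
proof -
 have "(LINT w|lborel. f w) = (LINT w|distr lborel borel (rotc c). f w)" by (simp add: distr_rotc[OF c])
 also have "... = (LINT w|lborel. f (rotc c w))" by (rule integral_distr) auto
 finally show ?thesis by simp
qed

section \<open>Circle means and radial smoothing\<close>

definition lbr :: "('a::euclidean_space => real) => bool" where
 "lbr f \<longleftrightarrow> f \<in> borel_measurable borel \<and> (\<forall>R. \<exists>B. \<forall>z. norm z <= R \<longrightarrow> \<bar>f z\<bar> <= B)"

lemma lbr_borel [measurable_dest]: "lbr f ==> f \<in> borel_measurable borel" by (simp add: lbr_def)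

lemma lbr_lbm: "lbr f ==> lbm (%z. complex_of_real (f z))"
 unfolding lbr_def lbm_def by auto

lemma lbr_bound: assumes "lbr f" obtains B where "B >= 0" "!!z. norm z <= R ==> \<bar>f z\<bar> <= B"
proof -
 obtain B where B: "!!z. norm z <= R ==> \<bar>f z\<bar> <= B" using assms unfolding lbr_def by metis
 have "\<bar>f z\<bar> <= \<bar>B\<bar>" if "norm z <= R" for z using B[OF that] by linarith
 then show thesis using that[of "\<bar>B\<bar>"] by simp
qed

lemma lbr_continuous: "continuous_on UNIV f ==> lbr f"
 using lbm_continuous[of "%z. complex_of_real (f z)"] unfolding lbm_def lbr_def by (auto intro: continuous_on_of_real borel_measurable_continuous_onI)

lemma lbr_compose:
 assumes f: "lbr f" and g: "continuous_on UNIV g"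
 shows "lbr (%x. f (g x))"
proof -
 have [measurable]: "f \<in> borel_measurable borel" "g \<in> borel_measurable borel"
  using f g by (auto simp: lbr_def borel_measurable_continuous_onI)
 have "\<exists>B. \<forall>x. norm x <= R \<longrightarrow> \<bar>f (g x)\<bar> <= B" for R
 proof -
  have "compact (g ` cball 0 R)" using g by (intro compact_continuous_image) (auto intro: continuous_on_subset)
  then obtain S where S: "!!x. norm x <= R ==> norm (g x) <= S" by (meson bounded_iff compact_imp_bounded image_eqI mem_cball_0)
  obtain B where "!!z. norm z <= S ==> \<bar>f z\<bar> <= B" using lbr_bound[OF f] by metis
  then show ?thesis using S by blast
 qed
 moreover have "(%x. f (g x)) \<in> borel_measurable borel" by measurable
 ultimately show ?thesis unfolding lbr_def by blast
qed

text \<open>The circle has radius 1; any other radius is absorbed into the direction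
  \<open>w\<close>.\<close>

definition cmean :: "(c2 => real) => c2 => c2 => real" where
 "cmean f z w = (LINT t:{0..2*pi}|lborel. f (cline z w (cis t))) / (2 * pi)"

lemma cline_rotc: "cline z w c = z + rotc c w" by (simp add: cline_def rotc_def plus_prod_def)

lemma continuous_cline:
 assumes "continuous_on S f" "continuous_on S g" "continuous_on S h"
 shows "continuous_on S (%x. cline (f x) (g x) (h x))"
 unfolding cline_def by (intro continuous_intros assms)

lemma fubini_circle:
 fixes g :: "real \<times> c2 => real" and k :: "c2 => real"
 assumes g: "lbr g" and k: "lbr k" "vanish r k"
 shows "(LINT w|lborel. k w * (LINT t:{0..2*pi}|lborel. g (t, w))) = (LINT t:{0..2*pi}|lborel. (LINT w|lborel. k w * g (t, w)))"
  and "integrable lborel (%w. k w * (LINT t:{0..2*pi}|lborel. g (t, w)))"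
  and "set_integrable lborel {0..2*pi} (%t. LINT w|lborel. k w * g (t, w))"
proof -
 note [measurable] = lbr_borel[OF g] lbr_borel[OF k(1)]
 define G where "G = (%(t, w). indicator {0..2*pi} t * (k w * g (t, w)))"
 obtain B where B: "B >= 0" "!!x. norm x <= 2 * pi + \<bar>r\<bar> ==> \<bar>g x\<bar> <= B" using lbr_bound[OF g] by metis
 obtain D where D: "D >= 0" "!!x. norm x <= r ==> \<bar>k x\<bar> <= D" using lbr_bound[OF k(1)] by metis
 have fs [measurable]: "fst \<in> borel_measurable (borel :: (real \<times> c2) measure)" "snd \<in> borel_measurable (borel :: (real \<times> c2) measure)"
  by (intro borel_measurable_continuous_onI continuous_intros)+
 have iG: "integrable (lborel \<Otimes>\<^sub>M lborel) G"
  unfolding lborel_prod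
 proof (rule integrable_real_bounded[of _ "D * B" "2 * pi + \<bar>r\<bar>"])
  have "G = (%x. indicator {0..2*pi} (fst x) * (k (snd x) * g x))" by (auto simp: G_def)
  then show "G \<in> borel_measurable borel" by simp
  have z: "G (t, w) = 0" if "\<not> (0 <= t \<and> t <= 2 * pi \<and> norm w < r)" for t w
   using that vanishD[OF k(2), of w] by (auto simp: G_def)
  show "\<bar>G x\<bar> <= D * B" for x
  proof -
   obtain t w where Pair: "x = (t, w)" by (metis surj_pair)
   show ?thesis
   proof (cases "0 <= t \<and> t <= 2 * pi \<and> norm w < r")
    case True
    have "norm (t, w) <= norm t + norm w" by (rule norm_Pair_le)
    then have "norm (t, w) <= 2 * pi + \<bar>r\<bar>" using True by (smt (verit) real_norm_def)
    then have "\<bar>g (t, w)\<bar> <= B" "\<bar>k w\<bar> <= D" using True B(2) D(2)[of w] by auto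
    then show ?thesis using True B(1) D(1) Pair by (simp add: G_def abs_mult mult_mono)
   next
    case False
    then show ?thesis using z[OF False] B D Pair by simp
   qed
  qed
  have "G x = 0" if "norm x >= 2 * pi + \<bar>r\<bar>" for x
  proof -
   obtain t w where Pair: "x = (t, w)" by (metis surj_pair)
   have "norm (t, w) <= norm t + norm w" by (rule norm_Pair_le)
   then have "\<not> (0 <= t \<and> t <= 2 * pi \<and> norm w < r)" using that Pair by auto
   then show ?thesis using z Pair by simp
  qed
  then show "vanish (2 * pi + \<bar>r\<bar>) G" unfolding vanish_def by blast
 qed
 have iG': "integrable (lborel \<Otimes>\<^sub>M lborel) (%(t, w). indicator {0..2*pi} t * (k w * g (t, w)))" using iG by (simp add: G_def)
 have e1: "(LINT t|lborel. indicator {0..2*pi} t * (k w * g (t, w))) = k w * (LINT t:{0..2*pi}|lborel. g (t, w))" for w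
 proof -
  have "(%t. indicator {0..2*pi} t * (k w * g (t, w))) = (%t. k w * (indicator {0..2*pi} t *\<^sub>R g (t, w)))" by (auto simp: )
  then show ?thesis unfolding set_lebesgue_integral_def by simp
 qed
 have e2: "(LINT w|lborel. indicator {0..2*pi} t * (k w * g (t, w))) = indicator {0..2*pi} t *\<^sub>R (LINT w|lborel. k w * g (t, w))" for t by simp
 show "(LINT w|lborel. k w * (LINT t:{0..2*pi}|lborel. g (t, w))) = (LINT t:{0..2*pi}|lborel. (LINT w|lborel. k w * g (t, w)))"
  using lborel_pair.Fubini_integral[OF iG'] unfolding e1 e2 set_lebesgue_integral_def .
 show "integrable lborel (%w. k w * (LINT t:{0..2*pi}|lborel. g (t, w)))"
  using lborel_pair.integrable_snd[OF iG'] unfolding e1 .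
 show "set_integrable lborel {0..2*pi} (%t. LINT w|lborel. k w * g (t, w))"
  using lborel_pair.integrable_fst[OF iG'] unfolding e2 set_integrable_def .
qed

definition keta :: "real => c2 => real" where "keta r z = cmod (eta r z)"

lemma keta_nonneg [simp]: "keta r z >= 0" by (simp add: keta_def)
lemma lbr_keta: "lbr (keta r)"
 unfolding keta_def[abs_def] by (intro lbr_continuous continuous_intros smooth_continuous smooth_eta)
lemma keta_borel [measurable]: "keta r \<in> borel_measurable borel" using lbr_keta by (simp add: lbr_def)
lemma vanish_keta: "r > 0 ==> vanish r (keta r)"
 using vanishD[OF vanish_eta[of r]] unfolding vanish_def keta_def by (simp del: split_paired_All)
lemma keta_int: "r > 0 ==> (LINT w|lborel. keta r w) = 1" by (simp add: keta_def cmod_eta_integral)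
lemma keta_rotc: "cmod c = 1 ==> keta r (rotc c w) = keta r w"
 unfolding keta_def using eta_norm_cong[OF norm_rotc] by metis

definition sm :: "real => (c2 => real) => c2 => real" where
 "sm r f z = (LINT w|lborel. keta r w * f (z + w))"

lemma integrable_keta:
 assumes r: "r > 0" and g: "lbr g" shows "integrable lborel (%w. keta r w * g w)"
proof -
 note [measurable] = lbr_borel[OF g]
 obtain B where B: "B >= 0" "!!x. norm x <= r ==> \<bar>g x\<bar> <= B" using lbr_bound[OF g] by metis
 obtain D where D: "D >= 0" "!!x. norm x <= r ==> \<bar>keta r x\<bar> <= D" using lbr_bound[OF lbr_keta[of r]] by metis
 show ?thesis
 proof (rule integrable_real_bounded[of _ "D * B" r])
  show "\<bar>keta r x * g x\<bar> <= D * B" for x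
   using B(1) B(2)[of x] D(1) D(2)[of x] vanishD[OF vanish_keta[OF r], of x] by (cases "norm x <= r") (auto simp: abs_mult intro!: mult_mono)
 qed (auto intro: vanish_mult1[OF vanish_keta[OF r]])
qed

lemma lbr_shift: "lbr f ==> lbr (%w. f (z + w))" by (erule lbr_compose) (intro continuous_intros)

lemma sm_conv: assumes r: "r > 0" and f: "lbr f" shows "conv (eta r) (%w. complex_of_real (f w)) z = of_real (sm r f z)"
proof -
 note [measurable] = lbr_borel[OF f] and [measurable] = smooth_borel[OF smooth_eta[of r]]
 have "conv (eta r) (%w. complex_of_real (f w)) z = (LINT w|lborel. (%w. eta r (- w) * of_real (f (z + w))) (0 - (z - w)))"
  unfolding conv_def by (rule Bochner_Integration.integral_cong[OF refl]) (simp add: algebra_simps)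
 also have "... = (LINT w|lborel. (%w. eta r (- w) * of_real (f (z + w))) (0 - w))"
  by (rule integral_reflect[of "%w. (%w. eta r (- w) * of_real (f (z + w))) (0 - w)"]) measurable
 also have "... = (LINT w|lborel. eta r (- w) * of_real (f (z + w)))" by (rule integral_reflect) measurable
 also have "... = (LINT w|lborel. complex_of_real (keta r w * f (z + w)))"
 proof -
  have "eta r (- w) = of_real (keta r w)" for w
   using eta_norm_cong[of "- w" w r] eta_real[OF r, of w] by (simp add: keta_def)
  then show ?thesis by simp
 qed
 finally show ?thesis by (simp only: sm_def integral_complex_of_real)
qed

lemma smooth_sm: assumes "r > 0" "lbr f" shows "smooth (sm r f)"
proof -
 have "smooth (%z. Re (conv (eta r) (%w. complex_of_real (f w)) z))"
  by (intro smooth_Re smooth_conv[OF smooth_eta vanish_eta[OF assms(1)]] lbr_lbm assms)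
 then show ?thesis by (simp add: sm_conv[OF assms])
qed

text \<open>\<open>keta r\<close> is invariant under the rotations by \<open>cis t\<close>.
  Averaging over \<open>t\<close> turns the smoothing into an average of circle means, to which
  sub-mean inequalities apply directly.\<close>

lemma sm_rot_mean:
 assumes r: "r > 0" and f: "lbr f"
 shows "sm r f z = (LINT w|lborel. keta r w * cmean f z w)" and "integrable lborel (%w. keta r w * cmean f z w)"
proof -
 note [measurable] = lbr_borel[OF f]
 have g: "lbr (%(t, w). f (cline z w (cis t)))"
  unfolding split_beta by (rule lbr_compose[OF f]) (intro continuous_cline continuous_intros)
 have rot: "(LINT w|lborel. keta r w * f (cline z w (cis t))) = sm r f z" for t
 proof -
  have "(LINT w|lborel. keta r w * f (cline z w (cis t))) = (LINT w|lborel. (%w. keta r w * f (z + w)) (rotc (cis t) w))"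
   by (simp add: keta_rotc cline_rotc)
  also have "... = sm r f z" unfolding sm_def by (rule integral_rotc) auto
  finally show ?thesis .
 qed
 have "(LINT w|lborel. keta r w * (LINT t:{0..2*pi}|lborel. f (cline z w (cis t)))) = (LINT t:{0..2*pi}|lborel. sm r f z)"
  using fubini_circle(1)[OF g lbr_keta vanish_keta[OF r]] by (simp add: rot)
 also have "... = 2 * pi * sm r f z" by (simp add: set_integral_const)
 finally show "sm r f z = (LINT w|lborel. keta r w * cmean f z w)" by (simp add: cmean_def)
 show "integrable lborel (%w. keta r w * cmean f z w)"
  using integrable_divide[OF fubini_circle(2)[OF g lbr_keta vanish_keta[OF r]], of "2 * pi"] by (simp add: cmean_def)
qed

text \<open>Plurisubharmonicity without its topological half; semicontinuity, local boundedness or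
  smoothness are added where they matter.\<close>

definition submean :: "(c2 => real) => bool" where "submean f \<longleftrightarrow> (\<forall>z w. f z <= cmean f z w)"

lemma submeanD: "submean f ==> f z <= cmean f z w" by (simp only: submean_def)

lemma integrable_keta_const: "r > 0 ==> integrable lborel (%w. keta r w * c)" by (rule integrable_keta) (auto intro: lbr_continuous)

lemma sm_ge: assumes r: "r > 0" and f: "lbr f" "submean f" shows "f z <= sm r f z"
proof -
 have "f z = (LINT w|lborel. keta r w * f z)" using keta_int[OF r] by simp
 also have "... <= (LINT w|lborel. keta r w * cmean f z w)"
  by (intro integral_mono sm_rot_mean(2)[OF r f(1)] mult_left_mono integrable_keta_const[OF r]
    submeanD[OF f(2)] keta_nonneg)
 finally show ?thesis by (simp add: sm_rot_mean(1)[OF r f(1), symmetric])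
qed

lemma submean_sm: assumes r: "r > 0" and f: "lbr f" "submean f" shows "submean (sm r f)"
 unfolding submean_def
proof (intro allI)
 fix z v
 have g: "lbr (%(t, w). f (cline z v (cis t) + w))"
  unfolding split_beta by (rule lbr_compose[OF f(1)]) (intro continuous_cline continuous_intros)
 have c: "cline (z + w) v t = cline z v t + w" for w t by (simp add: cline_def plus_prod_def)
 have "sm r f z <= (LINT w|lborel. keta r w * cmean f (z + w) v)"
  unfolding sm_def
 proof (rule integral_mono)
  show "integrable lborel (%w. keta r w * f (z + w))" by (rule integrable_keta[OF r lbr_shift[OF f(1)]])
  show "integrable lborel (%w. keta r w * cmean f (z + w) v)"
   using integrable_divide[OF fubini_circle(2)[OF g lbr_keta vanish_keta[OF r]], of "2 * pi"] by (simp add: cmean_def c)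
  show "keta r w * f (z + w) <= keta r w * cmean f (z + w) v" for w by (intro mult_left_mono submeanD[OF f(2)] keta_nonneg)
 qed
 also have "... = cmean (sm r f) z v"
  using fubini_circle(1)[OF g lbr_keta vanish_keta[OF r]] by (simp add: cmean_def c sm_def)
 finally show "sm r f z <= cmean (sm r f) z v" .
qed

lemma sm_close:
 assumes r: "r > 0" and f: "lbr f" and L: "!!w. norm w < r ==> \<bar>f (z + w) - f z\<bar> <= L"
 shows "\<bar>sm r f z - f z\<bar> <= L"
 using conv_eta_close[OF r lbr_lbm[OF f], of z L] L[of "w - z" for w]
 unfolding sm_conv[OF r f] by (simp add: norm_minus_commute flip: of_real_diff)

lemma sm_le:
 assumes r: "r > 0" and f: "lbr f" and L: "!!w. norm w < r ==> f (z + w) <= L"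
 shows "sm r f z <= L"
proof -
 have "sm r f z <= (LINT w|lborel. keta r w * L)"
  unfolding sm_def
 proof (rule integral_mono)
  show "keta r w * f (z + w) <= keta r w * L" for w
   using L[of w] vanishD[OF vanish_keta[OF r], of w] by (cases "norm w < r") (auto intro: mult_left_mono)
 qed (intro integrable_keta_const[OF r] integrable_keta[OF r] lbr_shift[OF f])+
 then show ?thesis using keta_int[OF r] by simp
qed

section \<open>Mean values and Jensen's inequality\<close>

lemma circle_integral_holo:
 fixes g :: "complex => complex"
 assumes "g holomorphic_on cball c R" "0 < R"
 shows "(LINT t:{0..2*pi}|lborel. g (c + of_real R * cis t)) = of_real (2 * pi) * g c"
proof -
 have cont: "continuous_on {0..2*pi} (%t. g (c + of_real R * cis t))"
  by (rule continuous_on_compose2[OF holomorphic_on_imp_continuous_on[OF assms(1)]])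
   (use assms(2) in \<open>auto intro!: continuous_intros simp: dist_norm norm_mult\<close>)
 have "((%u. g u / (u - c)) has_contour_integral (2 * of_real pi * \<i> * g c)) (part_circlepath c R 0 (2 * pi))"
  using Cauchy_integral_circlepath_simple[OF assms(1), of c] assms(2) by (simp add: circlepath_def)
 then have "((%t. g (c + of_real R * cis t) / ((c + of_real R * cis t) - c) * of_real R * \<i> * cis t) has_integral (2 * of_real pi * \<i> * g c)) {0..2*pi}"
  by (subst (asm) has_contour_integral_part_circlepath_iff) auto
 also have "(%t. g (c + of_real R * cis t) / ((c + of_real R * cis t) - c) * of_real R * \<i> * cis t) = (%t. \<i> * g (c + of_real R * cis t))"
  using assms(2) by (auto simp: field_simps)
 finally have "((%t. - \<i> * (\<i> * g (c + of_real R * cis t))) has_integral (- \<i> * (2 * of_real pi * \<i> * g c))) {0..2*pi}"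
  by (rule has_integral_mult_right)
 moreover have "- \<i> * (2 * of_real pi * \<i> * g c) = of_real (2 * pi) * g c" by (simp add: complex_eq_iff)
 moreover have "- \<i> * (\<i> * x) = x" for x by simp
 ultimately have "integral {0..2*pi} (%t. g (c + of_real R * cis t)) = of_real (2 * pi) * g c" by (intro integral_unique) (simp only:)
 moreover have "set_integrable lborel {0..2*pi} (%t. g (c + of_real R * cis t))"
  by (rule borel_integrable_compact[OF compact_Icc cont, folded set_integrable_def]) 
 ultimately show ?thesis using set_borel_integral_eq_integral(2) by metis
qed

definition circ :: "(real => real) => real" where
 "circ g = (LINT t:{0..2*pi}|lborel. g t) / (2 * pi)"

lemma cmean_circ: "cmean f z w = circ (%t. f (cline z w (cis t)))" by (simp add: cmean_def circ_def)

lemma circ_integrable: "continuous_on {0..2*pi} g ==> set_integrable lborel {0..2*pi} (g :: real => real)" by (rule borel_integrable_atLeastAtMost')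

lemma circ_mono:
 assumes "continuous_on {0..2*pi} f" "continuous_on {0..2*pi} g" "!!t. t \<in> {0..2*pi} ==> f t <= g t"
 shows "circ f <= circ g"
 unfolding circ_def by (intro divide_right_mono set_integral_mono circ_integrable assms) auto

lemma circ_add:
 assumes "continuous_on {0..2*pi} f" "continuous_on {0..2*pi} g"
 shows "circ (%t. f t + g t) = circ f + circ g"
 unfolding circ_def using set_integral_add(2)[OF circ_integrable[OF assms(1)] circ_integrable[OF assms(2)]] by (simp add: add_divide_distrib)

lemma circ_cmult: "circ (%t. c * f t) = c * circ f"
 unfolding circ_def by simp

lemma circ_diff:
 assumes "continuous_on {0..2*pi} f" "continuous_on {0..2*pi} g"
 shows "circ (%t. f t - g t) = circ f - circ g"
 using circ_add[OF assms(1), of "%t. (-1) * g t"] circ_cmult[of "-1" g] assms(2) by (auto intro: continuous_intros)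

lemma circ_const [simp]: "circ (%t. c) = c"
 unfolding circ_def by (simp add: set_integral_const)

lemma circ_Re_holo:
 assumes "g holomorphic_on cball c R" "0 < R"
 shows "circ (%t. Re (g (c + of_real R * cis t))) = Re (g c)"
proof -
 have cont: "continuous_on {0..2*pi} (%t. g (c + of_real R * cis t))"
  by (rule continuous_on_compose2[OF holomorphic_on_imp_continuous_on[OF assms(1)]])
   (use assms(2) in \<open>auto intro!: continuous_intros simp: dist_norm norm_mult\<close>)
 have "set_integrable lborel {0..2*pi} (%t. g (c + of_real R * cis t))"
  unfolding set_integrable_def by (rule borel_integrable_compact[OF compact_Icc cont])
 then have "(LINT t:{0..2*pi}|lborel. Re (g (c + of_real R * cis t))) = Re (LINT t:{0..2*pi}|lborel. g (c + of_real R * cis t))"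
  unfolding set_lebesgue_integral_def set_integrable_def by (subst integral_Re[symmetric]) auto
 then show ?thesis unfolding circ_def circle_integral_holo[OF assms] by simp
qed

lemma circ_ln_one_minus:
 assumes "cmod c < 1" shows "circ (%t. ln (cmod (1 - c * cis t))) = 0"
proof -
 have ne: "1 - c * z \<notin> \<real>\<^sub>\<le>\<^sub>0" if "z \<in> cball 0 1" for z
 proof -
  have "cmod (c * z) < 1"
   using that assms by (simp add: norm_mult) (smt (verit) mult_left_le norm_ge_zero)
  then have "Re (c * z) < 1" using complex_Re_le_cmod[of "c * z"] by linarith
  then show ?thesis by (auto simp: complex_nonpos_Reals_iff)
 qed
 have hol: "(%z. Ln (1 - c * z)) holomorphic_on cball 0 1" by (intro holomorphic_intros) (use ne in auto)
 have "Re (Ln (1 - c * cis t)) = ln (cmod (1 - c * cis t))" for t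
  using ne[of "cis t"] by (subst Re_Ln) auto
 with circ_Re_holo[OF hol, of ] show ?thesis by simp
qed

text \<open>Jensen's formula for one linear factor. If the zero lies outside the circle, the
  logarithm is harmonic inside and equality holds. If it lies inside, |s cis t - a| = s |1 - d cis
  t| with the reflected coefficient \<open>d\<close>, and the mean is ln s, which exceeds ln
  |a|.\<close>

lemma circ_ln_linear:
 assumes "a ~= 0" "s > 0" "cmod a ~= s"
 shows "ln (cmod a) <= circ (%t. ln (cmod (of_real s * cis t - a)))"
proof (cases "cmod a > s")
 case True
 have lt: "cmod (of_real s / a) < 1" using True assms by (simp add: norm_divide)
 have "ln (cmod (of_real s * cis t - a)) = ln (cmod a) + ln (cmod (1 - (of_real s / a) * cis t))" for t
 proof -
  have "of_real s * cis t - a = - a * (1 - (of_real s / a) * cis t)" using assms by (simp add: field_simps)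
  then have "cmod (of_real s * cis t - a) = cmod a * cmod (1 - (of_real s / a) * cis t)" by (simp only: norm_mult norm_minus_cancel)
  moreover have "cmod (of_real s / a * cis t) < 1" using lt by (metis norm_mult norm_cis mult.right_neutral)
  then have "1 - of_real s / a * cis t ~= 0" by auto
  ultimately show ?thesis using assms by (simp add: ln_mult)
 qed
 moreover have "continuous_on {0..2*pi} (%t. ln (cmod (1 - (of_real s / a) * cis t)))"
 proof (intro continuous_intros ballI)
  fix t show "cmod (1 - of_real s / a * cis t) ~= 0"
   using lt by (smt (verit) norm_cis norm_eq_zero norm_mult norm_one right_minus_eq mult.right_neutral)
 qed
 ultimately show ?thesis using circ_add[of "%_. ln (cmod a)"] circ_ln_one_minus[OF lt] by simp
next
 case False
 then have as: "cmod a < s" using assms by simp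
 define d where "d = cnj (a / of_real s)"
 have lt: "cmod d < 1" using as assms by (simp add: d_def norm_divide)
 have "ln (cmod (of_real s * cis t - a)) = ln s + ln (cmod (1 - d * cis t))" for t
 proof -
  have "cmod (1 - d * cis t) = cmod (cnj (1 - d * cis t))" by (rule complex_mod_cnj[symmetric])
  also have "cnj (1 - d * cis t) = 1 - a / of_real s * cis (- t)" by (simp add: d_def cis_cnj)
  also have "cmod ... = cmod (cis t * (1 - a / of_real s * cis (- t)))" by (simp add: norm_mult)
  also have "cis t * (1 - a / of_real s * cis (- t)) = (of_real s * cis t - a) / of_real s"
   using assms by (simp add: field_simps cis_mult)
  finally have e: "cmod (1 - d * cis t) = cmod (of_real s * cis t - a) / s" using assms by (simp add: norm_divide)
  have "of_real s * cis t ~= a" using as assms by (auto simp: norm_mult)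
  then show ?thesis unfolding e using assms by (simp add: ln_div)
 qed
 moreover have "continuous_on {0..2*pi} (%t. ln (cmod (1 - d * cis t)))"
 proof (intro continuous_intros ballI)
  fix t show "cmod (1 - d * cis t) ~= 0"
   using lt by (smt (verit) norm_cis norm_eq_zero norm_mult norm_one right_minus_eq mult.right_neutral)
 qed
 ultimately have "circ (%t. ln (cmod (of_real s * cis t - a))) = ln s"
  using circ_add[of "%_. ln s"] circ_ln_one_minus[OF lt] by simp
 then show ?thesis using as assms by simp
qed

text \<open>One root is split off at a time. The absence of roots on the circle keeps all the
  logarithms continuous, and nonvanishing at 0 makes the left side additive over the
  factors.\<close>

lemma circ_ln_poly:
 fixes q :: "complex poly"
 assumes "s > 0" "!!z. cmod z = s ==> poly q z ~= 0" "poly q 0 ~= 0"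
 shows "ln (cmod (poly q 0)) <= circ (%t. ln (cmod (poly q (of_real s * cis t))))"
 using assms(2,3)
proof (induction "degree q" arbitrary: q rule: less_induct)
 case less
 show ?case
 proof (cases "degree q = 0")
  case True
  then obtain c where "q = [:c:]" by (rule degree_eq_zeroE)
  then show ?thesis by simp
 next
  case False
  then obtain a where a: "poly q a = 0"
   using fundamental_theorem_of_algebra[of q] by (auto simp: constant_degree)
  then obtain q' where q': "q = [:- a, 1:] * q'" by (metis dvdE poly_eq_0_iff_dvd)
  have "q' ~= 0" using q' less.prems(2) by auto
  then have deg: "degree q' < degree q" unfolding q' by (subst degree_mult_eq) auto
  have a0: "a ~= 0" "cmod a ~= s" using a less.prems by auto
  have q'z: "poly q' z ~= 0" if "cmod z = s" for z using less.prems(1)[OF that] q' by auto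
  have q'0: "poly q' 0 ~= 0" using less.prems(2) q' by auto
  have cs: "cmod (of_real s * cis t) = s" for t using assms(1) by (simp add: norm_mult)
  have ne: "of_real s * cis t - a ~= 0" for t using cs[of t] a0(2) by auto
  have c1: "continuous_on {0..2*pi} (%t. ln (cmod (of_real s * cis t - a)))"
   using ne by (intro continuous_intros) auto
  have c2: "continuous_on {0..2*pi} (%t. ln (cmod (poly q' (of_real s * cis t))))"
   using q'z[OF cs] by (intro continuous_intros continuous_on_compose2[OF continuous_on_poly[OF continuous_on_id], of UNIV]) auto
  have "(%t. ln (cmod (poly q (of_real s * cis t)))) =
    (%t. ln (cmod (of_real s * cis t - a)) + ln (cmod (poly q' (of_real s * cis t))))"
  proof
   fix t
   have "poly q (of_real s * cis t) = (of_real s * cis t - a) * poly q' (of_real s * cis t)" by (simp add: q' algebra_simps)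
   then show "ln (cmod (poly q (of_real s * cis t))) = ln (cmod (of_real s * cis t - a)) + ln (cmod (poly q' (of_real s * cis t)))"
    using ne[of t] q'z[OF cs, of t] by (simp add: norm_mult ln_mult)
  qed
  then have "circ (%t. ln (cmod (poly q (of_real s * cis t)))) =
   circ (%t. ln (cmod (of_real s * cis t - a))) + circ (%t. ln (cmod (poly q' (of_real s * cis t))))"
   using circ_add[OF c1 c2] by simp
  moreover have "ln (cmod (poly q 0)) = ln (cmod a) + ln (cmod (poly q' 0))"
   using a0 q'0 by (simp add: q' norm_mult ln_mult)
  ultimately show ?thesis
   using circ_ln_linear[OF a0(1) assms(1) a0(2)] less.hyps[OF deg q'z q'0] by simp
 qed
qed

lemma continuous_logplus: "continuous_on UNIV logplus"
proof -
 have e: "logplus = (%x. ln (max 1 x))" by (auto simp: logplus_def fun_eq_iff max_def)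
 show ?thesis unfolding e by (intro continuous_intros ballI) linarith
qed

lemma logplus_nonneg [simp]: "logplus x >= 0" by (simp add: logplus_def)
lemma logplus_ge_ln: "x > 0 ==> ln x <= logplus x" by (simp add: logplus_def)
lemma logplus_mono: "x <= y ==> logplus x <= logplus y" by (auto simp: logplus_def)

text \<open>Jensen's inequality is used on a circle free of zeros. Only finitely many moduli are
  excluded, so some radius slightly above 1 is admissible, and uniform continuity of
  \<open>g\<close> returns to radius 1.\<close>

lemma logplus_poly_mean:
 fixes q :: "complex poly"
 shows "logplus (cmod (poly q 0)) <= circ (%t. logplus (cmod (poly q (cis t))))"
proof -
 define g where "g = (%(s, t). logplus (cmod (poly q (of_real s * cis t))))"
 have contg: "continuous_on UNIV g"
  unfolding g_def split_beta by (intro continuous_on_compose2[OF continuous_logplus] continuous_intros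
    continuous_on_compose2[OF continuous_on_poly[OF continuous_on_id], of UNIV]) auto
 have ct: "continuous_on {0..2*pi} (%t. g (s, t))" for s by (rule continuous_on_compose2[OF contg]) (auto intro!: continuous_intros)
 have g1: "g (1, t) = logplus (cmod (poly q (cis t)))" for t by (simp add: g_def)
 have "circ (%_. 0) <= circ (%t. g (1, t))" by (rule circ_mono[OF _ ct]) (auto simp: g1)
 then have pos: "0 <= circ (%t. g (1, t))" by simp
 show ?thesis
 proof (cases "cmod (poly q 0) <= 1")
  case True
  then have "logplus (cmod (poly q 0)) = 0" by (simp add: logplus_def)
  then show ?thesis using pos unfolding g1 by (simp only:)
 next
  case False
  then have q0: "poly q 0 ~= 0" by auto
  have "ln (cmod (poly q 0)) <= circ (%t. g (1, t)) + \<epsilon>" if e: "\<epsilon> > 0" for \<epsilon>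
  proof -
   have "compact ({0..2::real} \<times> {0..2*pi})" by (intro compact_Times compact_Icc)
   then have "uniformly_continuous_on ({0..2} \<times> {0..2*pi}) g" by (intro compact_uniformly_continuous continuous_on_subset[OF contg]) auto
   then obtain \<delta> where \<delta>: "\<delta> > 0" "!!x y. x \<in> {0..2} \<times> {0..2*pi} ==> y \<in> {0..2} \<times> {0..2*pi} ==> dist x y < \<delta> ==> dist (g x) (g y) < \<epsilon>"
    unfolding uniformly_continuous_on_def using e by metis
   have "finite (cmod ` {z. poly q z = 0})" using poly_roots_finite[of q] q0 by fastforce
   moreover have "infinite {1<..<1 + min 1 \<delta>}" using \<delta> by (simp add: infinite_Ioo)
   ultimately have "{1<..<1 + min 1 \<delta>} - cmod ` {z. poly q z = 0} ~= {}" by (metis Diff_eq_empty_iff finite_subset)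
   then obtain s where "s \<in> {1<..<1 + min 1 \<delta>} - cmod ` {z. poly q z = 0}" by blast
   then have s: "1 < s" "s < 1 + min 1 \<delta>" "s \<notin> cmod ` {z. poly q z = 0}" unfolding Diff_iff greaterThanLessThan_iff by blast+
   have nz: "poly q z ~= 0" if "cmod z = s" for z using s(3) that by auto
   have cs: "cmod (of_real s * cis t) = s" for t using s by (simp add: norm_mult)
   have "ln (cmod (poly q 0)) <= circ (%t. ln (cmod (poly q (of_real s * cis t))))" by (rule circ_ln_poly[OF _ nz q0]) (use s in auto)
   also have "... <= circ (%t. g (s, t))"
   proof (rule circ_mono[OF _ ct])
    show "continuous_on {0..2*pi} (%t. ln (cmod (poly q (of_real s * cis t))))"
     using nz[OF cs] by (intro continuous_intros continuous_on_compose2[OF continuous_on_poly[OF continuous_on_id], of UNIV]) auto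
    show "ln (cmod (poly q (of_real s * cis t))) <= g (s, t)" for t
     using nz[OF cs, of t] by (simp add: g_def logplus_ge_ln)
   qed
   also have "... <= circ (%t. g (1, t) + \<epsilon>)"
   proof (rule circ_mono[OF ct])
    fix t assume t: "t \<in> {0..2*pi}"
    have "dist (s, t) (1, t) < \<delta>" using s by (simp add: dist_Pair_Pair dist_real_def)
    then have "dist (g (s, t)) (g (1, t)) < \<epsilon>" using s t by (intro \<delta>(2)) auto
    then show "g (s, t) <= g (1, t) + \<epsilon>" by (simp add: dist_real_def)
   qed (intro continuous_intros ct)
   also have "... = circ (%t. g (1, t)) + \<epsilon>" using circ_add[OF ct] by simp
   finally show ?thesis .
  qed
  then have "ln (cmod (poly q 0)) <= circ (%t. g (1, t))" by (rule field_le_epsilon)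
  moreover have "logplus (cmod (poly q 0)) = ln (cmod (poly q 0))" using False by (simp add: logplus_def)
  ultimately show ?thesis unfolding g1 by (simp only:)
 qed
qed

section \<open>A maximum principle with cubic error\<close>

definition asub :: "(complex => real) => complex => bool" where
 "asub w x \<longleftrightarrow> (\<exists>C. \<exists>r0>0. \<forall>r. 0 < r \<and> r < r0 \<longrightarrow> w x <= circ (%t. w (x + of_real r * cis t)) + C * r ^ 3)"

text \<open>Harmonicity as it is used for comparison functions: they are sums of constants and
  logarithms of moduli of affine functions, for which small circles can be treated with a local
  branch of the logarithm.\<close>

definition hmean :: "(complex => real) => complex => bool" where
 "hmean h x \<longleftrightarrow> (\<exists>r0>0. continuous_on (cball x r0) h \<and> (\<forall>r. 0 < r \<and> r < r0 \<longrightarrow> circ (%t. h (x + of_real r * cis t)) = h x))"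

lemma cont_circle:
 assumes "continuous_on (cball x r0) (h :: complex => real)" "0 < r" "r < r0"
 shows "continuous_on {0..2*pi} (%t. h (x + of_real r * cis t))"
 by (rule continuous_on_compose2[OF assms(1)]) (use assms in \<open>auto intro!: continuous_intros simp: dist_norm norm_mult\<close>)

lemma hmean_const: "hmean (%_. c) x"
 unfolding hmean_def by (intro exI[of _ 1]) auto

lemma hmean_add: assumes "hmean f x" "hmean g x" shows "hmean (%z. f z + g z) x"
proof -
 obtain r1 r2 where r: "r1 > 0" "continuous_on (cball x r1) f" "!!r. 0 < r ==> r < r1 ==> circ (%t. f (x + of_real r * cis t)) = f x"
  "r2 > 0" "continuous_on (cball x r2) g" "!!r. 0 < r ==> r < r2 ==> circ (%t. g (x + of_real r * cis t)) = g x"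
  using assms unfolding hmean_def by metis
 show ?thesis
  unfolding hmean_def
 proof (intro exI[of _ "min r1 r2"] conjI allI impI)
  show "continuous_on (cball x (min r1 r2)) (%z. f z + g z)"
   by (intro continuous_intros continuous_on_subset[OF r(2)] continuous_on_subset[OF r(5)]) auto
  show "circ (%t. f (x + of_real s * cis t) + g (x + of_real s * cis t)) = f x + g x" if "0 < s \<and> s < min r1 r2" for s
   using circ_add[OF cont_circle[OF r(2)] cont_circle[OF r(5)], of s s] r(3)[of s] r(6)[of s] that by simp
 qed (use r in auto)
qed

lemma hmean_cmult: assumes "hmean f x" shows "hmean (%z. c * f z) x"
proof -
 obtain r1 where r: "r1 > 0" "continuous_on (cball x r1) f" "!!r. 0 < r ==> r < r1 ==> circ (%t. f (x + of_real r * cis t)) = f x"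
  using assms unfolding hmean_def by metis
 then show ?thesis
  unfolding hmean_def by (intro exI[of _ r1]) (auto simp: circ_cmult intro!: continuous_intros)
qed

lemma hmean_ln:
 assumes "\<alpha> * x + \<beta> ~= 0" shows "hmean (%z. ln (cmod (\<alpha> * z + \<beta>))) x"
proof -
 define d where "d = \<alpha> * x + \<beta>"
 define r0 where "r0 = cmod d / (cmod \<alpha> + 1)"
 have r0: "r0 > 0" using assms by (simp add: r0_def d_def add_nonneg_pos)
 have near: "cmod (\<alpha> * (z - x) / d) < 1" if "z \<in> cball x r0" for z
 proof -
  have "cmod (\<alpha> * (z - x)) <= cmod \<alpha> * r0" using that by (auto simp: norm_mult dist_norm norm_minus_commute intro!: mult_left_mono)
  also have "... < (cmod \<alpha> + 1) * r0" using r0 by simp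
  also have "... = cmod d"
  proof -
   have "cmod \<alpha> + 1 ~= 0" using norm_ge_zero[of \<alpha>] by linarith
   then show ?thesis by (simp add: r0_def)
  qed
  finally show ?thesis using assms by (simp add: norm_divide d_def)
 qed
 have ne: "1 + \<alpha> * (z - x) / d \<notin> \<real>\<^sub>\<le>\<^sub>0" if "z \<in> cball x r0" for z
 proof -
  have "- 1 < Re (\<alpha> * (z - x) / d)"
   using near[OF that] complex_Re_le_cmod[of "- (\<alpha> * (z - x) / d)"] by simp
  then show ?thesis by (auto simp: complex_nonpos_Reals_iff)
 qed
 have eq: "ln (cmod (\<alpha> * z + \<beta>)) = ln (cmod d) + Re (Ln (1 + \<alpha> * (z - x) / d))" if "z \<in> cball x r0" for z
 proof -
  have "\<alpha> * z + \<beta> = d * (1 + \<alpha> * (z - x) / d)" using assms by (simp add: d_def field_simps)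
  moreover have "1 + \<alpha> * (z - x) / d ~= 0" using ne[OF that] by auto
  ultimately show ?thesis using assms by (simp add: norm_mult ln_mult d_def)
 qed
 have "hmean (%z. ln (cmod d) + Re (Ln (1 + \<alpha> * (z - x) / d))) x"
 proof (rule hmean_add[OF hmean_const])
  have hol: "(%z. Ln (1 + \<alpha> * (z - x) / d)) holomorphic_on cball x r0"
   by (intro holomorphic_intros) (use ne assms in \<open>auto simp: d_def\<close>)
  show "hmean (%z. Re (Ln (1 + \<alpha> * (z - x) / d))) x"
   unfolding hmean_def
  proof (intro exI[of _ r0] conjI allI impI)
   show "continuous_on (cball x r0) (%z. Re (Ln (1 + \<alpha> * (z - x) / d)))" by (intro continuous_intros holomorphic_on_imp_continuous_on[OF hol])
   fix r assume r: "0 < r \<and> r < r0"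
   have "(%z. Ln (1 + \<alpha> * (z - x) / d)) holomorphic_on cball x r" by (rule holomorphic_on_subset[OF hol]) (use r in auto)
   from circ_Re_holo[OF this] r
   show "circ (%t. Re (Ln (1 + \<alpha> * (x + of_real r * cis t - x) / d))) = Re (Ln (1 + \<alpha> * (x - x) / d))" by simp
  qed (use r0 in auto)
 qed
 then obtain r1 where r1: "r1 > 0" "continuous_on (cball x r1) (%z. ln (cmod d) + Re (Ln (1 + \<alpha> * (z - x) / d)))"
  "!!r. 0 < r ==> r < r1 ==> circ (%t. ln (cmod d) + Re (Ln (1 + \<alpha> * (x + of_real r * cis t - x) / d))) = ln (cmod d) + Re (Ln (1 + \<alpha> * (x - x) / d))"
  unfolding hmean_def by metis
 show ?thesis
  unfolding hmean_def
 proof (intro exI[of _ "min r0 r1"] conjI allI impI)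
  show "continuous_on (cball x (min r0 r1)) (%z. ln (cmod (\<alpha> * z + \<beta>)))"
  proof -
   have "continuous_on (cball x (min r0 r1)) (%z. ln (cmod d) + Re (Ln (1 + \<alpha> * (z - x) / d)))" by (rule continuous_on_subset[OF r1(2)]) auto
   moreover have "\<forall>z\<in>cball x (min r0 r1). ln (cmod (\<alpha> * z + \<beta>)) = ln (cmod d) + Re (Ln (1 + \<alpha> * (z - x) / d))"
    using eq by simp
   ultimately show ?thesis using continuous_on_cong by (metis (no_types, lifting))
  qed
  fix r assume r: "0 < r \<and> r < min r0 r1"
  have "x + of_real r * cis t \<in> cball x r0" for t using r by (simp add: dist_norm norm_mult)
  then have "(%t. ln (cmod (\<alpha> * (x + of_real r * cis t) + \<beta>))) = (%t. ln (cmod d) + Re (Ln (1 + \<alpha> * (x + of_real r * cis t - x) / d)))"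
   using eq by blast
  moreover have "ln (cmod (\<alpha> * x + \<beta>)) = ln (cmod d) + Re (Ln (1 + \<alpha> * (x - x) / d))" using eq[of x] r0 by simp
  ultimately show "circ (%t. ln (cmod (\<alpha> * (x + of_real r * cis t) + \<beta>))) = ln (cmod (\<alpha> * x + \<beta>))"
   using r1(3)[OF conjunct1[OF r] less_le_trans[OF conjunct2[OF r] min.cobounded2]] by (simp only:)
 qed (use r0 r1 in auto)
qed

lemma asub_diff:
 assumes "asub u x" "continuous_on X u" "open X" "x \<in> X" "hmean h x" shows "asub (%z. u z - h z) x"
proof -
 obtain C r1 where u: "r1 > 0" "!!r. 0 < r ==> r < r1 ==> u x <= circ (%t. u (x + of_real r * cis t)) + C * r ^ 3"
  using assms(1) unfolding asub_def by metis
 obtain r2 where h: "r2 > 0" "continuous_on (cball x r2) h" "!!r. 0 < r ==> r < r2 ==> circ (%t. h (x + of_real r * cis t)) = h x"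
  using assms(5) unfolding hmean_def by metis
 obtain r3 where r3: "r3 > 0" "cball x r3 \<subseteq> X" using assms(3,4) open_contains_cball by metis
 show ?thesis
  unfolding asub_def
 proof (rule exI[of _ C], rule exI[of _ "min r3 (min r1 r2)"], intro conjI allI impI)
  fix r assume r: "0 < r \<and> r < min r3 (min r1 r2)"
  have "continuous_on {0..2*pi} (%t. u (x + of_real r * cis t))" by (rule cont_circle[OF continuous_on_subset[OF assms(2) r3(2)]]) (use r in auto)
  from circ_diff[OF this cont_circle[OF h(2), of r]] r
  show "u x - h x <= circ (%t. u (x + of_real r * cis t) - h (x + of_real r * cis t)) + C * r ^ 3"
   using u(2)[of r] h(3)[of r] by simp
 qed (use u h r3 in auto)
qed

text \<open>At a maximum of w + \<tau> |z|^2 the quadratic term raises the circle mean by \<tau>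
  r^2, which beats the cubic error allowed by \<open>asub\<close> once \<open>r\<close> is small.
  The value of \<open>\<tau>\<close> keeps the perturbation at most half of \<open>w y\<close> on
  \<open>S\<close>, so the maximum is attained where \<open>w\<close> is positive, hence in
  \<open>X\<close>.\<close>

lemma max_principle:
 fixes w :: "complex => real"
 assumes S: "compact S" "continuous_on S w" and X: "open X" "X \<subseteq> S" "!!x. x \<in> X ==> asub w x"
  and bd: "!!x. x \<in> S - X ==> w x <= 0" and y: "y \<in> S"
 shows "w y <= 0"
proof (rule ccontr)
 assume neg: "\<not> w y <= 0"
 obtain R where R: "R > 0" "!!x. x \<in> S ==> cmod x <= R"
  using compact_imp_bounded[OF S(1)] unfolding bounded_pos by metis
 define \<tau> where "\<tau> = w y / (2 * R^2)"
 have \<tau>: "\<tau> > 0" using neg R by (simp add: \<tau>_def)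
 define v where "v z = w z + \<tau> * (cmod z)^2" for z
 have "continuous_on S v" unfolding v_def by (intro continuous_intros S)
 then obtain x where x: "x \<in> S" "!!z. z \<in> S ==> v z <= v x"
  using continuous_attains_sup[OF S(1), of v] y by blast
 have "w x > 0"
 proof -
  have "w y <= v y" using \<tau> by (simp add: v_def)
  also have "... <= v x" by (rule x(2)[OF y])
  also have "... <= w x + \<tau> * R^2" unfolding v_def using \<tau> R(2)[OF x(1)] by (intro add_left_mono mult_left_mono power_mono) auto
  also have "\<tau> * R^2 = w y / 2" using R by (simp add: \<tau>_def)
  finally show ?thesis using neg by simp
 qed
 then have xX: "x \<in> X" using bd x(1) by force
 obtain C r0 where C: "r0 > 0" "!!r. 0 < r ==> r < r0 ==> w x <= circ (%t. w (x + of_real r * cis t)) + C * r ^ 3"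
  using X(3)[OF xX] unfolding asub_def by metis
 obtain r1 where r1: "r1 > 0" "cball x r1 \<subseteq> X" using X(1) xX open_contains_cball by metis
 define r where "r = min (min (r0 / 2) (r1 / 2)) (\<tau> / (2 * (\<bar>C\<bar> + 1)))"
 have r: "0 < r" "r < r0" "r < r1" "r * (\<bar>C\<bar> + 1) < \<tau>"
 proof -
  show "0 < r" using C(1) r1(1) \<tau> by (simp add: r_def)
  have "r <= r0 / 2" "r <= r1 / 2" unfolding r_def by linarith+
  then show "r < r0" "r < r1" using C(1) r1(1) by linarith+
  have "r * (\<bar>C\<bar> + 1) <= \<tau> / (2 * (\<bar>C\<bar> + 1)) * (\<bar>C\<bar> + 1)" by (intro mult_right_mono) (auto simp: r_def)
  also have "... = \<tau> / 2" by (simp add: field_simps)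
  finally show "r * (\<bar>C\<bar> + 1) < \<tau>" using \<tau> by simp
 qed
 have inS: "x + of_real r * cis t \<in> S" for t
  using r r1 X(2) by (auto simp: dist_norm norm_mult intro!: subsetD[OF X(2)] subsetD[OF r1(2)])
 have cw: "continuous_on {0..2*pi} (%t. w (x + of_real r * cis t))"
  by (rule continuous_on_compose2[OF S(2)]) (use inS in \<open>auto intro!: continuous_intros\<close>)
 define L where "L t = 2 * r * Re (cnj x * cis t)" for t
 have cL: "continuous_on {0..2*pi} L" unfolding L_def by (intro continuous_intros)
 have L0: "circ L = 0"
 proof -
  have "circ (%t. Re (cnj x * (0 + of_real 1 * cis t))) = Re (cnj x * 0)" by (rule circ_Re_holo) (auto intro!: holomorphic_intros)
  then show ?thesis unfolding L_def using circ_cmult[of "2 * r" "%t. Re (cnj x * cis t)"] by simp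
 qed
 have sq: "(cmod (x + of_real r * cis t))^2 = (cmod x)^2 + r^2 + L t" for t
 proof -
  have "complex_of_real ((cmod (x + of_real r * cis t))^2) = (x + of_real r * cis t) * cnj (x + of_real r * cis t)" by (rule complex_norm_square)
  also have "... = x * cnj x + of_real r * of_real r * (cis t * cnj (cis t)) + of_real r * (cnj x * cis t + cnj (cnj x * cis t))"
   by (simp add: algebra_simps)
  also have "... = complex_of_real ((cmod x)^2 + r^2 + L t)"
   unfolding complex_add_cnj by (simp add: complex_norm_square[symmetric] L_def power2_eq_square)
  finally show ?thesis by (metis of_real_eq_iff)
 qed
 have "circ (%t. w (x + of_real r * cis t)) + \<tau> * ((cmod x)^2 + r^2) = circ (%t. v (x + of_real r * cis t))"
 proof -
  have "(%t. v (x + of_real r * cis t)) = (%t. w (x + of_real r * cis t) + (\<tau> * ((cmod x)^2 + r^2) + \<tau> * L t))"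
   unfolding v_def sq by (simp add: distrib_left add.assoc)
  moreover have "circ (%t. \<tau> * ((cmod x)^2 + r^2) + \<tau> * L t) = \<tau> * ((cmod x)^2 + r^2)"
   using circ_add[of "%t. \<tau> * ((cmod x)^2 + r^2)" "%t. \<tau> * L t"] cL L0 by (simp add: circ_cmult continuous_intros)
  ultimately show ?thesis
   using circ_add[OF cw, of "%t. \<tau> * ((cmod x)^2 + r^2) + \<tau> * L t"] cL by (simp add: continuous_intros)
 qed
 also have "... <= circ (%t. v x)"
 proof (rule circ_mono)
  show "continuous_on {0..2*pi} (%t. v (x + of_real r * cis t))"
   unfolding v_def by (intro continuous_intros cw)
 qed (use x(2) inS in auto)
 finally have "circ (%t. w (x + of_real r * cis t)) + \<tau> * r^2 <= w x" by (simp add: v_def algebra_simps)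
 then have "\<tau> * r^2 <= C * r ^ 3" using C(2)[OF r(1,2)] by linarith
 also have "... <= (r * (\<bar>C\<bar> + 1)) * r^2" using r(1) by (simp add: power2_eq_square power3_eq_cube mult_ac mult_left_mono)
 finally show False using r(4) r(1) by (simp add: mult_le_cancel_right)
qed

section \<open>Subharmonicity along weighted orbits\<close>

definition cut :: "real => c2 => complex" where
 "cut R = conv (eta 1) (%w. indicator (ball 0 R) w)"

lemma lbm_indicator_ball: "lbm (%w :: c2. indicator (ball 0 R) w :: complex)"
 unfolding lbm_def
proof (intro conjI allI exI[of _ 1] impI)
 show "(%w :: c2. indicator (ball 0 R) w :: complex) \<in> borel_measurable borel" by (intro borel_measurable_indicator borel_open) auto
qed (simp add: indicator_def)

lemma smooth_cut: "smooth (cut R)"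
 unfolding cut_def by (rule smooth_conv[OF smooth_eta vanish_eta lbm_indicator_ball]) simp

lemma vanish_cut: "vanish (1 + R) (cut R)"
 unfolding cut_def by (rule vanish_conv[OF vanish_eta]) (auto simp: vanish_def indicator_def)

lemma cut_one: assumes "norm z <= R - 1" shows "cut R z = 1"
proof -
 have "cut R z = (LINT w|lborel. eta 1 (z - w))"
  unfolding cut_def conv_def
 proof (rule Bochner_Integration.integral_cong[OF refl])
  fix w
  show "eta 1 (z - w) * indicator (ball 0 R) w = eta 1 (z - w)"
  proof (cases "norm w < R")
   case False
   then have "norm (z - w) >= 1" using assms norm_triangle_ineq2[of w z] by (simp add: norm_minus_commute)
   then show ?thesis using vanishD[OF vanish_eta, of 1 "z - w"] by simp
  qed simp
 qed
 then show ?thesis using conv_eta_const[of 1 z] by simp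
qed

lemma smooth_vanish_D2_bounded:
 fixes f :: "c2 => complex"
 assumes f: "smooth f" and v: "vanish r f"
 obtains C where "C >= 0" "!!e e' z. cmod (Dd e' (Dd e f) z) <= C * norm e * norm e'"
proof -
 have "\<exists>B\<ge>0. \<forall>e z. cmod (Dd e (Dd b f) z) <= B * norm e" for b
  using smooth_Dd_bounded[OF smooth_Dd[OF f] vanish_Dd[OF v, of 1]] by (metis zero_less_one)
 then obtain B where B: "!!b. B b >= 0" "!!b e z. cmod (Dd e (Dd b f) z) <= B b * norm e" by metis
 define C where "C = (\<Sum>b\<in>(Basis::c2 set). B b)"
 have "cmod (Dd e' (Dd e f) z) <= C * norm e * norm e'" for e e' z
 proof -
  have "Dd e' (Dd e f) z = (\<Sum>b\<in>Basis. (e \<bullet> b) *\<^sub>R Dd e' (Dd b f) z)"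
   unfolding Dd_commute[OF f, of e'] by (rule Dd_sum_Basis[OF smooth_Dd[OF f]])
  also have "cmod ... <= (\<Sum>b\<in>(Basis::c2 set). norm e * (B b * norm e'))"
   by (intro sum_norm_le) (auto intro!: mult_mono B(2) simp: Basis_le_norm)
  also have "... = C * norm e * norm e'" by (simp add: C_def sum_distrib_left sum_distrib_right mult_ac)
  finally show ?thesis .
 qed
 then show thesis using that[of C] B(1) by (simp add: C_def sum_nonneg)
qed

lemma smooth_vanish_Dd_Lipschitz:
 fixes f :: "c2 => complex"
 assumes f: "smooth f" and v: "vanish r f"
 obtains C where "C >= 0" "!!e x y. cmod (Dd e f x - Dd e f y) <= C * norm e * norm (x - y)"
proof -
 obtain C where C: "C >= 0" "!!e e' z. cmod (Dd e' (Dd e f) z) <= C * norm e * norm e'"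
  using smooth_vanish_D2_bounded[OF f v] by blast
 show thesis by (rule that[OF C(1)]) (rule Dd_bounded_Lipschitz[OF smooth_Dd[OF f] C(2)])
qed

lemma power_expand2:
 fixes x :: complex
 shows "\<exists>d e C. C >= 0 \<and> (\<forall>\<mu>. cmod \<mu> <= 1 \<longrightarrow> cmod ((x + \<mu>) ^ a - (x ^ a + d * \<mu> + e * \<mu>^2)) <= C * cmod \<mu> ^ 3)"
proof (induction a)
 case 0
 show ?case by (intro exI[of _ 0]) simp
next
 case (Suc a)
 then obtain d e C where C: "C >= 0" "!!\<mu>. cmod \<mu> <= 1 ==> cmod ((x + \<mu>) ^ a - (x ^ a + d * \<mu> + e * \<mu>^2)) <= C * cmod \<mu> ^ 3" by blast
 show ?case
 proof (rule exI[of _ "x * d + x ^ a"], rule exI[of _ "x * e + d"], rule exI[of _ "(cmod x + 1) * C + cmod e"], intro conjI allI impI)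
  fix \<mu> :: complex assume m: "cmod \<mu> <= 1"
  have "(x + \<mu>) ^ Suc a - (x ^ Suc a + (x * d + x ^ a) * \<mu> + (x * e + d) * \<mu>^2)
   = (x + \<mu>) * ((x + \<mu>) ^ a - (x ^ a + d * \<mu> + e * \<mu>^2)) + e * \<mu> ^ 3" by (simp add: algebra_simps power2_eq_square power3_eq_cube)
  also have "cmod ... <= cmod (x + \<mu>) * cmod ((x + \<mu>) ^ a - (x ^ a + d * \<mu> + e * \<mu>^2)) + cmod e * cmod \<mu> ^ 3"
   by (rule order_trans[OF norm_triangle_ineq]) (simp add: norm_mult norm_power)
  also have "... <= (cmod x + 1) * (C * cmod \<mu> ^ 3) + cmod e * cmod \<mu> ^ 3"
   using m C(2)[OF m] norm_triangle_ineq[of x \<mu>] by (intro add_right_mono mult_mono) auto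
  finally show "cmod ((x + \<mu>) ^ Suc a - (x ^ Suc a + (x * d + x ^ a) * \<mu> + (x * e + d) * \<mu>^2)) <= ((cmod x + 1) * C + cmod e) * cmod \<mu> ^ 3"
   by (simp add: algebra_simps)
 qed (use C(1) in auto)
qed

text \<open>To second order the orbit is p0 + \<mu> w + \<mu>^2 f. The sub-mean inequality is
  available on the complex line p0 + \<mu> w. The quadratic displacement acts in first order through
  a function of frequency 2, which averages to 0, and the rest is cubic: this is where the error
  term in \<open>asub\<close> comes from.\<close>

lemma asub_curve:
 fixes G :: "c2 => real"
 assumes G: "smooth G" "submean G"
 shows "asub (%l. G (wscale a b l z)) x"
proof -
 obtain d1 f1 C1 where E1: "C1 >= 0" "!!\<mu>. cmod \<mu> <= 1 ==> cmod ((x + \<mu>) ^ a - (x ^ a + d1 * \<mu> + f1 * \<mu>^2)) <= C1 * cmod \<mu> ^ 3"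
  using power_expand2[of x a] by blast
 obtain d2 f2 C2 where E2: "C2 >= 0" "!!\<mu>. cmod \<mu> <= 1 ==> cmod ((x + \<mu>) ^ b - (x ^ b + d2 * \<mu> + f2 * \<mu>^2)) <= C2 * cmod \<mu> ^ 3"
  using power_expand2[of x b] by blast
 define p0 where "p0 = wscale a b x z"
 define w where "w = (d1 * fst z, d2 * snd z)"
 define f where "f = (f1 * fst z, f2 * snd z)"
 define Rm where "Rm \<mu> = wscale a b (x + \<mu>) z - (p0 + rotc \<mu> w + rotc (\<mu>^2) f)" for \<mu>
 define C3 where "C3 = C1 * cmod (fst z) + C2 * cmod (snd z)"
 have C3: "C3 >= 0" using E1 E2 by (simp add: C3_def)
 have Rm: "norm (Rm \<mu>) <= C3 * cmod \<mu> ^ 3" if "cmod \<mu> <= 1" for \<mu>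
 proof -
  have "Rm \<mu> = (((x + \<mu>) ^ a - (x ^ a + d1 * \<mu> + f1 * \<mu>^2)) * fst z, ((x + \<mu>) ^ b - (x ^ b + d2 * \<mu> + f2 * \<mu>^2)) * snd z)"
   by (simp add: Rm_def p0_def wscale_def w_def f_def rotc_def algebra_simps)
  then have "norm (Rm \<mu>) <= cmod ((x + \<mu>) ^ a - (x ^ a + d1 * \<mu> + f1 * \<mu>^2)) * cmod (fst z) + cmod ((x + \<mu>) ^ b - (x ^ b + d2 * \<mu> + f2 * \<mu>^2)) * cmod (snd z)"
   using norm_Pair_le by (metis norm_mult)
  also have "... <= C1 * cmod \<mu> ^ 3 * cmod (fst z) + C2 * cmod \<mu> ^ 3 * cmod (snd z)"
   using E1(2)[OF that] E2(2)[OF that] by (intro add_mono mult_right_mono) auto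
  finally show ?thesis by (simp add: C3_def algebra_simps)
 qed
 define K where "K = norm w + norm f + C3"
 have K: "K >= 0" using C3 by (simp add: K_def)
 have nr: "norm (rotc c v) = cmod c * norm v" for c v
  by (cases v) (simp add: rotc_def norm_Pair norm_mult power_mult_distrib real_sqrt_mult flip: distrib_left)
 \<comment> \<open>The cut-off gives \<open>G\<close> globally bounded derivatives; its radius
   covers all points that occur for |\<mu>| <= 1.\<close>
 define h where "h = (%y. complex_of_real (G y) * cut (norm p0 + K + 2) y)"
 have sh: "smooth h" unfolding h_def by (intro smooth_mult smooth_of_real G smooth_cut)
 have vh: "vanish (1 + (norm p0 + K + 2)) h" unfolding h_def by (rule vanish_mult2[OF vanish_cut])
 have hG: "h y = of_real (G y)" if "norm y <= norm p0 + K" for y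
  using that by (simp add: h_def cut_one)
 obtain T where T: "T >= 0" "!!y v. cmod (h (y + v) - h y - Dd v h y) <= T * (norm v)^2"
  using smooth_vanish_taylor2[OF sh vh] by metis
 obtain Lc where Lc: "Lc >= 0" "!!e x y. cmod (Dd e h x - Dd e h y) <= Lc * norm e * norm (x - y)"
  using smooth_vanish_Dd_Lipschitz[OF sh vh] by metis
 obtain Bd where Bd: "Bd >= 0" "!!e y. cmod (Dd e h y) <= Bd * norm e"
  using smooth_Dd_bounded[OF sh vh] by metis
 define q where "q r t = Re (Dd (rotc ((of_real r * cis t)^2) f) h p0)" for r t
 define C where "C = T * (norm f + C3)^2 + Lc * norm f * norm w + Bd * C3"
 have main: "G (p0 + rotc \<mu> w) <= G (wscale a b (x + \<mu>) z) - q r t + C * r ^ 3"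
  if r: "0 < r" "r < 1" and mu: "\<mu> = of_real r * cis t" for r t \<mu>
 proof -
  have mr: "cmod \<mu> = r" using r mu by (simp add: norm_mult)
  define y where "y = p0 + rotc \<mu> w"
  define v where "v = rotc (\<mu>^2) f + Rm \<mu>"
  have yv: "y + v = wscale a b (x + \<mu>) z" by (simp add: y_def v_def Rm_def)
  have r32: "r ^ 3 <= r^2" "r^2 <= r" "r ^ 4 <= r ^ 3" "r^2 <= 1"
   using r power_decreasing[of 2 3 r] power_decreasing[of 1 2 r] power_decreasing[of 3 4 r] power_decreasing[of 0 2 r] by simp_all
  have nR: "norm (Rm \<mu>) <= C3 * r ^ 3" using Rm[of \<mu>] mr r by simp
  have nv: "norm v <= (norm f + C3) * r^2"
  proof -
   have "norm v <= r^2 * norm f + C3 * r ^ 3" unfolding v_def using norm_triangle_ineq[of "rotc (\<mu>^2) f" "Rm \<mu>"] nR mr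
    by (simp add: nr norm_power)
   also have "... <= r^2 * norm f + C3 * r^2" using r32 C3 by (intro add_left_mono mult_left_mono) auto
   finally show ?thesis by (simp add: algebra_simps)
  qed
  have ny: "norm y <= norm p0 + r * norm w" unfolding y_def using norm_triangle_ineq[of p0 "rotc \<mu> w"] mr by (simp add: nr)
  have rw: "r * norm w <= norm w" using r by (simp add: mult_left_le_one_le)
  have ny1: "norm y <= norm p0 + K" using ny rw C3 norm_ge_zero[of f] unfolding K_def by linarith
  have ny2: "norm (y + v) <= norm p0 + K"
  proof -
   have "(norm f + C3) * r^2 <= (norm f + C3) * 1" using r32 C3 by (intro mult_left_mono) auto
   then have "(norm f + C3) * r^2 <= norm f + C3" by simp
   then show ?thesis using norm_triangle_ineq[of y v] ny rw nv unfolding K_def by linarith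
  qed
  have t1: "cmod (h (y + v) - h y - Dd v h y) <= T * (norm f + C3)^2 * r ^ 3"
  proof -
   have "(norm v)^2 <= ((norm f + C3) * r^2)^2" using nv by (intro power_mono) auto
   also have "... = (norm f + C3)^2 * r ^ 4" by (simp add: power_mult_distrib)
   also have "... <= (norm f + C3)^2 * r ^ 3" using r32 by (intro mult_left_mono) auto
   finally have "T * (norm v)^2 <= T * ((norm f + C3)^2 * r ^ 3)" using T(1) by (intro mult_left_mono)
   then show ?thesis using T(2)[of y v] by simp
  qed
  have Dv: "Dd v h y = Dd (rotc (\<mu>^2) f) h y + Dd (Rm \<mu>) h y"
   unfolding v_def by (rule linear_add[OF bounded_linear.linear[OF smooth_linear_Dd[OF sh]]])
  have t2: "cmod (Dd (Rm \<mu>) h y) <= Bd * C3 * r ^ 3"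
   using Bd(2)[of "Rm \<mu>" y] mult_left_mono[OF nR Bd(1)] by simp
  have t3: "cmod (Dd (rotc (\<mu>^2) f) h y - Dd (rotc (\<mu>^2) f) h p0) <= Lc * norm f * norm w * r ^ 3"
  proof -
   have "norm (rotc (\<mu>^2) f) = r^2 * norm f" "norm (y - p0) = r * norm w" using mr by (simp_all add: nr norm_power y_def)
   then show ?thesis using Lc(2)[of "rotc (\<mu>^2) f" y p0] by (simp add: power2_eq_square power3_eq_cube mult_ac)
  qed
  define A where "A = (h (y + v) - h y - Dd v h y) + Dd (Rm \<mu>) h y + (Dd (rotc (\<mu>^2) f) h y - Dd (rotc (\<mu>^2) f) h p0)"
  have "h (y + v) - h y = Dd (rotc (\<mu>^2) f) h p0 + A" by (simp add: A_def Dv)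
  then have "Re (h (y + v)) - Re (h y) = q r t + Re A" by (simp add: q_def mu flip: minus_complex.sel plus_complex.sel)
  moreover have "cmod A <= C * r ^ 3"
  proof -
   have "cmod A <= cmod (h (y + v) - h y - Dd v h y) + cmod (Dd (Rm \<mu>) h y) + cmod (Dd (rotc (\<mu>^2) f) h y - Dd (rotc (\<mu>^2) f) h p0)"
    unfolding A_def by (meson add_right_mono norm_triangle_ineq order_trans)
   also have "... <= C * r ^ 3" using t1 t2 t3 by (simp add: C_def algebra_simps)
   finally show ?thesis .
  qed
  then have "- (C * r ^ 3) <= Re A" using abs_Re_le_cmod[of A] by linarith
  moreover have "Re (h (y + v)) = G (wscale a b (x + \<mu>) z)" "Re (h y) = G (p0 + rotc \<mu> w)"
   using hG[OF ny1] hG[OF ny2] unfolding yv by (simp_all add: y_def)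
  ultimately show ?thesis by linarith
 qed
 \<comment> \<open>The square of \<open>cis t\<close> contributes cos 2t and sin 2t, the real parts
   of z^2 and of - i z^2 on the unit circle, so that the mean value property applies.\<close>
 have q0: "circ (q r) = 0" for r
 proof -
  have rl: "rotc ((of_real r * cis t)^2) f = (r^2 * cos (2 * t)) *\<^sub>R f + (r^2 * sin (2 * t)) *\<^sub>R ii f" for t
  proof -
   have "(of_real r * cis t)^2 = of_real (r^2 * cos (2 * t)) + \<i> * of_real (r^2 * sin (2 * t))"
    unfolding cos_double sin_double by (simp add: power_mult_distrib complex_eq_iff cis.ctr Re_power2 Im_power2 power2_eq_square algebra_simps)
   then show ?thesis by (cases f) (simp add: rotc_def ii_def scaleR_conv_of_real algebra_simps)
  qed
  define A where "A = Re (Dd f h p0)"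
  define B where "B = Re (Dd (ii f) h p0)"
  have qe: "q r t = r^2 * (A * Re ((0 + of_real 1 * cis t)^2) + B * Re (- \<i> * (0 + of_real 1 * cis t)^2))" for t
  proof -
   interpret bl: bounded_linear "%e. Dd e h p0" by (rule smooth_linear_Dd[OF sh])
   show ?thesis
    unfolding q_def rl bl.add bl.scaleR cos_double sin_double by (simp add: A_def B_def Re_power2 Im_power2 algebra_simps)
  qed
  have c1: "circ (%t. Re ((0 + of_real 1 * cis t)^2)) = 0" by (subst circ_Re_holo[of "%z. z^2" 0 1]) (auto intro!: holomorphic_intros)
  have c2: "circ (%t. Re (- \<i> * (0 + of_real 1 * cis t)^2)) = 0"
   by (subst circ_Re_holo[of "%z. - \<i> * z^2" 0 1]) (auto intro!: holomorphic_intros)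
  have "circ (q r) = r^2 * (A * circ (%t. Re ((0 + of_real 1 * cis t)^2)) + B * circ (%t. Re (- \<i> * (0 + of_real 1 * cis t)^2)))"
   unfolding qe[abs_def] circ_cmult by (subst circ_add) (auto intro!: continuous_intros simp del: mult_minus_left simp: circ_cmult)
  then show ?thesis using c1 c2 by simp
 qed
 have cq: "continuous_on {0..2*pi} (q r)" for r
 proof -
  interpret bl: bounded_linear "%e. Dd e h p0" by (rule smooth_linear_Dd[OF sh])
  show ?thesis unfolding q_def rotc_def by (intro continuous_intros bl.continuous_on)
 qed
 show ?thesis
  unfolding asub_def
 proof (rule exI[of _ C], rule exI[of _ 1], intro conjI allI impI)
  fix r :: real assume r: "0 < r \<and> r < 1"
  have cG: "continuous_on UNIV G" by (rule smooth_continuous[OF G(1)])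
  have cc: "continuous_on {0..2*pi} (%t. G (wscale a b (x + of_real r * cis t) z))"
   by (rule continuous_on_compose2[OF cG]) (auto simp: wscale_def intro!: continuous_intros)
  have "G p0 <= cmean G p0 (rotc (of_real r) w)" by (rule submeanD[OF G(2)])
  also have "... = circ (%t. G (p0 + rotc (of_real r * cis t) w))"
   unfolding cmean_circ cline_rotc by (simp add: rotc_def mult_ac)
  also have "... <= circ (%t. (G (wscale a b (x + of_real r * cis t) z) - q r t) + C * r ^ 3)"
  proof (rule circ_mono)
   show "continuous_on {0..2*pi} (%t. G (p0 + rotc (of_real r * cis t) w))"
    by (rule continuous_on_compose2[OF cG]) (auto simp: rotc_def intro!: continuous_intros)
   show "continuous_on {0..2*pi} (%t. (G (wscale a b (x + of_real r * cis t) z) - q r t) + C * r ^ 3)" by (intro continuous_intros cc cq)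
   show "G (p0 + rotc (of_real r * cis t) w) <= (G (wscale a b (x + of_real r * cis t) z) - q r t) + C * r ^ 3" for t
    using main[OF _ _ refl, of r t] r by simp
  qed
  also have "... = circ (%t. G (wscale a b (x + of_real r * cis t) z)) + C * r ^ 3"
   using circ_add[OF continuous_on_diff[OF cc cq], of "%_. C * r ^ 3"] circ_diff[OF cc cq] q0 by simp
  finally show "G (wscale a b x z) <= circ (%t. G (wscale a b (x + of_real r * cis t) z)) + C * r ^ 3" by (simp add: p0_def)
 qed auto
qed

lemma cmod_fst: "cmod (fst (z :: c2)) <= norm z" and cmod_snd: "cmod (snd z) <= norm z"
 by (metis norm_fst_le prod.collapse, metis norm_snd_le prod.collapse)

section \<open>The extremal function through real competitors\<close>

definition usc :: "(c2 => real) => bool" where "usc f \<longleftrightarrow> (\<forall>c. open {z. f z < c})"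

lemma usc_continuous: "continuous_on UNIV f ==> usc f"
 unfolding usc_def by (auto intro: open_Collect_less)

lemma usc_borel: "usc f ==> f \<in> borel_measurable borel"
 unfolding usc_def borel_measurable_iff_less by (auto intro: borel_open)

text \<open>Nonnegative real competitors in the definition of the extremal function: replacing \<open>u\<close> by \<open>max 0 u\<close>
  does not change the supremum.\<close>

definition comp :: "(c2 => real) => c2 set => (c2 => real) set" where
 "comp H K = {f. (\<forall>z. 0 <= f z) \<and> usc f \<and> submean f \<and> (\<exists>c. \<forall>z. f z <= H z + c) \<and> (\<forall>z\<in>K. f z = 0)}"

lemma compD:
 assumes "f \<in> comp H K"
 shows "0 <= f z" "usc f" "submean f" "\<exists>c. \<forall>z. f z <= H z + c" "z \<in> K ==> f z = 0"
 using assms unfolding comp_def by blast+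

lemma lbr_usc:
 assumes H: "continuous_on UNIV H" and f: "!!z. 0 <= f z" "usc f" "\<exists>c. \<forall>z. f z <= H z + c"
 shows "lbr f"
proof -
 obtain c where c: "!!z. f z <= H z + c" using f(3) by blast
 have "\<exists>B. \<forall>z. norm z <= R \<longrightarrow> \<bar>f z\<bar> <= B" for R
 proof -
  obtain B where B: "!!z. norm z <= R ==> \<bar>H z\<bar> <= B" using lbr_bound[OF lbr_continuous[OF H]] by metis
  have "\<bar>f z\<bar> <= B + c" if "norm z <= R" for z using B[OF that] c[of z] f(1)[of z] by linarith
  then show ?thesis by blast
 qed
 then show ?thesis unfolding lbr_def using usc_borel[OF f(2)] by blast
qed

lemma comp_lbr: "continuous_on UNIV H ==> f \<in> comp H K ==> lbr f"
 using lbr_usc compD by metis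

lemma cmean_integrable:
 assumes "lbr f" shows "set_integrable lborel {0..2*pi} (%t. f (cline z w (cis t)))"
proof -
 have l: "lbr (%t. f (cline z w (cis t)))" by (rule lbr_compose[OF assms]) (intro continuous_cline continuous_intros)
 note [measurable] = lbr_borel[OF l]
 obtain B where B: "B >= 0" "!!t. norm t <= 2 * pi ==> \<bar>f (cline z w (cis t))\<bar> <= B" using lbr_bound[OF l] by metis
 show ?thesis unfolding set_integrable_def
 proof (rule Bochner_Integration.integrable_bound[where f="%t. indicat_real {0..2*pi} t *\<^sub>R B"])
  show "AE t in lborel. norm (indicat_real {0..2*pi} t *\<^sub>R f (cline z w (cis t))) <= norm (indicat_real {0..2*pi} t *\<^sub>R B)"
   using B by (auto simp: indicator_def)
 qed auto
qed

lemma cmean_mono: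
 assumes "lbr f" "lbr g" "!!z. f z <= g z" shows "cmean f z w <= cmean g z w"
 unfolding cmean_def by (intro divide_right_mono set_integral_mono cmean_integrable assms) auto

lemma cmean_nonneg: "(!!z. 0 <= f z) ==> 0 <= cmean f z w"
 unfolding cmean_def set_lebesgue_integral_def by (intro divide_nonneg_nonneg Bochner_Integration.integral_nonneg) auto

lemma cmean_diff_const:
 assumes "lbr f" shows "cmean (%z. f z - c) z w = cmean f z w - c"
proof -
 have "(LINT t:{0..2*pi}|lborel. f (cline z w (cis t)) - c) = (LINT t:{0..2*pi}|lborel. f (cline z w (cis t))) - (LINT t:{0..2*pi}|lborel. c)"
  by (rule set_integral_diff(2)[OF cmean_integrable[OF assms]]) (simp add: set_integrable_def)
 then show ?thesis by (simp add: cmean_def set_integral_const diff_divide_distrib)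
qed

lemma submean_max:
 assumes f: "lbr f" "submean f" and g: "lbr g" "submean g" and m: "lbr (%z. max (f z) (g z))"
 shows "submean (%z. max (f z) (g z))"
 unfolding submean_def
proof (intro allI)
 fix z w
 have "f z <= cmean (%z. max (f z) (g z)) z w" by (rule order_trans[OF submeanD[OF f(2)] cmean_mono[OF f(1) m]]) simp
 moreover have "g z <= cmean (%z. max (f z) (g z)) z w" by (rule order_trans[OF submeanD[OF g(2)] cmean_mono[OF g(1) m]]) simp
 ultimately show "max (f z) (g z) <= cmean (%z. max (f z) (g z)) z w" by simp
qed

lemma submean_cmult: assumes "submean f" "0 <= c" shows "submean (%z. c * f z)"
 unfolding submean_def
proof (intro allI)
 fix z w
 have "cmean (%z. c * f z) z w = c * cmean f z w" by (simp add: cmean_def)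
 then show "c * f z <= cmean (%z. c * f z) z w" using submeanD[OF assms(1)] assms(2) by (simp add: mult_left_mono)
qed

lemma submean_zero: "submean (%_. 0)" by (simp add: submean_def cmean_def)

lemma nn_circle:
 assumes f: "lbr f" "!!z. 0 <= f z"
 shows "(\<integral>\<^sup>+t\<in>{0..2*pi}. ennreal (f (cline z w (cis t))) \<partial>lborel) = ennreal (2 * pi * cmean f z w)"
proof -
 have i: "integrable lborel (%t. indicator {0..2*pi} t *\<^sub>R f (cline z w (cis t)))"
  using cmean_integrable[OF f(1)] unfolding set_integrable_def .
 have "(\<integral>\<^sup>+t\<in>{0..2*pi}. ennreal (f (cline z w (cis t))) \<partial>lborel) = (\<integral>\<^sup>+t. ennreal (indicator {0..2*pi} t *\<^sub>R f (cline z w (cis t))) \<partial>lborel)"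
  by (rule nn_integral_cong) (auto simp: indicator_def)
 also have "... = ennreal (LINT t|lborel. indicator {0..2*pi} t *\<^sub>R f (cline z w (cis t)))"
  by (rule nn_integral_eq_integral[OF i]) (use f(2) in auto)
 finally show ?thesis by (simp add: cmean_def set_lebesgue_integral_def)
qed

lemma Lclass_comp:
 assumes H: "continuous_on UNIV H" "!!z. 0 <= H z" and u: "u \<in> Lclass H" "!!w. w \<in> K ==> u w <= 0"
 obtains f where "f \<in> comp H K" "!!z. u z <= ereal (f z)"
proof -
 define f where "f z = real_of_ereal (max 0 (u z))" for z
 have p: "psh u" using u(1) by (simp add: Lclass_def)
 obtain c where c: "!!z. u z <= ereal (H z + c)" using u(1) unfolding Lclass_def by blast
 have ui: "u z < \<infinity>" for z using p unfolding psh_def by blast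
 have ef: "ereal (f z) = max 0 (u z)" for z proof -
  have "\<bar>max 0 (u z)\<bar> ~= \<infinity>" using ui[of z] by (cases "u z") (auto simp: max_def)
  then show ?thesis unfolding f_def by (simp add: ereal_real')
 qed
 have f0: "0 <= f z" for z using ef[of z] by (metis ereal_less_eq(5) max.cobounded1)
 have fc: "f z <= H z + \<bar>c\<bar>" for z
 proof -
  have "ereal (f z) <= ereal (H z + \<bar>c\<bar>)"
   unfolding ef using c[of z] H(2)[of z] order_trans[OF c[of z], of "ereal (H z + \<bar>c\<bar>)"] by auto
  then show ?thesis by simp
 qed
 have us: "usc f"
  unfolding usc_def
 proof (intro allI)
  fix d
  show "open {z. f z < d}"
  proof (subst openI, goal_cases)
   case (1 z)
   then have d: "f z < d" by simp
   have "0 < d" using d f0[of z] by linarith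
   have "u z < ereal d" using d ef[of z] by (metis less_ereal.simps(1) max_less_iff_conj)
   moreover have "Limsup (at z) u <= u z" using p unfolding psh_def by blast
   ultimately have "eventually (%x. u x < ereal d) (at z)" by (intro Limsup_lessD) (rule le_less_trans)
   then have "eventually (%x. u x < ereal d) (nhds z)"
    using \<open>u z < ereal d\<close> by (simp add: eventually_nhds_conv_at)
   then obtain T where T: "open T" "z \<in> T" "!!x. x \<in> T ==> u x < ereal d" unfolding eventually_nhds by blast
   have "f x < d" if "x \<in> T" for x
    using T(3)[OF that] \<open>0 < d\<close> ef[of x] by (metis less_ereal.simps(1) max_less_iff_conj zero_ereal_def)
   then have "T \<subseteq> {z. f z < d}" by blast
   then show ?case using T(1,2) by (meson open_contains_ball subset_trans)
  qed simp
 qed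
 have lb: "lbr f" by (rule lbr_usc[OF H(1) f0 us]) (use fc in blast)
 have "submean f"
  unfolding submean_def
 proof (intro allI)
  fix z w
  show "f z <= cmean f z w"
  proof (cases "f z = 0")
   case True then show ?thesis using cmean_nonneg[of f z w, OF f0] by simp
  next
   case False
   \<comment> \<open>Where \<open>f\<close> is positive it equals \<open>u\<close>, and dropping the
     negative part of the circle integral of \<open>u\<close> only enlarges it.\<close>
   then have uz: "ereal (f z) = u z" using ef[of z] by (metis max_def zero_ereal_def ereal.inject)
   have "u (cline z w 0) <= circle_mean (%t. u (cline z w t)) 0 1" using p unfolding psh_def by (metis zero_less_one)
   then have "u z <= eintegral {0..2*pi} (%\<theta>. u (cline z w (cis \<theta>))) / ereal (2 * pi)" by (simp add: circle_mean_def cline_def)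
   also have "... <= ereal (2 * pi * cmean f z w) / ereal (2 * pi)"
   proof (rule ereal_divide_right_mono)
    have "(\<integral>\<^sup>+x\<in>{0..2*pi}. e2ennreal (max 0 (u (cline z w (cis x)))) \<partial>lborel) = ennreal (2 * pi * cmean f z w)"
     using nn_circle[OF lb f0, of z w] by (simp flip: ef)
    then show "eintegral {0..2*pi} (%\<theta>. u (cline z w (cis \<theta>))) <= ereal (2 * pi * cmean f z w)"
     unfolding eintegral_def using cmean_nonneg[of f z w, OF f0] by (simp add: ereal_diff_le_self enn2ereal_nonneg)
   qed simp
   also have "... = ereal (cmean f z w)" by simp
   finally show ?thesis using uz by (metis ereal_less_eq(3))
  qed
 qed
 moreover have "f z = 0" if "z \<in> K" for z using u(2)[OF that] by (simp add: f_def max_def)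
 ultimately have "f \<in> comp H K" unfolding comp_def using f0 us fc by blast
 moreover have "u z <= ereal (f z)" for z by (simp add: ef)
 ultimately show thesis by (rule that)
qed

text \<open>For a nonnegative function the negative part of the extended integral is 0, and a circle
  of radius \<open>r\<close> about any centre is a unit circle in a rescaled direction.\<close>

lemma comp_Lclass:
 assumes H: "continuous_on UNIV H" and f: "f \<in> comp H K"
 shows "(%z. ereal (f z)) \<in> Lclass H"
proof -
 have lb: "lbr f" by (rule comp_lbr[OF assms])
 have "Limsup (at z) (%z. ereal (f z)) <= ereal (f z)" for z
 proof (rule ereal_le_epsilon2)
  fix e :: real assume "0 < e"
  then have "z \<in> {x. f x < f z + e}" "open {x. f x < f z + e}" using compD(2)[OF f] by (auto simp: usc_def)
  then have "eventually (%x. f x < f z + e) (at z)" by (metis (mono_tags) eventually_at_topological mem_Collect_eq)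
  then show "Limsup (at z) (%z. ereal (f z)) <= ereal (f z) + ereal e" by (intro Limsup_bounded) (auto elim: eventually_mono)
 qed
 moreover have "ereal (f (cline z w c)) <= circle_mean (%t. ereal (f (cline z w t))) c r" if "r > 0" for z w c r
 proof -
  have cl: "cline z w (c + of_real r * cis t) = cline (cline z w c) (rotc (of_real r) w) (cis t)" for t
   by (simp add: cline_def rotc_def algebra_simps)
  have e0: "e2ennreal 0 = 0" using e2ennreal_ereal[of 0, folded zero_ereal_def] by simp
  have n: "max 0 (- ereal (f x)) = 0" "max 0 (ereal (f x)) = ereal (f x)" for x
   using compD(1)[OF f, of x] by (auto simp: max_def)
  have "circle_mean (%t. ereal (f (cline z w t))) c r = ereal (cmean f (cline z w c) (rotc (of_real r) w))"
   unfolding circle_mean_def eintegral_def n cl e2ennreal_ereal nn_circle[OF lb compD(1)[OF f]]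
   using cmean_nonneg[of f, OF compD(1)[OF f]] by (simp add: e0 zero_ennreal.rep_eq)
  then show ?thesis using submeanD[OF compD(3)[OF f]] by simp
 qed
 ultimately have "psh (%z. ereal (f z))" unfolding psh_def by simp
 then show ?thesis using compD(4)[OF f] by (simp add: Lclass_def)
qed

lemma Vext_upper:
 assumes "continuous_on UNIV H" "f \<in> comp H K" shows "ereal (f z) <= Vext H K z"
 unfolding Vext_def using comp_Lclass[OF assms] compD(5)[OF assms(2)] by (intro Sup_upper) (auto intro!: exI[of _ "%z. ereal (f z)"])

lemma Vext_least:
 assumes "continuous_on UNIV H" "!!z. 0 <= H z" "!!f. f \<in> comp H K ==> ereal (f z) <= x"
 shows "Vext H K z <= x"
 unfolding Vext_def
proof (rule Sup_least)
 fix y assume "y \<in> {u z |u. u \<in> Lclass H \<and> (\<forall>w\<in>K. u w <= 0)}"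
 then obtain u where u: "y = u z" "u \<in> Lclass H" "!!w. w \<in> K ==> u w <= 0" by blast
 obtain f where "f \<in> comp H K" "u z <= ereal (f z)" using Lclass_comp[OF assms(1,2) u(2,3)] by metis
 then show "y <= x" using assms(3) u(1) order_trans by metis
qed

lemma comp_zero: "(!!z. 0 <= H z) ==> (%_. 0) \<in> comp H K"
 unfolding comp_def by (auto intro!: usc_continuous submean_zero exI[of _ 0])

lemma continuous_logplus_comp: "continuous_on S f ==> continuous_on S (%x. logplus (f x))"
 by (rule continuous_on_compose2[OF continuous_logplus]) auto

lemma continuous_H_C: "continuous_on UNIV (H_C a b)"
 unfolding H_C_def[abs_def] by (intro continuous_intros continuous_logplus_comp)

lemma continuous_H_Sigma: "continuous_on UNIV H_Sigma"
 unfolding H_Sigma_def[abs_def] by (intro continuous_intros continuous_logplus_comp)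

lemma H_C_nonneg [simp]: "0 <= H_C a b z" by (simp add: H_C_def le_max_iff_disj)
lemma H_Sigma_nonneg [simp]: "0 <= H_Sigma z" by (simp add: H_Sigma_def le_max_iff_disj)

lemma logplus_eq: "logplus x = ln (max 1 x)" by (auto simp: logplus_def max_def)

lemma logplus_mult_le:
 assumes "0 <= x" "0 <= y" "0 <= s" "x <= s * max 1 y" shows "logplus x <= logplus s + logplus y"
proof -
 have "max 1 x <= max 1 s * max 1 y"
 proof -
  have "s * max 1 y <= max 1 s * max 1 y" by (intro mult_right_mono) auto
  moreover have "1 * 1 <= max 1 s * max 1 y" by (intro mult_mono) auto
  ultimately show ?thesis using assms(4) by simp
 qed
 then have "ln (max 1 x) <= ln (max 1 s * max 1 y)" by (subst ln_le_cancel_iff) (auto simp: zero_less_mult_iff)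
 also have "... = ln (max 1 s) + ln (max 1 y)" by (rule ln_mult_pos) auto
 finally show ?thesis by (simp add: logplus_eq)
qed

lemma H_C_affine: "\<exists>c\<ge>0. \<forall>z h. norm h <= B \<longrightarrow> H_C a b (\<alpha> * fst z + fst h, \<beta> * snd z + snd h) <= H_C a b z + c"
proof -
 define s where "s = cmod \<alpha> + cmod \<beta> + \<bar>B\<bar>"
 define c where "c = (real a + real b) * logplus s"
 have c0: "0 <= c" by (simp add: c_def)
 have "H_C a b (\<alpha> * fst z + fst h, \<beta> * snd z + snd h) <= H_C a b z + c" if "norm h <= B" for z h
 proof -
  have *: "logplus (cmod (\<gamma> * x + k)) <= logplus s + logplus (cmod x)" if "cmod \<gamma> + cmod k <= s" for \<gamma> x k
  proof (rule logplus_mult_le)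
   have "cmod (\<gamma> * x + k) <= cmod \<gamma> * cmod x + cmod k" using norm_triangle_ineq[of "\<gamma> * x" k] by (simp add: norm_mult)
   also have "... <= cmod \<gamma> * max 1 (cmod x) + cmod k * max 1 (cmod x)" by (intro add_mono mult_left_mono) (auto simp: mult_le_cancel_left1)
   also have "... <= s * max 1 (cmod x)" using that by (subst distrib_right[symmetric]) (intro mult_right_mono, auto)
   finally show "cmod (\<gamma> * x + k) <= s * max 1 (cmod x)" .
  qed (auto simp: s_def)
  have h: "cmod (fst h) <= B" "cmod (snd h) <= B" using that cmod_fst[of h] cmod_snd[of h] by linarith+
  have 1: "logplus (cmod (\<alpha> * fst z + fst h)) <= logplus s + logplus (cmod (fst z))"
   by (rule *) (use h(1) in \<open>simp add: s_def\<close>, use norm_ge_zero[of \<beta>] in linarith)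
  have 2: "logplus (cmod (\<beta> * snd z + snd h)) <= logplus s + logplus (cmod (snd z))"
   by (rule *) (use h(2) in \<open>simp add: s_def\<close>, use norm_ge_zero[of \<alpha>] in linarith)
  have "real b * logplus (cmod (\<alpha> * fst z + fst h)) <= real b * logplus s + real b * logplus (cmod (fst z))"
   using mult_left_mono[OF 1, of "real b"] by (simp add: distrib_left)
  moreover have "real a * logplus (cmod (\<beta> * snd z + snd h)) <= real a * logplus s + real a * logplus (cmod (snd z))"
   using mult_left_mono[OF 2, of "real a"] by (simp add: distrib_left)
  moreover have "real b * logplus s <= c" "real a * logplus s <= c" by (auto simp: c_def distrib_right)
  ultimately show ?thesis unfolding H_C_def fst_conv snd_conv by linarith
 qed
 then show ?thesis using c0 by blast
qed

lemma submean_logplus_poly: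
 assumes "!!z w. \<exists>q :: complex poly. \<forall>t. F (cline z w t) = poly q t"
 shows "submean (%z. logplus (cmod (F z)))"
 unfolding submean_def
proof (intro allI)
 fix z w
 obtain q where q: "!!t. F (cline z w t) = poly q t" using assms by blast
 have "F z = poly q 0" using q[of 0] by (simp add: cline_def)
 then show "logplus (cmod (F z)) <= cmean (%z. logplus (cmod (F z))) z w"
  unfolding cmean_circ q using logplus_poly_mean[of q] by simp
qed

section \<open>Stability and continuity of the extremal function\<close>

locale pluri =
 fixes a b :: nat and K :: "c2 set"
 assumes ab: "0 < a" "0 < b" and K: "compact K" and reg: "regular K"
begin

definition V :: "c2 => real" where "V z = real_of_ereal (Vext (H_C a b) K z)"
definition VS :: "c2 => real" where "VS z = real_of_ereal (Vext H_Sigma K z)"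
definition mab :: real where "mab = max (real a) (real b)"

lemma mab: "mab > 0" using ab by (simp add: mab_def less_max_iff_disj)

lemma Vext_Sigma: "Vext H_Sigma K z = ereal (VS z)"
proof -
 have "\<bar>Vext H_Sigma K z\<bar> ~= \<infinity>" by (rule reg[unfolded regular_def, THEN conjunct1, THEN spec])
 then show ?thesis by (auto simp: VS_def ereal_real')
qed

lemma continuous_VS: "continuous_on UNIV VS"
 using reg unfolding regular_def VS_def by blast

lemma VS_upper: "f \<in> comp H_Sigma K ==> f z <= VS z"
 using Vext_upper[OF continuous_H_Sigma, of f K z] by (simp add: Vext_Sigma)

lemma VS_nonneg: "0 <= VS z" by (rule VS_upper[OF comp_zero]) simp

lemma VS_K: "z \<in> K ==> VS z = 0"
 using Vext_least[OF continuous_H_Sigma, of K z 0] VS_nonneg[of z] by (simp add: Vext_Sigma compD(5))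

text \<open>\<open>H_C\<close> is at most \<open>mab\<close> times \<open>H_Sigma\<close>, so a
  competitor divided by \<open>mab\<close> competes for the simplex. This transfers the hypothesis
  of regularity to the triangle.\<close>

lemma comp_le_VS:
 assumes f: "f \<in> comp (H_C a b) K" shows "f z <= mab * VS z"
proof -
 obtain c where c: "!!z. f z <= H_C a b z + c" using compD(4)[OF f] by blast
 have HH: "H_C a b z <= mab * H_Sigma z" for z
  unfolding H_C_def H_Sigma_def mab_def by (auto intro!: mult_mono simp: le_max_iff_disj)
 have "(%z. inverse mab * f z) \<in> comp H_Sigma K"
  unfolding comp_def mem_Collect_eq
 proof (intro conjI allI ballI)
  show "0 <= inverse mab * f z" for z using mab compD(1)[OF f] by simp
  show "usc (%z. inverse mab * f z)"
   unfolding usc_def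
  proof
   fix d
   have "{z. inverse mab * f z < d} = {z. f z < mab * d}" using mab by (auto simp: field_simps)
   then show "open {z. inverse mab * f z < d}" using compD(2)[OF f] by (simp add: usc_def)
  qed
  show "submean (%z. inverse mab * f z)" using mab by (intro submean_cmult compD(3)[OF f]) simp
  show "\<exists>c. \<forall>z. inverse mab * f z <= H_Sigma z + c"
  proof (intro exI allI)
   fix z
   have "inverse mab * f z <= inverse mab * (mab * H_Sigma z + c)"
    using c[of z] HH[of z] mab by (intro mult_left_mono) auto
   then show "inverse mab * f z <= H_Sigma z + inverse mab * c"
    using mab by (simp add: distrib_left mult.assoc[symmetric])
  qed
  show "inverse mab * f z = 0" if "z \<in> K" for z using compD(5)[OF f that] by simp
 qed
 from VS_upper[OF this, of z] show ?thesis using mab by (simp add: field_simps)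
qed

lemma Vext_V: "Vext (H_C a b) K z = ereal (V z)"
proof -
 have "Vext (H_C a b) K z <= ereal (mab * VS z)" by (rule Vext_least[OF continuous_H_C]) (auto intro: comp_le_VS)
 moreover have "ereal 0 <= Vext (H_C a b) K z" by (rule Vext_upper[OF continuous_H_C comp_zero]) simp
 ultimately have "\<bar>Vext (H_C a b) K z\<bar> ~= \<infinity>" by (cases "Vext (H_C a b) K z") auto
 then show ?thesis by (auto simp: V_def ereal_real')
qed

lemma V_upper: "f \<in> comp (H_C a b) K ==> f z <= V z"
 using Vext_upper[OF continuous_H_C, of f a b K z] by (simp add: Vext_V)

lemma V_least: "(!!f. f \<in> comp (H_C a b) K ==> f z <= x) ==> V z <= x"
 using Vext_least[OF continuous_H_C, of a b K z "ereal x"] by (simp add: Vext_V)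

lemma V_nonneg: "0 <= V z" by (rule V_upper[OF comp_zero]) simp

lemma V_le_VS: "V z <= mab * VS z" by (rule V_least[OF comp_le_VS])

lemma V_K: "z \<in> K ==> V z = 0" using V_le_VS[of z] VS_K[of z] V_nonneg[of z] by simp

lemma V_near_K:
 assumes "\<epsilon> > 0"
 obtains \<delta> where "\<delta> > 0" "!!x z. x \<in> K ==> norm (z - x) <= \<delta> ==> V z <= \<epsilon>"
proof -
 have "open {z. VS z < \<epsilon> / mab}" by (intro open_Collect_less continuous_VS continuous_intros)
 moreover have "K \<subseteq> {z. VS z < \<epsilon> / mab}" using VS_K assms mab by auto
 ultimately obtain \<delta> where d: "\<delta> > 0" "(\<Union>x\<in>K. cball x \<delta>) \<subseteq> {z. VS z < \<epsilon> / mab}"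
  using compact_subset_open_imp_cball_epsilon_subset[OF K] by metis
 have "V z <= \<epsilon>" if "x \<in> K" "norm (z - x) <= \<delta>" for x z
 proof -
  have "z \<in> (\<Union>x\<in>K. cball x \<delta>)" using that by (auto simp: dist_norm norm_minus_commute)
  then have "VS z < \<epsilon> / mab" using d(2) by blast
  then have "mab * VS z <= \<epsilon>" using mab by (simp add: field_simps)
  then show ?thesis using V_le_VS[of z] by linarith
 qed
 then show thesis using that d(1) by blast
qed

definition aff :: "complex => complex => c2 => c2 => c2" where
 "aff \<alpha> \<beta> h z = (\<alpha> * fst z + fst h, \<beta> * snd z + snd h)"

lemma continuous_aff: "continuous_on S (aff \<alpha> \<beta> h)"
 unfolding aff_def[abs_def] by (intro continuous_intros)

text \<open>Composing a competitor with the affine map, lowering it by \<epsilon> and truncating at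
  0 yields a competitor again. A bound on \<open>K\<close> alone thus becomes a bound on all of C^2,
  uniform in the point.\<close>

lemma V_aff:
 assumes e: "\<epsilon> >= 0" and k: "!!z. z \<in> K ==> V (aff \<alpha> \<beta> h z) <= \<epsilon>"
 shows "V (aff \<alpha> \<beta> h z) <= V z + \<epsilon>"
proof (rule V_least)
 fix f assume f: "f \<in> comp (H_C a b) K"
 have lf: "lbr f" by (rule comp_lbr[OF continuous_H_C f])
 define F where "F z = max 0 (f (aff \<alpha> \<beta> h z) - \<epsilon>)" for z
 have lg: "lbr (%z. f (aff \<alpha> \<beta> h z))" by (rule lbr_compose[OF lf continuous_aff])
 obtain c where c: "!!z. f z <= H_C a b z + c" using compD(4)[OF f] by blast
 obtain d where d: "d >= 0" "!!z. H_C a b (aff \<alpha> \<beta> h z) <= H_C a b z + d" using H_C_affine[of "norm h" a b \<alpha> \<beta>] by (auto simp: aff_def)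
 have FH: "F z <= H_C a b z + (\<bar>c\<bar> + d)" for z
  using c[of "aff \<alpha> \<beta> h z"] d(1) d(2)[of z] e H_C_nonneg[of a b z] unfolding F_def by linarith
 have us: "usc F"
  unfolding usc_def
 proof
  fix s
  have "{z. F z < s} = (if s <= 0 then {} else aff \<alpha> \<beta> h -` {z. f z < s + \<epsilon>})" by (auto simp: F_def max_def)
  moreover have "open (aff \<alpha> \<beta> h -` {z. f z < s + \<epsilon>})"
   using compD(2)[OF f] by (intro open_vimage continuous_aff) (simp add: usc_def)
  ultimately show "open {z. F z < s}" by simp
 qed
 have lF: "lbr F" by (rule lbr_usc[OF continuous_H_C _ us]) (use FH in \<open>auto simp: F_def\<close>)
 have "submean F"
  unfolding submean_def
 proof (intro allI)
  fix z w
  have cl: "aff \<alpha> \<beta> h (cline z w t) = cline (aff \<alpha> \<beta> h z) (\<alpha> * fst w, \<beta> * snd w) t" for t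
   by (simp add: aff_def cline_def algebra_simps)
  have "f (aff \<alpha> \<beta> h z) <= cmean (%z. f (aff \<alpha> \<beta> h z)) z w"
   using submeanD[OF compD(3)[OF f], of "aff \<alpha> \<beta> h z" "(\<alpha> * fst w, \<beta> * snd w)"] by (simp add: cmean_def cl)
  then have "f (aff \<alpha> \<beta> h z) - \<epsilon> <= cmean (%z. f (aff \<alpha> \<beta> h z) - \<epsilon>) z w" by (simp add: cmean_diff_const[OF lg])
  also have "... <= cmean F z w"
  proof (rule cmean_mono[OF _ lF])
   show "lbr (%z. f (aff \<alpha> \<beta> h z) - \<epsilon>)"
    using lg unfolding lbr_def
   proof (elim conjE, intro conjI allI)
    fix R assume "\<forall>R. \<exists>B. \<forall>z. norm z <= R \<longrightarrow> \<bar>f (aff \<alpha> \<beta> h z)\<bar> <= B"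
    then obtain B where B: "!!z. norm z <= R ==> \<bar>f (aff \<alpha> \<beta> h z)\<bar> <= B" by blast
    have "\<bar>f (aff \<alpha> \<beta> h z) - \<epsilon>\<bar> <= B + \<bar>\<epsilon>\<bar>" if "norm z <= R" for z using B[OF that] by linarith
    then show "\<exists>B. \<forall>z. norm z <= R \<longrightarrow> \<bar>f (aff \<alpha> \<beta> h z) - \<epsilon>\<bar> <= B" by blast
    show "(%z. f (aff \<alpha> \<beta> h z) - \<epsilon>) \<in> borel_measurable borel"
     using lbr_borel[OF lg] by (intro borel_measurable_diff borel_measurable_const)
   qed
  qed (simp add: F_def)
  finally have "f (aff \<alpha> \<beta> h z) - \<epsilon> <= cmean F z w" .
  moreover have "0 <= cmean F z w" by (rule cmean_nonneg) (simp add: F_def)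
  ultimately show "F z <= cmean F z w" by (simp add: F_def)
 qed
 moreover have "F z = 0" if "z \<in> K" for z
  using V_upper[OF f, of "aff \<alpha> \<beta> h z"] k[OF that] by (simp add: F_def)
 ultimately have "F \<in> comp (H_C a b) K" unfolding comp_def mem_Collect_eq using us FH by (auto simp: F_def)
 from V_upper[OF this, of z] show "f (aff \<alpha> \<beta> h z) <= V z + \<epsilon>" by (simp add: F_def)
qed

lemma V_translate:
 assumes "\<epsilon> > 0"
 obtains \<delta> where "\<delta> > 0" "!!z h. norm h <= \<delta> ==> \<bar>V (z + h) - V z\<bar> <= \<epsilon>"
proof -
 obtain \<delta> where d: "\<delta> > 0" "!!x z. x \<in> K ==> norm (z - x) <= \<delta> ==> V z <= \<epsilon>" using V_near_K[OF assms] by metis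
 have af: "aff 1 1 h z = z + h" for h z by (simp add: aff_def plus_prod_def)
 have up: "V (z + h) <= V z + \<epsilon>" if "norm h <= \<delta>" for z h
  unfolding af[symmetric] by (rule V_aff) (use assms d(2) that in \<open>auto simp: af\<close>)
 have "\<bar>V (z + h) - V z\<bar> <= \<epsilon>" if "norm h <= \<delta>" for z h
  using up[OF that, of z] up[of "- h" "z + h"] that by simp
 then show thesis using that d(1) by blast
qed

text \<open>Translations of bounded size are too weak on large orbits. A dilation moves a point by a
  proportion of its size and commutes with \<open>wscale\<close>, so it controls \<open>V\<close>
  equally well at every scale.\<close>

lemma V_dilate:
 assumes "\<epsilon> > 0"
 obtains \<delta> where "\<delta> > 0" "!!z \<alpha> \<beta>. cmod (\<alpha> - 1) <= \<delta> ==> cmod (\<beta> - 1) <= \<delta> ==> \<bar>V (\<alpha> * fst z, \<beta> * snd z) - V z\<bar> <= \<epsilon>"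
proof -
 obtain \<delta> where d: "\<delta> > 0" "!!x z. x \<in> K ==> norm (z - x) <= \<delta> ==> V z <= \<epsilon>" using V_near_K[OF assms] by metis
 obtain R where R: "R > 0" "!!x. x \<in> K ==> norm x <= R" using compact_imp_bounded[OF K] unfolding bounded_pos by metis
 define \<gamma> where "\<gamma> = \<delta> / (2 * R)"
 have g: "\<gamma> > 0" using d R by (simp add: \<gamma>_def)
 have af: "aff \<alpha> \<beta> 0 z = (\<alpha> * fst z, \<beta> * snd z)" for \<alpha> \<beta> z by (simp add: aff_def)
 have up: "V (\<alpha> * fst z, \<beta> * snd z) <= V z + \<epsilon>" if "cmod (\<alpha> - 1) <= \<gamma>" "cmod (\<beta> - 1) <= \<gamma>" for z \<alpha> \<beta>
  unfolding af[symmetric]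
 proof (rule V_aff)
  fix x assume x: "x \<in> K"
  have "norm (aff \<alpha> \<beta> 0 x - x) = norm ((\<alpha> - 1) * fst x, (\<beta> - 1) * snd x)" by (cases x) (simp add: aff_def algebra_simps)
  also have "... <= cmod (\<alpha> - 1) * cmod (fst x) + cmod (\<beta> - 1) * cmod (snd x)"
   using norm_Pair_le by (metis norm_mult)
  also have "... <= \<gamma> * R + \<gamma> * R"
   using that g R(2)[OF x] cmod_fst[of x] cmod_snd[of x] by (intro add_mono mult_mono) auto
  also have "... = \<delta>" using R by (simp add: \<gamma>_def)
  finally show "V (aff \<alpha> \<beta> 0 x) <= \<epsilon>" by (rule d(2)[OF x])
 qed (use assms in simp)
 have "\<bar>V (\<alpha> * fst z, \<beta> * snd z) - V z\<bar> <= \<epsilon>"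
  if 1: "cmod (\<alpha> - 1) <= min (1/2) (\<gamma> / 2)" and 2: "cmod (\<beta> - 1) <= min (1/2) (\<gamma> / 2)" for z \<alpha> \<beta>
 proof -
  \<comment> \<open>The lower bound is the upper bound for the inverse dilation, whose factors must
    be within \<gamma> of 1; hence the halved tolerance.\<close>
  have inv: "\<eta> ~= 0 \<and> cmod (1 / \<eta> - 1) <= \<gamma>" if "cmod (\<eta> - 1) <= min (1/2) (\<gamma> / 2)" for \<eta>
  proof -
   have n: "1 / 2 <= cmod \<eta>" using norm_triangle_ineq2[of 1 "1 - \<eta>"] that by (simp add: norm_minus_commute)
   then have "\<eta> ~= 0" by auto
   then have "1 / \<eta> - 1 = (1 - \<eta>) / \<eta>" by (simp add: field_simps)
   then have "cmod (1 / \<eta> - 1) = cmod (\<eta> - 1) / cmod \<eta>" by (simp add: norm_divide norm_minus_commute)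
   also have "... <= (\<gamma> / 2) / (1 / 2)" using that n g by (intro frac_le) auto
   finally show ?thesis using \<open>\<eta> ~= 0\<close> by simp
  qed
  have "V z = V (1 / \<alpha> * fst (\<alpha> * fst z, \<beta> * snd z), 1 / \<beta> * snd (\<alpha> * fst z, \<beta> * snd z))"
   using inv[OF 1] inv[OF 2] by simp
  also have "... <= V (\<alpha> * fst z, \<beta> * snd z) + \<epsilon>" using inv[OF 1] inv[OF 2] by (intro up) auto
  finally have "V z <= V (\<alpha> * fst z, \<beta> * snd z) + \<epsilon>" .
  moreover have "V (\<alpha> * fst z, \<beta> * snd z) <= V z + \<epsilon>" using 1 2 g by (intro up) auto
  ultimately show ?thesis by linarith
 qed
 then show thesis using that[of "min (1/2) (\<gamma> / 2)"] g by auto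
qed

lemma continuous_V: "continuous_on UNIV V"
 unfolding continuous_on_iff
proof (intro ballI allI impI)
 fix x and e :: real assume "0 < e"
 then obtain \<delta> where d: "\<delta> > 0" "!!z h. norm h <= \<delta> ==> \<bar>V (z + h) - V z\<bar> <= e / 2" using V_translate[of "e / 2"] by auto
 have "dist (V y) (V x) < e" if "dist y x < \<delta>" for y
  using d(2)[of "y - x" x] that \<open>0 < e\<close> by (simp add: dist_norm)
 then show "\<exists>d>0. \<forall>x'\<in>UNIV. dist x' x < d \<longrightarrow> dist (V x') (V x) < e" using d(1) by blast
qed

lemma lbr_V: "lbr V" by (rule lbr_continuous[OF continuous_V])

lemma submean_V: "submean V"
 unfolding submean_def
proof (intro allI V_least)
 fix z w f assume f: "f \<in> comp (H_C a b) K"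
 show "f z <= cmean V z w" by (rule order_trans[OF submeanD[OF compD(3)[OF f]] cmean_mono[OF comp_lbr[OF continuous_H_C f] lbr_V V_upper[OF f]]])
qed

lemma Vstar_V: "Vstar (H_C a b) K z = ereal (V z)"
proof -
 have "isCont V z" using continuous_V unfolding continuous_on_eq_continuous_at[OF open_UNIV] by blast
 then have "((%z. ereal (V z)) \<longlongrightarrow> ereal (V z)) (nhds z)" by (simp add: isCont_def tendsto_at_iff_tendsto_nhds)
 then show ?thesis unfolding Vstar_def Vext_V[abs_def] by (intro lim_imp_Limsup) (auto simp: Vext_V)
qed

text \<open>The competitor is the logarithmic function \<open>H_C\<close> of z / R, where
  \<open>R\<close> is the radius of a ball containing \<open>K\<close>, so that it vanishes on
  \<open>K\<close>.\<close>

lemma V_lower: obtains C where "!!z. H_C a b z - C <= V z"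
proof -
 obtain R0 where R0: "!!x. x \<in> K ==> norm x <= R0" using compact_imp_bounded[OF K] unfolding bounded_iff by metis
 define R where "R = max 1 R0"
 have R: "R >= 1" "!!x. x \<in> K ==> norm x <= R" using R0 by (auto simp: R_def le_max_iff_disj)
 define g1 where "g1 = (%z :: c2. real b * logplus (cmod (fst z / of_real R)))"
 define g2 where "g2 = (%z :: c2. real a * logplus (cmod (snd z / of_real R)))"
 have c: "continuous_on UNIV g1" "continuous_on UNIV g2" unfolding g1_def g2_def
  using R(1) by (auto intro!: continuous_intros continuous_logplus_comp)
 have c12: "continuous_on UNIV (%z. max (g1 z) (g2 z))" by (intro continuous_intros c)
 have p1: "\<exists>q :: complex poly. \<forall>t. fst (cline z w t) / of_real R = poly q t" for z w
  by (intro exI[of _ "[:fst z / of_real R, fst w / of_real R:]"]) (simp add: cline_def add_divide_distrib)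
 have p2: "\<exists>q :: complex poly. \<forall>t. snd (cline z w t) / of_real R = poly q t" for z w
  by (intro exI[of _ "[:snd z / of_real R, snd w / of_real R:]"]) (simp add: cline_def add_divide_distrib)
 have sub: "submean (%z. max (g1 z) (g2 z))"
 proof (rule submean_max[OF lbr_continuous[OF c(1)] _ lbr_continuous[OF c(2)] _ lbr_continuous[OF c12]])
  show "submean g1" unfolding g1_def by (rule submean_cmult[OF submean_logplus_poly[OF p1]]) simp
  show "submean g2" unfolding g2_def by (rule submean_cmult[OF submean_logplus_poly[OF p2]]) simp
 qed
 have l1: "logplus (cmod (x / of_real R)) <= logplus (cmod x)" for x
  using R(1) by (intro logplus_mono) (simp add: norm_divide divide_le_eq mult_le_cancel_left1)
 have l2: "logplus (cmod x) <= ln R + logplus (cmod (x / of_real R))" for x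
 proof -
  have "logplus (cmod x) <= logplus R + logplus (cmod (x / of_real R))"
   by (rule logplus_mult_le) (use R(1) in \<open>auto simp: norm_divide max_def mult_le_cancel_left1\<close>)
  then show ?thesis using R(1) by (simp add: logplus_def split: if_splits)
 qed
 have "(%z. max (g1 z) (g2 z)) \<in> comp (H_C a b) K"
  unfolding comp_def mem_Collect_eq
 proof (intro conjI allI ballI usc_continuous c12 sub exI[of _ 0])
  show "0 <= max (g1 z) (g2 z)" for z by (simp add: g1_def le_max_iff_disj)
  show "max (g1 z) (g2 z) <= H_C a b z + 0" for z
   unfolding g1_def g2_def H_C_def add_0_right by (intro max.mono mult_left_mono l1) auto
  show "max (g1 z) (g2 z) = 0" if "z \<in> K" for z
  proof -
   have "cmod (fst z) <= R" "cmod (snd z) <= R" using R(2)[OF that] cmod_fst[of z] cmod_snd[of z] by linarith+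
   then show ?thesis using R(1) by (simp add: g1_def g2_def logplus_def norm_divide divide_le_eq)
  qed
 qed
 from V_upper[OF this] have g: "max (g1 z) (g2 z) <= V z" for z .
 have "H_C a b z - (real a + real b) * ln R <= V z" for z
 proof -
  have "real b * logplus (cmod (fst z)) <= real b * ln R + g1 z"
   unfolding g1_def distrib_left[symmetric] by (intro mult_left_mono l2) auto
  moreover have "real a * logplus (cmod (snd z)) <= real a * ln R + g2 z"
   unfolding g2_def distrib_left[symmetric] by (intro mult_left_mono l2) auto
  moreover have "0 <= real a * ln R" "0 <= real b * ln R" using R(1) by auto
  ultimately show ?thesis using g[of z] unfolding H_C_def distrib_right by linarith
 qed
 then show thesis by (rule that)
qed

end

section \<open>Comparison outside a disc and weighted scaling\<close>

lemma ln_le_ln: "0 < x ==> x <= y ==> ln x <= ln (y :: real)" by (subst ln_le_cancel_iff) auto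

lemma logplus_ge_one: "1 <= x ==> logplus x = ln x" by (auto simp: logplus_def)

text \<open>A multiple of ln (|x| / r) is subtracted. Its factor \<open>k\<close> makes it at most
  \<open>e\<close> at \<open>y\<close>, and the radius \<open>T\<close> makes it at least |B| on the
  outer circle, so that the maximum principle on a compact set applies.\<close>

lemma exterior_max_principle:
 fixes w :: "complex => real"
 assumes S: "closed S" "continuous_on S w" "!!x. x \<in> S ==> r <= cmod x" and r: "r > 0"
  and X: "open X" "X \<subseteq> S" "!!x. x \<in> X ==> asub w x"
  and bd: "!!x. x \<in> S - X ==> w x <= 0" and B: "!!x. x \<in> S ==> w x <= B" and y: "y \<in> S"
 shows "w y <= 0"
proof (rule field_le_epsilon)
 fix e :: real assume e: "0 < e"
 define k where "k = e / (ln (cmod y) - ln r + 1)"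
 have ly: "0 <= ln (cmod y) - ln r" using ln_le_ln[OF r S(3)[OF y]] by simp
 have k: "k > 0" using e ly by (simp add: k_def)
 define T where "T = max (cmod y) (r * exp (\<bar>B\<bar> / k))"
 have T: "cmod y <= T" "\<bar>B\<bar> <= k * (ln T - ln r)"
 proof -
  have "ln (r * exp (\<bar>B\<bar> / k)) <= ln T" using r by (subst ln_le_cancel_iff) (auto simp: T_def less_max_iff_disj)
  then have "\<bar>B\<bar> / k <= ln T - ln r" using r by (simp add: ln_mult_pos)
  then show "\<bar>B\<bar> <= k * (ln T - ln r)" using k by (simp add: field_simps)
 qed (simp add: T_def)
 define h where "h x = (- (k * ln r)) + k * ln (cmod (1 * x + 0))" for x
 have hm: "hmean h x" if "x ~= 0" for x
  unfolding h_def by (intro hmean_add hmean_const hmean_cmult hmean_ln) (use that in simp)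
 have hx: "h x = k * (ln (cmod x) - ln r)" for x by (simp add: h_def algebra_simps)
 have h0: "0 <= h x" if "x \<in> S" for x unfolding hx using ln_le_ln[OF r S(3)[OF that]] k by simp
 have "w y - h y <= 0"
 proof (rule max_principle[where S="S \<inter> cball 0 T" and X="X \<inter> ball 0 T" and w="%x. w x - h x"])
  show "compact (S \<inter> cball 0 T)" using S(1) by (simp add: closed_Int_compact)
  show "continuous_on (S \<inter> cball 0 T) (%x. w x - h x)"
   unfolding hx using S(3) r by (intro continuous_intros continuous_on_subset[OF S(2)]) fastforce+
  show "asub (%x. w x - h x) x" if "x \<in> X \<inter> ball 0 T" for x
  proof (rule asub_diff[OF X(3) continuous_on_subset[OF S(2) X(2)] X(1)])
   have "x \<in> S" using that X(2) by blast
   then show "hmean h x" using S(3)[of x] r by (intro hm) auto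
  qed (use that in auto)
  show "w x - h x <= 0" if "x \<in> S \<inter> cball 0 T - X \<inter> ball 0 T" for x
  proof (cases "x \<in> X")
   case True
   then have "cmod x = T" "x \<in> S" using that by auto
   then show ?thesis using B[of x] T(2) by (simp add: hx)
  next
   case False
   then show ?thesis using bd[of x] h0[of x] that by auto
  qed
 qed (use X T y in auto)
 moreover have "h y <= e" unfolding hx k_def using e ly by (simp add: field_simps)
 ultimately show "w y <= 0 + e" by linarith
qed

text \<open>Bernstein-Walsh in the exterior of a disc: comparison with M + N ln (|l| / r). The
  growth hypothesis makes the difference bounded above; its constant \<open>c\<close> leaves no
  trace in the conclusion, which is how individual constants turn into uniform ones.\<close>

lemma annulus_bound:
 fixes u :: "complex => real"
 assumes u: "continuous_on UNIV u" "!!x. asub u x" and r: "r > 0"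
  and M: "!!l. cmod l = r ==> u l <= M" and g: "!!l. cmod l >= r ==> u l <= N * ln (cmod l) + c"
  and l: "cmod l >= r"
 shows "u l <= M + N * (ln (cmod l) - ln r)"
proof -
 define h where "h x = (M - N * ln r) + N * ln (cmod (1 * x + 0))" for x
 have hx: "h x = M + N * (ln (cmod x) - ln r)" for x by (simp add: h_def algebra_simps)
 have cl: "closed {x :: complex. r <= cmod x}" by (intro closed_Collect_le continuous_intros)
 have op: "open {x :: complex. r < cmod x}" by (intro open_Collect_less continuous_intros)
 have "u l - h l <= 0"
 proof (rule exterior_max_principle[where S="{x. r <= cmod x}" and X="{x. r < cmod x}" and w="%x. u x - h x" and r=r and B="c - M + N * ln r"])
  show "continuous_on {x. r <= cmod x} (%x. u x - h x)"
   unfolding hx using r by (intro continuous_intros continuous_on_subset[OF u(1)]) auto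
  show "asub (%x. u x - h x) x" if "x \<in> {x. r < cmod x}" for x
  proof (rule asub_diff[OF u(2) u(1) open_UNIV UNIV_I])
   show "hmean h x" unfolding h_def using that r by (intro hmean_add hmean_const hmean_cmult hmean_ln) auto
  qed
  show "u x - h x <= 0" if "x \<in> {x. r <= cmod x} - {x. r < cmod x}" for x
  proof -
   have "cmod x = r" using that by auto
   then show ?thesis using M[of x] by (simp add: hx)
  qed
  show "u x - h x <= c - M + N * ln r" if "x \<in> {x. r <= cmod x}" for x
   using g[of x] that by (simp add: hx algebra_simps)
 qed (use r l cl op in auto)
 then show ?thesis by (simp add: hx)
qed

lemma circ_arc:
 assumes g: "continuous_on {0..2*pi} g" "!!t. t \<in> {0..2*pi} ==> g t <= A" "!!t. t \<in> {0..s} ==> g t <= A - d"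
  and s: "0 <= s" "s <= 2 * pi"
 shows "circ g <= A - d * s / (2 * pi)"
proof -
 have si: "set_integrable lborel {0..2*pi} (%t. d * indicat_real {0..s} t)"
  unfolding set_integrable_def
 proof (rule Bochner_Integration.integrable_bound[where f="%t. indicat_real {0..2*pi} t *\<^sub>R d"])
  show "integrable lborel (%t. indicat_real {0..2*pi} t *\<^sub>R d)" by simp
  show "AE t in lborel. norm (indicat_real {0..2*pi} t *\<^sub>R (d * indicat_real {0..s} t)) <= norm (indicat_real {0..2*pi} t *\<^sub>R d)"
   by (auto simp: indicator_def)
 qed measurable
 have sc: "set_integrable lborel {0..2*pi} (%t. A)" by (simp add: set_integrable_def)
 have "(LINT t:{0..2*pi}|lborel. indicat_real {0..s} t) = (LINT t|lborel. indicat_real ({0..2*pi} \<inter> {0..s}) t)"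
  unfolding set_lebesgue_integral_def indicator_inter_arith real_scaleR_def ..
 also have "{0..2*pi} \<inter> {0..s} = {0..s}" using s by auto
 finally have i: "(LINT t:{0..2*pi}|lborel. indicat_real {0..s} t) = s" using s by simp
 have "(LINT t:{0..2*pi}|lborel. g t) <= (LINT t:{0..2*pi}|lborel. A - d * indicat_real {0..s} t)"
  by (rule set_integral_mono[OF circ_integrable[OF g(1)] set_integral_diff(1)[OF sc si]])
   (use g(2,3) in \<open>auto simp: indicator_def\<close>)
 also have "... = 2 * pi * A - d * s" using i by (subst set_integral_diff(2)[OF sc si]) (simp add: set_integral_const)
 finally have "circ g <= (2 * pi * A - d * s) / (2 * pi)" unfolding circ_def by (rule divide_right_mono) simp
 then show ?thesis by (simp add: diff_divide_distrib)
qed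

lemma wscale_mult: "wscale a b (l * m) z = wscale a b l (wscale a b m z)" by (simp add: wscale_def power_mult_distrib)

lemma wscale_linear: "wscale a b l (z + w) = wscale a b l z + wscale a b l w" "wscale a b l (z - w) = wscale a b l z - wscale a b l w"
 by (simp_all add: wscale_def algebra_simps)

lemma norm_wscale_le: "norm (wscale a b l z) <= (cmod l ^ a + cmod l ^ b) * norm z"
proof -
 have "norm (wscale a b l z) <= cmod l ^ a * cmod (fst z) + cmod l ^ b * cmod (snd z)"
  unfolding wscale_def using norm_Pair_le by (metis norm_mult norm_power)
 also have "... <= cmod l ^ a * norm z + cmod l ^ b * norm z" by (intro add_mono mult_left_mono cmod_fst cmod_snd) auto
 finally show ?thesis by (simp add: algebra_simps)
qed

lemma H_C_wscale_le: "H_C a b (wscale a b l z) <= real (a * b) * logplus (cmod l) + H_C a b z"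
proof -
 have p: "logplus (x ^ n) <= real n * logplus x" if "0 <= x" for x n
  using that by (auto simp: logplus_def ln_realpow power_le_one intro: mult_nonneg_nonneg)
 have 1: "logplus (cmod (l ^ n * y)) <= real n * logplus (cmod l) + logplus (cmod y)" for n y
 proof -
  have "logplus (cmod (l ^ n * y)) <= logplus (cmod l ^ n) + logplus (cmod y)"
   by (rule logplus_mult_le) (auto simp: norm_mult norm_power intro!: mult_left_mono)
  then show ?thesis using p[of "cmod l" n] by simp
 qed
 have "real b * logplus (cmod (l ^ a * fst z)) <= real (a * b) * logplus (cmod l) + real b * logplus (cmod (fst z))"
  using mult_left_mono[OF 1[of a "fst z"], of "real b"] by (simp add: algebra_simps)
 moreover have "real a * logplus (cmod (l ^ b * snd z)) <= real (a * b) * logplus (cmod l) + real a * logplus (cmod (snd z))"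
  using mult_left_mono[OF 1[of b "snd z"], of "real a"] by (simp add: algebra_simps)
 ultimately show ?thesis unfolding H_C_def wscale_def fst_conv snd_conv by linarith
qed

lemma H_C_wscale_ge:
 assumes "z ~= 0" obtains c where "!!l. l ~= 0 ==> real (a * b) * ln (cmod l) - c <= H_C a b (wscale a b l z)"
proof -
 have *: "real n * ln (cmod l) + ln (cmod y) <= logplus (cmod (l ^ n * y))" if "l ~= 0" "y ~= 0" for l y n
  using logplus_ge_ln[of "cmod (l ^ n * y)"] that by (simp add: norm_mult norm_power ln_mult_pos ln_realpow)
 show thesis
 proof (cases "fst z = 0")
  case False
  have "real (a * b) * ln (cmod l) - - (real b * ln (cmod (fst z))) <= H_C a b (wscale a b l z)" if "l ~= 0" for l
  proof -
   have "real (a * b) * ln (cmod l) - - (real b * ln (cmod (fst z))) = real b * (real a * ln (cmod l) + ln (cmod (fst z)))"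
    by (simp add: algebra_simps)
   also have "... <= real b * logplus (cmod (l ^ a * fst z))" by (intro mult_left_mono * that False) auto
   also have "... <= H_C a b (wscale a b l z)" by (simp add: H_C_def wscale_def)
   finally show ?thesis .
  qed
  then show thesis by (rule that)
 next
  case True
  then have s: "snd z ~= 0" using assms by (metis prod.collapse zero_prod_def)
  have "real (a * b) * ln (cmod l) - - (real a * ln (cmod (snd z))) <= H_C a b (wscale a b l z)" if "l ~= 0" for l
  proof -
   have "real (a * b) * ln (cmod l) - - (real a * ln (cmod (snd z))) = real a * (real b * ln (cmod l) + ln (cmod (snd z)))"
    by (simp add: algebra_simps)
   also have "... <= real a * logplus (cmod (l ^ b * snd z))" by (intro mult_left_mono * that s) auto
   also have "... <= H_C a b (wscale a b l z)" by (simp add: H_C_def wscale_def)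
   finally show ?thesis .
  qed
  then show thesis by (rule that)
 qed
qed

lemma H_C_wscale_ge_bidisk:
 assumes "z \<in> bidisk_boundary" "l ~= 0" shows "real (a * b) * ln (cmod l) <= H_C a b (wscale a b l z)"
proof -
 have *: "real n * ln (cmod l) <= logplus (cmod (l ^ n * y))" if "cmod y = 1" for y n
  using logplus_ge_ln[of "cmod (l ^ n * y)"] that assms(2) by (simp add: norm_mult norm_power ln_realpow)
 have "cmod (fst z) = 1 \<or> cmod (snd z) = 1" using assms(1) by (auto simp: bidisk_boundary_def max_def split: if_splits)
 then show ?thesis
 proof
  assume "cmod (fst z) = 1"
  from mult_left_mono[OF *[OF this, of a], of "real b"] show ?thesis by (simp add: H_C_def wscale_def mult_ac le_max_iff_disj)
 next
  assume "cmod (snd z) = 1"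
  from mult_left_mono[OF *[OF this, of b], of "real a"] show ?thesis by (simp add: H_C_def wscale_def mult_ac le_max_iff_disj)
 qed
qed

lemma bidisk_cmod: "z \<in> bidisk_boundary ==> cmod (fst z) <= 1" "z \<in> bidisk_boundary ==> cmod (snd z) <= 1" by (auto simp: bidisk_boundary_def)

lemma bidisk_norm: "z \<in> bidisk_boundary ==> norm z <= 2"
 using norm_Pair_le[of "fst z" "snd z"] bidisk_cmod[of z] by simp

lemma bidisk_nz: "z \<in> bidisk_boundary ==> z ~= 0" by (auto simp: bidisk_boundary_def)

lemma polar_decomposition:
 assumes ab: "0 < a" "0 < b" and z: "z ~= (0 :: c2)"
 obtains t \<zeta> where "t > 0" "\<zeta> \<in> bidisk_boundary" "z = wscale a b (of_real t) \<zeta>"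
proof -
 \<comment> \<open>The gauge that is homogeneous of degree one for \<open>wscale\<close>; its unit
   sphere is the boundary of the bidisk.\<close>
 define t where "t = max (root a (cmod (fst z))) (root b (cmod (snd z)))"
 have "fst z ~= 0 \<or> snd z ~= 0" using z by (metis prod.collapse zero_prod_def)
 then have t: "t > 0" using ab by (auto simp: t_def less_max_iff_disj)
 have r1: "cmod (fst z) <= t ^ a" "root a (cmod (fst z)) = t ==> cmod (fst z) = t ^ a"
  using ab power_mono[of "root a (cmod (fst z))" t a] by (auto simp: t_def)
 have r2: "cmod (snd z) <= t ^ b" "root b (cmod (snd z)) = t ==> cmod (snd z) = t ^ b"
  using ab power_mono[of "root b (cmod (snd z))" t b] by (auto simp: t_def)
 define \<zeta> where "\<zeta> = (fst z / of_real t ^ a, snd z / of_real t ^ b)"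
 have "cmod (fst \<zeta>) = cmod (fst z) / t ^ a" "cmod (snd \<zeta>) = cmod (snd z) / t ^ b"
  using t by (auto simp: \<zeta>_def norm_divide norm_power)
 moreover have "root a (cmod (fst z)) = t \<or> root b (cmod (snd z)) = t" by (auto simp: t_def max_def)
 moreover have "cmod (fst z) / t ^ a <= 1" "cmod (snd z) / t ^ b <= 1" using r1(1) r2(1) t by (auto simp: divide_le_eq)
 moreover have "cmod (fst z) / t ^ a = 1 \<or> cmod (snd z) / t ^ b = 1" using r1(2) r2(2) calculation(3) t by auto
 ultimately have "\<zeta> \<in> bidisk_boundary" by (auto simp: bidisk_boundary_def)
 moreover have "z = wscale a b (of_real t) \<zeta>" using t by (cases z) (simp add: \<zeta>_def wscale_def)
 ultimately show thesis using that t by blast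
qed

lemma continuous_wscale: "continuous_on S (%l. wscale a b l z)"
 unfolding wscale_def by (intro continuous_intros)

section \<open>Growth of V and its slices at infinity\<close>

context pluri
begin

text \<open>Each competitor has its own additive constant. \<open>annulus_bound\<close> on the
  orbits replaces it by a bound \<open>M\<close> of \<open>V\<close> on a fixed ball, after
  smoothing at radius 1, since \<open>asub_curve\<close> speaks of smooth functions.\<close>

lemma V_growth: obtains M where "M >= 0" "!!z. V z <= H_C a b z + M"
proof -
 \<comment> \<open>For |l| = 1 a scaled point of the bidisk boundary has norm at most (1 + 1) 2 = 4,
   and the smoothing reaches 1 further.\<close>
 obtain M where M: "M >= 0" "!!z. norm z <= 5 ==> \<bar>V z\<bar> <= M" using lbr_bound[OF lbr_V, of 5] by metis
 obtain d where d: "!!z h. norm h <= 1 ==> H_C a b (1 * fst z + fst h, 1 * snd z + snd h) <= H_C a b z + d"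
  using H_C_affine[of 1 a b 1 1] by blast
 have "V z <= H_C a b z + M" for z
 proof (rule V_least)
  fix f assume f: "f \<in> comp (H_C a b) K"
  have lf: "lbr f" by (rule comp_lbr[OF continuous_H_C f])
  obtain c where c: "!!z. f z <= H_C a b z + c" using compD(4)[OF f] by blast
  define F where "F = sm 1 f"
  have F: "smooth F" "submean F" unfolding F_def by (intro smooth_sm submean_sm lf compD[OF f] zero_less_one)+
  show "f z <= H_C a b z + M"
  proof (cases "norm z <= 5")
   case True
   then show ?thesis using V_upper[OF f, of z] M(2)[OF True] H_C_nonneg[of a b z] by linarith
  next
   case False
   then have "z ~= 0" by auto
   then obtain t \<zeta> where t: "t > 0" "\<zeta> \<in> bidisk_boundary" "z = wscale a b (of_real t) \<zeta>"
    using polar_decomposition[OF ab] by metis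
   have t1: "t >= 1"
   proof (rule ccontr)
    assume "\<not> t >= 1"
    then have "t ^ a + t ^ b <= 2" using t(1) power_le_one[of t a] power_le_one[of t b] by simp
    then have "(t ^ a + t ^ b) * norm \<zeta> <= 2 * 2" using bidisk_norm[OF t(2)] t(1) by (intro mult_mono) auto
    then show False using norm_wscale_le[of a b "of_real t" \<zeta>] False t by simp
   qed
   have H0: "H_C a b \<zeta> = 0" using bidisk_cmod[OF t(2)] by (simp add: H_C_def logplus_def)
   have "F (wscale a b (of_real t) \<zeta>) <= M + real (a * b) * (ln (cmod (of_real t)) - ln 1)"
   proof (rule annulus_bound[where u="%l. F (wscale a b l \<zeta>)" and c="d + c"])
    show "continuous_on UNIV (%l. F (wscale a b l \<zeta>))" by (rule continuous_on_compose2[OF smooth_continuous[OF F(1)] continuous_wscale]) auto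
    show "asub (%l. F (wscale a b l \<zeta>)) x" for x by (rule asub_curve[OF F])
    show "F (wscale a b l \<zeta>) <= M" if "cmod l = 1" for l
     unfolding F_def
    proof (rule sm_le[OF _ lf])
     fix w :: c2 assume w: "norm w < 1"
     have "norm (wscale a b l \<zeta>) <= 4" using norm_wscale_le[of a b l \<zeta>] bidisk_norm[OF t(2)] that by simp
     then have "norm (wscale a b l \<zeta> + w) <= 5" using norm_triangle_ineq[of "wscale a b l \<zeta>" w] w by linarith
     then show "f (wscale a b l \<zeta> + w) <= M" using M(2) V_upper[OF f] by (meson abs_le_D1 order_trans)
    qed simp
    show "F (wscale a b l \<zeta>) <= real (a * b) * ln (cmod l) + (d + c)" if "cmod l >= 1" for l
     unfolding F_def
    proof (rule sm_le[OF _ lf])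
     fix w :: c2 assume w: "norm w < 1"
     have lp: "logplus (cmod l) = ln (cmod l)" using that by (auto simp: logplus_def)
     show "f (wscale a b l \<zeta> + w) <= real (a * b) * ln (cmod l) + (d + c)"
      using c[of "wscale a b l \<zeta> + w"] d[of w "wscale a b l \<zeta>"] w H_C_wscale_le[of a b l \<zeta>] H0 lp by (simp add: plus_prod_def)
    qed simp
   qed (use t1 in auto)
   then have "F z <= M + real (a * b) * ln (cmod (of_real t))" by (simp add: t(3))
   moreover have "real (a * b) * ln (cmod (of_real t)) <= H_C a b z"
    unfolding t(3) by (rule H_C_wscale_ge_bidisk[OF t(2)]) (use t1 in auto)
   moreover have "f z <= F z" unfolding F_def by (rule sm_ge[OF _ lf compD(3)[OF f]]) simp
   ultimately show ?thesis by linarith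
  qed
 qed
 then show thesis using that M(1) by blast
qed

definition vv :: "c2 => complex => real" where
 "vv z l = V (wscale a b l z) - real (a * b) * ln (cmod l)"

lemma rho_C_vv: "rho_C a b K z = Limsup at_infinity (%l. ereal (vv z l))" by (simp add: rho_C_def Vstar_V vv_def)

definition rho :: "c2 => real" where "rho z = real_of_ereal (rho_C a b K z)"

lemma vv_bounds:
 assumes "z ~= 0" obtains c where "!!l. cmod l >= 1 ==> \<bar>vv z l\<bar> <= c"
proof -
 obtain M where M: "!!z. V z <= H_C a b z + M" using V_growth by blast
 obtain C where C: "!!z. H_C a b z - C <= V z" using V_lower by blast
 obtain d where d: "!!l. l ~= 0 ==> real (a * b) * ln (cmod l) - d <= H_C a b (wscale a b l z)"
  using H_C_wscale_ge[OF assms] by blast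
 have "\<bar>vv z l\<bar> <= \<bar>H_C a b z + M\<bar> + \<bar>C + d\<bar>" if "cmod l >= 1" for l
 proof -
  have lp: "logplus (cmod l) = ln (cmod l)" using that by (auto simp: logplus_def)
  have "l ~= 0" using that by auto
  have "real (a * b) * logplus (cmod l) = real (a * b) * ln (cmod l)" using lp by simp
  then show ?thesis unfolding vv_def
   using M[of "wscale a b l z"] C[of "wscale a b l z"] d[OF \<open>l ~= 0\<close>] H_C_wscale_le[of a b l z] by linarith
 qed
 then show thesis by (rule that)
qed

lemma rho_C_eq: assumes "z ~= 0" shows "rho_C a b K z = ereal (rho z)"
proof -
 obtain c where c: "!!l. cmod l >= 1 ==> \<bar>vv z l\<bar> <= c" using vv_bounds[OF assms] by blast
 have ev: "eventually (%l :: complex. cmod l >= 1) at_infinity" by (auto simp: eventually_at_infinity)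
 have "rho_C a b K z <= ereal c"
  unfolding rho_C_vv by (rule Limsup_bounded) (rule eventually_mono[OF ev], use c in fastforce)
 moreover have "ereal (- c) <= rho_C a b K z"
  unfolding rho_C_vv
 proof (rule order_trans[OF _ Liminf_le_Limsup])
  show "ereal (- c) <= Liminf at_infinity (%l. ereal (vv z l))" by (rule Liminf_bounded) (rule eventually_mono[OF ev], use c in fastforce)
 qed (rule trivial_limit_at_infinity)
 ultimately have "\<bar>rho_C a b K z\<bar> ~= \<infinity>" by (cases "rho_C a b K z") auto
 then show ?thesis by (simp add: rho_def ereal_real')
qed

lemma rho_upper:
 assumes "z ~= 0" "e > 0" obtains R where "R >= 1" "!!l. cmod l >= R ==> vv z l <= rho z + e"
proof -
 have "Limsup at_infinity (%l. ereal (vv z l)) < ereal (rho z + e)"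
  using rho_C_eq[OF assms(1)] assms(2) by (simp add: rho_C_vv)
 then have "eventually (%l. ereal (vv z l) < ereal (rho z + e)) at_infinity" by (rule Limsup_lessD)
 then obtain R where R: "!!l. cmod l >= R ==> vv z l < rho z + e" by (auto simp: eventually_at_infinity)
 show thesis by (rule that[of "max 1 R"]) (use R in \<open>auto intro: less_imp_le\<close>)
qed

lemma rho_le:
 assumes "z ~= 0" "!!l. cmod l >= R ==> vv z l <= x" shows "rho z <= x"
proof -
 have "rho_C a b K z <= ereal x"
  unfolding rho_C_vv by (rule Limsup_bounded) (use assms(2) in \<open>auto simp: eventually_at_infinity\<close>)
 then show ?thesis using rho_C_eq[OF assms(1)] by simp
qed

text \<open>Makes \<open>asub_curve\<close> applicable to \<open>V\<close>; the uniform modulus of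
  continuity keeps the error uniform on all of C^2.\<close>

lemma V_smoothing:
 assumes "e > 0" obtains W where "smooth W" "submean W" "!!z. \<bar>W z - V z\<bar> <= e"
proof -
 obtain \<delta> where d: "\<delta> > 0" "!!z h. norm h <= \<delta> ==> \<bar>V (z + h) - V z\<bar> <= e" using V_translate[OF assms] by metis
 show thesis
 proof (rule that[of "sm \<delta> V"])
  show "\<bar>sm \<delta> V z - V z\<bar> <= e" for z by (rule sm_close[OF d(1) lbr_V]) (use d(2) in auto)
 qed (intro smooth_sm submean_sm lbr_V submean_V d)+
qed

text \<open>On the circle |l| = R the orbits of nearby points stay within \<gamma> of each other,
  where translations control \<open>V\<close>. \<open>annulus_bound\<close> carries the estimate to
  all larger |l|.\<close>

lemma vv_upper_near:
 assumes z0: "z0 ~= 0" and e: "e > 0"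
 obtains \<delta> R where "\<delta> > 0" "R >= 1" "!!z l. norm (z - z0) <= \<delta> ==> cmod l >= R ==> vv z l <= rho z0 + e"
proof -
 obtain R where R: "R >= 1" "!!l. cmod l >= R ==> vv z0 l <= rho z0 + e / 4"
  using rho_upper[OF z0, of "e / 4"] e by auto
 obtain W where W: "smooth W" "submean W" "!!z. \<bar>W z - V z\<bar> <= e / 4" using V_smoothing[of "e / 4"] e by auto
 obtain \<gamma> where g: "\<gamma> > 0" "!!z h. norm h <= \<gamma> ==> \<bar>V (z + h) - V z\<bar> <= e / 4" using V_translate[of "e / 4"] e by auto
 obtain M where M: "!!z. V z <= H_C a b z + M" using V_growth by blast
 \<comment> \<open>Bounds the operator norm of \<open>wscale\<close> on the circle |l| = R.\<close>
 define D where "D = R ^ a + R ^ b"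
 have D: "D > 0" using R(1) by (simp add: D_def add_pos_pos)
 have "vv z l <= rho z0 + e" if z: "norm (z - z0) <= \<gamma> / D" and l: "cmod l >= R" for z l
 proof -
  have "W (wscale a b l z) <= (real (a * b) * ln R + rho z0 + 3 * e / 4) + real (a * b) * (ln (cmod l) - ln R)"
  proof (rule annulus_bound[where u="%l. W (wscale a b l z)" and c="H_C a b z + M + e / 4"])
   show "continuous_on UNIV (%l. W (wscale a b l z))" by (rule continuous_on_compose2[OF smooth_continuous[OF W(1)] continuous_wscale]) auto
   show "asub (%l. W (wscale a b l z)) x" for x by (rule asub_curve[OF W(1,2)])
   show "W (wscale a b l z) <= real (a * b) * ln R + rho z0 + 3 * e / 4" if "cmod l = R" for l
   proof -
    have "norm (wscale a b l (z - z0)) <= D * (\<gamma> / D)"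
     using norm_wscale_le[of a b l "z - z0"] mult_left_mono[OF z, of D] D that by (simp add: D_def)
    then have "norm (wscale a b l (z - z0)) <= \<gamma>" using D by simp
    from g(2)[OF this, of "wscale a b l z0"]
    have "\<bar>V (wscale a b l z) - V (wscale a b l z0)\<bar> <= e / 4" by (simp add: wscale_linear)
    moreover have "V (wscale a b l z0) <= real (a * b) * ln R + rho z0 + e / 4" using R(2)[of l] that by (simp add: vv_def)
    ultimately show ?thesis using W(3)[of "wscale a b l z"] by linarith
   qed
   show "W (wscale a b l z) <= real (a * b) * ln (cmod l) + (H_C a b z + M + e / 4)" if "cmod l >= R" for l
   proof -
    have lp: "logplus (cmod l) = ln (cmod l)" using that R(1) by (intro logplus_ge_one) simp
    have "real (a * b) * logplus (cmod l) = real (a * b) * ln (cmod l)" using lp by simp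
    then show ?thesis using W(3)[of "wscale a b l z"] M[of "wscale a b l z"] H_C_wscale_le[of a b l z] by linarith
   qed
  qed (use R l in auto)
  then have "W (wscale a b l z) <= real (a * b) * ln (cmod l) + rho z0 + 3 * e / 4" by (simp add: algebra_simps)
  then show ?thesis using W(3)[of "wscale a b l z"] unfolding vv_def by linarith
 qed
 then show thesis using that[of "\<gamma> / D" R] g(1) D R(1) by auto
qed

lemma rho_upper_near:
 assumes "z0 ~= 0" "e > 0"
 obtains \<delta> where "\<delta> > 0" "!!z. norm (z - z0) <= \<delta> ==> z ~= 0 \<and> rho z <= rho z0 + e"
proof -
 obtain \<delta> R where d: "\<delta> > 0" "!!z l. norm (z - z0) <= \<delta> ==> cmod l >= R ==> vv z l <= rho z0 + e"
  using vv_upper_near[OF assms] by metis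
 have "z ~= 0 \<and> rho z <= rho z0 + e" if "norm (z - z0) <= min \<delta> (norm z0 / 2)" for z
 proof -
  have "z ~= 0" using that assms(1) by auto
  then show ?thesis using rho_le[of z R "rho z0 + e"] d(2)[of z] that by simp
 qed
 then show thesis using that[of "min \<delta> (norm z0 / 2)"] d(1) assms(1) by auto
qed

text \<open>If the slice \<open>vv z0\<close> were far below \<open>rho z0\<close> at a point \<open>l1\<close>, it would be so on a disc of radius
  comparable to \<open>|l1|\<close>; comparison with the Green function of \<open>{|l| > |l1|/2}\<close> with pole \<open>l1\<close> would then push
  the limsup at infinity below \<open>rho z0\<close>.\<close>

lemma vv_lower:
 assumes z0: "z0 ~= 0" and e: "e > 0"
 obtains R where "R >= 1" "!!l. cmod l >= R ==> rho z0 - e <= vv z0 l"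
proof -
 obtain \<gamma> where \<gamma>: "\<gamma> > 0" "!!z \<alpha> \<beta>. cmod (\<alpha> - 1) <= \<gamma> ==> cmod (\<beta> - 1) <= \<gamma> ==> \<bar>V (\<alpha> * fst z, \<beta> * snd z) - V z\<bar> <= e / 4"
  using V_dilate[of "e / 4"] e by auto
 have "eventually (%x :: complex. cmod (x ^ a - 1) <= \<gamma> \<and> cmod (x ^ b - 1) <= \<gamma> \<and> - (e / 4) <= real (a * b) * ln (cmod x)) (nhds 1)"
 proof -
  have c: "isCont (%x :: complex. cmod (x ^ n - 1)) 1" for n by (intro continuous_intros)
  have l: "isCont (%x :: complex. real (a * b) * ln (cmod x)) 1" by (intro continuous_intros) auto
  have A: "eventually (%x :: complex. cmod (x ^ n - 1) < \<gamma>) (nhds 1)" for n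
   using order_tendstoD(2)[OF c[of n, unfolded isCont_def], of \<gamma>] \<gamma>(1) by (simp add: eventually_nhds_conv_at)
  have B: "eventually (%x :: complex. - (e / 4) < real (a * b) * ln (cmod x)) (nhds 1)"
   using order_tendstoD(1)[OF l[unfolded isCont_def], of "- (e / 4)"] e by (simp add: eventually_nhds_conv_at)
  show ?thesis using A[of a] A[of b] B by eventually_elim simp
 qed
 then obtain s0 where s0: "s0 > 0" "!!x. dist x 1 < s0 ==> cmod (x ^ a - 1) <= \<gamma> \<and> cmod (x ^ b - 1) <= \<gamma> \<and> - (e / 4) <= real (a * b) * ln (cmod x)"
  unfolding eventually_nhds_metric by blast
 define s where "s = min (1/4) (s0 / 2)"
 have s: "0 < s" "s <= 1/4" "s < s0" using s0(1) by (auto simp: s_def)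
 \<comment> \<open>\<open>G\<close> will bound the Green function on the circle |l - l1| = s L, so
   that \<open>q * G\<close> is exactly the deficit e / 2 available there.\<close>
 define G where "G = ln (7 / (2 * s))"
 have G: "G > 0" using s by (simp add: G_def)
 define q where "q = (e / 2) / G"
 have q: "q > 0" using e G by (simp add: q_def)
 \<comment> \<open>From |l| = 2 L on the Green function is at least ln (7 / 6), a gain of 4 \<eta>.
   The upper bound for the slice and the two passages between \<open>V\<close> and \<open>W\<close>
   spend 3 \<eta>.\<close>
 define \<eta> where "\<eta> = q * ln (7 / 6) / 4"
 have \<eta>: "\<eta> > 0" using q by (simp add: \<eta>_def)
 obtain R0 where R0: "R0 >= 1" "!!l. cmod l >= R0 ==> vv z0 l <= rho z0 + \<eta>" using rho_upper[OF z0 \<eta>] by metis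
 obtain W where W: "smooth W" "submean W" "!!z. \<bar>W z - V z\<bar> <= \<eta>" using V_smoothing[OF \<eta>] by metis
 have "rho z0 - e <= vv z0 l1" if l1: "cmod l1 >= 2 * R0" for l1
 proof (rule ccontr)
  assume low: "\<not> rho z0 - e <= vv z0 l1"
  define L where "L = cmod l1"
  define r where "r = L / 2"
  have L: "L >= 2 * R0" "L > 0" "l1 ~= 0" using l1 R0(1) by (auto simp: L_def)
  have r: "r >= R0" "r > 0" using L by (auto simp: r_def)
  \<comment> \<open>The quotient |N l| / (r |l - l1|) equals 1 on |l| = r and has its pole at
    \<open>l1\<close>, of modulus 2 r; its logarithm \<open>g\<close> is the Green function of the
    exterior of the disc.\<close>
  define N where "N l = r^2 - cnj l1 * l" for l
  define g where "g l = ln (cmod (N l)) - ln r - ln (cmod (l - l1))" for l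
  have Nup: "cmod (N l) <= L^2 / 4 + L * cmod l" for l
   using norm_triangle_ineq4[of "of_real (r^2)" "cnj l1 * l"] by (simp add: N_def norm_mult norm_power L_def[symmetric] r_def power_divide)
  have Nlo: "L * cmod l - L^2 / 4 <= cmod (N l)" for l
   using norm_triangle_ineq2[of "cnj l1 * l" "of_real (r^2)"] norm_minus_commute[of "cnj l1 * l" "of_real (r^2)"]
   by (simp add: N_def norm_mult norm_power L_def[symmetric] r_def power_divide)
  have Npos: "0 < cmod (N l)" if "cmod l >= r" for l
  proof -
   have "L * cmod l >= L * r" using that L by (intro mult_left_mono) auto
   moreover have "L * r = L^2 / 2" by (simp add: r_def power2_eq_square)
   moreover have "0 < L^2" using L by simp
   ultimately show ?thesis using Nlo[of l] by linarith
  qed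
  have far: "7 / 6 <= cmod (N l) / (r * cmod (l - l1))" "cmod (N l) / (r * cmod (l - l1)) <= 5" "0 < cmod (l - l1)" if "cmod l >= 2 * L" for l
  proof -
   have u: "cmod (l - l1) <= 3 / 2 * cmod l" using norm_triangle_ineq4[of l l1] that by (simp add: L_def)
   have lo: "cmod l / 2 <= cmod (l - l1)" using norm_triangle_ineq2[of l l1] that by (simp add: L_def)
   show p: "0 < cmod (l - l1)" using lo that L by linarith
   have LL: "L^2 / 4 <= L * cmod l / 8" using mult_left_mono[OF that, of L] L by (simp add: power2_eq_square)
   have "7 / 6 * (r * cmod (l - l1)) <= 7 / 6 * (r * (3 / 2 * cmod l))" using u r by (intro mult_left_mono) auto
   also have "... <= cmod (N l)" using Nlo[of l] LL by (simp add: r_def algebra_simps)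
   finally show "7 / 6 <= cmod (N l) / (r * cmod (l - l1))" using p r by (simp add: pos_le_divide_eq)
   have "cmod (N l) <= 9 / 8 * (L * cmod l)" using Nup[of l] LL by linarith
   also have "... <= 5 * (r * (cmod l / 2))" using L by (simp add: r_def)
   also have "... <= 5 * (r * cmod (l - l1))" using lo r by (intro mult_left_mono) auto
   finally show "cmod (N l) / (r * cmod (l - l1)) <= 5" using p r by (simp add: pos_divide_le_eq)
  qed
  have ge: "g l = ln (cmod (N l) / (r * cmod (l - l1)))" if "cmod l >= r" "l ~= l1" for l
   using Npos[OF that(1)] that r by (simp add: g_def ln_div ln_mult)
  \<comment> \<open>Dilation by x = l / l1, which is close to 1, spreads the low value at
    \<open>l1\<close> over the whole disc.\<close>
  have disc: "W (wscale a b l z0) - real (a * b) * ln (cmod l) <= rho z0 - e / 2 + \<eta>" if "cmod (l - l1) <= s * L" for l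
  proof -
   define x where "x = l / l1"
   have lx: "l = x * l1" using L by (simp add: x_def)
   have "l - l1 = (x - 1) * l1" by (simp add: lx algebra_simps)
   then have "cmod (x - 1) * L <= s * L" using that by (simp only: norm_mult L_def)
   then have "cmod (x - 1) <= s" using L(2) by (simp only: mult_le_cancel_right_pos)
   then have xs: "dist x 1 < s0" using s by (simp add: dist_norm)
   have "x ~= 0" using \<open>cmod (x - 1) <= s\<close> s by auto
   have "\<bar>V (x ^ a * fst (wscale a b l1 z0), x ^ b * snd (wscale a b l1 z0)) - V (wscale a b l1 z0)\<bar> <= e / 4"
    by (rule \<gamma>(2)) (use s0(2)[OF xs] in auto)
   then have "V (wscale a b l z0) <= V (wscale a b l1 z0) + e / 4"
    unfolding lx wscale_mult wscale_def[of a b x] by linarith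
   moreover have "real (a * b) * ln (cmod l) = real (a * b) * ln (cmod x) + real (a * b) * ln L"
    unfolding lx using \<open>x ~= 0\<close> L by (simp add: norm_mult ln_mult L_def[symmetric] distrib_left)
   ultimately show ?thesis using low s0(2)[OF xs] W(3)[of "wscale a b l z0"] unfolding vv_def L_def by linarith
  qed
  have all: "W (wscale a b l z0) - real (a * b) * ln (cmod l) <= rho z0 + 2 * \<eta>" if "cmod l >= r" for l
   using R0(2)[of l] that r W(3)[of "wscale a b l z0"] unfolding vv_def by linarith
  define S where "S = {l. r <= cmod l \<and> s * L <= cmod (l - l1)}"
  define X where "X = {l. r < cmod l \<and> s * L < cmod (l - l1)}"
  have Sl: "l ~= l1" if "l \<in> S" for l using that s L by (auto simp: S_def mult_le_0_iff)
  define H where "H l = real (a * b) * ln (cmod (1 * l + 0)) + ((rho z0 + 2 * \<eta>) + (- q) * (ln (cmod ((- cnj l1) * l + r^2)) + ((- ln r) + (- 1) * ln (cmod (1 * l + (- l1))))))" for l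
  have He: "H l = real (a * b) * ln (cmod l) + (rho z0 + 2 * \<eta>) - q * g l" for l by (simp add: H_def g_def N_def algebra_simps)
  \<comment> \<open>On |l| = r the Green function is 0 and the general upper bound suffices; on the
    small circle its multiple is at most e / 2, which the deficit covers. The bound at infinity is
    the sum of 5, valid for |l| >= 2 L, and of 9 / (2 s), valid closer in.\<close>
  have key: "W (wscale a b l z0) - H l <= 0" if "l \<in> S" for l
  proof (rule exterior_max_principle[where S=S and X=X and w="%l. W (wscale a b l z0) - H l" and r=r and B="q * ln (5 + 9 / (2 * s))"])
   show "closed S" unfolding S_def by (intro closed_Collect_conj closed_Collect_le continuous_intros)
   show "open X" unfolding X_def by (intro open_Collect_conj open_Collect_less continuous_intros)
   show "X \<subseteq> S" by (auto simp: X_def S_def)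
   have cW: "continuous_on T (%l. W (wscale a b l z0))" for T by (rule continuous_on_compose2[OF smooth_continuous[OF W(1)] continuous_wscale]) auto
   show "continuous_on S (%l. W (wscale a b l z0) - H l)"
    unfolding He g_def N_def by (intro continuous_intros cW) (use Npos Sl r in \<open>auto simp: S_def N_def\<close>)
   show "asub (%l. W (wscale a b l z0) - H l) l" if "l \<in> X" for l
   proof (rule asub_diff[OF asub_curve[OF W(1,2)] cW open_UNIV UNIV_I])
    have "l \<in> S" "cmod l >= r" using that by (auto simp: X_def S_def)
    have n1: "(- cnj l1) * l + r^2 ~= 0" using Npos[OF \<open>cmod l >= r\<close>] by (auto simp: N_def)
    show "hmean H l" unfolding H_def
     by (intro hmean_add hmean_const hmean_cmult hmean_ln) (use n1 Sl[OF \<open>l \<in> S\<close>] \<open>cmod l >= r\<close> r in auto)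
   qed
   show "W (wscale a b l z0) - H l <= 0" if "l \<in> S - X" for l
   proof -
    have lr: "cmod l >= r" and ll: "l ~= l1" using that Sl by (auto simp: S_def)
    have "cmod l = r \<or> cmod (l - l1) = s * L" using that by (auto simp: S_def X_def)
    then show ?thesis
    proof
     assume c: "cmod l = r"
     have "N l = l * cnj (l - l1)"
     proof -
      have "complex_of_real (r^2) = l * cnj l" using c by (simp add: complex_norm_square[symmetric])
      then show ?thesis by (simp add: N_def algebra_simps)
     qed
     then have "cmod (N l) = r * cmod (l - l1)" using c by (simp only: complex_mod_cnj norm_mult)
     then have "g l = 0" unfolding ge[OF lr ll] using r ll by simp
     then show ?thesis using all[OF lr] by (simp add: He)
    next
     assume c: "cmod (l - l1) = s * L"
     have "s * L <= 1 / 4 * L" using s L by (intro mult_right_mono) auto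
     moreover have "cmod l <= L + cmod (l - l1)" using norm_triangle_ineq[of l1 "l - l1"] by (simp add: L_def)
     ultimately have "cmod l <= 3 / 2 * L" unfolding c using L(2) by linarith
     then have "L * cmod l <= L * (3 / 2 * L)" using L by (intro mult_left_mono) auto
     then have "cmod (N l) <= 7 / 4 * L^2" using Nup[of l] by (simp add: power2_eq_square)
     also have "... = 7 / (2 * s) * (r * cmod (l - l1))" unfolding c using s by (simp add: r_def power2_eq_square)
     finally have "cmod (N l) / (r * cmod (l - l1)) <= 7 / (2 * s)" using r ll by (simp add: pos_divide_le_eq)
     then have "g l <= G" unfolding ge[OF lr ll] G_def using Npos[OF lr] r ll by (subst ln_le_cancel_iff) (auto intro!: divide_pos_pos mult_pos_pos s)
     then have "q * g l <= q * G" using q by (intro mult_left_mono) auto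
     also have "q * G = e / 2" using G by (simp add: q_def)
     finally show ?thesis using disc[of l] c \<eta> by (simp add: He)
    qed
   qed
   show "W (wscale a b l z0) - H l <= q * ln (5 + 9 / (2 * s))" if "l \<in> S" for l
   proof -
    have lr: "cmod l >= r" and ll: "l ~= l1" using that Sl by (auto simp: S_def)
    have pos: "0 < r * cmod (l - l1)" using r ll by simp
    have "cmod (N l) / (r * cmod (l - l1)) <= 5 + 9 / (2 * s)"
    proof (cases "cmod l >= 2 * L")
     case True
     then show ?thesis using far(2)[OF True] s by (simp add: add_increasing2)
    next
     case False
     then have "L * cmod l <= L * (2 * L)" using L by (intro mult_left_mono) auto
     then have "cmod (N l) <= 9 / 4 * L^2" using Nup[of l] by (simp add: power2_eq_square)
     also have "... = 9 / (2 * s) * (r * (s * L))" using s by (simp add: r_def power2_eq_square)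
     also have "... <= 9 / (2 * s) * (r * cmod (l - l1))" using that s r by (intro mult_left_mono) (auto simp: S_def)
     finally have "cmod (N l) / (r * cmod (l - l1)) <= 9 / (2 * s)" using pos by (simp add: pos_divide_le_eq)
     then show ?thesis by simp
    qed
    then have "g l <= ln (5 + 9 / (2 * s))" unfolding ge[OF lr ll] using Npos[OF lr] pos s
     by (subst ln_le_cancel_iff) (auto intro!: divide_pos_pos add_pos_pos)
    then have "q * g l <= q * ln (5 + 9 / (2 * s))" using q by (intro mult_left_mono) auto
    then show ?thesis using all[OF lr] unfolding He by linarith
   qed
  qed (use r that in \<open>auto simp: S_def\<close>)
  have "vv z0 l <= rho z0 - \<eta>" if lL: "cmod l >= 2 * L" for l
  proof -
   have lr: "cmod l >= r" using lL L by (simp add: r_def)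
   have ll: "l ~= l1" using far(3)[OF lL] by auto
   have "l \<in> S"
   proof -
    have "s * L <= 1 / 4 * L" using s L by (intro mult_right_mono) auto
    moreover have "cmod l - L <= cmod (l - l1)" using norm_triangle_ineq2[of l l1] by (simp add: L_def)
    ultimately have "s * L <= cmod (l - l1)" using lL L(2) by linarith
    then show ?thesis using lr by (simp add: S_def)
   qed
   have "ln (7 / 6) <= g l" unfolding ge[OF lr ll] by (rule ln_le_ln[OF _ far(1)[OF lL]]) simp
   then have "q * ln (7 / 6) <= q * g l" using q by (intro mult_left_mono) auto
   then have "4 * \<eta> <= q * g l" by (simp add: \<eta>_def)
   then show ?thesis using key[OF \<open>l \<in> S\<close>] W(3)[of "wscale a b l z0"] unfolding He vv_def by linarith
  qed
  from rho_le[OF z0 this] show False using \<eta> by simp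
 qed
 then show thesis using that[of "2 * R0"] R0(1) by auto
qed

text \<open>The point \<open>z\<close> is rotated about \<open>z0\<close>. A low value at
  \<open>z\<close> persists on a short arc, because rotating each coordinate amounts to a dilation
  close to 1; on the rest of the circle the upper bound near \<open>z0\<close> holds. The sub-mean
  inequality then lowers the slice of \<open>z0\<close> itself, against
  \<open>vv_lower\<close>.\<close>

lemma vv_lower_near:
 assumes z0: "z0 ~= 0" and e: "e > 0"
 obtains \<delta> R where "\<delta> > 0" "R >= 1" "!!z l. norm (z - z0) <= \<delta> ==> cmod l >= R ==> rho z0 - e <= vv z l"
proof -
 obtain \<gamma> where \<gamma>: "\<gamma> > 0" "!!z \<alpha> \<beta>. cmod (\<alpha> - 1) <= \<gamma> ==> cmod (\<beta> - 1) <= \<gamma> ==> \<bar>V (\<alpha> * fst z, \<beta> * snd z) - V z\<bar> <= e / 2"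
  using V_dilate[of "e / 2"] e by auto
 define s where "s = min \<gamma> 1"
 have s: "s > 0" "s <= 2 * pi" "s <= \<gamma>" using \<gamma> pi_gt3 by (auto simp: s_def)
 \<comment> \<open>One third of the loss in the mean. The upper bound exceeds \<open>rho z0\<close>
   by \<eta>, so the slice of \<open>z0\<close> ends at 2 \<eta> below it, while
   \<open>vv_lower\<close> permits only \<eta>.\<close>
 define \<eta> where "\<eta> = (e / 2) * s / (2 * pi) / 3"
 have \<eta>: "\<eta> > 0" using e s by (simp add: \<eta>_def)
 obtain \<delta>1 R1 where 1: "\<delta>1 > 0" "R1 >= 1" "!!z l. norm (z - z0) <= \<delta>1 ==> cmod l >= R1 ==> vv z l <= rho z0 + \<eta>"
  using vv_upper_near[OF z0 \<eta>] by metis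
 obtain R2 where 2: "R2 >= 1" "!!l. cmod l >= R2 ==> rho z0 - \<eta> <= vv z0 l" using vv_lower[OF z0 \<eta>] by metis
 \<comment> \<open>Within this tolerance a coordinate near a nonzero centre y0 satisfies |y - y0| <=
   |y|, so that its rotation about y0 is a multiple of y with factor near 1. About the centre 0 the
   rotation itself is such a multiple, and the tolerance 1 is a default.\<close>
 define h where "h y = (if y = 0 then 1 else cmod y / 2)" for y :: complex
 have h: "h y > 0" for y by (simp add: h_def)
 define \<delta> where "\<delta> = min \<delta>1 (min (h (fst z0)) (h (snd z0)))"
 have "rho z0 - e <= vv z l" if z: "norm (z - z0) <= \<delta>" and l: "cmod l >= max R1 R2" for z l
 proof (rule ccontr)
  assume low: "\<not> rho z0 - e <= vv z l"
  define zt where "zt t = z0 + rotc (cis t) (z - z0)" for t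
  define g where "g t = V (wscale a b l (zt t))" for t
  define A where "A = real (a * b) * ln (cmod l) + rho z0 + \<eta>"
  have cg: "continuous_on {0..2*pi} g" unfolding g_def zt_def rotc_def wscale_def
   by (rule continuous_on_compose2[OF continuous_V]) (auto intro!: continuous_intros)
  have up: "g t <= A" for t
  proof -
   have "norm (zt t - z0) <= \<delta>1" using z norm_rotc[of "cis t" "z - z0"] by (simp add: zt_def \<delta>_def)
   from 1(3)[OF this, of l] l show ?thesis by (simp add: vv_def g_def A_def)
  qed
  have close: "\<exists>\<alpha>. cmod (\<alpha> - 1) <= cmod (cis t - 1) \<and> y0 + cis t * (y - y0) = \<alpha> * y" if "cmod (y - y0) <= h y0" for y y0 t
  proof (cases "y = 0")
   case True
   have "y0 = 0" using that True by (auto simp: h_def split: if_splits)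
   then show ?thesis using True by (intro exI[of _ 1]) simp
  next
   case False
   have yy: "cmod (y - y0) <= cmod y"
   proof (cases "y0 = 0")
    case False
    then have "cmod (y - y0) <= cmod y0 / 2" using that by (simp add: h_def)
    then show ?thesis using norm_triangle_ineq2[of y0 "y0 - y"] by (simp add: norm_minus_commute)
   qed simp
   define \<alpha> where "\<alpha> = 1 + (cis t - 1) * ((y - y0) / y)"
   have "cmod (\<alpha> - 1) = cmod (cis t - 1) * (cmod (y - y0) / cmod y)" by (simp add: \<alpha>_def norm_mult norm_divide)
   also have "... <= cmod (cis t - 1)" using yy False by (intro mult_left_le) auto
   finally show ?thesis using False by (intro exI[of _ \<alpha>]) (simp add: \<alpha>_def field_simps)
  qed
  have arc: "g t <= A - e / 2" if t: "t \<in> {0..s}" for t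
  proof -
   have ct: "cmod (cis t - 1) <= \<gamma>"
   proof -
    have "cmod (cis t - 1) = dist (cis t) (cis 0)" by (simp add: dist_norm)
    also have "... <= \<bar>t\<bar>" using dist_exp_i_1[of t] by (simp add: dist_norm cis_conv_exp) (metis abs_sin_x_le_abs_x abs_divide abs_mult abs_numeral field_sum_of_halves mult_2 mult_le_cancel_left_pos nonzero_mult_div_cancel_left times_divide_eq_right zero_less_numeral zero_neq_numeral)
    finally show ?thesis using t s by auto
   qed
   have c1: "cmod (fst z - fst z0) <= h (fst z0)" and c2: "cmod (snd z - snd z0) <= h (snd z0)"
    using z cmod_fst[of "z - z0"] cmod_snd[of "z - z0"] by (auto simp: \<delta>_def)
   obtain \<alpha> where al: "cmod (\<alpha> - 1) <= \<gamma>" "fst (zt t) = \<alpha> * fst z" using close[OF c1, of t] order_trans[OF _ ct] unfolding zt_def rotc_def by (metis fst_add fst_conv fst_diff)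
   obtain \<beta> where be: "cmod (\<beta> - 1) <= \<gamma>" "snd (zt t) = \<beta> * snd z" using close[OF c2, of t] order_trans[OF _ ct] unfolding zt_def rotc_def by (metis snd_add snd_conv snd_diff)
   have "wscale a b l (zt t) = (\<alpha> * fst (wscale a b l z), \<beta> * snd (wscale a b l z))" by (simp add: wscale_def al be)
   then have "\<bar>g t - V (wscale a b l z)\<bar> <= e / 2" using \<gamma>(2)[OF al(1) be(1), of "wscale a b l z"] unfolding g_def by (simp only:)
   then have "g t <= V (wscale a b l z) + e / 2" by linarith
   then show ?thesis using low \<eta> by (simp add: vv_def A_def)
  qed
  have "V (wscale a b l z0) <= cmean V (wscale a b l z0) (wscale a b l (z - z0))" by (rule submeanD[OF submean_V])
  also have "... = circ g"
   unfolding cmean_circ g_def zt_def cline_rotc wscale_linear(1) by (simp add: rotc_def wscale_def mult_ac)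
  also have "... <= A - (e / 2) * s / (2 * pi)" by (rule circ_arc[OF cg up arc]) (use s in auto)
  also have "... = A - 3 * \<eta>" by (simp add: \<eta>_def)
  finally have "vv z0 l <= rho z0 - 2 * \<eta>" by (simp add: vv_def A_def)
  then show False using 2(2)[of l] l \<eta> by simp
 qed
 then show thesis using that[of \<delta> "max R1 R2"] 1 2 h by (auto simp: \<delta>_def le_max_iff_disj)
qed

end

section \<open>Hartogs type bounds for the sequence\<close>

lemma poly_coeff_bound:
 fixes P :: "complex poly"
 assumes s: "s > 0" and B: "!!x. cmod x = s ==> cmod (poly P x) <= B"
 shows "cmod (coeff P k) <= B * (2 / s) ^ k"
 using B
proof (induction k arbitrary: P B)
 case (0 P B)
 have "cmod ((deriv ^^ 0) (poly P) 0) <= fact 0 * B / s ^ 0"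
  by (rule Cauchy_inequality) (use 0 s in \<open>auto intro!: holomorphic_intros continuous_intros simp: norm_minus_commute\<close>)
 then show ?case by (simp add: poly_0_coeff_0)
next
 case (Suc k P B)
 obtain c P' where P: "P = pCons c P'" by (cases P)
 have "cmod ((deriv ^^ 0) (poly P) 0) <= fact 0 * B / s ^ 0"
  by (rule Cauchy_inequality) (use Suc.prems s in \<open>auto intro!: holomorphic_intros continuous_intros simp: norm_minus_commute\<close>)
 then have c: "cmod c <= B" by (simp add: P)
 \<comment> \<open>Dropping the constant term at most doubles the bound. The loss accumulates to a
   factor exponential in the degree, which is harmless for crude bounds of the form exp (n
   C).\<close>
 have "cmod (poly P' x) <= 2 * B / s" if "cmod x = s" for x
 proof -
  have "x * poly P' x = poly P x - c" by (simp add: P)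
  then have "s * cmod (poly P' x) <= cmod (poly P x) + cmod c"
   using that norm_triangle_ineq4[of "poly P x" c] by (metis norm_mult)
  then show ?thesis using Suc.prems[OF that] c s by (simp add: field_simps)
 qed
 from Suc.IH[OF this] have "cmod (coeff P (Suc k)) <= 2 * B / s * (2 / s) ^ k" by (simp add: P)
 then show ?case by (simp add: mult_ac)
qed

lemma poly_bound_of_coeff:
 fixes P :: "complex poly"
 assumes B: "B >= 0" "!!k. cmod (coeff P k) <= B * D ^ k" and D: "D >= 1" and d: "degree P <= d" and x: "cmod x <= r" "r >= 1"
 shows "cmod (poly P x) <= B * (real d + 1) * (D * r) ^ d"
proof -
 have "poly P x = (\<Sum>k\<le>d. coeff P k * x ^ k)" unfolding poly_altdef
  by (rule sum.mono_neutral_left) (use d in \<open>auto simp: coeff_eq_0\<close>)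
 also have "cmod ... <= (\<Sum>k\<le>d. B * (D * r) ^ d)"
 proof (rule sum_norm_le)
  fix k assume "k \<in> {..d}"
  have "cmod (coeff P k * x ^ k) <= (B * D ^ k) * r ^ k"
   unfolding norm_mult norm_power using B D x by (intro mult_mono power_mono) auto
  also have "... = B * (D * r) ^ k" by (simp add: power_mult_distrib)
  also have "... <= B * (D * r) ^ d"
   using \<open>k \<in> {..d}\<close> B(1) D x(2) mult_mono[OF D x(2)] by (intro mult_left_mono power_increasing) auto
  finally show "cmod (coeff P k * x ^ k) <= B * (D * r) ^ d" .
 qed
 finally show ?thesis by (simp add: mult_ac add.commute)
qed

lemma HC_E:
 assumes "Q \<in> HC a b n"
 obtains c where "!!j k. a * j + b * k ~= n * a * b ==> c j k = 0"
  "!!z. Q z = (\<Sum>j\<le>n * b. \<Sum>k\<le>n * a. c j k * fst z ^ j * snd z ^ k)"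
 using assms unfolding HC_def by blast

lemma HC_line:
 assumes "Q \<in> HC a b n" shows "\<exists>q :: complex poly. \<forall>t. Q (cline z w t) = poly q t"
proof -
 obtain c where "!!j k. a * j + b * k ~= n * a * b ==> c j k = 0"
  and c: "!!z. Q z = (\<Sum>j\<le>n * b. \<Sum>k\<le>n * a. c j k * fst z ^ j * snd z ^ k)" using HC_E[OF assms] by blast
 show ?thesis by (intro exI[of _ "\<Sum>j\<le>n * b. \<Sum>k\<le>n * a. smult (c j k) ([:fst z, fst w:] ^ j * [:snd z, snd w:] ^ k)"])
   (simp add: c poly_sum cline_def mult.assoc)
qed

lemma HC_continuous: assumes "Q \<in> HC a b n" shows "continuous_on S Q"
proof -
 obtain c where "!!j k. a * j + b * k ~= n * a * b ==> c j k = 0"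
  and Q: "!!z. Q z = (\<Sum>j\<le>n * b. \<Sum>k\<le>n * a. c j k * fst z ^ j * snd z ^ k)" using HC_E[OF assms] by blast
 have c: "Q = (%z. \<Sum>j\<le>n * b. \<Sum>k\<le>n * a. c j k * fst z ^ j * snd z ^ k)" by (rule ext) (rule Q)
 show ?thesis unfolding c by (intro continuous_intros)
qed

lemma HC_homogeneous: assumes "Q \<in> HC a b n" shows "Q (wscale a b l z) = l ^ (n * a * b) * Q z"
proof -
 obtain c where c: "!!j k. a * j + b * k ~= n * a * b ==> c j k = 0"
  "!!z. Q z = (\<Sum>j\<le>n * b. \<Sum>k\<le>n * a. c j k * fst z ^ j * snd z ^ k)" using HC_E[OF assms] by blast
 have "c j k * (l ^ a * fst z) ^ j * (l ^ b * snd z) ^ k = l ^ (n * a * b) * (c j k * fst z ^ j * snd z ^ k)" for j k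
 proof (cases "a * j + b * k = n * a * b")
  case True
  have "c j k * (l ^ a * fst z) ^ j * (l ^ b * snd z) ^ k = l ^ (a * j + b * k) * (c j k * fst z ^ j * snd z ^ k)"
   by (simp add: power_mult_distrib power_add power_mult mult_ac)
  then show ?thesis by (simp only: True)
 qed (simp add: c(1))
 then show ?thesis unfolding c(2) wscale_def fst_conv snd_conv sum_distrib_left by (intro sum.cong refl)
qed

text \<open>\<open>Qb\<close> is the hypothesis on the limsup freed of logarithms, so that zeros of
  \<open>Q n\<close> form no exception.\<close>

locale hart = pluri +
 fixes Q :: "nat => c2 => complex"
 assumes Q: "!!n. Q n \<in> HC a b n"
  and Qb: "!!\<zeta> e. \<zeta> \<in> bidisk_boundary ==> e > 0 ==> \<exists>N. \<forall>n\<ge>N. cmod (Q n \<zeta>) <= exp (real n * (rho \<zeta> + e))"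
begin

text \<open>The slice is merely reparametrised by m -> m l. Applied to the inverse of
  \<open>l\<close> this gives the reverse inequality as well.\<close>

lemma rho_homogeneous_le:
 assumes "z ~= 0" "l ~= 0" shows "rho (wscale a b l z) <= rho z + real (a * b) * ln (cmod l)"
proof (rule field_le_epsilon)
 fix e :: real assume "e > 0"
 then obtain R where R: "!!m. cmod m >= R ==> vv z m <= rho z + e" using rho_upper[OF assms(1)] by metis
 show "rho (wscale a b l z) <= rho z + real (a * b) * ln (cmod l) + e"
 proof (rule rho_le[where R="max 1 (R / cmod l)"])
  show "wscale a b l z ~= 0" using assms by (cases z) (auto simp: wscale_def zero_prod_def)
  fix m :: complex assume m: "cmod m >= max 1 (R / cmod l)"
  have "m ~= 0" using m by auto
  have "vv (wscale a b l z) m = vv z (m * l) + real (a * b) * ln (cmod l)"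
   using \<open>m ~= 0\<close> assms(2) by (simp add: vv_def wscale_mult norm_mult ln_mult distrib_left)
  moreover have "cmod (m * l) >= R" using m assms(2) by (simp add: norm_mult pos_divide_le_eq)
  ultimately show "vv (wscale a b l z) m <= rho z + real (a * b) * ln (cmod l) + e" using R[of "m * l"] by simp
 qed
qed

lemma Q_homogeneous: "Q n (wscale a b l z) = l ^ (n * a * b) * Q n z" by (rule HC_homogeneous[OF Q])

lemma power_exp_ln: "t > 0 ==> t ^ (n * a * b) = exp (real n * (real (a * b) * ln t))"
 using exp_of_nat_mult[of "n * a * b" "ln t"] by (simp add: mult_ac)

text \<open>Both sides scale alike along orbits, so the hypothesis on the bidisk boundary reaches
  every nonzero point.\<close>

lemma Q_pointwise:
 assumes "z ~= 0" "e > 0" shows "\<exists>N. \<forall>n\<ge>N. cmod (Q n z) <= exp (real n * (rho z + e))"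
proof -
 obtain t \<zeta> where t: "t > 0" "\<zeta> \<in> bidisk_boundary" "z = wscale a b (of_real t) \<zeta>"
  using polar_decomposition[OF ab assms(1)] by metis
 have "\<zeta> = wscale a b (of_real (1 / t)) z" using t(1) by (cases \<zeta>) (simp add: t(3) wscale_def field_simps)
 then have r: "rho \<zeta> <= rho z - real (a * b) * ln t"
  using rho_homogeneous_le[OF assms(1), of "of_real (1 / t)"] t(1) by (simp add: ln_div norm_divide)
 obtain N where N: "!!n. n >= N ==> cmod (Q n \<zeta>) <= exp (real n * (rho \<zeta> + e))" using Qb[OF t(2) assms(2)] by blast
 have "cmod (Q n z) <= exp (real n * (rho z + e))" if "n >= N" for n
 proof -
  have "cmod (Q n z) = t ^ (n * a * b) * cmod (Q n \<zeta>)" using t(1) by (simp add: t(3) Q_homogeneous norm_mult norm_power)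
  also have "... <= exp (real n * (real (a * b) * ln t)) * exp (real n * (rho \<zeta> + e))"
   unfolding power_exp_ln[OF t(1)] by (intro mult_left_mono N that) auto
  also have "... = exp (real n * (real (a * b) * ln t + rho \<zeta> + e))" by (simp add: exp_add[symmetric] algebra_simps)
  also have "... <= exp (real n * (rho z + e))" using r by (simp add: mult_left_mono)
  finally show ?thesis .
 qed
 then show ?thesis by blast
qed

text \<open>Baire's theorem for the closed sets \<open>E N\<close>, which cover the plane: pointwise
  bounds with unspecified constants become one bound on some disc of the line of points (1,
  x).\<close>

lemma Q_crude_disc:
 obtains N s \<tau> where "s > 0" "!!n x. n >= N ==> cmod (x - \<tau>) <= s ==> cmod (Q n (1, x)) <= exp (real n * real N)"
proof -
 define E where "E N = {x. \<forall>n\<ge>N. cmod (Q n (1, x)) <= exp (real n * real N)}" for N :: nat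
 have clE: "closed (E N)" for N
 proof -
  have "E N = (\<Inter>n\<in>{N..}. {x. cmod (Q n (1, x)) <= exp (real n * real N)})" by (auto simp: E_def)
  moreover have "closed {x. cmod (Q n (1, x)) <= exp (real n * real N)}" for n
   by (intro closed_Collect_le continuous_intros continuous_on_compose2[OF HC_continuous[OF Q], of UNIV]) auto
  ultimately show ?thesis by auto
 qed
 have cov: "\<exists>N. x \<in> E N" for x
 proof -
  have nz: "(1, x) ~= (0 :: c2)" by (simp add: zero_prod_def)
  obtain N0 where N0: "!!n. n >= N0 ==> cmod (Q n (1, x)) <= exp (real n * (rho (1, x) + 1))" using Q_pointwise[OF nz, of 1] by auto
  obtain N1 where N1: "rho (1, x) + 1 <= real N1" using real_arch_simple by blast
  have "cmod (Q n (1, x)) <= exp (real n * real (max N0 N1))" if "n >= max N0 N1" for n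
  proof -
   have "real n * (rho (1, x) + 1) <= real n * real (max N0 N1)" using N1 by (intro mult_left_mono) (auto simp: le_max_iff_disj)
   then show ?thesis using N0[of n] that by (meson exp_le_cancel_iff max.bounded_iff order_trans)
  qed
  then show ?thesis unfolding E_def by blast
 qed
 have "\<exists>N. \<not> UNIV \<subseteq> closure (- E N)"
 proof (rule ccontr)
  assume "\<nexists>N. \<not> UNIV \<subseteq> closure (- E N)"
  then have "UNIV \<subseteq> closure (\<Inter> (range (%N. - E N)))" by (intro Baire) (use clE in auto)
  moreover have "\<Inter> (range (%N. - E N)) = {}" using cov by auto
  ultimately show False by auto
 qed
 then obtain N \<tau> where "\<tau> \<notin> closure (- E N)" by blast
 then have "\<tau> \<in> interior (E N)" by (simp add: closure_complement)
 then obtain s where s: "s > 0" "cball \<tau> s \<subseteq> E N" unfolding mem_interior_cball by blast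
 have "cmod (Q n (1, x)) <= exp (real n * real N)" if "n >= N" "cmod (x - \<tau>) <= s" for n x
  using s(2) that by (auto simp: E_def subset_iff dist_norm norm_minus_commute)
 then show thesis using that s(1) by blast
qed

text \<open>From the disc to all balls: the polynomial x -> \<open>Q n (1, x)\<close> has degree at
  most n a, so its Taylor coefficients at \<tau>, then its values on the unit circle, then its
  coefficients at 0 are bounded with losses exponential in \<open>n\<close>. By weighted homogeneity
  these coefficients are all the coefficients of \<open>Q n\<close>.\<close>

lemma Q_crude:
 assumes B: "B >= 1"
 obtains C N where "C >= 0" "!!n z. n >= N ==> norm z <= B ==> cmod (Q n z) <= exp (real n * C)"
proof -
 obtain N s \<tau> where N: "s > 0" "!!n x. n >= N ==> cmod (x - \<tau>) <= s ==> cmod (Q n (1, x)) <= exp (real n * real N)"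
  using Q_crude_disc by metis
 define D where "D = max 1 (2 / s)"
 define D' where "D' = D * (1 + cmod \<tau>)"
 have D: "D >= 1" "D' >= 1" using mult_mono[of 1 D 1 "1 + cmod \<tau>"] by (auto simp: D_def D'_def)
 \<comment> \<open>The sum of the exponential rates: \<open>real N\<close> from the disc, one rate
   for each of the three polynomial factors absorbed by an exponential, and the logarithms of the
   powers of 2 D' and of \<open>B\<close>.\<close>
 define C where "C = real N + 2 * real a + real b + real a * ln (2 * D') + (real a + real b) * ln B"
 have C0: "C >= 0" using D B by (simp add: C_def)
 have "cmod (Q n z) <= exp (real n * C)" if n: "n >= N" and z: "norm z <= B" for n z
 proof -
  obtain c where c: "!!j k. a * j + b * k ~= n * a * b ==> c j k = 0"
   "!!z. Q n z = (\<Sum>j\<le>n * b. \<Sum>k\<le>n * a. c j k * fst z ^ j * snd z ^ k)" using HC_E[OF Q[of n]] by blast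
  define d where "d = n * a"
  define p where "p = (\<Sum>k\<le>d. monom (\<Sum>j\<le>n * b. c j k) k)"
  have pQ: "poly p x = Q n (1, x)" for x
   unfolding p_def c(2) poly_sum poly_monom d_def[symmetric] by (simp add: sum_distrib_right) (rule sum.swap)
  have dp: "degree p <= d" unfolding p_def by (rule degree_sum_le) (auto intro: order_trans[OF degree_monom_le])
  define E0 where "E0 = exp (real n * real N)"
  have E0: "E0 >= 0" by (simp add: E0_def)
  define P where "P = pcompose p [:\<tau>, 1:]"
  have PQ: "poly P x = Q n (1, \<tau> + x)" for x by (simp add: P_def poly_pcompose pQ)
  have dP: "degree P <= d" using degree_pcompose_le[of p "[:\<tau>, 1:]"] dp unfolding P_def by simp
  have "cmod (coeff P k) <= E0 * D ^ k" for k
  proof -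
   have "cmod (coeff P k) <= E0 * (2 / s) ^ k" by (rule poly_coeff_bound[OF N(1)]) (use N(2)[OF n] in \<open>simp add: PQ E0_def\<close>)
   also have "... <= E0 * D ^ k" using E0 N(1) by (intro mult_left_mono power_mono) (auto simp: D_def)
   finally show ?thesis .
  qed
  note cP = poly_bound_of_coeff[OF E0 this D(1) dP]
  define E1 where "E1 = E0 * (real d + 1) * D' ^ d"
  have E1: "E1 >= 0" using E0 D by (simp add: E1_def)
  have b1: "cmod (poly p x) <= E1" if "cmod x = 1" for x
  proof -
   have "poly p x = poly P (x - \<tau>)" by (simp add: pQ PQ)
   moreover have "cmod (x - \<tau>) <= 1 + cmod \<tau>" using norm_triangle_ineq4[of x \<tau>] that by simp
   ultimately show ?thesis using cP[of "x - \<tau>" "1 + cmod \<tau>"] by (simp add: E1_def D'_def)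
  qed
  define A where "A = E1 * 2 ^ d"
  have A: "A >= 0" using E1 by (simp add: A_def)
  \<comment> \<open>For given \<open>k\<close> the weight leaves room for a single \<open>j\<close>,
    so summing over \<open>j\<close> loses nothing.\<close>
  have cA: "cmod (c j k) <= A" if "j <= n * b" "k <= d" for j k
  proof (cases "a * j + b * k = n * a * b")
   case True
   have "(\<Sum>i\<le>n * b. c i k) = (\<Sum>i\<in>{j}. c i k)"
   proof (rule sum.mono_neutral_right)
    show "\<forall>i\<in>{..n * b} - {j}. c i k = 0"
    proof
     fix i assume "i \<in> {..n * b} - {j}"
     then have "i ~= j" by simp
     then have "a * i ~= a * j" using ab by simp
     then show "c i k = 0" using True by (intro c(1)) linarith
    qed
   qed (use that in auto)
   moreover have "coeff p k = (\<Sum>i\<le>n * b. c i k)"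
    using that(2) by (simp add: p_def coeff_sum if_distrib cong: if_cong)
   ultimately have "c j k = coeff p k" by simp
   moreover have "cmod (coeff p k) <= E1 * (2 / 1) ^ k" by (rule poly_coeff_bound) (use b1 in auto)
   moreover have "E1 * (2 / 1) ^ k <= A" unfolding A_def using E1 that by (intro mult_left_mono) (auto intro: power_increasing)
   ultimately show ?thesis by simp
  qed (use A c(1) in simp)
  have "cmod (Q n z) <= (\<Sum>j\<le>n * b. \<Sum>k\<le>d. A * B ^ (n * b) * B ^ d)"
   unfolding c(2) d_def[symmetric]
  proof (intro sum_norm_le)
   fix j k assume jk: "j \<in> {..n * b}" "k \<in> {..d}"
   have zz: "cmod (fst z) <= B" "cmod (snd z) <= B" using z cmod_fst[of z] cmod_snd[of z] by linarith+
   have "cmod (fst z) ^ j <= B ^ (n * b)"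
    using power_mono[OF zz(1), of j] power_increasing[of j "n * b" B] jk B by simp
   moreover have "cmod (snd z) ^ k <= B ^ d"
    using power_mono[OF zz(2), of k] power_increasing[of k d B] jk B by simp
   ultimately show "cmod (c j k * fst z ^ j * snd z ^ k) <= A * B ^ (n * b) * B ^ d"
    unfolding norm_mult norm_power using cA[of j k] jk A B by (intro mult_mono) auto
  qed
  also have "... = (real (n * b) + 1) * (real d + 1) * (E0 * (real d + 1) * D' ^ d * 2 ^ d * B ^ (n * b) * B ^ d)"
   by (simp add: A_def E1_def algebra_simps)
  also have "... <= exp (real (n * b)) * exp (real d) * (E0 * exp (real d) * D' ^ d * 2 ^ d * B ^ (n * b) * B ^ d)"
   using E0 D B by (intro mult_mono mult_right_mono mult_left_mono) (auto intro!: mult_nonneg_nonneg simp: add.commute)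
  also have "... = exp (real n * C)"
  proof -
   have pw: "x ^ m = exp (real m * ln x)" if "x >= 1" for x :: real and m
    using that by (simp add: exp_of_nat_mult)
   have "ln (2 * D') = ln 2 + ln D'" using D by (simp add: ln_mult)
   then show ?thesis unfolding E0_def pw[OF D(2)] pw[OF B] pw[of 2, simplified] C_def d_def by (simp add: exp_add[symmetric] algebra_simps)
  qed
  finally show ?thesis .
 qed
 then show thesis using that[OF C0] by blast
qed

text \<open>The functions \<open>h n\<close> are submean, bounded near \<open>z0\<close> by
  \<open>Q_crude\<close>, and tend to 0 pointwise because \<sigma> exceeds \<open>rho\<close> there.
  The positive part of the logarithm makes them nonnegative, so dominated convergence gives
  convergence to 0 of their integrals, and the sub-mean property over balls turns this into uniform
  convergence.\<close>

lemma hartogs_local: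
 assumes z0: "z0 ~= 0" and e: "e > 0"
 obtains \<delta> N where "\<delta> > 0" "!!n z. n >= N ==> norm (z - z0) <= \<delta> ==> cmod (Q n z) <= exp (real n * (rho z0 + e))"
proof -
 obtain \<delta>0 where d0: "\<delta>0 > 0" "!!z. norm (z - z0) <= \<delta>0 ==> z ~= 0 \<and> rho z <= rho z0 + e / 4"
  using rho_upper_near[OF z0, of "e / 4"] e by auto
 \<comment> \<open>Half of the allowance: a quarter for the variation of \<open>rho\<close>, a
   quarter for the pointwise bound. The other half is left for the uniform step.\<close>
 define \<sigma> where "\<sigma> = rho z0 + e / 2"
 define \<delta> where "\<delta> = \<delta>0 / 2"
 have \<delta>: "\<delta> > 0" using d0 by (simp add: \<delta>_def)
 have B1: "1 <= norm z0 + \<delta>0 + 1" using d0(1) norm_ge_zero[of z0] by linarith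
 obtain C N0 where C: "C >= 0" "!!n z. n >= N0 ==> norm z <= norm z0 + \<delta>0 + 1 ==> cmod (Q n z) <= exp (real n * C)"
  using Q_crude[OF B1] by metis
 define F where "F n z = Q n z * of_real (exp (- (real n * \<sigma>)))" for n z
 define h where "h n z = inverse (real n) * logplus (cmod (F n z))" for n z
 have ch: "continuous_on UNIV (h n)" for n
  unfolding h_def[abs_def] F_def by (intro continuous_intros continuous_logplus_comp HC_continuous[OF Q])
 have lh: "lbr (h n)" for n by (rule lbr_continuous[OF ch])
 have sh: "submean (h n)" for n
  unfolding h_def[abs_def]
 proof (intro submean_cmult submean_logplus_poly)
  fix z w
  obtain q where q: "!!t. Q n (cline z w t) = poly q t" using HC_line[OF Q] by blast
  show "\<exists>q. \<forall>t. F n (cline z w t) = poly q t"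
   by (intro exI[of _ "smult (of_real (exp (- (real n * \<sigma>)))) q"]) (simp add: F_def q)
 qed simp
 have h0: "0 <= h n z" for n z by (simp add: h_def)
 have cF: "cmod (F n z) = cmod (Q n z) * exp (- (real n * \<sigma>))" for n z by (simp add: F_def norm_mult)
 define B where "B = C + \<bar>\<sigma>\<bar>"
 have hB: "h n z <= B" if "n >= Suc N0" "norm (z - z0) <= \<delta>0" for n z
 proof -
  have "norm z <= norm z0 + \<delta>0 + 1" using norm_triangle_ineq[of z0 "z - z0"] that by simp
  then have "cmod (F n z) <= exp (real n * C) * exp (- (real n * \<sigma>))"
   unfolding cF using that by (intro mult_right_mono C(2)) auto
  also have "... <= exp (real n * B)" unfolding exp_add[symmetric] exp_le_cancel_iff
   using mult_left_mono[of "C - \<sigma>" B "real n"] by (simp add: B_def algebra_simps)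
  finally have "logplus (cmod (F n z)) <= logplus (exp (real n * B))" by (rule logplus_mono)
  also have "... = real n * B" using C(1) by (subst logplus_ge_one) (auto simp: B_def)
  finally show ?thesis using that unfolding h_def by (simp add: field_simps)
 qed
 have hz: "(%n. h n z) \<longlonglongrightarrow> 0" if z: "norm (z - z0) <= \<delta>0" for z
 proof -
  obtain N where N: "!!n. n >= N ==> cmod (Q n z) <= exp (real n * (rho z + e / 4))"
   using Q_pointwise[of z "e / 4"] d0(2)[OF z] e by auto
  have "h n z = 0" if "n >= N" for n
  proof -
   have "cmod (F n z) <= exp (real n * (rho z + e / 4)) * exp (- (real n * \<sigma>))"
    unfolding cF by (intro mult_right_mono N that) auto
   also have "... = exp (real n * (rho z + e / 4 - \<sigma>))" by (simp add: exp_add[symmetric] algebra_simps)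
   also have "... <= 1" using d0(2)[OF z] by (simp add: \<sigma>_def mult_nonneg_nonpos)
   finally show ?thesis by (simp add: h_def logplus_def)
  qed
  then have "eventually (%n. h n z = 0) sequentially" by (auto simp: eventually_sequentially)
  then show ?thesis by (rule tendsto_eventually)
 qed
 define I where "I n = (LINT z|lborel. indicator (cball z0 \<delta>0) z * h n z)" for n
 have mh: "(%z. indicat_real (cball z0 \<delta>0) z * h n z) \<in> borel_measurable borel" for n
  by (intro borel_measurable_times borel_measurable_indicator lbr_borel[OF lh]) auto
 have Id: "integrable lborel (%z. indicator (cball z0 \<delta>0) z * B)"
  using emeasure_bounded_finite[of "cball z0 \<delta>0"] by (intro integrable_mult_left integrable_real_indicator) auto
 have bnd: "norm (indicator (cball z0 \<delta>0) z * h n z) <= indicator (cball z0 \<delta>0) z * B" if "n >= Suc N0" for n z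
  using hB[OF that, of z] h0[of n z] by (auto simp: indicator_def dist_norm norm_minus_commute)
 have "(%n. I (n + Suc N0)) \<longlonglongrightarrow> (LINT z|(lborel :: c2 measure). (0 :: real))"
  unfolding I_def
 proof (rule integral_dominated_convergence[where w="%z. indicat_real (cball z0 \<delta>0) z * B" and f="%z. 0 :: real"])
  show "integrable lborel (%z. indicat_real (cball z0 \<delta>0) z * B)" by (rule Id)
  show "AE z in lborel. (%n. indicator (cball z0 \<delta>0) z * h (n + Suc N0) z) \<longlonglongrightarrow> 0"
  proof (rule AE_I2)
   fix z
   show "(%n. indicator (cball z0 \<delta>0) z * h (n + Suc N0) z) \<longlonglongrightarrow> 0"
   proof (cases "norm (z - z0) <= \<delta>0")
    case True
    from tendsto_mult_left[OF LIMSEQ_ignore_initial_segment[OF hz[OF True], of "Suc N0"], of "indicator (cball z0 \<delta>0) z"]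
    show ?thesis by simp
   next
    case False
    then have "indicator (cball z0 \<delta>0) z = (0 :: real)" by (simp add: dist_norm norm_minus_commute)
    then show ?thesis by simp
   qed
  qed
  show "AE z in lborel. norm (indicator (cball z0 \<delta>0) z * h (n + Suc N0) z) <= indicator (cball z0 \<delta>0) z * B" for n
   by (intro AE_I2 bnd) simp
  show "(%z. indicat_real (cball z0 \<delta>0) z * h (n + Suc N0) z) \<in> borel_measurable lborel" for n
   using mh[of "n + Suc N0"] by simp
 qed simp
 then have I0: "I \<longlonglongrightarrow> 0" using LIMSEQ_offset[of I "Suc N0" 0] by simp
 obtain D where D: "D >= 0" "!!w. norm w <= \<delta> ==> \<bar>keta \<delta> w\<bar> <= D" using lbr_bound[OF lbr_keta[of \<delta>]] by metis
 have hI: "h n z <= D * I n" if z: "norm (z - z0) <= \<delta>" and n: "n >= Suc N0" for n z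
 proof -
  have ii: "integrable lborel (%w. indicator (cball z0 \<delta>0) w * h n w)"
  proof (rule Bochner_Integration.integrable_bound[OF Id])
   show "(%w. indicator (cball z0 \<delta>0) w * h n w) \<in> borel_measurable lborel" using mh[of n] by simp
   show "AE w in lborel. norm (indicator (cball z0 \<delta>0) w * h n w) <= norm (indicat_real (cball z0 \<delta>0) w * B)"
    by (intro AE_I2 order_trans[OF bnd[OF n]]) simp
  qed
  have pm: "(+) z \<in> lborel \<rightarrow>\<^sub>M borel" by simp
  have ii': "integrable lborel (%w. indicator (cball z0 \<delta>0) (z + w) * h n (z + w))"
   by (rule integrable_distr[OF pm]) (use ii in \<open>simp only: lborel_distr_plus\<close>)
  have "h n z <= sm \<delta> (h n) z" by (rule sm_ge[OF \<delta> lh sh])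
  also have "... <= (LINT w|lborel. D * (indicator (cball z0 \<delta>0) (z + w) * h n (z + w)))"
   unfolding sm_def
  proof (rule integral_mono[OF integrable_keta[OF \<delta> lbr_shift[OF lh]]])
   fix w :: c2
   show "keta \<delta> w * h n (z + w) <= D * (indicator (cball z0 \<delta>0) (z + w) * h n (z + w))"
   proof (cases "norm w < \<delta>")
    case True
    then have "norm (z + w - z0) <= \<delta>0" using norm_triangle_ineq[of "z - z0" w] z by (simp add: \<delta>_def algebra_simps)
    then have "z + w \<in> cball z0 \<delta>0" by (simp add: dist_norm norm_minus_commute)
    then show ?thesis using D(2)[of w] True h0[of n "z + w"] by (simp add: mult_right_mono)
   next
    case False
    then have "keta \<delta> w = 0" using vanishD[OF vanish_keta[OF \<delta>]] by simp
    then show ?thesis using D(1) h0[of n "z + w"] by simp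
   qed
  qed (intro integrable_mult_right ii')
  also have "... = D * (LINT w|lborel. indicator (cball z0 \<delta>0) (z + w) * h n (z + w))" by simp
  also have "(LINT w|lborel. indicator (cball z0 \<delta>0) (z + w) * h n (z + w)) = I n"
  proof -
   have "I n = (LINT w|distr lborel borel ((+) z). indicator (cball z0 \<delta>0) w * h n w)" by (simp add: I_def lborel_distr_plus)
   also have "... = (LINT w|lborel. indicator (cball z0 \<delta>0) (z + w) * h n (z + w))" by (rule integral_distr[OF pm mh])
   finally show ?thesis by simp
  qed
  finally show ?thesis .
 qed
 have "(%n. D * I n) \<longlonglongrightarrow> 0" using tendsto_mult_left[OF I0, of D] by simp
 then have "eventually (%n. D * I n < e / 2) sequentially" using e by (intro order_tendstoD(2)) auto
 then obtain N1 where N1: "!!n. n >= N1 ==> D * I n < e / 2" by (auto simp: eventually_sequentially)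
 have "cmod (Q n z) <= exp (real n * (rho z0 + e))" if n: "n >= max N1 (Suc N0)" and z: "norm (z - z0) <= \<delta>" for n z
 proof -
  have "h n z < e / 2" using hI[OF z, of n] N1[of n] n by simp
  then have "logplus (cmod (F n z)) < real n * (e / 2)" using n by (simp add: h_def field_simps)
  then have "cmod (F n z) <= exp (real n * (e / 2))"
  proof (cases "cmod (F n z) <= 1")
   case True
   moreover have "1 <= exp (real n * (e / 2))" using e by simp
   ultimately show ?thesis by linarith
  next
   case False
   then have "ln (cmod (F n z)) <= real n * (e / 2)" using \<open>logplus (cmod (F n z)) < real n * (e / 2)\<close> by (simp add: logplus_def)
   then show ?thesis using False by (subst ln_le_cancel_iff[symmetric]) auto
  qed
  moreover have "cmod (Q n z) = cmod (F n z) * exp (real n * \<sigma>)" by (simp add: cF exp_minus field_simps)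
  ultimately have "cmod (Q n z) <= exp (real n * (e / 2)) * exp (real n * \<sigma>)" by (simp add: mult_right_mono)
  also have "... = exp (real n * (rho z0 + e))" by (simp add: exp_add[symmetric] \<sigma>_def algebra_simps)
  finally show ?thesis .
 qed
 then show thesis using that[OF \<delta>] by blast
qed

lemma compact_bidisk: "compact bidisk_boundary"
proof -
 have "closed bidisk_boundary" unfolding bidisk_boundary_def by (intro closed_Collect_eq continuous_intros)
 moreover have "bounded bidisk_boundary" unfolding bounded_iff using bidisk_norm by blast
 ultimately show ?thesis by (simp add: compact_eq_bounded_closed)
qed

text \<open>Near each point of the compact bidisk boundary the local bound for \<open>Q n\<close>
  meets the lower bound for the slices of \<open>V\<close>. Homogeneity of \<open>Q n\<close> along
  orbits carries the combination to all large |l|.\<close>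

lemma hartogs_global:
 assumes e: "e > 0"
 obtains R N where "R >= 1" "!!n z. n >= N ==> norm z >= R ==> cmod (Q n z) <= exp (real n * (V z + e))"
proof -
 have loc: "\<exists>\<delta> R N. \<delta> > 0 \<and> R >= 1 \<and> (\<forall>n z l. n >= N \<longrightarrow> norm (z - z0) <= \<delta> \<longrightarrow> cmod l >= R \<longrightarrow>
   cmod (Q n (wscale a b l z)) <= exp (real n * (V (wscale a b l z) + e)))" if "z0 \<in> bidisk_boundary" for z0
 proof -
  have nz: "z0 ~= 0" by (rule bidisk_nz[OF that])
  obtain \<delta>1 N where 1: "\<delta>1 > 0" "!!n z. n >= N ==> norm (z - z0) <= \<delta>1 ==> cmod (Q n z) <= exp (real n * (rho z0 + e / 2))"
   using hartogs_local[OF nz, of "e / 2"] e by auto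
  obtain \<delta>2 R where 2: "\<delta>2 > 0" "R >= 1" "!!z l. norm (z - z0) <= \<delta>2 ==> cmod l >= R ==> rho z0 - e / 2 <= vv z l"
   using vv_lower_near[OF nz, of "e / 2"] e by auto
  have "cmod (Q n (wscale a b l z)) <= exp (real n * (V (wscale a b l z) + e))"
   if n: "n >= N" and z: "norm (z - z0) <= min \<delta>1 \<delta>2" and l: "cmod l >= R" for n z l
  proof -
   have l0: "cmod l > 0" using l 2(2) by linarith
   have "cmod (Q n (wscale a b l z)) = cmod l ^ (n * a * b) * cmod (Q n z)" by (simp add: Q_homogeneous norm_mult norm_power)
   also have "... <= exp (real n * (real (a * b) * ln (cmod l))) * exp (real n * (rho z0 + e / 2))"
    unfolding power_exp_ln[OF l0] using z by (intro mult_left_mono 1(2)[OF n]) auto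
   also have "... = exp (real n * (real (a * b) * ln (cmod l) + rho z0 + e / 2))" by (simp add: exp_add[symmetric] algebra_simps)
   also have "... <= exp (real n * (V (wscale a b l z) + e))"
    unfolding exp_le_cancel_iff using 2(3)[of z l] z l by (intro mult_left_mono) (auto simp: vv_def)
   finally show ?thesis .
  qed
  then show ?thesis using 1(1) 2(1,2) by (intro exI[of _ "min \<delta>1 \<delta>2"] exI[of _ R] exI[of _ N]) auto
 qed
 define good where "good z0 \<delta> R N \<longleftrightarrow> \<delta> > 0 \<and> R >= 1 \<and> (\<forall>n z l. n >= N \<longrightarrow> norm (z - z0) <= \<delta> \<longrightarrow> cmod l >= R \<longrightarrow>
   cmod (Q n (wscale a b l z)) <= exp (real n * (V (wscale a b l z) + e)))" for z0 :: c2 and \<delta> R :: real and N :: nat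
 have "\<exists>t. good z0 (fst t) (fst (snd t)) (snd (snd t))" if zb: "z0 \<in> bidisk_boundary" for z0
 proof -
  obtain \<delta> R N where "good z0 \<delta> R N" using loc[OF zb] unfolding good_def by blast
  then show ?thesis by (intro exI[of _ "(\<delta>, R, N)"]) simp
 qed
 then have "\<forall>z0\<in>bidisk_boundary. \<exists>t. good z0 (fst t) (fst (snd t)) (snd (snd t))" by blast
 from bchoice[OF this] obtain f where f: "\<forall>z0\<in>bidisk_boundary. good z0 (fst (f z0)) (fst (snd (f z0))) (snd (snd (f z0)))" by blast
 define \<delta> R N where "\<delta> z0 = fst (f z0)" and "R z0 = fst (snd (f z0))" and "N z0 = snd (snd (f z0))" for z0
 have g: "good z0 (\<delta> z0) (R z0) (N z0)" if "z0 \<in> bidisk_boundary" for z0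
  using f that unfolding \<delta>_def R_def N_def by blast
 have "z0 \<in> ball z0 (\<delta> z0)" if "z0 \<in> bidisk_boundary" for z0
  using g[OF that] unfolding good_def centre_in_ball by blast
 then have cov: "bidisk_boundary \<subseteq> (\<Union>c\<in>bidisk_boundary. ball c (\<delta> c))" by blast
 obtain D where D: "D \<subseteq> bidisk_boundary" "finite D" "bidisk_boundary \<subseteq> (\<Union>c\<in>D. ball c (\<delta> c))"
  using compactE_image[OF compact_bidisk open_ball cov] by blast
 define RR where "RR = 1 + (\<Sum>c\<in>D. R c)"
 define NN where "NN = (\<Sum>c\<in>D. N c)"
 have R1: "R c >= 1" if "c \<in> D" for c using g[OF subsetD[OF D(1) that]] unfolding good_def by blast
 have RR: "R c <= RR" if "c \<in> D" for c
  proof -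
  have "R c <= sum R D" by (rule member_le_sum[OF that _ D(2)]) (use R1 in force)
  then show ?thesis by (simp add: RR_def)
 qed
 have RR1: "RR >= 1" proof -
  have "sum R D >= 0" by (rule sum_nonneg) (use R1 in force)
  then show ?thesis by (simp add: RR_def)
 qed
 have NN: "N c <= NN" if "c \<in> D" for c using member_le_sum[OF that _ D(2), of N] by (simp add: NN_def)
 \<comment> \<open>Points of gauge t < RR have norm at most 2 (RR^a + RR^b), because the bidisk
   boundary lies in the ball of radius 2.\<close>
 have "cmod (Q n z) <= exp (real n * (V z + e))" if n: "n >= NN" and z: "norm z >= 2 * (RR ^ a + RR ^ b) + 1" for n z
 proof -
  have "RR ^ a + RR ^ b >= 0" using RR1 by simp
  then have "z ~= 0" using z by auto
  then obtain t \<zeta> where t: "t > 0" "\<zeta> \<in> bidisk_boundary" "z = wscale a b (of_real t) \<zeta>"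
   using polar_decomposition[OF ab] by metis
  have "t >= RR"
  proof (rule ccontr)
   assume "\<not> t >= RR"
   then have "t ^ a + t ^ b <= RR ^ a + RR ^ b" using t(1) by (intro add_mono power_mono) auto
   then have "(t ^ a + t ^ b) * norm \<zeta> <= (RR ^ a + RR ^ b) * 2" using bidisk_norm[OF t(2)] t(1) RR1 by (intro mult_mono) auto
   then show False using norm_wscale_le[of a b "of_real t" \<zeta>] z t by simp
  qed
  obtain c where c: "c \<in> D" "\<zeta> \<in> ball c (\<delta> c)" using D(3) t(2) by blast
  then have "good c (\<delta> c) (R c) (N c)" using g D(1) by blast
  moreover have "norm (\<zeta> - c) <= \<delta> c" using c(2) by (simp add: dist_norm norm_minus_commute)
  moreover have "cmod (of_real t) >= R c" using RR[OF c(1)] \<open>t >= RR\<close> t(1) by simp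
  moreover have "n >= N c" using NN[OF c(1)] n by simp
  ultimately show ?thesis unfolding t(3) good_def by blast
 qed
 then show thesis using that[of "2 * (RR ^ a + RR ^ b) + 1" NN] RR1 by auto
qed

end

section \<open>Construction of the weight\<close>

lemma conv_zero_mean_bound:
 assumes g: "smooth g" "vanish r g" and g0: "(LINT w|lborel. g w) = 0" and G: "!!z. cmod (g z) <= G"
  and f: "lbm f" and L: "!!w. norm (z - w) < r ==> cmod (f w - c) <= L" "L >= 0"
 shows "cmod (conv g f z) <= G * L * measure lborel (cball (0 :: c2) r)"
proof -
 have G0: "G >= 0" using G[of 0] norm_ge_zero order_trans by blast
 note [measurable] = smooth_borel[OF g(1)]
 have i1: "integrable lborel (%w. g (z - w) * f w)" by (rule conv_integrable[OF lbm_smooth[OF g(1)] f disjI1[OF g(2)]])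
 have i2: "integrable lborel (%w. g (z - w) * c)" by (rule conv_integrable[OF lbm_smooth[OF g(1)] lbm_smooth[OF smooth_const[of c]] disjI1[OF g(2)]])
 have "(LINT w|lborel. g (z - w) * c) = 0" using integral_reflect[of g z] g0 by simp
 then have "conv g f z = (LINT w|lborel. g (z - w) * f w - g (z - w) * c)"
  unfolding conv_def using i1 i2 by simp
 also have "cmod ... <= (LINT w|lborel. (%w. G * L * indicator (cball 0 r) w) (z - w))"
 proof (rule bochner_norm_bound)
  show "integrable lborel (%w. g (z - w) * f w - g (z - w) * c)" using i1 i2 by simp
  have "integrable lborel (%w. G * L * indicator (cball z r) w)"
   using emeasure_bounded_finite[of "cball z r"] by (intro integrable_mult_right integrable_real_indicator) auto
  moreover have "(%w. (%w. G * L * indicator (cball 0 r) w) (z - w)) = (%w. G * L * indicator (cball z r) w)"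
   by (simp add: indicator_def dist_norm norm_minus_commute fun_eq_iff)
  ultimately show "integrable lborel (%w. (%w. G * L * indicator (cball 0 r) w) (z - w))" by simp
  show "cmod (g (z - w) * f w - g (z - w) * c) <= G * L * indicator (cball 0 r) (z - w)" for w
  proof (cases "norm (z - w) < r")
   case True
   then show ?thesis using mult_mono[OF G[of "z - w"] L(1)[OF True] G0 norm_ge_zero] by (simp add: right_diff_distrib[symmetric] norm_mult)
  next
   case False
   then show ?thesis using vanishD[OF g(2), of "z - w"] G0 L(2) by (simp add: indicator_def)
  qed
 qed
 also have "... = (LINT w|lborel. G * L * indicator (cball (0 :: c2) r) w)" by (rule integral_reflect_real) (intro borel_measurable_times borel_measurable_const borel_measurable_indicator, simp)
 also have "... = G * L * measure lborel (cball (0 :: c2) r)" by simp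
 finally show ?thesis .
qed

lemma Dd_of_real: "smooth f ==> Dd e (%z. complex_of_real (f z)) = (%z. of_real (Dd e f z))"
 by (rule ext) (rule Dd_compose_linear[OF bounded_linear_of_real smooth_differentiable])

text \<open>Derivatives of \<open>eta r\<close> have integral 0, so convolution with them depends
  only on the oscillation of \<open>f\<close> and stays bounded although \<open>f\<close> may
  grow.\<close>

lemma sm_derivative_bounds:
 assumes r: "r > 0" and f: "lbr f" and L: "!!z h. norm h < 3 * r ==> \<bar>f (z + h) - f z\<bar> <= L"
 obtains B where "B >= 0" "!!e z. \<bar>Dd e (sm r f) z\<bar> <= B * norm e" "!!e e' z. \<bar>Dd e' (Dd e (sm r f)) z\<bar> <= B * norm e * norm e'"
proof -
 have L0: "L >= 0" using L[of 0 0] r by simp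
 have ve: "vanish r (eta r)" by (rule vanish_eta[OF r])
 have ve1: "vanish (r + r) (Dd e (eta r))" for e by (rule vanish_Dd[OF ve r])
 \<comment> \<open>Each derivative enlarges the support radius by at most \<open>r\<close>; hence
   the scale 3 r in the hypothesis on the oscillation.\<close>
 have ve2: "vanish (3 * r) (Dd e' (Dd e (eta r)))" for e e' using vanish_Dd[OF ve1 r] by simp
 have ve1': "vanish (3 * r) (Dd e (eta r))" for e by (rule vanish_mono[OF ve1]) (use r in simp)
 note se = smooth_eta[of r]
 obtain B1 where B1: "B1 >= 0" "!!e z. cmod (Dd e (eta r) z) <= B1 * norm e" using smooth_Dd_bounded[OF se ve] by metis
 obtain B2 where B2: "B2 >= 0" "!!e e' z. cmod (Dd e' (Dd e (eta r)) z) <= B2 * norm e * norm e'"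
  using smooth_vanish_D2_bounded[OF se ve] by metis
 define F where "F = (%w. complex_of_real (f w))"
 have lF: "lbm F" unfolding F_def by (rule lbr_lbm[OF f])
 have FL: "cmod (F w - F z) <= L" if "norm (z - w) < 3 * r" for w z
  using L[of "w - z" z] that by (simp add: F_def norm_minus_commute flip: of_real_diff)
 define m where "m = measure lborel (cball (0 :: c2) (3 * r))"
 have m0: "m >= 0" by (simp add: m_def)
 have CW: "conv (eta r) F = (%z. complex_of_real (sm r f z))" unfolding F_def by (rule ext) (rule sm_conv[OF r f])
 have ss: "smooth (sm r f)" by (rule smooth_sm[OF r f])
 have d1: "(%z. complex_of_real (Dd e (sm r f) z)) = conv (Dd e (eta r)) F" for e
  using Dd_conv[OF se ve lF, of e] Dd_of_real[OF ss, of e] by (simp add: CW)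
 have d2: "complex_of_real (Dd e' (Dd e (sm r f)) z) = conv (Dd e' (Dd e (eta r))) F z" for e e' z
  using Dd_conv[OF smooth_Dd[OF se] ve1 lF, of e' e] Dd_of_real[OF smooth_Dd[OF ss], of e' e] by (metis d1)
 have b1: "\<bar>Dd e (sm r f) z\<bar> <= B1 * norm e * L * m" for e z
 proof -
  have "cmod (conv (Dd e (eta r)) F z) <= B1 * norm e * L * m"
   unfolding m_def by (rule conv_zero_mean_bound[OF smooth_Dd[OF se] ve1' integral_Dd_zero[OF se ve] B1(2) lF FL L0])
  then show ?thesis using fun_cong[OF d1[of e], of z] by (metis norm_of_real)
 qed
 have b2: "\<bar>Dd e' (Dd e (sm r f)) z\<bar> <= B2 * norm e * norm e' * L * m" for e e' z
 proof -
  have "cmod (conv (Dd e' (Dd e (eta r))) F z) <= B2 * norm e * norm e' * L * m"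
   unfolding m_def by (rule conv_zero_mean_bound[OF smooth_Dd[OF smooth_Dd[OF se]] ve2 integral_Dd_zero[OF smooth_Dd[OF se] ve1] B2(2) lF FL L0])
  then show ?thesis using d2[of e' e z] by (metis norm_of_real)
 qed
 define B where "B = B1 * L * m + B2 * L * m"
 have BB: "B1 * L * m <= B" "B2 * L * m <= B" "B >= 0" using B1(1) B2(1) L0 m0 by (auto simp: B_def)
 show thesis
 proof (rule that[OF BB(3)])
  show "\<bar>Dd e (sm r f) z\<bar> <= B * norm e" for e z
   using b1[of e z] mult_right_mono[OF BB(1), of "norm e"] by (simp add: mult_ac)
  show "\<bar>Dd e' (Dd e (sm r f)) z\<bar> <= B * norm e * norm e'" for e e' z
   using b2[of e' e z] mult_right_mono[OF BB(2), of "norm e * norm e'"] by (simp add: mult_ac)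
 qed
qed

text \<open>For \<open>L\<close> a coordinate this is ln (1 + |z_j|^2): its Levi form is strictly
  positive in that coordinate, yet its derivatives are bounded and its growth is only logarithmic.
  The square |z_j|^2 would fail on both counts.\<close>

definition lnq :: "(c2 => complex) => c2 => real" where "lnq L z = ln (1 + L z \<bullet> L z)"

lemma lnq:
 assumes L: "bounded_linear L" "!!z. cmod (L z) <= norm z"
 shows "smooth (lnq L)"
  and "Dd e (lnq L) z = 2 * (L z \<bullet> L e) * inverse (1 + L z \<bullet> L z)"
  and "Dd e' (Dd e (lnq L)) z = 2 * (L e' \<bullet> L e) * inverse (1 + L z \<bullet> L z) - 4 * (L z \<bullet> L e) * (L z \<bullet> L e') * (inverse (1 + L z \<bullet> L z))^2"
  and "\<bar>Dd e (lnq L) z\<bar> <= norm e"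
  and "\<bar>Dd e' (Dd e (lnq L)) z\<bar> <= 3 * norm e * norm e'"
proof -
 define u where "u z = 1 + L z \<bullet> L z" for z
 have u1: "u z >= 1" for z by (simp add: u_def)
 have up: "u z > 0" for z using u1[of z] by linarith
 have su: "smooth u" unfolding u_def by (intro smooth_add smooth_const smooth_bilinear[OF bounded_bilinear_inner] smooth_bounded_linear L)
 have hL: "(L has_derivative L) (at z)" for z by (rule bounded_linear_imp_has_derivative[OF L(1)])
 have hu: "(u has_derivative (%h. 2 * (L z \<bullet> L h))) (at z)" for z
  unfolding u_def by (rule derivative_eq_intros hL refl)+ (simp add: inner_commute)
 have Du: "Dd e u z = 2 * (L z \<bullet> L e)" for e z by (rule Dd_eq[OF hu])
 have l: "lnq L = (%z. ln (u z))" by (simp add: lnq_def u_def fun_eq_iff)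
 show "smooth (lnq L)" unfolding l by (rule smooth_ln[OF su up])
 have D1: "Dd e (lnq L) z = 2 * (L z \<bullet> L e) * inverse (u z)" for e z
  unfolding l smooth_ln(2)[OF su up] Du ..
 then show "Dd e (lnq L) z = 2 * (L z \<bullet> L e) * inverse (1 + L z \<bullet> L z)" by (simp add: u_def)
 have "((%z. 2 * (L z \<bullet> L e) * inverse (u z)) has_derivative
  (%h. 2 * (L z \<bullet> L e) * (- (inverse (u z) * (2 * (L z \<bullet> L h)) * inverse (u z))) + 2 * (L h \<bullet> L e) * inverse (u z))) (at z)"
 proof (rule has_derivative_mult)
  show "((%z. 2 * (L z \<bullet> L e)) has_derivative (%h. 2 * (L h \<bullet> L e))) (at z)" by (rule derivative_eq_intros hL refl)+ simp
  show "((%z. inverse (u z)) has_derivative (%h. - (inverse (u z) * (2 * (L z \<bullet> L h)) * inverse (u z)))) (at z)"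
   by (rule Deriv.has_derivative_inverse[OF _ hu]) (use up[of z] in simp)
 qed
 from Dd_eq[OF this, of e'] have D2: "Dd e' (Dd e (lnq L)) z = 2 * (L e' \<bullet> L e) * inverse (u z) - 4 * (L z \<bullet> L e) * (L z \<bullet> L e') * (inverse (u z))^2"
  unfolding ext[OF D1[of e]] by (simp add: power2_eq_square algebra_simps)
 then show "Dd e' (Dd e (lnq L)) z = 2 * (L e' \<bullet> L e) * inverse (1 + L z \<bullet> L z) - 4 * (L z \<bullet> L e) * (L z \<bullet> L e') * (inverse (1 + L z \<bullet> L z))^2"
  by (simp add: u_def)
 have q: "2 * cmod (L z) * inverse (u z) <= 1"
 proof -
  have "0 <= (cmod (L z) - 1)^2" by simp
  then have "2 * cmod (L z) <= u z" by (simp add: u_def power2_diff power2_norm_eq_inner)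
  then show ?thesis using up[of z] by (simp add: field_simps)
 qed
 have k: "\<bar>2 * (L z \<bullet> L e) * inverse (u z)\<bar> <= norm e" for e
 proof -
  have "\<bar>L z \<bullet> L e\<bar> <= cmod (L z) * norm e" by (rule order_trans[OF Cauchy_Schwarz_ineq2]) (intro mult_left_mono L norm_ge_zero)
  then have "2 * \<bar>L z \<bullet> L e\<bar> * inverse (u z) <= 2 * (cmod (L z) * norm e) * inverse (u z)"
   using up[of z] by (intro mult_right_mono mult_left_mono) auto
  also have "... = (2 * cmod (L z) * inverse (u z)) * norm e" by simp
  also have "... <= 1 * norm e" by (intro mult_right_mono q) simp
  finally show ?thesis using up[of z] by (simp add: abs_mult)
 qed
 show "\<bar>Dd e (lnq L) z\<bar> <= norm e" unfolding D1 by (rule k)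
 have "\<bar>2 * (L e' \<bullet> L e) * inverse (u z)\<bar> <= 2 * (norm e' * norm e) * 1"
 proof -
  have "\<bar>L e' \<bullet> L e\<bar> <= norm e' * norm e" by (rule order_trans[OF Cauchy_Schwarz_ineq2]) (intro mult_mono L norm_ge_zero)
  moreover have "inverse (u z) <= 1" using u1[of z] by (simp add: field_simps)
  ultimately have "2 * \<bar>L e' \<bullet> L e\<bar> * inverse (u z) <= 2 * (norm e' * norm e) * 1" using up[of z] by (intro mult_mono) auto
  then show ?thesis using up[of z] by (simp add: abs_mult)
 qed
 moreover have "\<bar>4 * (L z \<bullet> L e) * (L z \<bullet> L e') * (inverse (u z))^2\<bar> <= norm e * norm e'"
 proof -
  have "\<bar>4 * (L z \<bullet> L e) * (L z \<bullet> L e') * (inverse (u z))^2\<bar> = \<bar>2 * (L z \<bullet> L e) * inverse (u z)\<bar> * \<bar>2 * (L z \<bullet> L e') * inverse (u z)\<bar>"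
   by (simp add: abs_mult power2_eq_square)
  also have "... <= norm e * norm e'" by (intro mult_mono k) auto
  finally show ?thesis .
 qed
 ultimately show "\<bar>Dd e' (Dd e (lnq L)) z\<bar> <= 3 * norm e * norm e'" unfolding D2 by (simp add: mult_ac)
qed

lemma inner_complex_rotate: "(x \<bullet> y)^2 + (x \<bullet> (\<i> * y))^2 = (x \<bullet> x) * (y \<bullet> (y :: complex))"
 by (simp add: inner_complex_def power2_eq_square algebra_simps)

text \<open>Summing over \<open>w\<close> and \<open>ii w\<close> removes the pluriharmonic part of
  the Hessian and gives four times the Levi form. The squares of the first derivatives combine by
  \<open>inner_complex_rotate\<close>, which lowers the factor to (1 + |L z|^2)^(-2).\<close>

lemma lnq_hessian:
 assumes L: "bounded_linear L" "!!z. cmod (L z) <= norm z" and c: "!!w. L (ii w) = \<i> * L w"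
 shows "Dd w (Dd w (lnq L)) z + Dd (ii w) (Dd (ii w) (lnq L)) z = 4 * (cmod (L w))^2 * (inverse (1 + L z \<bullet> L z))^2"
proof -
 define u where "u = 1 + L z \<bullet> L z"
 define y where "y = L w \<bullet> L w"
 have up: "u > 0" unfolding u_def by (simp add: add_pos_nonneg)
 have "(\<i> * L w) \<bullet> (\<i> * L w) = y" by (simp add: y_def inner_complex_def)
 then have "Dd w (Dd w (lnq L)) z + Dd (ii w) (Dd (ii w) (lnq L)) z = 4 * y * inverse u - 4 * ((L z \<bullet> L w)^2 + (L z \<bullet> (\<i> * L w))^2) * (inverse u)^2"
  unfolding lnq(3)[OF L] c u_def[symmetric] y_def[symmetric] by (simp add: power2_eq_square algebra_simps y_def)
 also have "(L z \<bullet> L w)^2 + (L z \<bullet> (\<i> * L w))^2 = (u - 1) * y"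
  unfolding inner_complex_rotate by (simp add: u_def y_def)
 also have "4 * y * inverse u - 4 * ((u - 1) * y) * (inverse u)^2 = 4 * y * (inverse u)^2"
  using up by (simp add: field_simps power2_eq_square)
 finally show ?thesis by (simp add: u_def y_def power2_norm_eq_inner)
qed

text \<open>Translates the complex form demanded by \<open>weight\<close> into real second
  derivatives, where the sub-mean inequality can be exploited.\<close>

lemma levi_hessian:
 assumes p: "smooth p"
 shows "Re (dzb (1,0) (dz (1,0) (%z. of_real (p z))) z * w1 * cnj w1
    + dzb (0,1) (dz (1,0) (%z. of_real (p z))) z * w1 * cnj w2
    + dzb (1,0) (dz (0,1) (%z. of_real (p z))) z * w2 * cnj w1
    + dzb (0,1) (dz (0,1) (%z. of_real (p z))) z * w2 * cnj w2)
  = (Dd (w1, w2) (Dd (w1, w2) p) z + Dd (ii (w1, w2)) (Dd (ii (w1, w2)) p) z) / 4"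
proof -
 define P where "P = (%z. complex_of_real (p z))"
 define h where "h x y = Dd x (Dd y p) z" for x y
 have sP: "smooth P" unfolding P_def by (rule smooth_of_real[OF p])
 have HP: "Dd x (Dd y P) z = of_real (h x y)" for x y
  unfolding h_def P_def Dd_of_real[OF p] Dd_of_real[OF smooth_Dd[OF p]] ..
 have sym: "h x y = h y x" for x y unfolding h_def by (rule Dd_commute[OF p])
 have lin: "h (s *\<^sub>R x + t *\<^sub>R x') y = s * h x y + t * h x' y" for s t x x' y
 proof -
  interpret bounded_linear "%e. Dd e (Dd y p) z" by (rule smooth_linear_Dd[OF smooth_Dd[OF p]])
  show ?thesis unfolding h_def by (simp add: add scaleR)
 qed
 have lin2: "h y (s *\<^sub>R x + t *\<^sub>R x') = s * h y x + t * h y x'" for s t x x' y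
  unfolding sym[of y] by (rule lin)
 have D: "dzb u (dz v P) z = (of_real (h u v + h (ii u) (ii v)) + \<i> * of_real (h (ii u) v - h u (ii v))) / 4" for u v
 proof -
  have Dx: "Dd x (dz v P) z = (of_real (h x v) + (- \<i>) * of_real (h x (ii v))) / 2" for x
   using Dd_lin2[OF smooth_Dd[OF sP] smooth_Dd[OF sP], of x v "- \<i>" "ii v" z] by (simp add: dz_def[abs_def] HP)
  show ?thesis unfolding dzb_def Dx by (simp add: field_simps)
 qed
 define E1 E2 where "E1 = (1 :: complex, 0 :: complex)" and "E2 = (0 :: complex, 1 :: complex)"
 define x1 y1 x2 y2 where "x1 = Re w1" and "y1 = Im w1" and "x2 = Re w2" and "y2 = Im w2"
 have W: "w1 = Complex x1 y1" "w2 = Complex x2 y2" by (simp_all add: x1_def y1_def x2_def y2_def)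
 have e: "(w1, w2) = 1 *\<^sub>R (x1 *\<^sub>R E1 + y1 *\<^sub>R ii E1) + 1 *\<^sub>R (x2 *\<^sub>R E2 + y2 *\<^sub>R ii E2)"
  "ii (w1, w2) = 1 *\<^sub>R ((- y1) *\<^sub>R E1 + x1 *\<^sub>R ii E1) + 1 *\<^sub>R ((- y2) *\<^sub>R E2 + x2 *\<^sub>R ii E2)"
  by (simp_all add: W E1_def E2_def ii_def complex_eq_iff)
 have s: "h (ii E1) E1 = h E1 (ii E1)" "h E2 E1 = h E1 E2" "h (ii E2) E1 = h E1 (ii E2)" "h E2 (ii E1) = h (ii E1) E2"
  "h (ii E2) (ii E1) = h (ii E1) (ii E2)" "h (ii E2) E2 = h E2 (ii E2)"
  using sym by blast+
 have "Re (dzb E1 (dz E1 P) z * w1 * cnj w1 + dzb E2 (dz E1 P) z * w1 * cnj w2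
    + dzb E1 (dz E2 P) z * w2 * cnj w1 + dzb E2 (dz E2 P) z * w2 * cnj w2)
  = (h (w1, w2) (w1, w2) + h (ii (w1, w2)) (ii (w1, w2))) / 4"
  unfolding e(2) unfolding e(1) unfolding lin lin2 D s unfolding W by (simp add: field_simps)
 then show ?thesis by (simp add: E1_def E2_def P_def h_def)
qed

text \<open>If the trace were negative, compare \<open>W\<close> on a small circle with the real
  part of a holomorphic quadratic polynomial \<open>q\<close>, whose circle mean is its value 0 at
  the centre. This removes the linear term and the trace free part of the Hessian, and the negative
  trace violates the sub-mean inequality.\<close>

lemma submean_hessian:
 assumes W: "smooth W" "submean W"
 shows "0 <= Dd w (Dd w W) z + Dd (ii w) (Dd (ii w) W) z"
proof (rule ccontr)
 define h where "h x y y' = Dd x (Dd y W) y'" for x y y'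
 define H11 H12 H22 where "H11 = h w w z" and "H12 = h w (ii w) z" and "H22 = h (ii w) (ii w) z"
 assume "\<not> 0 <= Dd w (Dd w W) z + Dd (ii w) (Dd (ii w) W) z"
 then have neg: "H11 + H22 < 0" by (simp add: H11_def H22_def h_def)
 \<comment> \<open>In these units the trace contributes - 4 k r^2, and the variation of the Hessian
   within the disc at most k r^2.\<close>
 define k where "k = - (H11 + H22) / 16"
 have k: "k > 0" using neg by (simp add: k_def)
 have cont: "\<exists>d>0. \<forall>x'. dist x' z < d \<longrightarrow> \<bar>h x y x' - h x y z\<bar> < k" for x y
  using smooth_continuous[OF smooth_Dd[OF smooth_Dd[OF W(1)]], of UNIV x y] k
  unfolding continuous_on_iff h_def by (metis UNIV_I dist_real_def)
 obtain d1 d2 d3 where d: "d1 > 0" "d2 > 0" "d3 > 0"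
  "!!x'. dist x' z < d1 ==> \<bar>h w w x' - H11\<bar> < k" "!!x'. dist x' z < d2 ==> \<bar>h w (ii w) x' - H12\<bar> < k"
  "!!x'. dist x' z < d3 ==> \<bar>h (ii w) (ii w) x' - H22\<bar> < k"
  using cont[of w w] cont[of w "ii w"] cont[of "ii w" "ii w"] unfolding H11_def H12_def H22_def by metis
 define r where "r = min d1 (min d2 d3) / (2 * (norm w + 1))"
 have nw: "norm w + 1 > 0" using norm_ge_zero[of w] by linarith
 have r: "r > 0" using d nw by (simp add: r_def)
 have rw: "r * norm w < min d1 (min d2 d3)"
 proof -
  have "r * norm w <= r * (norm w + 1)" using r by simp
  also have "... = min d1 (min d2 d3) / 2" using nw unfolding r_def times_divide_eq_left by (subst mult_divide_mult_cancel_right) auto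
  also have "... < min d1 (min d2 d3)" using d by auto
  finally show ?thesis .
 qed
 \<comment> \<open>The coefficients make the real part of \<open>q\<close> equal to the linear part
   of \<open>W\<close> plus the trace free part of its second order Taylor term on the plane spanned
   by \<open>w\<close> and \<open>ii w\<close>.\<close>
 define \<beta> where "\<beta> = Complex ((H11 - H22) / 4) (- H12 / 2)"
 define \<alpha> where "\<alpha> = Complex (Dd w W z) (- Dd (ii w) W z)"
 define q where "q \<zeta> = \<alpha> * \<zeta> + \<beta> * \<zeta>^2" for \<zeta>
 have up: "W (cline z (rotc (of_real r) w) (cis t)) <= W z + Re (q (0 + of_real r * cis t)) - 2 * k * r^2" for t
 proof -
  define x y where "x = r * cos t" and "y = r * sin t"
  define v where "v = x *\<^sub>R w + y *\<^sub>R ii w"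
  have xy: "x^2 + y^2 = r^2"
   unfolding x_def y_def power_mult_distrib distrib_left[symmetric] by simp
  have v: "v = rotc (of_real r * cis t) w" by (cases w) (simp add: v_def x_def y_def rotc_def ii_def complex_eq_iff)
  have nv: "norm v = r * norm w"
   unfolding v using r by (cases w) (simp add: rotc_def norm_Pair norm_mult power_mult_distrib real_sqrt_mult flip: distrib_left)
  have cl: "cline z (rotc (of_real r) w) (cis t) = z + v" by (simp add: v cline_rotc rotc_def mult_ac)
  have der0: "((%s. W (z + s *\<^sub>R v)) has_real_derivative Dd v W (z + s *\<^sub>R v)) (at s)" for s
   using smooth_line[OF W(1), of z v s UNIV] by (simp add: has_real_derivative_iff_has_vector_derivative)
  have der1: "((%s. Dd v W (z + s *\<^sub>R v)) has_real_derivative h v v (z + s *\<^sub>R v)) (at s)" for s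
   using smooth_line[OF smooth_Dd[OF W(1)], of v z v s UNIV] by (simp add: has_real_derivative_iff_has_vector_derivative h_def)
  define diff where "diff m s = (if m = 0 then W (z + s *\<^sub>R v) else if m = 1 then Dd v W (z + s *\<^sub>R v) else h v v (z + s *\<^sub>R v))" for m :: nat and s
  have "\<exists>s. 0 < s \<and> s < 1 \<and> W (z + 1 *\<^sub>R v) = (\<Sum>m<2. diff m 0 / fact m * 1 ^ m) + diff 2 s / fact 2 * 1 ^ 2"
  proof (rule Maclaurin)
   show "\<forall>m s. m < 2 \<and> 0 <= s \<and> s <= 1 \<longrightarrow> DERIV (diff m) s :> diff (Suc m) s"
   proof (intro allI impI)
    fix m :: nat and s :: real assume "m < 2 \<and> 0 <= s \<and> s <= 1"
    then have "m = 0 \<or> m = 1" by auto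
    then show "DERIV (diff m) s :> diff (Suc m) s"
    proof
     assume "m = 0"
     moreover have "diff 0 = (%s. W (z + s *\<^sub>R v))" "diff (Suc 0) s = Dd v W (z + s *\<^sub>R v)" by (auto simp: diff_def)
     ultimately show ?thesis using der0 by simp
    next
     assume "m = 1"
     moreover have "diff 1 = (%s. Dd v W (z + s *\<^sub>R v))" "diff (Suc 1) s = h v v (z + s *\<^sub>R v)" by (auto simp: diff_def)
     ultimately show ?thesis using der1 by simp
    qed
   qed
  qed (auto simp: diff_def)
  then obtain s where s: "0 < s" "s < 1" "W (z + v) = W z + Dd v W z + h v v (z + s *\<^sub>R v) / 2"
   by (auto simp: diff_def lessThan_Suc numeral_2_eq_2)
  define z' where "z' = z + s *\<^sub>R v"
  have "dist z' z <= norm v" using s by (simp add: z'_def dist_norm mult_left_le_one_le)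
  then have dz': "dist z' z < d1" "dist z' z < d2" "dist z' z < d3" using rw nv by auto
  have lin: "h (s *\<^sub>R x + t *\<^sub>R x') y y' = s * h x y y' + t * h x' y y'" for s t x x' y y'
  proof -
   interpret bounded_linear "%e. Dd e (Dd y W) y'" by (rule smooth_linear_Dd[OF smooth_Dd[OF W(1)]])
   show ?thesis unfolding h_def by (simp add: add scaleR)
  qed
  have sym: "h x y y' = h y x y'" for x y y' unfolding h_def by (rule Dd_commute[OF W(1)])
  have lin2: "h y (s *\<^sub>R x + t *\<^sub>R x') y' = s * h y x y' + t * h y x' y'" for s t x x' y y'
   unfolding sym[of y] by (rule lin)
  have "h v v z' = x^2 * h w w z' + 2 * x * y * h w (ii w) z' + y^2 * h (ii w) (ii w) z'"
  proof -
   have "h v v z' = x * h w v z' + y * h (ii w) v z'" unfolding v_def[of ] by (rule lin)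
   also have "h w v z' = x * h w w z' + y * h w (ii w) z'" unfolding v_def by (rule lin2)
   also have "h (ii w) v z' = x * h (ii w) w z' + y * h (ii w) (ii w) z'" unfolding v_def by (rule lin2)
   also have "h (ii w) w z' = h w (ii w) z'" by (rule sym)
   finally show ?thesis by (simp add: power2_eq_square algebra_simps)
  qed
  also have "... <= (x^2 * H11 + x^2 * k) + (2 * x * y * H12 + (x^2 + y^2) * k) + (y^2 * H22 + y^2 * k)"
  proof (intro add_mono)
   show "x^2 * h w w z' <= x^2 * H11 + x^2 * k" unfolding distrib_left[symmetric] using d(4)[OF dz'(1)] by (intro mult_left_mono) auto
   show "y^2 * h (ii w) (ii w) z' <= y^2 * H22 + y^2 * k" unfolding distrib_left[symmetric] using d(6)[OF dz'(3)] by (intro mult_left_mono) auto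
   have "\<bar>2 * x * y\<bar> <= x^2 + y^2" using zero_le_power2[of "\<bar>x\<bar> - \<bar>y\<bar>"] by (simp add: power2_diff abs_mult)
   then have "\<bar>2 * x * y\<bar> * \<bar>h w (ii w) z' - H12\<bar> <= (x^2 + y^2) * k" using d(5)[OF dz'(2)] k by (intro mult_mono) auto
   then have "2 * x * y * (h w (ii w) z' - H12) <= (x^2 + y^2) * k" by (metis abs_le_D1 abs_mult)
   then show "2 * x * y * h w (ii w) z' <= 2 * x * y * H12 + (x^2 + y^2) * k" by (simp add: right_diff_distrib)
  qed
  also have "... = (x^2 * H11 + 2 * x * y * H12 + y^2 * H22) + 2 * (x^2 + y^2) * k" by (simp add: algebra_simps)
  finally have hv0: "h v v z' <= (x^2 * H11 + 2 * x * y * H12 + y^2 * H22) + 2 * r^2 * k" unfolding xy .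
  have "A / 2 <= X / 2 + r^2 * k" if "A <= X + 2 * r^2 * k" for A X using that by simp
  from this[OF hv0] have hv: "h v v z' / 2 <= (x^2 * H11 + 2 * x * y * H12 + y^2 * H22) / 2 + r^2 * k" .
  have Dv: "Dd v W z = x * Dd w W z + y * Dd (ii w) W z"
  proof -
   interpret bounded_linear "%e. Dd e W z" by (rule smooth_linear_Dd[OF W(1)])
   show ?thesis unfolding v_def by (simp add: add scaleR)
  qed
  have cz: "0 + of_real r * cis t = Complex x y" by (simp add: x_def y_def complex_eq_iff)
  have qz: "Re (q (0 + of_real r * cis t)) = x * Dd w W z + y * Dd (ii w) W z + ((H11 - H22) / 4 * (x^2 - y^2) + H12 * x * y)"
   unfolding cz q_def \<alpha>_def \<beta>_def by (simp add: power2_eq_square field_simps)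
  have "(x^2 * H11 + 2 * x * y * H12 + y^2 * H22) / 2 = ((H11 - H22) / 4 * (x^2 - y^2) + H12 * x * y) + (H11 + H22) / 4 * (x^2 + y^2)"
   by (simp add: field_simps)
  also have "(H11 + H22) / 4 * (x^2 + y^2) = - 4 * k * r^2" unfolding xy by (simp add: k_def)
  finally have E: "(x^2 * H11 + 2 * x * y * H12 + y^2 * H22) / 2 = ((H11 - H22) / 4 * (x^2 - y^2) + H12 * x * y) + - 4 * k * r^2" .
  have "A <= B + Rq - 3 * k * r^2"
   if "hh / 2 <= X / 2 + r^2 * k" "X / 2 = Y + - 4 * k * r^2" "A = B + D + hh / 2" "Rq = D + Y" for A B Rq hh X Y D
   using that by (simp add: algebra_simps)
  from this[OF hv E s(3)[unfolded Dv z'_def[symmetric]] qz]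
  have "W (z + v) <= W z + Re (q (0 + of_real r * cis t)) - 3 * k * r^2" .
  moreover have "0 <= k * r^2" using k by simp
  ultimately show ?thesis unfolding cl by (simp add: algebra_simps)
 qed
 have cW: "continuous_on {0..2*pi} (%t. W (cline z (rotc (of_real r) w) (cis t)))"
  by (rule continuous_on_compose2[OF smooth_continuous[OF W(1)]]) (auto intro!: continuous_cline continuous_intros)
 have cq: "continuous_on {0..2*pi} (%t. Re (q (0 + of_real r * cis t)))" unfolding q_def by (intro continuous_intros)
 have "W z <= circ (%t. W (cline z (rotc (of_real r) w) (cis t)))"
  using submeanD[OF W(2), of z "rotc (of_real r) w"] by (simp add: cmean_circ)
 also have "... <= circ (%t. Re (q (0 + of_real r * cis t)) + (W z - 2 * k * r^2))"
 proof (rule circ_mono[OF cW])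
  show "continuous_on {0..2*pi} (%t. Re (q (0 + of_real r * cis t)) + (W z - 2 * k * r^2))" by (intro continuous_on_add cq continuous_on_const)
  show "W (cline z (rotc (of_real r) w) (cis t)) <= Re (q (0 + of_real r * cis t)) + (W z - 2 * k * r^2)" for t
   using up[of t] by linarith
 qed
 also have "... = circ (%t. Re (q (0 + of_real r * cis t))) + (W z - 2 * k * r^2)"
  using circ_add[OF cq, of "%_. W z - 2 * k * r^2"] by simp
 also have "circ (%t. Re (q (0 + of_real r * cis t))) = Re (q 0)" by (rule circ_Re_holo) (auto simp: q_def r intro!: holomorphic_intros)
 finally have "k * r^2 <= 0" by (simp add: q_def)
 moreover have "k * r^2 > 0" using k r by (intro mult_pos_pos) auto
 ultimately show False by linarith
qed

text \<open>With \<open>c = 2 * N\<close> the exponential of half the weight grows at most like exp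
  (N W) (1 + |z1|) (1 + |z2|).\<close>

definition wt :: "real => (c2 => real) => c2 => real" where
 "wt c W z = c * W z + (lnq fst z + lnq snd z)"

definition wm :: "c2 => real" where "wm z = inverse (1 + z \<bullet> z)"

text \<open>\<open>W\<close> contributes a nonnegative Levi form. The two logarithms contribute a
  diagonal form with entries (1 + |z_j|^2)^(-2), both at least \<open>(wm z)^2\<close>.\<close>

lemma weight_wt:
 assumes W: "smooth W" "submean W" and B: "!!e z. \<bar>Dd e W z\<bar> <= B * norm e" "!!e e' z. \<bar>Dd e' (Dd e W) z\<bar> <= B * norm e * norm e'"
  and c: "c >= 0"
 shows "weight (wt c W) (c * B + 6) wm"
proof -
 have Lf: "bounded_linear (fst :: c2 => complex)" "!!z. cmod (fst z) <= norm (z :: c2)" "!!w. fst (ii w) = \<i> * fst w"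
  by (auto simp: bounded_linear_fst cmod_fst ii_def)
 have Ls: "bounded_linear (snd :: c2 => complex)" "!!z. cmod (snd z) <= norm (z :: c2)" "!!w. snd (ii w) = \<i> * snd w"
  by (auto simp: bounded_linear_snd cmod_snd ii_def)
 note f = lnq[OF Lf(1,2)] and s = lnq[OF Ls(1,2)]
 have sw: "smooth (wt c W)" unfolding wt_def[abs_def] by (intro smooth_add smooth_mult smooth_const W f(1) s(1))
 have Dl: "Dd e (%z. c * F z + (G z + H z)) = (%z. c * Dd e F z + (Dd e G z + Dd e H z))"
  if "smooth F" "smooth G" "smooth H" for e and F G H :: "c2 => real"
 proof
  fix z
  have "((%z. c * F z + (G z + H z)) has_derivative (%e. c * Dd e F z + (Dd e G z + Dd e H z))) (at z)"
   by (intro has_derivative_add has_derivative_mult_right smooth_has_derivative that)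
  then show "Dd e (%z. c * F z + (G z + H z)) z = c * Dd e F z + (Dd e G z + Dd e H z)" by (rule Dd_eq)
 qed
 have D1: "Dd e (wt c W) = (%z. c * Dd e W z + (Dd e (lnq fst) z + Dd e (lnq snd) z))" for e
  unfolding wt_def[abs_def] by (rule Dl[OF W(1) f(1) s(1)])
 have D2: "Dd e' (Dd e (wt c W)) z = c * Dd e' (Dd e W) z + (Dd e' (Dd e (lnq fst)) z + Dd e' (Dd e (lnq snd)) z)" for e e' z
  unfolding D1 by (simp add: Dl[OF smooth_Dd[OF W(1)] smooth_Dd[OF f(1)] smooth_Dd[OF s(1)]])
 show ?thesis
 proof
  show "smooth (wt c W)" by (rule sw)
  show "\<bar>Dd e (wt c W) z\<bar> <= (c * B + 6) * norm e" for e z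
  proof -
   have "\<bar>c * Dd e W z\<bar> <= c * (B * norm e)" using c B(1)[of e z] by (simp add: abs_mult mult_left_mono)
   then show ?thesis unfolding D1 using f(4)[of e z] s(4)[of e z] norm_ge_zero[of e] by (simp add: algebra_simps)
  qed
  show "\<bar>Dd e' (Dd e (wt c W)) z\<bar> <= (c * B + 6) * norm e * norm e'" for e e' z
  proof -
   have "\<bar>c * Dd e' (Dd e W) z\<bar> <= c * (B * norm e * norm e')" using c B(2)[of e' e z] by (simp add: abs_mult mult_left_mono)
   then show ?thesis unfolding D2 using f(5)[of e' e z] s(5)[of e' e z] by (simp add: algebra_simps)
  qed
  have pos: "1 + z \<bullet> z > 0" for z :: c2 by (simp add: add_pos_nonneg)
  show "smooth wm" unfolding wm_def
   by (intro smooth_inverse smooth_add smooth_const smooth_bilinear[OF bounded_bilinear_inner] smooth_bounded_linear[OF bounded_linear_ident])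
    (use pos in \<open>metis less_irrefl\<close>)
  show "wm z > 0" for z using pos[of z] by (simp add: wm_def)
  fix z w1 w2
  have "(wm z)^2 * ((cmod w1)^2 + (cmod w2)^2) <= (cmod w1)^2 * (inverse (1 + fst z \<bullet> fst z))^2 + (cmod w2)^2 * (inverse (1 + snd z \<bullet> snd z))^2"
  proof -
   have zz: "z \<bullet> z = fst z \<bullet> fst z + snd z \<bullet> snd z" by (simp add: inner_prod_def)
   have "wm z <= inverse (1 + fst z \<bullet> fst z)" "wm z <= inverse (1 + snd z \<bullet> snd z)"
    unfolding wm_def zz by (intro le_imp_inverse_le; simp add: add_pos_nonneg)+
   then have "(wm z)^2 <= (inverse (1 + fst z \<bullet> fst z))^2" "(wm z)^2 <= (inverse (1 + snd z \<bullet> snd z))^2"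
    using \<open>!!z. wm z > 0\<close>[of z] by (intro power_mono; simp)+
   then have "(cmod w1)^2 * (wm z)^2 + (cmod w2)^2 * (wm z)^2 <= (cmod w1)^2 * (inverse (1 + fst z \<bullet> fst z))^2 + (cmod w2)^2 * (inverse (1 + snd z \<bullet> snd z))^2"
    by (intro add_mono mult_left_mono) auto
   then show ?thesis by (simp only: distrib_left mult.commute[of "(wm z)^2"])
  qed
  also have "... <= (Dd (w1, w2) (Dd (w1, w2) (wt c W)) z + Dd (ii (w1, w2)) (Dd (ii (w1, w2)) (wt c W)) z) / 4"
  proof -
   have "0 <= c * (Dd (w1, w2) (Dd (w1, w2) W) z + Dd (ii (w1, w2)) (Dd (ii (w1, w2)) W) z)" by (intro mult_nonneg_nonneg c submean_hessian[OF W])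
   then show ?thesis unfolding D2
    using lnq_hessian[OF Lf, of "(w1, w2)" z] lnq_hessian[OF Ls, of "(w1, w2)" z] by (simp add: distrib_left)
  qed
  finally show "(wm z)^2 * ((cmod w1)^2 + (cmod w2)^2) <=
   Re (dzb (1,0) (dz (1,0) (%z. of_real (wt c W z))) z * w1 * cnj w1
    + dzb (0,1) (dz (1,0) (%z. of_real (wt c W z))) z * w1 * cnj w2
    + dzb (1,0) (dz (0,1) (%z. of_real (wt c W z))) z * w2 * cnj w1
    + dzb (0,1) (dz (0,1) (%z. of_real (wt c W z))) z * w2 * cnj w2)"
   unfolding levi_hessian[OF sw] .
 qed
qed

section \<open>Data of the d-bar problem and growth of its solution\<close>

definition hol :: "(c2 => complex) => bool" where "hol F \<longleftrightarrow> smooth F \<and> (\<forall>e z. dzb e F z = 0)"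

lemma hol_const: "hol (%_. c)" by (simp add: hol_def dzb_def)

lemma hol_linear: assumes "bounded_linear L" "!!w. L (ii w) = \<i> * L w" shows "hol L"
 unfolding hol_def dzb_def using assms by (simp add: smooth_bounded_linear Dd_bounded_linear flip: mult.assoc)

lemma hol_mult: "hol F ==> hol G ==> hol (%z. F z * G z)"
 unfolding hol_def by (auto simp: dz_mult)

lemma hol_add: "hol F ==> hol G ==> hol (%z. F z + G z)"
 unfolding hol_def by (auto simp: dz_add)

lemma hol_power: "hol F ==> hol (%z. F z ^ n)" by (induction n) (auto intro: hol_const hol_mult)

lemma hol_sum: "finite I ==> (!!i. i \<in> I ==> hol (F i)) ==> hol (%z. \<Sum>i\<in>I. F i z)"
 by (induction I rule: finite_induct) (auto intro: hol_const hol_add)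

lemma HC_hol: assumes "Q \<in> HC a b n" shows "hol Q"
proof -
 obtain c where "Q = (%z. \<Sum>j\<le>n * b. \<Sum>k\<le>n * a. c j k * fst z ^ j * snd z ^ k)" using assms unfolding HC_def by blast
 moreover have "hol (fst :: c2 => complex)" "hol (snd :: c2 => complex)"
  by (auto intro!: hol_linear bounded_linear_fst bounded_linear_snd simp: ii_def)
 ultimately show ?thesis by (auto intro!: hol_sum hol_mult hol_power hol_const)
qed

lemma sm_harmonic:
 assumes r: "r > 0" and f: "lbr f" and m: "!!w. cmean f z w = f z" shows "sm r f z = f z"
 unfolding sm_rot_mean(1)[OF r f] m using keta_int[OF r] by simp

text \<open>On every complex line a polynomial has harmonic real and imaginary parts, so the radial
  kernel reproduces it.\<close>

lemma HC_mean_value: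
 assumes Q: "Q \<in> HC a b n" and r: "r > 0" shows "conv (eta r) Q z = Q z"
proof -
 define f1 f2 where "f1 = (%z. Re (Q z))" and "f2 = (%z. Re (- \<i> * Q z))"
 have l: "lbr f1" "lbr f2" unfolding f1_def f2_def by (intro lbr_continuous continuous_intros HC_continuous[OF Q])+
 have m: "cmean (%z. Re (c * Q z)) z w = Re (c * Q z)" for w c
 proof -
  obtain q where q: "!!t. Q (cline z w t) = poly q t" using HC_line[OF Q] by blast
  have "Q z = poly q 0" using q[of 0] by (simp add: cline_def)
  moreover have "circ (%t. Re (c * poly q (0 + of_real 1 * cis t))) = Re (c * poly q 0)" by (rule circ_Re_holo) (auto intro!: holomorphic_intros)
  ultimately show ?thesis unfolding cmean_circ q by simp
 qed
 have s: "sm r f1 z = f1 z" "sm r f2 z = f2 z"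
  using sm_harmonic[OF r l(1), of z] sm_harmonic[OF r l(2), of z] m[of 1] m[of "- \<i>"] by (simp_all add: f1_def f2_def)
 have i: "integrable lborel (%w. eta r (z - w) * complex_of_real (f w))" if "lbr f" for f
  by (rule conv_integrable[OF lbm_smooth[OF smooth_eta] lbr_lbm[OF that] disjI1[OF vanish_eta[OF r]]])
 have "conv (eta r) Q z = (LINT w|lborel. eta r (z - w) * of_real (f1 w) + \<i> * (eta r (z - w) * of_real (f2 w)))"
  unfolding conv_def
 proof (rule Bochner_Integration.integral_cong[OF refl])
  fix w
  have "Q w = of_real (f1 w) + \<i> * of_real (f2 w)" by (simp add: f1_def f2_def complex_eq_iff)
  then show "eta r (z - w) * Q w = eta r (z - w) * of_real (f1 w) + \<i> * (eta r (z - w) * of_real (f2 w))" by (simp add: algebra_simps)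
 qed
 also have "... = conv (eta r) (%w. of_real (f1 w)) z + \<i> * conv (eta r) (%w. of_real (f2 w)) z"
  unfolding conv_def using i[OF l(1)] i[OF l(2)] by simp
 also have "... = of_real (f1 z) + \<i> * of_real (f2 z)" unfolding sm_conv[OF r l(1)] sm_conv[OF r l(2)] s ..
 also have "... = Q z" by (simp add: f1_def f2_def complex_eq_iff)
 finally show ?thesis .
qed

lemma norm_tf_bound:
 assumes A: "!!z. cmod (tfun f z) <= A" and v: "vanish s (tfun f)"
 shows "norm f <= A * sqrt (measure lborel (cball (0 :: c2) s))"
proof -
 have A0: "A >= 0" using A[of 0] norm_ge_zero order_trans by blast
 have "(norm f)^2 <= (LINT z|lborel. A^2 * indicat_real (cball (0 :: c2) s) z)"
  unfolding norm_tf_sq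
 proof (rule integral_mono[OF sq_integrable])
  show "integrable lborel (%z. A^2 * indicat_real (cball (0 :: c2) s) z)"
   using emeasure_bounded_finite[of "cball (0 :: c2) s"] by (intro integrable_mult_right integrable_real_indicator) auto
  show "(cmod (tfun f z))^2 <= A^2 * indicat_real (cball 0 s) z" for z
   using vanishD[OF v, of z] power_mono[OF A[of z], of 2] by (cases "norm z <= s") auto
 qed
 then have "(norm f)^2 <= (A * sqrt (measure lborel (cball (0 :: c2) s)))^2" by (simp add: power_mult_distrib)
 then show ?thesis by (rule power2_le_imp_le) (use A0 in simp)
qed

context weight
begin

definition emp :: "c2 => complex" where "emp z = of_real (exp (- (p z / 2)))"

lemma smooth_emp: "smooth emp"
 unfolding emp_def[abs_def] divide_inverse by (intro smooth_of_real smooth_exp smooth_minus smooth_mult smooth_p smooth_const)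

lemma ex_emp: "ex z * emp z = 1" by (simp add: ex_def emp_def exp_minus flip: of_real_mult)

lemma Dd_emp: "Dd e emp z = - (Dd e ph z / 2) * emp z"
proof -
 have s0: "smooth (%z. p z / 2)" unfolding divide_inverse by (intro smooth_mult smooth_p smooth_const)
 have s: "smooth (%z. - (p z / 2))" by (rule smooth_minus[OF s0])
 have 1: "Dd e emp z = of_real (Dd e (%z. exp (- (p z / 2))) z)"
  unfolding emp_def[abs_def] by (rule Dd_compose_linear[OF bounded_linear_of_real smooth_differentiable[OF smooth_exp[OF s]]])
 have 2: "Dd e (%z. exp (- (p z / 2))) z = Dd e (%z. - (p z / 2)) z * exp (- (p z / 2))" by (rule Dd_exp[OF s])
 have 3: "Dd e (%z. - (p z / 2)) z = - (Dd e p z / 2)"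
  using Dd_compose_linear[OF bounded_linear_minus[OF bounded_linear_divide[of 2]] smooth_differentiable[OF smooth_p]] .
 show ?thesis unfolding 1 2 3 Dd_ph emp_def by simp
qed

text \<open>Division by exp (p / 2) carries a cut-off function into the unweighted space. There the
  twisted operator acts as exp (- p / 2) times the ordinary d-bar derivative, so the data inherit
  the decay of the weight.\<close>

lemma dbar_data:
 assumes g: "smooth g" "vanish s g" and f0: "f0 = Tf (%z. g z * emp z)"
 shows "tfun (mulop ex f0) = g" "tfun (opA e f0) z = dzb e g z * emp z"
proof -
 have t: "tfun f0 = (%z. g z * emp z)"
  unfolding f0 by (rule tfun_Tf[OF smooth_mult[OF g(1) smooth_emp] vanish_mult1[OF g(2)]])
 show "tfun (mulop ex f0) = g"
  unfolding tfun_mulop[OF smooth_ex] t using ex_emp by (auto simp: fun_eq_iff mult.left_commute mult.commute[of "ex _"] mult.assoc)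
 have "dzb e emp z = - cA e z * emp z" unfolding dzb_def cA_def Dd_emp by (simp add: field_simps)
 then show "tfun (opA e f0) z = dzb e g z * emp z"
  unfolding tfun_opA t dz_mult(2)[OF g(1) smooth_emp] by (simp add: algebra_simps)
qed

end

lemma exp_logplus: "exp (real k * logplus x) = max 1 x ^ k" by (simp add: logplus_eq exp_of_nat_mult)

lemma exp_H_C_le: "exp (real N * H_C a b z) <= (1 + cmod (fst z)) ^ (N * b) * (1 + cmod (snd z)) ^ (N * a)"
proof -
 have "real N * H_C a b z <= real (N * b) * logplus (cmod (fst z)) + real (N * a) * logplus (cmod (snd z))"
 proof -
  have "H_C a b z <= real b * logplus (cmod (fst z)) + real a * logplus (cmod (snd z))" by (simp add: H_C_def)
  from mult_left_mono[OF this, of "real N"] show ?thesis by (simp add: algebra_simps)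
 qed
 then have "exp (real N * H_C a b z) <= exp (real (N * b) * logplus (cmod (fst z))) * exp (real (N * a) * logplus (cmod (snd z)))"
  by (simp flip: exp_add)
 also have "... = max 1 (cmod (fst z)) ^ (N * b) * max 1 (cmod (snd z)) ^ (N * a)" unfolding exp_logplus ..
 also have "... <= (1 + cmod (fst z)) ^ (N * b) * (1 + cmod (snd z)) ^ (N * a)" by (intro mult_mono power_mono) auto
 finally show ?thesis .
qed

lemma has_derivative_separate:
 fixes U :: "c2 => complex"
 assumes D: "(U has_derivative D) (at (x, y))" and c: "D (ii (1,0)) = \<i> * D (1,0)" "D (ii (0,1)) = \<i> * D (0,1)"
 shows "((%x. U (x, y)) has_field_derivative D (1,0)) (at x)" "((%y. U (x, y)) has_field_derivative D (0,1)) (at y)"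
proof -
 interpret bounded_linear D by (rule has_derivative_bounded_linear[OF D])
 have 1: "D (h, 0) = D (1,0) * h" for h
 proof -
  have "(h, 0) = Re h *\<^sub>R (1, 0 :: complex) + Im h *\<^sub>R ii (1, 0)" by (simp add: ii_def complex_eq_iff)
  then have "D (h, 0) = of_real (Re h) * D (1,0) + of_real (Im h) * (\<i> * D (1,0))" by (simp only: add scaleR c) (simp add: scaleR_conv_of_real)
  also have "... = D (1,0) * (of_real (Re h) + \<i> * of_real (Im h))" by (simp add: algebra_simps)
  finally show ?thesis by (simp add: complex_eq[symmetric])
 qed
 have 2: "D (0, h) = D (0,1) * h" for h
 proof -
  have "(0, h) = Re h *\<^sub>R (0 :: complex, 1) + Im h *\<^sub>R ii (0, 1)" by (simp add: ii_def complex_eq_iff)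
  then have "D (0, h) = of_real (Re h) * D (0,1) + of_real (Im h) * (\<i> * D (0,1))" by (simp only: add scaleR c) (simp add: scaleR_conv_of_real)
  also have "... = D (0,1) * (of_real (Re h) + \<i> * of_real (Im h))" by (simp add: algebra_simps)
  finally show ?thesis by (simp add: complex_eq[symmetric])
 qed
 have "((%x. U (x, y)) has_derivative (%h. D (h, 0))) (at x)"
  by (rule has_derivative_compose[of "%x. (x, y)" "%h. (h, 0)" x UNIV U D, OF _ D]) (auto intro!: derivative_eq_intros)
 moreover have "(%h. D (h, 0)) = (*) (D (1,0))" by (rule ext) (rule 1)
 ultimately show "((%x. U (x, y)) has_field_derivative D (1,0)) (at x)" by (simp only: has_field_derivative_def)
 have "((%y. U (x, y)) has_derivative (%h. D (0, h))) (at y)"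
  by (rule has_derivative_compose[of "%y. (x, y)" "%h. (0, h)" y UNIV U D, OF _ D]) (auto intro!: derivative_eq_intros)
 moreover have "(%h. D (0, h)) = (*) (D (0,1))" by (rule ext) (rule 2)
 ultimately show "((%y. U (x, y)) has_field_derivative D (0,1)) (at y)" by (simp only: has_field_derivative_def)
qed

text \<open>A count of weighted degrees: along an orbit the factors 2 + |z_j| add \<open>a\<close>
  and \<open>b\<close>, and (n - 3) a b + a + b <= (n - 1) a b, because both \<open>a\<close> and
  \<open>b\<close> are at most a b.\<close>

lemma growth_PolyC:
 fixes U :: "c2 => complex"
 assumes ab: "0 < a" "0 < b" and n: "n >= 3"
  and U: "!!z. \<exists>D. (U has_derivative D) (at z) \<and> D (ii (1,0)) = \<i> * D (1,0) \<and> D (ii (0,1)) = \<i> * D (0,1)"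
  and G: "G >= 0" "!!z. cmod (U z) <= G * exp (real (n - 3) * H_C a b z) * ((2 + cmod (fst z)) * (2 + cmod (snd z)))"
 shows "U \<in> PolyC a b (n - 1)"
proof -
 define N where "N = n - 3"
 have h1: "(%x. U (x, y)) holomorphic_on UNIV" for y
 proof -
  have "(%x. U (x, y)) field_differentiable at x" for x
   unfolding field_differentiable_def using U[of "(x, y)"] has_derivative_separate(1) by blast
  then show ?thesis by (simp add: holomorphic_on_def)
 qed
 have h2: "(%y. U (x, y)) holomorphic_on UNIV" for x
 proof -
  have "(%y. U (x, y)) field_differentiable at y" for y
   unfolding field_differentiable_def using U[of "(x, y)"] has_derivative_separate(2) by blast
  then show ?thesis by (simp add: holomorphic_on_def)
 qed
 define L where "L = N * (a + b) + 1"
 have "cmod (U (x, y)) <= (4 * G) * (1 + cmod x) ^ L * (1 + cmod y) ^ L" for x y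
 proof -
  have "cmod (U (x, y)) <= G * ((1 + cmod x) ^ (N * b) * (1 + cmod y) ^ (N * a)) * ((2 * (1 + cmod x)) * (2 * (1 + cmod y)))"
  proof (rule order_trans[OF G(2)])
   show "G * exp (real (n - 3) * H_C a b (x, y)) * ((2 + cmod (fst (x, y))) * (2 + cmod (snd (x, y))))
    <= G * ((1 + cmod x) ^ (N * b) * (1 + cmod y) ^ (N * a)) * ((2 * (1 + cmod x)) * (2 * (1 + cmod y)))"
    unfolding fst_conv snd_conv N_def[symmetric] using exp_H_C_le[of N a b "(x, y)"] G(1)
    by (intro mult_mono mult_left_mono) (auto intro!: mult_nonneg_nonneg)
  qed
  also have "... = (4 * G) * (1 + cmod x) ^ (N * b + 1) * (1 + cmod y) ^ (N * a + 1)" by (simp add: algebra_simps)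
  also have "... <= (4 * G) * (1 + cmod x) ^ L * (1 + cmod y) ^ L"
   using G(1) by (intro mult_mono mult_left_mono power_increasing) (auto simp: L_def)
  finally show ?thesis .
 qed
 then obtain c where c: "!!x y. U (x, y) = (\<Sum>j\<le>L. \<Sum>k\<le>L. c j k * x ^ j * y ^ k)"
  using separate_poly[OF h1 h2] by blast
 show ?thesis
 proof (rule poly_in_PolyC[OF ab c])
  fix x y
  have "cmod (U (t ^ a * x, t ^ b * y)) <= (G * exp (real N * H_C a b (x, y)) * ((2 + cmod x) * (2 + cmod y))) * cmod t ^ ((n - 1) * a * b)"
   if t: "1 <= cmod t" for t
  proof -
   define T where "T = cmod t"
   have T: "T >= 1" using t by (simp add: T_def)
   have "real N * H_C a b (wscale a b t (x, y)) <= real N * (real (a * b) * ln T + H_C a b (x, y))"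
    using H_C_wscale_le[of a b t "(x, y)"] logplus_ge_one[OF t] by (intro mult_left_mono) (auto simp: T_def)
   then have "exp (real N * H_C a b (wscale a b t (x, y))) <= exp (real (N * a * b) * ln T) * exp (real N * H_C a b (x, y))"
    by (simp add: exp_add[symmetric] algebra_simps)
   also have "exp (real (N * a * b) * ln T) = T ^ (N * a * b)" using T exp_of_nat_mult[of "N * a * b" "ln T"] by simp
   finally have e: "exp (real N * H_C a b (wscale a b t (x, y))) <= T ^ (N * a * b) * exp (real N * H_C a b (x, y))" .
   have f: "2 + cmod (t ^ k * u) <= T ^ k * (2 + cmod u)" for k u
    using one_le_power[OF T, of k] by (simp add: norm_mult norm_power T_def algebra_simps)
   have "cmod (U (t ^ a * x, t ^ b * y)) <= G * (T ^ (N * a * b) * exp (real N * H_C a b (x, y))) * ((T ^ a * (2 + cmod x)) * (T ^ b * (2 + cmod y)))"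
   proof (rule order_trans[OF G(2)])
    show "G * exp (real (n - 3) * H_C a b (t ^ a * x, t ^ b * y)) * ((2 + cmod (fst (t ^ a * x, t ^ b * y))) * (2 + cmod (snd (t ^ a * x, t ^ b * y))))
     <= G * (T ^ (N * a * b) * exp (real N * H_C a b (x, y))) * ((T ^ a * (2 + cmod x)) * (T ^ b * (2 + cmod y)))"
     unfolding fst_conv snd_conv N_def[symmetric] using e f[of a x] f[of b y] G(1) T
     by (intro mult_mono mult_left_mono) (auto simp: wscale_def intro!: mult_nonneg_nonneg)
   qed
   also have "... = (G * exp (real N * H_C a b (x, y)) * ((2 + cmod x) * (2 + cmod y))) * T ^ (N * a * b + a + b)" by (simp add: power_add mult_ac)
   also have "... <= (G * exp (real N * H_C a b (x, y)) * ((2 + cmod x) * (2 + cmod y))) * T ^ ((n - 1) * a * b)"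
   proof (intro mult_left_mono power_increasing T)
    have "n - 1 = N + 2" using n by (simp add: N_def)
    then have "(n - 1) * a * b = N * a * b + (a * b + a * b)" by (simp add: algebra_simps)
    moreover have "a <= a * b" "b <= a * b" using ab by auto
    ultimately show "N * a * b + a + b <= (n - 1) * a * b" by linarith
   qed (use G(1) in auto)
   finally show ?thesis by (simp add: T_def)
  qed
  then show "\<exists>C. \<forall>t. 1 <= cmod t \<longrightarrow> cmod (U (t ^ a * x, t ^ b * y)) <= C * cmod t ^ ((n - 1) * a * b)" by blast
 qed
qed

lemma lnq_facts:
 shows "0 <= lnq L z" "norm z <= R ==> (!!z. cmod (L z) <= norm z) ==> lnq L z <= ln (1 + R^2)" "exp (lnq L z / 2) <= 1 + cmod (L z)"
proof -
 have n: "L z \<bullet> L z = (cmod (L z))^2" by (simp add: power2_norm_eq_inner)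
 show "0 <= lnq L z" by (simp add: lnq_def)
 show "lnq L z <= ln (1 + R^2)" if "norm z <= R" "!!z. cmod (L z) <= norm z"
  unfolding lnq_def n using power_mono[of "cmod (L z)" R 2] order_trans[OF that(2)[of z] that(1)] by (intro ln_le_ln) (auto intro: add_pos_nonneg)
 have "exp (lnq L z / 2) = sqrt (1 + (cmod (L z))^2)"
 proof -
  have "(exp (lnq L z / 2))^2 = 1 + (cmod (L z))^2" by (simp add: lnq_def n add_pos_nonneg flip: exp_double)
  then show ?thesis by (metis real_sqrt_unique exp_ge_zero)
 qed
 also have "... <= 1 + cmod (L z)" by (rule real_le_lsqrt) (auto simp: power2_eq_square algebra_simps)
 finally show "exp (lnq L z / 2) <= 1 + cmod (L z)" .
qed

text \<open>For empty \<open>K\<close> every nonnegative constant would compete, and the extremal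
  function would be infinite, against regularity.\<close>

lemma (in pluri) K_nonempty: "K ~= {}"
proof
 assume "K = {}"
 then have "(%_. VS 0 + 1) \<in> comp H_Sigma K"
  unfolding comp_def using VS_nonneg[of 0] by (auto intro!: usc_continuous exI[of _ "VS 0 + 1"] simp: submean_def cmean_def set_integral_const)
 from VS_upper[OF this, of 0] show False by simp
qed

lemma exp_growth_absorb:
 fixes C e :: real assumes "e > 0" obtains N where "!!n. n >= N ==> C <= exp (real n * e)"
proof -
 obtain N :: nat where N: "\<bar>C\<bar> / e <= real N" using real_arch_simple by blast
 have "C <= exp (real n * e)" if "n >= N" for n
 proof -
  have "\<bar>C\<bar> / e <= real n" using N that by linarith
  then have "\<bar>C\<bar> <= real n * e" using assms by (simp add: field_simps)
  also have "... <= exp (real n * e)" using exp_ge_add_one_self[of "real n * e"] by linarith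
  finally show ?thesis by linarith
 qed
 then show thesis by (rule that)
qed

section \<open>The correction and the Chebyshev bound\<close>

context hart
begin

text \<open>d-bar of \<open>g\<close> lives in a shell where \<open>hartogs_global\<close> applies,
  and there the weight absorbs \<open>Q n\<close> up to a factor \<open>E\<close> and a constant.
  The averages of \<open>u\<close> tend to the entire function \<open>U\<close>. On \<open>K\<close>
  the averages of \<open>f0\<close> are - \<open>Q n\<close>, so \<open>Q n + U\<close> is minus the
  limit of the averages of \<open>v\<close>, whose norms are controlled by the data.\<close>

lemma corrected_bound:
 assumes e: "\<epsilon> > 0"
 obtains C N1 where "!!n. n >= N1 ==> \<exists>U\<in>PolyC a b (n - 1). \<forall>x\<in>K. cmod (Q n x + U x) <= C * exp (real n * (4 * \<epsilon>))"
proof -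
 obtain \<delta> where \<delta>: "\<delta> > 0" "!!z h. norm h <= \<delta> ==> \<bar>V (z + h) - V z\<bar> <= \<epsilon>" using V_translate[OF e] by metis
 \<comment> \<open>A third of \<delta>, because second derivatives of the mollifier live at scale 3
   r; at most 1, so that averages at points of \<open>K\<close> stay where the cut-off is 1.\<close>
 define r where "r = min 1 (\<delta> / 3)"
 have r: "r > 0" "r <= 1" "3 * r <= \<delta>" using \<delta> by (auto simp: r_def)
 have osc: "\<bar>V (z + h) - V z\<bar> <= \<epsilon>" if "norm h < 3 * r" for z h using \<delta>(2)[of h z] that r by simp
 define W where "W = sm r V"
 have W: "smooth W" "submean W" unfolding W_def by (intro smooth_sm submean_sm r lbr_V submean_V)+
 have WV: "\<bar>W z - V z\<bar> <= \<epsilon>" for z unfolding W_def by (rule sm_close[OF r(1) lbr_V]) (use osc r in auto)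
 have Wn: "W w <= V z + 2 * \<epsilon>" if "norm (w - z) < r" for w z
  using WV[of w] osc[of "w - z" z] that r by simp
 obtain B where B: "B >= 0" "!!e z. \<bar>Dd e W z\<bar> <= B * norm e" "!!e e' z. \<bar>Dd e' (Dd e W) z\<bar> <= B * norm e * norm e'"
  unfolding W_def using sm_derivative_bounds[OF r(1) lbr_V osc] by blast
 obtain Mv where Mv: "Mv >= 0" "!!z. V z <= H_C a b z + Mv" using V_growth by blast
 obtain R0 N0 where R0: "R0 >= 1" "!!n z. n >= N0 ==> norm z >= R0 ==> cmod (Q n z) <= exp (real n * (V z + \<epsilon>))"
  using hartogs_global[OF e] by blast
 obtain RK where RK: "!!x. x \<in> K ==> norm x <= RK" using compact_imp_bounded[OF K] unfolding bounded_iff by blast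
 define R where "R = max R0 RK"
 have R: "R >= 1" "R0 <= R" "!!x. x \<in> K ==> norm x <= R" using R0(1) RK by (auto simp: R_def intro: max.coboundedI2)
 \<comment> \<open>Equal to 1 on the ball of radius R + 1, which contains every point within
   distance 1 of \<open>K\<close>.\<close>
 define \<kappa> where "\<kappa> = cut (R + 2)"
 have sk: "smooth \<kappa>" unfolding \<kappa>_def by (rule smooth_cut)
 have vk: "vanish (R + 3) \<kappa>" unfolding \<kappa>_def using vanish_cut[of "R + 2"] by (simp add: add.commute)
 have k1: "\<kappa> z = 1" if "norm z <= R + 1" for z unfolding \<kappa>_def by (rule cut_one) (use that in simp)
 obtain Bk where Bk: "Bk >= 0" "!!e z. cmod (Dd e \<kappa> z) <= Bk * norm e" using smooth_Dd_bounded[OF sk vk] by blast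
 have dzbk: "cmod (dzb e \<kappa> z) <= Bk" if "norm e = 1" for e z
 proof -
  have "norm (ii e) = 1" using that by (simp add: ii_def norm_Pair norm_mult norm_prod_def)
  then have "cmod (Dd e \<kappa> z + \<i> * Dd (ii e) \<kappa> z) <= Bk + Bk"
   using Bk(2)[of e z] Bk(2)[of "ii e" z] that norm_triangle_ineq[of "Dd e \<kappa> z" "\<i> * Dd (ii e) \<kappa> z"] by (simp add: norm_mult)
  then show ?thesis by (simp add: dzb_def norm_divide)
 qed
 have dzb0: "dzb e \<kappa> z = 0" if "norm z < R + 1" for e z
 proof -
  have "(\<kappa> has_derivative (%_. 0)) (at z)"
  proof (rule has_derivative_transform_within_open[of "%_. 1" "%_. 0" z UNIV "ball 0 (R + 1)"])
   show "1 = \<kappa> x" if "x \<in> ball 0 (R + 1)" for x using k1[of x] that by simp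
  qed (use that in auto)
  then show ?thesis unfolding dzb_def by (simp add: Dd_eq)
 qed
 obtain MV where MV: "!!z. norm z <= R + 4 ==> \<bar>V z\<bar> <= MV" using lbr_bound[OF lbr_V, of "R + 4"] by blast
 define vR where "vR = sqrt (measure lborel (cball (0 :: c2) (R + 4)))"
 \<comment> \<open>1 + (R + 4)^2 bounds 1 / wm on the shell, \<open>Bk\<close> the derivative of the
   cut-off, and exp (3 MV) makes up for the three powers of exp V that the weight lacks.\<close>
 define A1 where "A1 = (1 + (R + 4)^2) * (Bk * exp (3 * MV))"
 have A1: "A1 >= 0" using Bk by (simp add: A1_def)
 obtain B\<eta> where B\<eta>: "B\<eta> >= 0" "!!z. cmod (eta r z) <= B\<eta>"
  using vanish_bounded[OF smooth_continuous[OF smooth_eta] vanish_eta[OF r(1)]] by blast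
 define C\<eta> where "C\<eta> = B\<eta> * sqrt (measure lborel (cball (0 :: c2) r))"
 have C\<eta>: "C\<eta> >= 0" using B\<eta> by (simp add: C\<eta>_def)
 define A2 where "A2 = 1 + (R + 4)^2"
 have A2: "A2 >= 0" by (simp add: A2_def)
 define C where "C = A2 * C\<eta> * (2 * (A1 * vR) + 1)"
 have vR: "vR >= 0" by (simp add: vR_def)
 have main: "\<exists>U\<in>PolyC a b (n - 1). \<forall>x\<in>K. cmod (Q n x + U x) <= C * exp (real n * (4 * \<epsilon>))" if n: "n >= max N0 3" for n
 proof -
  define N where "N = real (n - 3)"
  have N: "N >= 0" "N <= real n" "real n = N + 3" using n by (auto simp: N_def)
  interpret w: weight "wt (2 * N) W" "2 * N * B + 6" wm by (rule weight_wt[OF W B(2,3)]) (use N in simp)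
  have p2: "wt (2 * N) W z / 2 = N * W z + (lnq fst z / 2 + lnq snd z / 2)" for z by (simp add: wt_def)
  \<comment> \<open>One \<epsilon> stems from the bound on \<open>Q n\<close>, the other from
    replacing \<open>V\<close> by \<open>W\<close> in the weight. The same quantity bounds exp (N W)
    near \<open>K\<close>, and the two factors together give the exponent 4 \<epsilon>.\<close>
  define E where "E = exp (real n * (2 * \<epsilon>))"
  have E1: "E >= 1" using e by (simp add: E_def)
  have sQ: "smooth (Q n)" "!!e z. dzb e (Q n) z = 0" using HC_hol[OF Q[of n]] by (auto simp: hol_def)
  define g where "g = (%z. - (\<kappa> z * Q n z))"
  have sg: "smooth g" unfolding g_def by (intro smooth_minus smooth_mult sk sQ(1))
  have vg: "vanish (R + 3) g" using vanishD[OF vk] unfolding vanish_def g_def by (simp del: split_paired_All)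
  have dg: "dzb e g z = - (dzb e \<kappa> z * Q n z)" for e z
   unfolding g_def dz_minus(2)[OF smooth_mult[OF sk sQ(1)]] dz_mult(2)[OF sk sQ(1)] sQ(2) by simp
  define f0 where "f0 = Tf (%z. g z * w.emp z)"
  note f0 = w.dbar_data[OF sg vg f0_def]
  have normA: "norm (w.im (w.opA e f0)) <= A1 * E * vR" if e1: "norm e = 1" for e
   unfolding vR_def
  proof (rule norm_tf_bound)
   have t: "tfun (w.im (w.opA e f0)) z = of_real (inverse (wm z)) * (dzb e g z * w.emp z)" for z
    unfolding w.im_def tfun_mulop[OF w.smooth_cim] f0(2) ..
   have z0: "dzb e g z = 0" if "norm z < R + 1 \<or> norm z >= R + 4" for z
   proof -
    have "vanish (R + 3 + 1) (dzb e g)" by (rule vanish_dz(2)[OF vg])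
    then show ?thesis using that vanishD[of "R + 3 + 1" "dzb e g" z] dzb0[of z e] by (auto simp: dg)
   qed
   show "vanish (R + 4) (tfun (w.im (w.opA e f0)))"
    unfolding vanish_def using t z0 by (simp del: split_paired_All)
   show "cmod (tfun (w.im (w.opA e f0)) z) <= A1 * E" for z
   proof (cases "norm z < R + 1 \<or> norm z >= R + 4")
    case True
    then show ?thesis using t[of z] z0[OF True] A1 E1 by simp
   next
    case False
    then have z: "norm z >= R0" "norm z <= R + 4" using R by auto
    have Vz: "V z <= MV" using MV[OF z(2)] by simp
    have m1: "inverse (wm z) <= 1 + (R + 4)^2" "inverse (wm z) > 0"
     using power_mono[OF z(2), of 2] w.m_pos[of z] by (auto simp: wm_def power2_norm_eq_inner)
    have "cmod (Q n z) * cmod (w.emp z) <= exp (real n * (V z + \<epsilon>)) * exp (- (N * (V z - \<epsilon>)))"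
    proof (intro mult_mono)
     show "cmod (Q n z) <= exp (real n * (V z + \<epsilon>))" by (rule R0(2)) (use n z in auto)
     have "N * (V z - \<epsilon>) <= N * W z" using WV[of z] N by (intro mult_left_mono) auto
     then show "cmod (w.emp z) <= exp (- (N * (V z - \<epsilon>)))"
      unfolding w.emp_def p2 using lnq_facts(1)[of fst z] lnq_facts(1)[of snd z] by simp
    qed auto
    also have "... = exp (3 * V z + (real n + N) * \<epsilon>)"
     unfolding exp_add[symmetric] N(3) by (simp add: algebra_simps)
    also have "... <= exp (3 * MV + real n * (2 * \<epsilon>))"
     using Vz N e mult_right_mono[of "real n + N" "2 * real n" \<epsilon>] by (simp add: algebra_simps)
    also have "... = exp (3 * MV) * E" by (simp add: exp_add E_def)
    finally have qe: "cmod (Q n z) * cmod (w.emp z) <= exp (3 * MV) * E" .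
    have "cmod (tfun (w.im (w.opA e f0)) z) = inverse (wm z) * (cmod (dzb e \<kappa> z) * (cmod (Q n z) * cmod (w.emp z)))"
     unfolding t dg using m1(2) by (simp add: norm_mult norm_inverse mult_ac)
    also have "... <= (1 + (R + 4)^2) * (Bk * (exp (3 * MV) * E))"
    proof (rule mult_mono[OF m1(1)])
     show "cmod (dzb e \<kappa> z) * (cmod (Q n z) * cmod (w.emp z)) <= Bk * (exp (3 * MV) * E)" by (rule mult_mono[OF dzbk[OF e1] qe Bk(1)]) simp
    qed auto
    finally show ?thesis by (simp add: A1_def mult_ac)
   qed
  qed
  define M where "M = sqrt ((norm (w.im (w.opA w.e1 f0)))^2 + (norm (w.im (w.opA w.e2 f0)))^2)"
  have M: "M <= 2 * (A1 * vR) * E"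
  proof -
   have "M <= norm (w.im (w.opA w.e1 f0)) + norm (w.im (w.opA w.e2 f0))"
    unfolding M_def by (rule sqrt_sum_squares_le_sum) auto
   also have "... <= A1 * E * vR + A1 * E * vR" by (intro add_mono normA) (auto simp: norm_Pair)
   finally show ?thesis by (simp add: algebra_simps)
  qed
  have M0: "M >= 0" by (simp add: M_def)
  obtain v where v: "Cauchy v" "!!k. norm (v k) <= M + 1"
   "!!\<beta>1 \<beta>2. (%k. (f0 - v k) \<bullet> (w.opB w.e1 \<beta>1 + w.opB w.e2 \<beta>2)) \<longlonglongrightarrow> 0"
   using w.minimal_sequence[OF M_def] by blast
  define u where "u k = f0 - v k" for k
  have cu: "Cauchy u"
  proof (rule metric_CauchyI)
   fix e :: real assume "e > 0"
   then obtain k0 where k0: "!!i j. i >= k0 ==> j >= k0 ==> dist (v i) (v j) < e" using v(1) unfolding Cauchy_def by blast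
   have "dist (u i) (u j) < e" if "i >= k0" "j >= k0" for i j
    using k0[OF that] by (simp add: u_def dist_norm norm_minus_commute)
   then show "\<exists>k0. \<forall>i\<ge>k0. \<forall>j\<ge>k0. dist (u i) (u j) < e" by blast
  qed
  obtain U where U: "!!z. (%k. w.Ev r (u k) z) \<longlonglongrightarrow> U z"
   "!!z. \<exists>D. (U has_derivative D) (at z) \<and> D (ii w.e1) = \<i> * D w.e1 \<and> D (ii w.e2) = \<i> * D w.e2"
   using w.holo_limit[OF r(1) cu v(3)[folded u_def]] by blast
  have Evb: "cmod (w.Ev r y z) <= S * C\<eta> * norm y"
   if "!!x. norm (x - z) < r ==> exp (wt (2 * N) W x / 2) <= S" "S >= 0" for y z S
   unfolding w.Ev_def C\<eta>_def by (rule w.conv_ex_bound[OF smooth_eta vanish_eta[OF r(1)] r(1) B\<eta>(2,1) that])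
  define Mu where "Mu = norm f0 + M + 1"
  have Mu: "norm (u k) <= Mu" for k using norm_triangle_ineq4[of f0 "v k"] v(2)[of k] by (simp add: u_def Mu_def)
  have Mu0: "Mu >= 0" using M0 by (simp add: Mu_def)
  \<comment> \<open>This constant depends on \<open>n\<close>, which does no harm: it enters only
    the qualitative growth of \<open>U\<close>, and so its degree.\<close>
  define G where "G = exp (N * (Mv + 2 * \<epsilon>)) * C\<eta> * Mu"
  have G: "G >= 0" using C\<eta> Mu0 by (simp add: G_def)
  have growth: "cmod (U z) <= G * exp (real (n - 3) * H_C a b z) * ((2 + cmod (fst z)) * (2 + cmod (snd z)))" for z
  proof -
   define S where "S = exp (N * (H_C a b z + Mv + 2 * \<epsilon>)) * ((2 + cmod (fst z)) * (2 + cmod (snd z)))"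
   have S0: "S >= 0" by (simp add: S_def)
   have "exp (wt (2 * N) W x / 2) <= S" if x: "norm (x - z) < r" for x
   proof -
    have "W x <= H_C a b z + Mv + 2 * \<epsilon>" using Wn[OF x] Mv(2)[of z] by linarith
    then have "exp (N * W x) <= exp (N * (H_C a b z + Mv + 2 * \<epsilon>))" using N(1) by (simp add: mult_left_mono)
    moreover have "exp (lnq fst x / 2) <= 2 + cmod (fst z)"
     using lnq_facts(3)[of fst x] norm_triangle_ineq[of "fst z" "fst (x - z)"] cmod_fst[of "x - z"] x r(2) by simp
    moreover have "exp (lnq snd x / 2) <= 2 + cmod (snd z)"
     using lnq_facts(3)[of snd x] norm_triangle_ineq[of "snd z" "snd (x - z)"] cmod_snd[of "x - z"] x r(2) by simp
    ultimately show ?thesis unfolding p2 exp_add S_def by (intro mult_mono) auto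
   qed
   note S = this
   have "cmod (w.Ev r (u k) z) <= S * C\<eta> * Mu" for k
    using Evb[where y="u k" and z=z and S=S, OF S S0] mult_left_mono[OF Mu[of k], of "S * C\<eta>"] S0 C\<eta> by simp
   then have "cmod (U z) <= S * C\<eta> * Mu"
    using tendsto_norm[OF U(1)[of z]] by (intro LIMSEQ_le_const2[of "%k. cmod (w.Ev r (u k) z)"]) auto
   also have "... = G * exp (real (n - 3) * H_C a b z) * ((2 + cmod (fst z)) * (2 + cmod (snd z)))"
    unfolding S_def G_def N_def[symmetric] by (simp add: distrib_left exp_add mult_ac)
   finally show ?thesis .
  qed
  have UP: "U \<in> PolyC a b (n - 1)" by (rule growth_PolyC[OF ab _ U(2) G growth]) (use n in simp)
  have "cmod (Q n x + U x) <= C * exp (real n * (4 * \<epsilon>))" if x: "x \<in> K" for x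
  proof -
   have "conv (eta r) g x = - Q n x"
   proof -
    have "conv (eta r) g x = (LINT y|lborel. - (eta r (x - y) * Q n y))"
     unfolding conv_def
    proof (rule Bochner_Integration.integral_cong[OF refl])
     fix y
     show "eta r (x - y) * g y = - (eta r (x - y) * Q n y)"
     proof (cases "norm (x - y) < r")
      case True
      then have "norm y <= R + 1" using norm_triangle_ineq4[of x "x - y"] R(3)[OF x] r(2) by simp
      then show ?thesis by (simp add: g_def k1)
     next
      case False
      then have "eta r (x - y) = 0" using vanishD[OF vanish_eta[OF r(1)]] by simp
      then show ?thesis by simp
     qed
    qed
    also have "... = - conv (eta r) (Q n) x" unfolding conv_def by simp
    finally show ?thesis by (simp only: HC_mean_value[OF Q r(1)])
   qed
   then have Ef: "w.Ev r f0 x = - Q n x" unfolding w.Ev_def f0(1) .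
   have lin: "w.Ev r (u k) x = w.Ev r f0 x - w.Ev r (v k) x" for k
   proof -
    have "mulop w.ex (f0 - v k) = mulop w.ex f0 - mulop w.ex (v k)" by (rule linear_diff[OF linear_mulop[OF w.smooth_ex]])
    then show ?thesis
     unfolding w.Ev_def u_def
     using conv_tf_lin[OF smooth_eta vanish_eta[OF r(1)], of "-1" "mulop w.ex (v k)" "mulop w.ex f0" x] by simp
   qed
   have "(%k. cmod (w.Ev r (v k) x)) \<longlonglongrightarrow> cmod (- Q n x - U x)"
   proof -
    have "(%k. - Q n x - w.Ev r (u k) x) \<longlonglongrightarrow> - Q n x - U x" by (intro tendsto_intros U(1))
    moreover have "- Q n x - w.Ev r (u k) x = w.Ev r (v k) x" for k unfolding lin Ef by simp
    ultimately show ?thesis by (intro tendsto_norm) simp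
   qed
   moreover have "cmod (w.Ev r (v k) x) <= C * exp (real n * (4 * \<epsilon>))" for k
   proof -
    have S: "exp (wt (2 * N) W y / 2) <= A2 * E" if y: "norm (y - x) < r" for y
    proof -
     have "W y <= 2 * \<epsilon>" using Wn[OF y] V_K[OF x] by simp
     then have "N * W y <= N * (2 * \<epsilon>)" using N(1) by (intro mult_left_mono) auto
     also have "... <= real n * (2 * \<epsilon>)" using N(2) e by (intro mult_right_mono) auto
     finally have 1: "exp (N * W y) <= E" by (simp add: E_def)
     have ny: "norm y <= R + 4" using norm_triangle_ineq[of x "y - x"] R(3)[OF x] y r(2) by simp
     have "lnq fst y / 2 + lnq snd y / 2 <= ln (1 + (R + 4)^2)"
      using lnq_facts(2)[of y "R + 4" fst] lnq_facts(2)[of y "R + 4" snd] ny cmod_fst cmod_snd by force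
     then have "exp (lnq fst y / 2 + lnq snd y / 2) <= exp (ln (1 + (R + 4)^2))" by simp
     also have "... = A2" by (simp add: A2_def add_pos_nonneg)
     finally have 2: "exp (lnq fst y / 2 + lnq snd y / 2) <= A2" .
     have "exp (wt (2 * N) W y / 2) = exp (lnq fst y / 2 + lnq snd y / 2) * exp (N * W y)"
      unfolding p2 by (subst add.commute) (rule exp_add)
     also have "... <= A2 * E" using 1 2 A2 by (intro mult_mono) auto
     finally show ?thesis .
    qed
    have "cmod (w.Ev r (v k) x) <= A2 * E * C\<eta> * norm (v k)" by (rule Evb[OF S]) (use A2 E1 in auto)
    also have "... <= A2 * E * C\<eta> * (2 * (A1 * vR) * E + E)"
     using v(2)[of k] M E1 A2 C\<eta> by (intro mult_left_mono) auto
    also have "... = C * (E * E)" by (simp add: C_def algebra_simps)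
    also have "E * E = exp (real n * (4 * \<epsilon>))" unfolding E_def exp_add[symmetric] by (simp add: algebra_simps)
    finally show ?thesis .
   qed
   ultimately have "cmod (- Q n x - U x) <= C * exp (real n * (4 * \<epsilon>))" by (intro LIMSEQ_le_const2[of "%k. cmod (w.Ev r (v k) x)"]) auto
   moreover have "cmod (- Q n x - U x) = cmod (Q n x + U x)" using norm_minus_cancel[of "Q n x + U x"] by simp
   ultimately show ?thesis by simp
  qed
  then show ?thesis using UP by blast
 qed
 show thesis by (rule that[of "max N0 3" C]) (rule main)
qed

text \<open>The correction \<open>U\<close> competes in the infimum, and one more factor exp (n
  \<epsilon>) absorbs the constant \<open>C\<close>. Nonnegativity is recorded for the monotonicity
  of \<open>powr\<close>.\<close>

lemma Tch_bound:
 assumes e: "\<epsilon> > 0" and T: "!!n. n >= 1 ==> is_Tch a b K n (Q n) (T n)"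
 obtains N where "!!n. n >= N ==> 0 <= supnorm K (T n) \<and> supnorm K (T n) <= exp (real n * (5 * \<epsilon>))"
proof -
 obtain C N1 where C: "!!n. n >= N1 ==> \<exists>U\<in>PolyC a b (n - 1). \<forall>x\<in>K. cmod (Q n x + U x) <= C * exp (real n * (4 * \<epsilon>))"
  using corrected_bound[OF e] by blast
 obtain N2 where N2: "!!n. n >= N2 ==> C <= exp (real n * \<epsilon>)" using exp_growth_absorb[OF e] by blast
 obtain x0 where x0: "x0 \<in> K" using K_nonempty by blast
 have cont: "continuous_on K p" if pP: "p \<in> PolyC a b m" for p m
 proof -
  obtain c where "p = (%z. \<Sum>j\<le>m * b. \<Sum>k\<le>m * a. c j k * fst z ^ j * snd z ^ k)" using pP unfolding PolyC_def by blast
  then show ?thesis by (auto intro!: continuous_intros)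
 qed
 have nonneg: "0 <= supnorm K (%z. Q n z + p z)" if "p \<in> PolyC a b m" for n m p
 proof -
  have "continuous_on K (%z. cmod (Q n z + p z))" by (intro continuous_intros HC_continuous[OF Q] cont[OF that])
  then have "bdd_above ((%z. cmod (Q n z + p z)) ` K)" by (intro bounded_imp_bdd_above compact_imp_bounded compact_continuous_image[OF _ K])
  from cSUP_upper[OF x0 this] show ?thesis unfolding supnorm_def by (rule order_trans[OF norm_ge_zero])
 qed
 have "0 <= supnorm K (T n) \<and> supnorm K (T n) <= exp (real n * (5 * \<epsilon>))" if n: "n >= max 1 (max N1 N2)" for n
 proof -
  have it: "is_Tch a b K n (Q n) (T n)" using T n by simp
  obtain p where p: "p \<in> PolyC a b (n - 1)" "T n = (%z. Q n z + p z)" using it unfolding is_Tch_def by blast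
  obtain U where U: "U \<in> PolyC a b (n - 1)" "!!x. x \<in> K ==> cmod (Q n x + U x) <= C * exp (real n * (4 * \<epsilon>))" using C[of n] n by auto
  have "supnorm K (T n) = Inf {supnorm K (%z. Q n z + q z) | q. q \<in> PolyC a b (n - 1)}" using it unfolding is_Tch_def by blast
  also have "... <= supnorm K (%z. Q n z + U z)"
  proof (rule cInf_lower)
   show "bdd_below {supnorm K (%z. Q n z + q z) | q. q \<in> PolyC a b (n - 1)}"
    unfolding bdd_below_def using nonneg by blast
  qed (use U(1) in blast)
  also have "... <= C * exp (real n * (4 * \<epsilon>))"
   unfolding supnorm_def by (rule cSUP_least[OF K_nonempty]) (use U(2) in blast)
  also have "... <= exp (real n * \<epsilon>) * exp (real n * (4 * \<epsilon>))" using N2[of n] n by (intro mult_right_mono) auto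
  also have "... = exp (real n * (5 * \<epsilon>))" by (simp add: exp_add[symmetric] algebra_simps)
  finally show ?thesis using nonneg[OF p(1), of n] p(2) by simp
 qed
 then show thesis by (rule that)
qed

end

theorem theorem5p3:
  fixes a b :: nat and K :: "(complex \<times> complex) set"
    and Q T :: "nat \<Rightarrow> complex \<times> complex \<Rightarrow> complex"
  assumes "0 < a" "0 < b" "coprime a b"
    and "compact K" "regular K" "polynomially_convex K"
    and "\<And>n. Q n \<in> HC a b n"
    and "\<And>\<zeta>. \<zeta> \<in> bidisk_boundary \<Longrightarrow>
           limsup (\<lambda>n. elog (cmod (Q n \<zeta>)) * ereal (1 / real n)) \<le> rho_C a b K \<zeta>"
    and "\<And>n. n \<ge> 1 \<Longrightarrow> is_Tch a b K n (Q n) (T n)"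
  shows "limsup (\<lambda>n. ereal (supnorm K (T n) powr (1 / real n))) \<le> 1"
proof -
 interpret pluri a b K by unfold_locales (fact assms)+
 interpret hart a b K Q
 proof
  show "Q n \<in> HC a b n" for n by fact
  fix \<zeta> and e :: real assume z: "\<zeta> \<in> bidisk_boundary" and e: "e > 0"
  have "limsup (%n. elog (cmod (Q n \<zeta>)) * ereal (1 / real n)) < ereal (rho \<zeta> + e)"
   using assms(8)[OF z] rho_C_eq[OF bidisk_nz[OF z]] e by (auto intro: le_less_trans)
  then have "eventually (%n. elog (cmod (Q n \<zeta>)) * ereal (1 / real n) < ereal (rho \<zeta> + e)) sequentially" by (rule Limsup_lessD)
  then obtain N where N: "!!n. n >= N ==> elog (cmod (Q n \<zeta>)) * ereal (1 / real n) < ereal (rho \<zeta> + e)"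
   unfolding eventually_sequentially by blast
  \<comment> \<open>The index 0 is excluded because 1 / real 0 is 0. A zero of \<open>Q n\<close>
    satisfies the bound trivially, which covers the value - \<infinity> of
    \<open>elog\<close>.\<close>
  have "cmod (Q n \<zeta>) <= exp (real n * (rho \<zeta> + e))" if "n >= max 1 N" for n
  proof (cases "Q n \<zeta> = 0")
   case False
   then have "ln (cmod (Q n \<zeta>)) / real n < rho \<zeta> + e" using N[of n] that by (simp add: elog_def)
   then have "ln (cmod (Q n \<zeta>)) <= real n * (rho \<zeta> + e)" using that by (simp add: field_simps)
   then have "exp (ln (cmod (Q n \<zeta>))) <= exp (real n * (rho \<zeta> + e))" by simp
   then show ?thesis using False by simp
  qed simp
  then show "\<exists>N. \<forall>n\<ge>N. cmod (Q n \<zeta>) <= exp (real n * (rho \<zeta> + e))" by blast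
 qed
 show ?thesis
 proof (rule ereal_le_epsilon2)
  fix \<eta> :: real assume \<eta>: "0 < \<eta>"
  \<comment> \<open>Makes exp (5 \<epsilon>) equal to 1 + \<eta>.\<close>
  define \<epsilon> where "\<epsilon> = ln (1 + \<eta>) / 5"
  have e: "\<epsilon> > 0" using \<eta> by (simp add: \<epsilon>_def)
  obtain N where N: "!!n. n >= N ==> 0 <= supnorm K (T n) \<and> supnorm K (T n) <= exp (real n * (5 * \<epsilon>))"
   using Tch_bound[OF e assms(9)] by blast
  have "supnorm K (T n) powr (1 / real n) <= 1 + \<eta>" if "n >= max 1 N" for n
  proof -
   have "supnorm K (T n) powr (1 / real n) <= exp (real n * (5 * \<epsilon>)) powr (1 / real n)"
    using N[of n] that by (intro powr_mono2) auto
   also have "... = exp (5 * \<epsilon>)" using that by (simp add: powr_def)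
   also have "... = 1 + \<eta>" using \<eta> by (simp add: \<epsilon>_def)
   finally show ?thesis .
  qed
  then have "eventually (%n. ereal (supnorm K (T n) powr (1 / real n)) <= 1 + ereal \<eta>) sequentially"
   unfolding eventually_sequentially by (intro exI[of _ "max 1 N"]) (auto simp: one_ereal_def)
  then show "limsup (%n. ereal (supnorm K (T n) powr (1 / real n))) <= 1 + ereal \<eta>" by (rule Limsup_bounded)
 qed
qed



end
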